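(* Let $G$ be an infinite locally compact solvable group. Then the following conditions are equivalent: (1) $G$ is hereditarily totally minimal; (2) $G$ is topologically isomorphic to $K_{p,F}=\mathbb{Z}_p\rtimes F$, where $F\le F_p$ for some prime $p$.
   Context: All topological groups are Hausdorff. A Hausdorff topological group $(G,\tau)$ is minimal if there is no Hausdorff group topology on $G$ strictly coarser than $\tau$; it is totally minimal if the quotient group $G/N$ is minimal for every closed normal subgroup $N$ of $G$. A topological group is hereditarily totally minimal if every subgroup of it (not necessarily closed), with the subspace topology, is totally minimal. For a prime $p$, $\mathbb{Z}_p$ is the additive group of $p$-adic integers with the $p$-adic topology, $\mathbb{Z}_p^*=(\mathbb{Z}_p\setminus p\mathbb{Z}_p,\cdot)$, and $F_p$ is the (finite) torsion subgroup of $\mathbb{Z}_p^*$. For a subgroup $F\le F_p$, $K_{p,F}=(\mathbb{Z}_p,+)\rtimes F$ is the topological semidirect product (product topology) with $F$ acting on $\mathbb{Z}_p$ by multiplication. *)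

theory Defs
  imports
    "HOL-Analysis.Abstract_Topological_Spaces"
    "HOL-Algebra.Solvable_Groups"
    "HOL-Algebra.Ideal"
    "HOL-Computational_Algebra.Primes"
    "HOL-Number_Theory.Cong"
begin

section \<open>Minimality conditions for topological groups\<close>

text \<open>All topological groups are Hausdorff, so this is part of the definition.\<close>

definition topological_group :: "('a, 'b) monoid_scheme \<Rightarrow> 'a topology \<Rightarrow> bool" where
  "topological_group G \<tau> \<longleftrightarrow>
     group G \<and> topspace \<tau> = carrier G \<and> Hausdorff_space \<tau> \<and>
     continuous_map (prod_topology \<tau> \<tau>) \<tau> (\<lambda>(x, y). x \<otimes>\<^bsub>G\<^esub> y) \<and>
     continuous_map \<tau> \<tau> (\<lambda>x. inv\<^bsub>G\<^esub> x)"

definition minimal_group :: "('a, 'b) monoid_scheme \<Rightarrow> 'a topology \<Rightarrow> bool" where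
  "minimal_group G \<tau> \<longleftrightarrow>
     topological_group G \<tau> \<and>
     \<not> (\<exists>\<sigma>. topological_group G \<sigma> \<and> (\<forall>U. openin \<sigma> U \<longrightarrow> openin \<tau> U) \<and> \<sigma> \<noteq> \<tau>)"

definition quotient_group_topology ::
    "('a, 'b) monoid_scheme \<Rightarrow> 'a topology \<Rightarrow> 'a set \<Rightarrow> 'a set topology" where
  "quotient_group_topology G \<tau> N =
     topology (\<lambda>W. W \<subseteq> carrier (G Mod N) \<and> openin \<tau> {x \<in> topspace \<tau>. N #>\<^bsub>G\<^esub> x \<in> W})"

definition totally_minimal :: "('a, 'b) monoid_scheme \<Rightarrow> 'a topology \<Rightarrow> bool" where
  "totally_minimal G \<tau> \<longleftrightarrow>
     topological_group G \<tau> \<and>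
     (\<forall>N. N \<lhd> G \<and> closedin \<tau> N \<longrightarrow> minimal_group (G Mod N) (quotient_group_topology G \<tau> N))"

definition hereditarily_totally_minimal :: "('a, 'b) monoid_scheme \<Rightarrow> 'a topology \<Rightarrow> bool" where
  "hereditarily_totally_minimal G \<tau> \<longleftrightarrow>
     topological_group G \<tau> \<and>
     (\<forall>H. subgroup H G \<longrightarrow> totally_minimal (G\<lparr>carrier := H\<rparr>) (subtopology \<tau> H))"

definition topologically_isomorphic ::
    "('a, 'c) monoid_scheme \<Rightarrow> 'a topology \<Rightarrow> ('b, 'd) monoid_scheme \<Rightarrow> 'b topology \<Rightarrow> bool" where
  "topologically_isomorphic G \<tau> H \<sigma> \<longleftrightarrow> (\<exists>f. f \<in> iso G H \<and> homeomorphic_map \<tau> \<sigma> f)"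

lemma openin_quotient_group_topology:
  "openin (quotient_group_topology G \<tau> N) W \<longleftrightarrow>
     W \<subseteq> carrier (G Mod N) \<and> openin \<tau> {x \<in> topspace \<tau>. N #>\<^bsub>G\<^esub> x \<in> W}"
proof -
  let ?P = "\<lambda>W. {x \<in> topspace \<tau>. N #>\<^bsub>G\<^esub> x \<in> W}"
  have 1: "?P (S \<inter> T) = ?P S \<inter> ?P T" for S T by auto
  have 2: "?P (\<Union>\<K>) = (\<Union>K\<in>\<K>. ?P K)" for \<K> by auto
  have "istopology (\<lambda>W. W \<subseteq> carrier (G Mod N) \<and> openin \<tau> (?P W))"
    unfolding istopology_def 1 2 by blast
  then show ?thesis
    by (simp add: quotient_group_topology_def topology_inverse')
qed

section \<open>The p-adic integers\<close>

text \<open>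
  The ring of \<open>p\<close>-adic integers is the inverse limit of the rings of integers modulo \<open>p ^ n\<close>:
  a \<open>p\<close>-adic integer is the sequence of its least nonnegative residues modulo \<open>p ^ n\<close>.
\<close>

definition padic_int :: "nat \<Rightarrow> (nat \<Rightarrow> int) ring" where
  "padic_int p =
     \<lparr>carrier = {x. \<forall>n. 0 \<le> x n \<and> x n < int p ^ n \<and> x (Suc n) mod int p ^ n = x n},
      monoid.mult = (\<lambda>x y n. (x n * y n) mod int p ^ n),
      one = (\<lambda>n. 1 mod int p ^ n),
      zero = (\<lambda>n. 0),
      add = (\<lambda>x y n. (x n + y n) mod int p ^ n)\<rparr>"

definition padic_of_int :: "nat \<Rightarrow> int \<Rightarrow> nat \<Rightarrow> int" where
  "padic_of_int p k = (\<lambda>n. k mod int p ^ n)"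

definition padic_topology :: "nat \<Rightarrow> (nat \<Rightarrow> int) topology" where
  "padic_topology p =
     topology (\<lambda>U. U \<subseteq> carrier (padic_int p) \<and>
       (\<forall>x\<in>U. \<exists>n. x <+\<^bsub>padic_int p\<^esub> PIdl\<^bsub>padic_int p\<^esub> (padic_of_int p (int p ^ n)) \<subseteq> U))"

definition padic_units :: "nat \<Rightarrow> (nat \<Rightarrow> int) monoid" where
  "padic_units p =
     \<lparr>carrier = carrier (padic_int p) - PIdl\<^bsub>padic_int p\<^esub> (padic_of_int p (int p)),
      monoid.mult = monoid.mult (padic_int p),
      one = one (padic_int p)\<rparr>"

definition padic_torsion_units :: "nat \<Rightarrow> (nat \<Rightarrow> int) set" where
  "padic_torsion_units p =
     {u \<in> carrier (padic_units p). \<exists>n::nat. n > 0 \<and> u [^]\<^bsub>padic_units p\<^esub> n = \<one>\<^bsub>padic_units p\<^esub>}"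

definition padic_semidirect :: "nat \<Rightarrow> (nat \<Rightarrow> int) set \<Rightarrow> ((nat \<Rightarrow> int) \<times> (nat \<Rightarrow> int)) monoid" where
  "padic_semidirect p F =
     \<lparr>carrier = carrier (padic_int p) \<times> F,
      monoid.mult = (\<lambda>(a, u) (b, v). (a \<oplus>\<^bsub>padic_int p\<^esub> (u \<otimes>\<^bsub>padic_int p\<^esub> b), u \<otimes>\<^bsub>padic_int p\<^esub> v)),
      one = (\<zero>\<^bsub>padic_int p\<^esub>, \<one>\<^bsub>padic_int p\<^esub>)\<rparr>"

definition padic_semidirect_topology ::
    "nat \<Rightarrow> (nat \<Rightarrow> int) set \<Rightarrow> ((nat \<Rightarrow> int) \<times> (nat \<Rightarrow> int)) topology" where
  "padic_semidirect_topology p F =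
     prod_topology (padic_topology p) (subtopology (padic_topology p) F)"

lemma padic_compat:
  assumes "x \<in> carrier (padic_int p)" "m \<le> n"
  shows "x n mod int p ^ m = x m"
  using assms(2)
proof (induction n rule: dec_induct)
  case base
  then show ?case using assms by (simp add: padic_int_def)
next
  case (step n)
  have "x (Suc n) mod int p ^ m = (x (Suc n) mod int p ^ n) mod int p ^ m"
    by (simp add: mod_mod_cancel le_imp_power_dvd step.hyps)
  also have "x (Suc n) mod int p ^ n = x n"
    using assms by (simp add: padic_int_def)
  finally show ?case using step by simp
qed

lemma padic_carrierI:
  assumes "p > 0" "\<And>n. x (Suc n) mod int p ^ n = x n mod int p ^ n"
  shows "(\<lambda>n. x n mod int p ^ n) \<in> carrier (padic_int p)"
  using assms by (simp add: padic_int_def mod_mod_cancel le_imp_power_dvd)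

lemma padic_of_int_closed: "p > 0 \<Longrightarrow> padic_of_int p k \<in> carrier (padic_int p)"
  unfolding padic_of_int_def by (rule padic_carrierI) auto

lemma padic_suc_mod: "x \<in> carrier (padic_int p) \<Longrightarrow> x (Suc n) mod int p ^ n = x n mod int p ^ n"
  by (simp add: padic_int_def)

lemma padic_mod: "x \<in> carrier (padic_int p) \<Longrightarrow> x n mod int p ^ n = x n"
  by (simp add: padic_int_def)

lemma padic_closed:
  assumes "p > 0" "x \<in> carrier (padic_int p)" "y \<in> carrier (padic_int p)"
  shows "x \<oplus>\<^bsub>padic_int p\<^esub> y \<in> carrier (padic_int p)"
    and "x \<otimes>\<^bsub>padic_int p\<^esub> y \<in> carrier (padic_int p)"
    and "(\<lambda>n. (- x n) mod int p ^ n) \<in> carrier (padic_int p)"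
proof -
  show "x \<oplus>\<^bsub>padic_int p\<^esub> y \<in> carrier (padic_int p)"
    using padic_carrierI[of p "\<lambda>n. x n + y n", OF assms(1)
        mod_add_cong[OF padic_suc_mod[OF assms(2)] padic_suc_mod[OF assms(3)]]]
    by (simp add: padic_int_def)
  show "x \<otimes>\<^bsub>padic_int p\<^esub> y \<in> carrier (padic_int p)"
    using padic_carrierI[of p "\<lambda>n. x n * y n", OF assms(1)
        mod_mult_cong[OF padic_suc_mod[OF assms(2)] padic_suc_mod[OF assms(3)]]]
    by (simp add: padic_int_def)
  show "(\<lambda>n. (- x n) mod int p ^ n) \<in> carrier (padic_int p)"
    by (rule padic_carrierI[OF assms(1)]) (rule mod_minus_cong[OF padic_suc_mod[OF assms(2)]])
qed

lemma padic_cring: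
  assumes "p > 0"
  shows "cring (padic_int p)"
proof (rule cringI)
  let ?R = "padic_int p"
  show "abelian_group ?R"
  proof (rule abelian_groupI)
    show "\<exists>y\<in>carrier ?R. y \<oplus>\<^bsub>?R\<^esub> x = \<zero>\<^bsub>?R\<^esub>" if "x \<in> carrier ?R" for x
      by (rule bexI[OF _ padic_closed(3)[OF assms that that]])
        (simp add: padic_int_def mod_simps)
    show "\<zero>\<^bsub>?R\<^esub> \<oplus>\<^bsub>?R\<^esub> x = x" if "x \<in> carrier ?R" for x
      using that by (simp add: padic_int_def)
    show "\<zero>\<^bsub>?R\<^esub> \<in> carrier ?R" using assms by (simp add: padic_int_def)
    show "x \<oplus>\<^bsub>?R\<^esub> y \<in> carrier ?R" if "x \<in> carrier ?R" "y \<in> carrier ?R" for x y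
      by (rule padic_closed(1)[OF assms that])
  qed (auto simp: padic_int_def mod_simps algebra_simps)
  show "comm_monoid ?R"
  proof (rule comm_monoidI)
    show "\<one>\<^bsub>?R\<^esub> \<in> carrier ?R"
      using padic_of_int_closed[OF assms, of 1] by (simp add: padic_of_int_def padic_int_def)
    show "\<one>\<^bsub>?R\<^esub> \<otimes>\<^bsub>?R\<^esub> x = x" if "x \<in> carrier ?R" for x
      using that by (simp add: padic_int_def mod_simps)
    show "x \<otimes>\<^bsub>?R\<^esub> y \<in> carrier ?R" if "x \<in> carrier ?R" "y \<in> carrier ?R" for x y
      by (rule padic_closed(2)[OF assms that])
  qed (auto simp: padic_int_def mod_simps algebra_simps)
qed (auto simp: padic_int_def mod_simps algebra_simps)

text \<open>The basic neighbourhood \<open>x + p ^ n Z\<^sub>p\<close> consists of the \<open>y\<close> congruent to \<open>x\<close> modulo \<open>p ^ n\<close>.\<close>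

lemma padic_ball:
  assumes p: "p > 0" and x: "x \<in> carrier (padic_int p)"
  shows "x <+\<^bsub>padic_int p\<^esub> PIdl\<^bsub>padic_int p\<^esub> (padic_of_int p (int p ^ n)) =
    {y \<in> carrier (padic_int p). y n = x n}"
proof (rule subset_antisym; rule subsetI)
  let ?R = "padic_int p"
  interpret cring ?R by (rule padic_cring[OF p])
  show "y \<in> {y \<in> carrier ?R. y n = x n}"
    if "y \<in> x <+\<^bsub>?R\<^esub> PIdl\<^bsub>?R\<^esub> (padic_of_int p (int p ^ n))" for y
  proof -
    from that obtain z where z: "z \<in> carrier ?R" "y = x \<oplus>\<^bsub>?R\<^esub> (z \<otimes>\<^bsub>?R\<^esub> padic_of_int p (int p ^ n))"
      by (auto simp: a_l_coset_def' cgenideal_def)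
    have "y \<in> carrier ?R" using z x padic_of_int_closed[OF p] by simp
    moreover have "y n = x n" using z(2) padic_mod[OF x]
      by (simp add: padic_int_def padic_of_int_def)
    ultimately show ?thesis by simp
  qed
  show "y \<in> x <+\<^bsub>?R\<^esub> PIdl\<^bsub>?R\<^esub> (padic_of_int p (int p ^ n))"
    if "y \<in> {y \<in> carrier ?R. y n = x n}" for y
  proof -
    from that have y: "y \<in> carrier ?R" "y n = x n" by auto
    define z where "z k = ((y (k + n) - x (k + n)) div int p ^ n) mod int p ^ k" for k
    have dv: "int p ^ n dvd y (k + n) - x (k + n)" for k
      using padic_compat[OF y(1), of n "k+n"] padic_compat[OF x, of n "k+n"] y(2)
        mod_eq_dvd_iff[of "y (k + n)" "int p ^ n" "x (k + n)"] by simp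
    have zR: "z \<in> carrier ?R"
      unfolding z_def
    proof (rule padic_carrierI[OF p])
      fix k
      have "int p ^ (k + n) dvd (y (Suc k + n) - x (Suc k + n)) - (y (k + n) - x (k + n))"
        using mod_diff_cong[OF padic_suc_mod[OF y(1), of "k+n"] padic_suc_mod[OF x, of "k+n"]]
        unfolding mod_eq_dvd_iff add_Suc .
      then have "int p ^ k * int p ^ n dvd
          int p ^ n * ((y (Suc k + n) - x (Suc k + n)) div int p ^ n - (y (k + n) - x (k + n)) div int p ^ n)"
        by (simp only: right_diff_distrib dvd_mult_div_cancel[OF dv] power_add)
      then show "(y (Suc k + n) - x (Suc k + n)) div int p ^ n mod int p ^ k =
          (y (k + n) - x (k + n)) div int p ^ n mod int p ^ k"
        using p by (simp add: mod_eq_dvd_iff mult.commute)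
    qed
    have "y = x \<oplus>\<^bsub>?R\<^esub> (z \<otimes>\<^bsub>?R\<^esub> padic_of_int p (int p ^ n))"
    proof
      fix k
      have "int p ^ k dvd (y (k + n) - x (k + n)) div int p ^ n - z k"
        by (simp add: z_def dvd_minus_mod)
      then have "int p ^ k dvd (y (k + n) - x (k + n)) - z k * int p ^ n"
        using dvd_mult2[of "int p ^ k" "(y (k + n) - x (k + n)) div int p ^ n - z k" "int p ^ n"] dv[of k]
        by (simp add: left_diff_distrib)
      then have 1: "[y (k + n) = x (k + n) + z k * int p ^ n] (mod int p ^ k)"
        by (simp add: cong_iff_dvd_diff algebra_simps)
      have yk: "[y (k + n) = y k] (mod int p ^ k)" and xk: "[x (k + n) = x k] (mod int p ^ k)"
        using padic_compat[OF y(1), of k "k+n"] padic_compat[OF x, of k "k+n"] padic_mod[OF y(1), of k]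
          padic_mod[OF x, of k] by (simp_all add: cong_def)
      have "[y k = x k + z k * int p ^ n] (mod int p ^ k)"
        by (rule cong_trans[OF cong_sym[OF yk] cong_trans[OF 1 cong_add[OF xk cong_refl]]])
      then show "y k = (x \<oplus>\<^bsub>?R\<^esub> (z \<otimes>\<^bsub>?R\<^esub> padic_of_int p (int p ^ n))) k"
        using padic_mod[OF y(1), of k] by (simp add: cong_def padic_int_def padic_of_int_def mod_simps)
    qed
    moreover have "z \<otimes>\<^bsub>?R\<^esub> padic_of_int p (int p ^ n) \<in> PIdl\<^bsub>?R\<^esub> (padic_of_int p (int p ^ n))"
      unfolding cgenideal_def using zR by blast
    ultimately show ?thesis
      unfolding a_l_coset_def' by (metis UN_I singletonI)
  qed
qed

lemma openin_padic_topology: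
  assumes "p > 0"
  shows "openin (padic_topology p) U \<longleftrightarrow> U \<subseteq> carrier (padic_int p) \<and>
    (\<forall>x\<in>U. \<exists>n. \<forall>y\<in>carrier (padic_int p). y n = x n \<longrightarrow> y \<in> U)"
proof -
  let ?R = "padic_int p"
  let ?P = "\<lambda>U. U \<subseteq> carrier ?R \<and> (\<forall>x\<in>U. \<exists>n. \<forall>y\<in>carrier ?R. y n = x n \<longrightarrow> y \<in> U)"
  let ?Q = "\<lambda>U. U \<subseteq> carrier ?R \<and>
       (\<forall>x\<in>U. \<exists>n. x <+\<^bsub>?R\<^esub> PIdl\<^bsub>?R\<^esub> (padic_of_int p (int p ^ n)) \<subseteq> U)"
  have "?Q U = ?P U" for U
  proof (cases "U \<subseteq> carrier ?R")
    case True
    then have "x <+\<^bsub>?R\<^esub> PIdl\<^bsub>?R\<^esub> (padic_of_int p (int p ^ n)) \<subseteq> U \<longleftrightarrow>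
        (\<forall>y\<in>carrier ?R. y n = x n \<longrightarrow> y \<in> U)" if "x \<in> U" for x n
      using that padic_ball[OF assms, of x n] by blast
    then show ?thesis by simp
  qed simp
  then have eq: "?Q = ?P" by (rule ext)
  have "istopology ?P"
    unfolding istopology_def
  proof (intro conjI allI impI ballI)
    fix S T x assume S: "?P S" and T: "?P T" and x: "x \<in> S \<inter> T"
    from S x obtain m where m: "\<forall>y\<in>carrier ?R. y m = x m \<longrightarrow> y \<in> S" by blast
    from T x obtain n where n: "\<forall>y\<in>carrier ?R. y n = x n \<longrightarrow> y \<in> T" by blast
    have xR: "x \<in> carrier ?R" using S x by blast
    have "y m = x m \<and> y n = x n" if "y \<in> carrier ?R" "y (max m n) = x (max m n)" for y
      using that padic_compat[OF that(1), of _ "max m n"] padic_compat[OF xR, of _ "max m n"]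
      by (metis max.cobounded1 max.cobounded2)
    then show "\<exists>n. \<forall>y\<in>carrier ?R. y n = x n \<longrightarrow> y \<in> S \<inter> T"
      using m n by blast
  next
    fix \<K> x assume K: "\<forall>K\<in>\<K>. ?P K" and "x \<in> \<Union>\<K>"
    then obtain K where "K \<in> \<K>" "x \<in> K" by blast
    with K obtain n where "\<forall>y\<in>carrier ?R. y n = x n \<longrightarrow> y \<in> K" by blast
    with \<open>K \<in> \<K>\<close> show "\<exists>n. \<forall>y\<in>carrier ?R. y n = x n \<longrightarrow> y \<in> \<Union>\<K>" by blast
  qed blast+
  then show ?thesis unfolding padic_topology_def eq by (simp add: topology_inverse')
qed

end

theory Submission
  imports Defs
    "HOL-Analysis.Complex_Transcendental"
    "HOL-Analysis.Urysohn"
    "HOL-Number_Theory.Residues"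
begin

text \<open>
  A dense minimal subgroup meets every nontrivial closed normal subgroup, and an infinite discrete
  abelian group is not minimal because its characters induce a coarser topology. Applied to all
  subgroups, this makes the closure of an infinite cyclic group compact (Weil's lemma), then
  isomorphic to \<open>Z\<^sub>p\<close>, and lets no nontrivial torsion element commute with an element of infinite
  order. Moreover, a closed normal subgroup with abelian torsion quotient has finite index. An
  infinite abelian group is therefore \<open>Z\<^sub>p\<close> itself, and induction on the derived length yields a
  closed normal self-centralizing subgroup \<open>Z\<close> of finite index isomorphic to \<open>Z\<^sub>p\<close>. Conjugation on
  \<open>Z\<close> embeds the quotient by \<open>Z\<close> into \<open>F\<^sub>p\<close>, and the extension splits: for odd \<open>p\<close> a complement is the
  centralizer of an element acting by a unit \<open>u\<close> with \<open>1 - u\<close> invertible, and for \<open>p = 2\<close> an element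
  inverting \<open>Z\<close> has order two.

  Conversely, let \<open>A\<close> be the normal copy of \<open>Z\<^sub>p\<close> in \<open>K\<close>. A subgroup is either finite or meets \<open>A\<close>,
  and in the latter case each trace of \<open>p ^ n Z\<^sub>p\<close> contains the closure of a smaller trace in any
  coarser group topology, because that closure consists of elements of \<open>A\<close> and avoids a given point.
\<close>

subsection \<open>Topological groups\<close>

text \<open>The contradictions in the forward direction mostly come from a badly placed dense
  subgroup: one looks for a non-closed subgroup that avoids a closed normal subgroup of its closure.
  For the closure of a cyclic group the real obstacle on the way to Z_p is a divisible part, as in a
  solenoid; it is removed by dynamics instead of duality. Independence then comes from cardinality:
  Z_p is uncountable, so it contains some \<open>y\<close> without any relation to \<open>x\<close>,
  and for a torsion element \<open>c\<close> commuting with \<open>x\<close> the closure of the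
  group generated by \<open>x\<close> and \<open>y \<otimes> c\<close> contains \<open>c\<close>,
  although that group avoids it. Total minimality is used to divide out \<open>p\<close>-th powers:
  the quotient acquires elements of order \<open>p\<close>, which must not commute with elements of
  infinite order. The prime 2 is special because -1 is a torsion unit congruent to 1 modulo 2. In
  the converse, an arbitrary subgroup of Z_p is not a module over Z_p, so only powers of elements
  and residues are used there.\<close>

lemma (in group) mult_inv_cancel_left:
  "\<lbrakk>a \<in> carrier G; x \<in> carrier G\<rbrakk> \<Longrightarrow> a \<otimes> (inv a \<otimes> x) = x"
  "\<lbrakk>a \<in> carrier G; x \<in> carrier G\<rbrakk> \<Longrightarrow> inv a \<otimes> (a \<otimes> x) = x"
  by (simp_all flip: m_assoc)

text \<open>Together with the simplification rules of groups these bring a word in elements and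
  inverses to reduced right-nested form, which settles the cancellation identities below.\<close>

lemmas (in group) group_normalize = m_assoc inv_mult_group mult_inv_cancel_left

locale topgroup =
  fixes G (structure) and \<tau>
  assumes top_group: "topological_group G \<tau>"

sublocale topgroup \<subseteq> group G
  using top_group by (simp add: topological_group_def)

context topgroup
begin

lemma topspace_eq [simp]: "topspace \<tau> = carrier G"
  using top_group by (simp add: topological_group_def)

lemma hausdorff: "Hausdorff_space \<tau>"
  using top_group by (simp add: topological_group_def)

lemma t1: "t1_space \<tau>"
  by (simp add: Hausdorff_imp_t1_space hausdorff)

lemma openin_carrier: "openin \<tau> U \<Longrightarrow> U \<subseteq> carrier G"
  using openin_subset by fastforce

lemma continuous_map_mult:
  assumes "continuous_map X \<tau> f" "continuous_map X \<tau> g"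
  shows "continuous_map X \<tau> (\<lambda>x. f x \<otimes> g x)"
proof -
  have "continuous_map X (prod_topology \<tau> \<tau>) (\<lambda>x. (f x, g x))"
    using assms by (simp add: continuous_map_pairedI)
  moreover have "continuous_map (prod_topology \<tau> \<tau>) \<tau> (\<lambda>(x, y). x \<otimes> y)"
    using top_group by (simp add: topological_group_def)
  ultimately have "continuous_map X \<tau> ((\<lambda>(x, y). x \<otimes> y) \<circ> (\<lambda>x. (f x, g x)))"
    using continuous_map_compose by blast
  then show ?thesis by (simp add: o_def)
qed

lemma continuous_map_inv:
  assumes "continuous_map X \<tau> f"
  shows "continuous_map X \<tau> (\<lambda>x. inv f x)"
proof -
  have "continuous_map \<tau> \<tau> (\<lambda>x. inv x)"
    using top_group by (simp add: topological_group_def)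
  with assms have "continuous_map X \<tau> ((\<lambda>x. inv x) \<circ> f)"
    using continuous_map_compose by blast
  then show ?thesis by (simp add: o_def)
qed

lemma continuous_map_pow:
  fixes n :: nat
  assumes "continuous_map X \<tau> f"
  shows "continuous_map X \<tau> (\<lambda>x. f x [^] n)"
  by (induction n) (auto intro: continuous_map_mult assms)

lemma continuous_map_lmult: "a \<in> carrier G \<Longrightarrow> continuous_map \<tau> \<tau> (\<lambda>x. a \<otimes> x)"
  by (rule continuous_map_mult) auto

lemma continuous_map_rmult: "a \<in> carrier G \<Longrightarrow> continuous_map \<tau> \<tau> (\<lambda>x. x \<otimes> a)"
  by (rule continuous_map_mult) auto

lemma continuous_map_conj: "a \<in> carrier G \<Longrightarrow> continuous_map \<tau> \<tau> (\<lambda>x. a \<otimes> x \<otimes> inv a)"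
  by (intro continuous_map_mult continuous_map_lmult continuous_map_rmult) auto

lemma openin_preimage:
  "continuous_map \<tau> \<tau> f \<Longrightarrow> openin \<tau> U \<Longrightarrow> openin \<tau> {x \<in> carrier G. f x \<in> U}"
  using openin_continuous_map_preimage by fastforce

lemma closedin_preimage:
  "continuous_map \<tau> \<tau> f \<Longrightarrow> closedin \<tau> U \<Longrightarrow> closedin \<tau> {x \<in> carrier G. f x \<in> U}"
  using closedin_continuous_map_preimage by fastforce

lemma closedin_equalizer:
  assumes "continuous_map \<tau> \<tau> f" "continuous_map \<tau> \<tau> g"
  shows "closedin \<tau> {x \<in> carrier G. f x = g x}"
  using closedin_continuous_maps_eq[OF hausdorff assms] by simp

lemma closedin_finite: "finite S \<Longrightarrow> S \<subseteq> carrier G \<Longrightarrow> closedin \<tau> S"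
  using t1 by (simp add: t1_space_closedin_finite)

lemma nbhd_mult:
  assumes "openin \<tau> U" "a \<in> carrier G" "b \<in> carrier G" "a \<otimes> b \<in> U"
  shows "\<exists>V W. openin \<tau> V \<and> openin \<tau> W \<and> a \<in> V \<and> b \<in> W \<and> (\<forall>v\<in>V. \<forall>w\<in>W. v \<otimes> w \<in> U)"
proof -
  let ?P = "{p \<in> topspace (prod_topology \<tau> \<tau>). (case p of (x, y) \<Rightarrow> x \<otimes> y) \<in> U}"
  have "openin (prod_topology \<tau> \<tau>) ?P"
    using top_group assms(1) openin_continuous_map_preimage
    unfolding topological_group_def by blast
  moreover have "(a, b) \<in> ?P"
    using assms by simp
  ultimately obtain V W where "openin \<tau> V" "openin \<tau> W" "a \<in> V" "b \<in> W" "V \<times> W \<subseteq> ?P"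
    unfolding openin_prod_topology_alt by meson
  then show ?thesis
    by (intro exI[of _ V] exI[of _ W]) fastforce
qed

lemma nbhd_one:
  assumes "openin \<tau> U" "\<one> \<in> U"
  shows "\<exists>V. openin \<tau> V \<and> \<one> \<in> V \<and> V \<subseteq> U \<and> (\<forall>x\<in>V. inv x \<in> V) \<and> (\<forall>x\<in>V. \<forall>y\<in>V. x \<otimes> y \<in> U)"
proof -
  obtain V W where V: "openin \<tau> V" "openin \<tau> W" "\<one> \<in> V" "\<one> \<in> W"
    "\<forall>v\<in>V. \<forall>w\<in>W. v \<otimes> w \<in> U"
    using nbhd_mult[OF assms(1), of \<one> \<one>] assms(2) by auto
  define A where "A = U \<inter> V \<inter> W"
  define B where "B = A \<inter> {x \<in> carrier G. inv x \<in> A}"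
  have A: "openin \<tau> A" "\<one> \<in> A" using V assms by (auto simp: A_def)
  have "openin \<tau> B"
    unfolding B_def using A(1) openin_preimage[OF continuous_map_inv[OF continuous_map_id[unfolded id_def]] A(1)]
    by blast
  moreover have "inv x \<in> B" if "x \<in> B" for x
    using that openin_carrier[OF A(1)] by (auto simp: B_def)
  moreover have "\<one> \<in> B" using A by (simp add: B_def)
  moreover have "x \<otimes> y \<in> U" if "x \<in> B" "y \<in> B" for x y
    using that V(5) by (auto simp: B_def A_def)
  ultimately show ?thesis
    by (intro exI[of _ B]) (auto simp: B_def A_def)
qed

lemma nbhd_translate:
  assumes "openin \<tau> U" "a \<in> U"
  shows "openin \<tau> {x \<in> carrier G. a \<otimes> x \<in> U}" "\<one> \<in> {x \<in> carrier G. a \<otimes> x \<in> U}"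
proof -
  have a: "a \<in> carrier G" using assms openin_carrier by blast
  show "openin \<tau> {x \<in> carrier G. a \<otimes> x \<in> U}"
    by (rule openin_preimage[OF continuous_map_lmult[OF a] assms(1)])
  show "\<one> \<in> {x \<in> carrier G. a \<otimes> x \<in> U}" using a assms by simp
qed

lemma openin_lcoset:
  assumes "openin \<tau> U" "a \<in> carrier G"
  shows "openin \<tau> {x \<in> carrier G. inv a \<otimes> x \<in> U}"
  by (rule openin_preimage[OF continuous_map_lmult]) (use assms in auto)

text \<open>Symmetry of \<open>V\<close> turns the last condition into disjointness of
  \<open>V\<close> and its translate by \<open>a\<close>; this is how \<open>a\<close> is kept out
  of closures.\<close>

lemma nbhd_exclude:
  assumes "a \<in> carrier G" "a \<noteq> \<one>"
  shows "\<exists>V. openin \<tau> V \<and> \<one> \<in> V \<and> (\<forall>x\<in>V. inv x \<in> V) \<and> (\<forall>x\<in>V. \<forall>y\<in>V. x \<otimes> y \<noteq> a)"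
proof -
  have "openin \<tau> (carrier G - {a})"
    using closedin_finite[of "{a}"] assms(1) by (simp add: closedin_def)
  from nbhd_one[OF this] show ?thesis using assms by auto
qed

lemma in_closure_iff:
  assumes "a \<in> carrier G" "S \<subseteq> carrier G"
  shows "a \<in> \<tau> closure_of S \<longleftrightarrow> (\<forall>U. openin \<tau> U \<and> \<one> \<in> U \<longrightarrow> (\<exists>s\<in>S. inv a \<otimes> s \<in> U))"
proof
  assume a: "a \<in> \<tau> closure_of S"
  show "\<forall>U. openin \<tau> U \<and> \<one> \<in> U \<longrightarrow> (\<exists>s\<in>S. inv a \<otimes> s \<in> U)"
  proof (intro allI impI)
    fix U assume U: "openin \<tau> U \<and> \<one> \<in> U"
    define T where "T = {x \<in> carrier G. inv a \<otimes> x \<in> U}"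
    have "openin \<tau> T" unfolding T_def using openin_lcoset U assms by blast
    moreover have "a \<in> T" using U assms by (simp add: T_def)
    ultimately obtain y where "y \<in> S" "y \<in> T" using a by (auto simp: in_closure_of)
    then show "\<exists>s\<in>S. inv a \<otimes> s \<in> U" by (auto simp: T_def)
  qed
next
  assume H: "\<forall>U. openin \<tau> U \<and> \<one> \<in> U \<longrightarrow> (\<exists>s\<in>S. inv a \<otimes> s \<in> U)"
  show "a \<in> \<tau> closure_of S"
    unfolding in_closure_of
  proof (intro conjI allI impI)
    show "a \<in> topspace \<tau>" using assms by simp
    fix T assume T: "a \<in> T \<and> openin \<tau> T"
    have "\<exists>s\<in>S. inv a \<otimes> s \<in> {x \<in> carrier G. a \<otimes> x \<in> T}"
      by (rule H[rule_format, OF conjI[OF nbhd_translate[of T a]]]) (use T in auto)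
    then obtain s where s: "s \<in> S" "inv a \<otimes> s \<in> {x \<in> carrier G. a \<otimes> x \<in> T}" ..
    then have "a \<otimes> (inv a \<otimes> s) \<in> T" "s \<in> carrier G" using assms(2) by blast+
    then show "\<exists>y. y \<in> S \<and> y \<in> T" using s(1) assms(1) by (auto simp: mult_inv_cancel_left)
  qed
qed

lemma closure_subset: "\<tau> closure_of S \<subseteq> carrier G"
  using closure_of_subset_topspace by fastforce

lemma subgroup_closure:
  assumes "subgroup H G"
  shows "subgroup (\<tau> closure_of H) G"
proof (rule subgroupI)
  have H: "H \<subseteq> carrier G" "\<one> \<in> H" using assms by (auto simp: subgroup.subset subgroup.one_closed)
  have sub: "H \<subseteq> \<tau> closure_of H" using H(1) by (simp add: closure_of_subset)
  show "\<tau> closure_of H \<subseteq> carrier G" by (rule closure_subset)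
  show "\<tau> closure_of H \<noteq> {}" using sub H by auto
  show "inv a \<in> \<tau> closure_of H" if a: "a \<in> \<tau> closure_of H" for a
  proof -
    have "(\<lambda>x. inv x) ` (\<tau> closure_of H) \<subseteq> \<tau> closure_of ((\<lambda>x. inv x) ` H)"
      by (rule continuous_map_image_closure_subset) (simp add: continuous_map_inv)
    moreover have "(\<lambda>x. inv x) ` H \<subseteq> H" using assms by (auto simp: subgroup.m_inv_closed)
    ultimately show ?thesis using a closure_of_mono by blast
  qed
  show "a \<otimes> b \<in> \<tau> closure_of H" if a: "a \<in> \<tau> closure_of H" and b: "b \<in> \<tau> closure_of H" for a b
    unfolding in_closure_of
  proof (intro conjI allI impI)
    have ab: "a \<in> carrier G" "b \<in> carrier G" using a b closure_subset by auto
    then show "a \<otimes> b \<in> topspace \<tau>" by simp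
    fix T assume T: "a \<otimes> b \<in> T \<and> openin \<tau> T"
    then obtain V W where V: "openin \<tau> V" "openin \<tau> W" "a \<in> V" "b \<in> W"
      "\<forall>v\<in>V. \<forall>w\<in>W. v \<otimes> w \<in> T"
      using nbhd_mult[of T a b] ab by blast
    obtain h k where "h \<in> H" "h \<in> V" "k \<in> H" "k \<in> W"
      using a b V unfolding in_closure_of by metis
    then show "\<exists>y. y \<in> H \<and> y \<in> T" using V(5) assms by (metis subgroup.m_closed)
  qed
qed

lemma closure_conj:
  assumes "g \<in> carrier G" "S \<subseteq> carrier G" "\<And>s. s \<in> S \<Longrightarrow> g \<otimes> s \<otimes> inv g \<in> S" "a \<in> \<tau> closure_of S"
  shows "g \<otimes> a \<otimes> inv g \<in> \<tau> closure_of S"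
proof -
  have "(\<lambda>x. g \<otimes> x \<otimes> inv g) ` (\<tau> closure_of S) \<subseteq> \<tau> closure_of ((\<lambda>x. g \<otimes> x \<otimes> inv g) ` S)"
    by (rule continuous_map_image_closure_subset) (simp add: continuous_map_conj assms)
  moreover have "\<tau> closure_of ((\<lambda>x. g \<otimes> x \<otimes> inv g) ` S) \<subseteq> \<tau> closure_of S"
    by (rule closure_of_mono) (use assms in auto)
  ultimately show ?thesis using assms(4) by blast
qed

text \<open>Commuting with a fixed element is a closed condition, so the two closures are taken one
  variable at a time.\<close>

lemma closure_commute:
  assumes "S \<subseteq> carrier G" "T \<subseteq> carrier G" "\<And>s t. s \<in> S \<Longrightarrow> t \<in> T \<Longrightarrow> s \<otimes> t = t \<otimes> s"
    "a \<in> \<tau> closure_of S" "b \<in> \<tau> closure_of T"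
  shows "a \<otimes> b = b \<otimes> a"
proof -
  have 1: "x \<otimes> t = t \<otimes> x" if "x \<in> \<tau> closure_of S" "t \<in> T" for x t
  proof -
    have "closedin \<tau> {x \<in> carrier G. x \<otimes> t = t \<otimes> x}"
      using that assms(2) by (intro closedin_equalizer continuous_map_lmult continuous_map_rmult) auto
    moreover have "S \<subseteq> {x \<in> carrier G. x \<otimes> t = t \<otimes> x}" using assms that by auto
    ultimately show ?thesis using that(1) closure_of_minimal by blast
  qed
  have aG: "a \<in> carrier G" using assms closure_subset by blast
  have "closedin \<tau> {x \<in> carrier G. a \<otimes> x = x \<otimes> a}"
    using aG by (intro closedin_equalizer continuous_map_lmult continuous_map_rmult)
  moreover have "T \<subseteq> {x \<in> carrier G. a \<otimes> x = x \<otimes> a}" using assms 1 by auto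
  ultimately show ?thesis using assms(5) closure_of_minimal by blast
qed

lemma topological_subgroup:
  assumes "subgroup H G"
  shows "topgroup (G\<lparr>carrier := H\<rparr>) (subtopology \<tau> H)"
proof
  have H: "H \<subseteq> carrier G" using assms by (simp add: subgroup.subset)
  let ?\<sigma> = "subtopology \<tau> H"
  have fst: "continuous_map (prod_topology ?\<sigma> ?\<sigma>) \<tau> fst"
    using continuous_map_fst[of ?\<sigma> ?\<sigma>] continuous_map_into_fulltopology by blast
  have snd: "continuous_map (prod_topology ?\<sigma> ?\<sigma>) \<tau> snd"
    using continuous_map_snd[of ?\<sigma> ?\<sigma>] continuous_map_into_fulltopology by blast
  have m: "continuous_map (prod_topology ?\<sigma> ?\<sigma>) ?\<sigma> (\<lambda>(x, y). x \<otimes> y)"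
    using continuous_map_mult[OF fst snd] assms
    by (auto simp: continuous_map_in_subtopology case_prod_unfold subgroup.m_closed)
  have "continuous_map ?\<sigma> \<tau> (\<lambda>x. inv x)"
    using continuous_map_inv[OF continuous_map_from_subtopology[OF continuous_map_id[unfolded id_def]]] .
  then have "continuous_map ?\<sigma> ?\<sigma> (\<lambda>x. inv x)"
    using assms by (auto simp: continuous_map_in_subtopology subgroup.m_inv_closed)
  then have i: "continuous_map ?\<sigma> ?\<sigma> (\<lambda>x. inv\<^bsub>G\<lparr>carrier := H\<rparr>\<^esub> x)"
    by (rule continuous_map_eq) (use assms in auto)
  show "topological_group (G\<lparr>carrier := H\<rparr>) ?\<sigma>"
    unfolding topological_group_def
    using m i H hausdorff assms by (auto simp: Hausdorff_space_subtopology subgroup_imp_group)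
qed

lemma subgroup_subgroup:
  assumes "subgroup H G" "subgroup K (G\<lparr>carrier := H\<rparr>)"
  shows "subgroup K G" "K \<subseteq> H"
  using assms by (simp add: incl_subgroup, simp add: subgroup_def)

end

subsection \<open>Minimality through neighbourhood bases\<close>

text \<open>The classical axioms for a filter base at the identity of a Hausdorff group topology.
  Its members are arbitrary sets, in general neither open nor symmetric; the instances below are
  sets \<open>H \<inter> U N\<close> and sets cut out by characters.\<close>

locale nbhd_base = group +
  fixes \<B>
  assumes nonempty: "\<B> \<noteq> {}"
    and subset: "B \<in> \<B> \<Longrightarrow> B \<subseteq> carrier G"
    and inter: "A \<in> \<B> \<Longrightarrow> B \<in> \<B> \<Longrightarrow> \<exists>C\<in>\<B>. C \<subseteq> A \<inter> B"
    and mult: "B \<in> \<B> \<Longrightarrow> \<exists>A\<in>\<B>. \<forall>x\<in>A. \<forall>y\<in>A. x \<otimes> y \<in> B"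
    and inverse: "B \<in> \<B> \<Longrightarrow> \<exists>A\<in>\<B>. \<forall>x\<in>A. inv x \<in> B"
    and conj: "B \<in> \<B> \<Longrightarrow> g \<in> carrier G \<Longrightarrow> \<exists>A\<in>\<B>. \<forall>x\<in>A. g \<otimes> x \<otimes> inv g \<in> B"
    and one: "B \<in> \<B> \<Longrightarrow> \<one> \<in> B"
    and separating: "x \<in> carrier G \<Longrightarrow> x \<noteq> \<one> \<Longrightarrow> \<exists>B\<in>\<B>. x \<notin> B"

lemma (in nbhd_base) topological_group_exists:
  obtains \<sigma> where "topological_group G \<sigma>"
    "\<And>U. openin \<sigma> U \<longleftrightarrow> U \<subseteq> carrier G \<and> (\<forall>x\<in>U. \<exists>B\<in>\<B>. \<forall>b\<in>B. x \<otimes> b \<in> U)"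
proof -
  note BG = subsetD[OF subset]
  define P where "P U \<longleftrightarrow> U \<subseteq> carrier G \<and> (\<forall>x\<in>U. \<exists>B\<in>\<B>. \<forall>b\<in>B. x \<otimes> b \<in> U)" for U
  define \<sigma> where "\<sigma> = topology P"
  have "istopology P"
    unfolding istopology_def
  proof (intro conjI allI impI)
    fix S T assume S: "P S" and T: "P T"
    show "P (S \<inter> T)"
      unfolding P_def
    proof (intro conjI ballI)
      show "S \<inter> T \<subseteq> carrier G" using S by (auto simp: P_def)
      fix x assume x: "x \<in> S \<inter> T"
      obtain A B where "A \<in> \<B>" "\<forall>b\<in>A. x \<otimes> b \<in> S" "B \<in> \<B>" "\<forall>b\<in>B. x \<otimes> b \<in> T"
        using S T x unfolding P_def by blast
      then show "\<exists>B\<in>\<B>. \<forall>b\<in>B. x \<otimes> b \<in> S \<inter> T" using inter[of A B] by blast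
    qed
  next
    fix \<K> assume K: "\<forall>K\<in>\<K>. P K"
    show "P (\<Union>\<K>)"
      unfolding P_def
    proof (intro conjI ballI)
      show "\<Union>\<K> \<subseteq> carrier G" using K by (auto simp: P_def)
      fix x assume "x \<in> \<Union>\<K>"
      then obtain S where S: "S \<in> \<K>" "x \<in> S" by blast
      then obtain B where "B \<in> \<B>" "\<forall>b\<in>B. x \<otimes> b \<in> S" using K unfolding P_def by meson
      then show "\<exists>B\<in>\<B>. \<forall>b\<in>B. x \<otimes> b \<in> \<Union>\<K>" using S by blast
    qed
  qed
  then have op: "openin \<sigma> U \<longleftrightarrow> P U" for U by (simp add: \<sigma>_def topology_inverse')
  obtain B0 where "B0 \<in> \<B>" using nonempty by blast
  then have PG: "P (carrier G)" using BG by (auto simp: P_def intro!: bexI[of _ B0])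
  have top: "topspace \<sigma> = carrier G"
  proof
    show "topspace \<sigma> \<subseteq> carrier G" using op[of "topspace \<sigma>"] by (simp add: P_def)
    show "carrier G \<subseteq> topspace \<sigma>" using op PG openin_subset by blast
  qed
  have nb: "\<exists>W. openin \<sigma> W \<and> x \<in> W \<and> (\<forall>w\<in>W. inv x \<otimes> w \<in> B)"
    if B: "B \<in> \<B>" and x: "x \<in> carrier G" for x B
  proof -
    \<comment> \<open>The interior of the translate \<open>x B\<close>: the points around which some
      translate of a base set still fits. The product axiom makes it open.\<close>
    define W where "W = {w \<in> carrier G. \<exists>A\<in>\<B>. \<forall>a\<in>A. inv x \<otimes> w \<otimes> a \<in> B}"
    have "P W" unfolding P_def
    proof (intro conjI ballI)
      show "W \<subseteq> carrier G" by (auto simp: W_def)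
      fix w assume w: "w \<in> W"
      then obtain A where A: "A \<in> \<B>" "\<forall>a\<in>A. inv x \<otimes> w \<otimes> a \<in> B" by (auto simp: W_def)
      obtain C where C: "C \<in> \<B>" "\<forall>a\<in>C. \<forall>b\<in>C. a \<otimes> b \<in> A" using mult[OF A(1)] by blast
      have "w \<otimes> c \<in> W" if c: "c \<in> C" for c
      proof -
        have "inv x \<otimes> (w \<otimes> c) \<otimes> a \<in> B" if "a \<in> C" for a
        proof -
          have "inv x \<otimes> (w \<otimes> c) \<otimes> a = inv x \<otimes> w \<otimes> (c \<otimes> a)"
            using x w BG[OF C(1)] c that by (simp add: W_def m_assoc)
          then show ?thesis using A C c that by simp
        qed
        then show ?thesis using w c C BG[OF C(1)] by (auto simp: W_def)
      qed
      then show "\<exists>B\<in>\<B>. \<forall>b\<in>B. w \<otimes> b \<in> W" using C by blast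
    qed
    moreover have "x \<in> W" using B x BG by (auto simp: W_def intro!: bexI[OF _ B])
    moreover have "inv x \<otimes> w \<in> B" if w: "w \<in> W" for w
    proof -
      obtain A where A: "A \<in> \<B>" "\<forall>a\<in>A. inv x \<otimes> w \<otimes> a \<in> B" using w by (auto simp: W_def)
      then have "inv x \<otimes> w \<otimes> \<one> \<in> B" using one by blast
      then show ?thesis using x w by (simp add: W_def)
    qed
    ultimately show ?thesis using op by blast
  qed
  have "Hausdorff_space \<sigma>"
    unfolding Hausdorff_space_def
  proof (intro allI impI)
    fix x y assume xy: "x \<in> topspace \<sigma> \<and> y \<in> topspace \<sigma> \<and> x \<noteq> y"
    then have G: "x \<in> carrier G" "y \<in> carrier G" by (auto simp: top)
    have "inv x \<otimes> y \<noteq> \<one>" using G xy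
      by (metis inv_closed inv_equality inv_inv)
    then obtain B where B: "B \<in> \<B>" "inv x \<otimes> y \<notin> B"
      using separating[of "inv x \<otimes> y"] G by auto
    obtain A where A: "A \<in> \<B>" "\<forall>a\<in>A. \<forall>b\<in>A. a \<otimes> b \<in> B" using mult[OF B(1)] by blast
    obtain C where C: "C \<in> \<B>" "\<forall>a\<in>C. inv a \<in> A" using inverse[OF A(1)] by blast
    obtain V where V: "openin \<sigma> V" "x \<in> V" "\<forall>w\<in>V. inv x \<otimes> w \<in> A" using nb[OF A(1) G(1)] by blast
    obtain W where W: "openin \<sigma> W" "y \<in> W" "\<forall>w\<in>W. inv y \<otimes> w \<in> C" using nb[OF C(1) G(2)] by blast
    have "disjnt V W"
      unfolding disjnt_iff
    proof (intro allI notI)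
      fix w assume w: "w \<in> V \<and> w \<in> W"
      then have wG: "w \<in> carrier G" using V op by (auto simp: P_def)
      have "(inv x \<otimes> w) \<otimes> inv (inv y \<otimes> w) \<in> B" using V W A C w by blast
      moreover have "(inv x \<otimes> w) \<otimes> inv (inv y \<otimes> w) = inv x \<otimes> y"
        using G wG by (simp add: group_normalize)
      ultimately show False using B by simp
    qed
    then show "\<exists>U V. openin \<sigma> U \<and> openin \<sigma> V \<and> x \<in> U \<and> y \<in> V \<and> disjnt U V"
      using V W by blast
  qed
  moreover have "continuous_map (prod_topology \<sigma> \<sigma>) \<sigma> (\<lambda>(x, y). x \<otimes> y)"
    unfolding continuous_map_def
  proof (intro conjI allI impI)
    show "(\<lambda>(x, y). x \<otimes> y) \<in> topspace (prod_topology \<sigma> \<sigma>) \<rightarrow> topspace \<sigma>" by (auto simp: top)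
    fix U assume U: "openin \<sigma> U"
    show "openin (prod_topology \<sigma> \<sigma>) {p \<in> topspace (prod_topology \<sigma> \<sigma>). (case p of (x, y) \<Rightarrow> x \<otimes> y) \<in> U}"
      unfolding openin_prod_topology_alt
    proof (intro allI impI)
      fix x y assume "(x, y) \<in> {p \<in> topspace (prod_topology \<sigma> \<sigma>). (case p of (x, y) \<Rightarrow> x \<otimes> y) \<in> U}"
      then have G: "x \<in> carrier G" "y \<in> carrier G" and xyU: "x \<otimes> y \<in> U" by (auto simp: top)
      obtain B where B: "B \<in> \<B>" "\<forall>b\<in>B. (x \<otimes> y) \<otimes> b \<in> U" using U xyU op by (auto simp: P_def)
      obtain A where A: "A \<in> \<B>" "\<forall>a\<in>A. \<forall>b\<in>A. a \<otimes> b \<in> B" using mult[OF B(1)] by blast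
      \<comment> \<open>A product of perturbations of \<open>x\<close> and \<open>y\<close> is
        \<open>x \<otimes> y\<close> times the perturbation of \<open>x\<close>, conjugated by
        \<open>inv y\<close>, times that of \<open>y\<close>. The first must therefore be small
        after conjugation.\<close>
      obtain C where C: "C \<in> \<B>" "\<forall>c\<in>C. inv y \<otimes> c \<otimes> inv (inv y) \<in> A"
        using conj[OF A(1), of "inv y"] G by blast
      obtain V where V: "openin \<sigma> V" "x \<in> V" "\<forall>w\<in>V. inv x \<otimes> w \<in> C" using nb[OF C(1) G(1)] by blast
      obtain W where W: "openin \<sigma> W" "y \<in> W" "\<forall>w\<in>W. inv y \<otimes> w \<in> A" using nb[OF A(1) G(2)] by blast
      have "v \<otimes> w \<in> U" if v: "v \<in> V" and w: "w \<in> W" for v w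
      proof -
        have vw: "v \<in> carrier G" "w \<in> carrier G" using v w V W op by (auto simp: P_def)
        have "(x \<otimes> y) \<otimes> ((inv y \<otimes> (inv x \<otimes> v) \<otimes> inv (inv y)) \<otimes> (inv y \<otimes> w)) \<in> U"
          using A B C V W v w by blast
        moreover have "(x \<otimes> y) \<otimes> ((inv y \<otimes> (inv x \<otimes> v) \<otimes> inv (inv y)) \<otimes> (inv y \<otimes> w)) = v \<otimes> w"
          using G vw by (simp add: group_normalize)
        ultimately show ?thesis by simp
      qed
      then show "\<exists>U' V. openin \<sigma> U' \<and> openin \<sigma> V \<and> x \<in> U' \<and> y \<in> V \<and>
          U' \<times> V \<subseteq> {p \<in> topspace (prod_topology \<sigma> \<sigma>). (case p of (x, y) \<Rightarrow> x \<otimes> y) \<in> U}"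
        using V W openin_subset[OF V(1)] openin_subset[OF W(1)]
        by (intro exI[of _ V] exI[of _ W]) auto
    qed
  qed
  moreover have "continuous_map \<sigma> \<sigma> (\<lambda>x. inv x)"
    unfolding continuous_map_def
  proof (intro conjI allI impI)
    show "(\<lambda>x. inv x) \<in> topspace \<sigma> \<rightarrow> topspace \<sigma>" by (auto simp: top)
    fix U assume U: "openin \<sigma> U"
    show "openin \<sigma> {x \<in> topspace \<sigma>. inv x \<in> U}"
      unfolding op P_def
    proof (intro conjI ballI)
      fix x assume "x \<in> {x \<in> topspace \<sigma>. inv x \<in> U}"
      then have x: "x \<in> carrier G" "inv x \<in> U" by (auto simp: top)
      obtain B where B: "B \<in> \<B>" "\<forall>b\<in>B. inv x \<otimes> b \<in> U" using U x op by (auto simp: P_def)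
      obtain A where A: "A \<in> \<B>" "\<forall>a\<in>A. x \<otimes> a \<otimes> inv x \<in> B" using conj[OF B(1) x(1)] by blast
      obtain C where C: "C \<in> \<B>" "\<forall>c\<in>C. inv c \<in> A" using inverse[OF A(1)] by blast
      have "x \<otimes> c \<in> {x \<in> topspace \<sigma>. inv x \<in> U}" if c: "c \<in> C" for c
      proof -
        have cG: "c \<in> carrier G" using BG C c by blast
        have "inv x \<otimes> (x \<otimes> inv c \<otimes> inv x) = inv (x \<otimes> c)"
          using x cG by (simp add: group_normalize)
        moreover have "inv x \<otimes> (x \<otimes> inv c \<otimes> inv x) \<in> U" using A B C c by blast
        ultimately show ?thesis using x cG by (auto simp: top)
      qed
      then show "\<exists>B\<in>\<B>. \<forall>b\<in>B. x \<otimes> b \<in> {x \<in> topspace \<sigma>. inv x \<in> U}" using C by blast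
    qed (auto simp: top)
  qed
  ultimately have "topological_group G \<sigma>"
    by (simp add: topological_group_def top group_axioms)
  then show thesis using that op P_def by blast
qed

text \<open>The base defines a Hausdorff group topology, coarser than \<tau> by the assumption on
  its members, and minimality makes the two equal. So a base made of \<tau>-neighbourhoods must
  contain arbitrarily small sets.\<close>

lemma minimal_group_nbhd_base:
  fixes G (structure)
  assumes min: "minimal_group G \<tau>" and "nbhd_base G \<B>"
    and coarse: "\<And>B. B \<in> \<B> \<Longrightarrow> \<exists>U. openin \<tau> U \<and> \<one> \<in> U \<and> U \<subseteq> B"
    and U: "openin \<tau> U" "\<one> \<in> U"
  shows "\<exists>B\<in>\<B>. B \<subseteq> U"
proof -
  interpret nbhd_base G \<B> by fact
  interpret topgroup G \<tau> using min by unfold_locales (simp add: minimal_group_def)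
  obtain \<sigma> where \<sigma>: "topological_group G \<sigma>"
    "\<And>U. openin \<sigma> U \<longleftrightarrow> U \<subseteq> carrier G \<and> (\<forall>x\<in>U. \<exists>B\<in>\<B>. \<forall>b\<in>B. x \<otimes> b \<in> U)"
    using topological_group_exists by blast
  have "openin \<tau> V" if V: "openin \<sigma> V" for V
  proof (subst openin_subopen, intro ballI)
    fix x assume x: "x \<in> V"
    then obtain B where B: "B \<in> \<B>" "\<forall>b\<in>B. x \<otimes> b \<in> V" using V \<sigma>(2) by blast
    obtain W where W: "openin \<tau> W" "\<one> \<in> W" "W \<subseteq> B" using coarse[OF B(1)] by blast
    have xG: "x \<in> carrier G" using x V \<sigma>(2) by blast
    have "{y \<in> carrier G. inv x \<otimes> y \<in> W} \<subseteq> V"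
    proof
      fix y assume "y \<in> {y \<in> carrier G. inv x \<otimes> y \<in> W}"
      then have "y \<in> carrier G" "x \<otimes> (inv x \<otimes> y) \<in> V" using W B by auto
      then show "y \<in> V" using xG by (simp add: mult_inv_cancel_left)
    qed
    moreover have "openin \<tau> {y \<in> carrier G. inv x \<otimes> y \<in> W}" by (rule openin_lcoset[OF W(1) xG])
    moreover have "x \<in> {y \<in> carrier G. inv x \<otimes> y \<in> W}" using W xG by simp
    ultimately show "\<exists>T. openin \<tau> T \<and> x \<in> T \<and> T \<subseteq> V" by blast
  qed
  then have "\<sigma> = \<tau>" using min \<sigma>(1) unfolding minimal_group_def by blast
  then obtain B where "B \<in> \<B>" "\<forall>b\<in>B. \<one> \<otimes> b \<in> U" using U \<sigma>(2) by blast
  moreover have "B \<subseteq> carrier G" using \<open>B \<in> \<B>\<close> by (rule subset)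
  ultimately show ?thesis by (metis l_one subset_iff)
qed

subsection \<open>Quotients and hereditary minimality\<close>

lemma topological_group_transport:
  assumes \<tau>: "topological_group G \<tau>" and H: "group H" and f: "f \<in> iso G H" "homeomorphic_map \<tau> \<sigma> f"
  shows "topological_group H \<sigma>"
proof -
  interpret topgroup G \<tau> by unfold_locales (rule \<tau>)
  interpret H: group H by (rule H)
  interpret f: group_hom G H f using f(1) by unfold_locales (simp add: iso_def)
  have bij: "bij_betw f (carrier G) (carrier H)" using f(1) by (simp add: iso_def)
  then have img: "f ` carrier G = carrier H" by (simp add: bij_betw_def)
  obtain g where g: "homeomorphic_maps \<tau> \<sigma> f g" using f(2) homeomorphic_map_maps by blast
  have top: "topspace \<sigma> = carrier H"
    using homeomorphic_imp_surjective_map[OF f(2)] img by simp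
  have cf: "continuous_map \<tau> \<sigma> f" and cg: "continuous_map \<sigma> \<tau> g"
    and fg: "\<And>y. y \<in> carrier H \<Longrightarrow> f (g y) = y"
    using g top by (auto simp: homeomorphic_maps_def)
  have gG: "\<And>y. y \<in> carrier H \<Longrightarrow> g y \<in> carrier G"
    using cg top by (auto simp: continuous_map_def)
  have haus: "Hausdorff_space \<sigma>"
    using hausdorff homeomorphic_Hausdorff_space homeomorphic_map_imp_homeomorphic_space[OF f(2)] by blast
  have "continuous_map (prod_topology \<sigma> \<sigma>) \<tau> (g \<circ> fst)" "continuous_map (prod_topology \<sigma> \<sigma>) \<tau> (g \<circ> snd)"
    using continuous_map_compose[OF continuous_map_fst cg] continuous_map_compose[OF continuous_map_snd cg] by auto
  from continuous_map_compose[OF continuous_map_mult[OF this] cf]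
  have m: "continuous_map (prod_topology \<sigma> \<sigma>) \<sigma> (\<lambda>(x, y). x \<otimes>\<^bsub>H\<^esub> y)"
    by (rule continuous_map_eq) (auto simp: top gG fg)
  from continuous_map_compose[OF continuous_map_inv[OF cg] cf]
  have "continuous_map \<sigma> \<sigma> (\<lambda>x. inv\<^bsub>H\<^esub> x)"
    by (rule continuous_map_eq) (auto simp: top gG fg)
  with m show ?thesis
    by (simp add: topological_group_def H top haus)
qed

text \<open>A strictly coarser topology on \<open>H\<close> would be pulled back along the
  isomorphism to a strictly coarser one on \<open>G\<close>.\<close>

lemma minimal_group_transport:
  assumes min: "minimal_group G \<tau>" and H: "group H" and f: "f \<in> iso G H" "homeomorphic_map \<tau> \<sigma> f"
  shows "minimal_group H \<sigma>"
  unfolding minimal_group_def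
proof (intro conjI notI)
  have \<tau>: "topological_group G \<tau>" using min by (simp add: minimal_group_def)
  interpret topgroup G \<tau> by unfold_locales (rule \<tau>)
  show tH: "topological_group H \<sigma>" by (rule topological_group_transport[OF \<tau> H f])
  assume "\<exists>\<sigma>'. topological_group H \<sigma>' \<and> (\<forall>U. openin \<sigma>' U \<longrightarrow> openin \<sigma> U) \<and> \<sigma>' \<noteq> \<sigma>"
  then obtain \<sigma>' where \<sigma>': "topological_group H \<sigma>'" "\<And>U. openin \<sigma>' U \<Longrightarrow> openin \<sigma> U" "\<sigma>' \<noteq> \<sigma>" by blast
  have bij: "bij_betw f (carrier G) (carrier H)" using f(1) by (simp add: iso_def)
  have top: "topspace \<sigma>' = carrier H" "topspace \<sigma> = carrier H"
    using \<sigma>'(1) tH by (auto simp: topological_group_def)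
  define \<tau>' where "\<tau>' = pullback_topology (carrier G) f \<sigma>'"
  have op: "openin \<tau>' U \<longleftrightarrow> (\<exists>V. openin \<sigma>' V \<and> U = f -` V \<inter> carrier G)" for U
    by (simp add: \<tau>'_def openin_pullback_topology)
  have top': "topspace \<tau>' = carrier G"
    using bij by (auto simp: \<tau>'_def topspace_pullback_topology top bij_betw_def)
  have img: "f ` (f -` V \<inter> carrier G) = V" if "V \<subseteq> carrier H" for V
  proof -
    have "f ` (f -` V \<inter> carrier G) = V \<inter> f ` carrier G" by blast
    then show ?thesis using bij that by (auto simp: bij_betw_def)
  qed
  have "homeomorphic_map \<tau>' \<sigma>' f"
  proof (rule bijective_open_imp_homeomorphic_map)
    show "continuous_map \<tau>' \<sigma>' f"
      using bij op by (auto simp: continuous_map_def top' top bij_betw_def Collect_conj_eq vimage_def Int_commute)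
    show "open_map \<tau>' \<sigma>' f"
      unfolding open_map_def op using img openin_subset top by metis
    show "f ` topspace \<tau>' = topspace \<sigma>'" "inj_on f (topspace \<tau>')"
      using bij by (auto simp: top' top bij_betw_def)
  qed
  then obtain g where g: "homeomorphic_maps \<tau>' \<sigma>' f g" using homeomorphic_map_maps by blast
  \<comment> \<open>The inverse homeomorphism is compared with \<open>inv_into\<close> on the
    carrier only, and the homomorphism property is carried over there.\<close>
  have gf: "g x = inv_into (carrier G) f x" if "x \<in> carrier H" for x
    using g that bij unfolding homeomorphic_maps_def top top' bij_betw_def continuous_map_def
    by (metis Pi_iff inv_into_f_f)
  have "g \<in> iso H G"
  proof -
    have "inv_into (carrier G) f \<in> iso H G" by (rule iso_set_sym[OF f(1)])
    then show ?thesis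
      using gf H group.is_monoid[OF H]
      unfolding iso_def hom_def
      by (auto simp: Pi_iff monoid.m_closed cong: bij_betw_cong)
  qed
  moreover have "homeomorphic_map \<sigma>' \<tau>' g"
    using g homeomorphic_maps_map homeomorphic_maps_sym by blast
  ultimately have "topological_group G \<tau>'"
    using topological_group_transport[OF \<sigma>'(1) group_axioms] by blast
  moreover have "openin \<tau> U" if U: "openin \<tau>' U" for U
  proof -
    obtain V where "openin \<sigma>' V" "U = f -` V \<inter> carrier G" using U op by blast
    then show ?thesis
      using \<sigma>'(2) openin_continuous_map_preimage[OF homeomorphic_imp_continuous_map[OF f(2)], of V]
      by (simp add: vimage_def Int_def conj_commute)
  qed
  ultimately have "\<tau>' = \<tau>" using min unfolding minimal_group_def by blast
  have "openin \<sigma>' V" if V: "openin \<sigma> V" for V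
  proof -
    have VH: "V \<subseteq> carrier H" using V openin_subset top by metis
    have "openin \<tau> (f -` V \<inter> carrier G)"
      using openin_continuous_map_preimage[OF homeomorphic_imp_continuous_map[OF f(2)] V]
      by (simp add: vimage_def Int_def conj_commute)
    then obtain W where "openin \<sigma>' W" "f -` V \<inter> carrier G = f -` W \<inter> carrier G"
      using op \<open>\<tau>' = \<tau>\<close> by blast
    moreover have "W \<subseteq> carrier H" using \<open>openin \<sigma>' W\<close> openin_subset top by metis
    ultimately show ?thesis using img VH by metis
  qed
  then have "\<sigma>' = \<sigma>" using \<sigma>'(2) topology_eq by blast
  then show False using \<sigma>'(3) by simp
qed

text \<open>The part of the hypothesis that passes to quotients: every quotient of a hereditarily
  totally minimal group by a closed normal subgroup has this property, and most arguments take place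
  in a group that has it.\<close>

definition hereditarily_minimal :: "('a, 'b) monoid_scheme \<Rightarrow> 'a topology \<Rightarrow> bool" where
  "hereditarily_minimal G \<tau> \<longleftrightarrow>
     topological_group G \<tau> \<and> (\<forall>H. subgroup H G \<longrightarrow> minimal_group (G\<lparr>carrier := H\<rparr>) (subtopology \<tau> H))"

context topgroup
begin

lemma hereditarily_minimal_subgroup:
  assumes "hereditarily_minimal G \<tau>" "subgroup H G"
  shows "hereditarily_minimal (G\<lparr>carrier := H\<rparr>) (subtopology \<tau> H)"
proof -
  interpret H: topgroup "G\<lparr>carrier := H\<rparr>" "subtopology \<tau> H" by (rule topological_subgroup[OF assms(2)])
  show ?thesis
    using assms H.top_group subgroup_subgroup[OF assms(2)]
    by (auto simp: hereditarily_minimal_def subtopology_subtopology inf.absorb2)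
qed

lemma hereditarily_totally_minimal_subgroup:
  assumes "hereditarily_totally_minimal G \<tau>" "subgroup H G"
  shows "hereditarily_totally_minimal (G\<lparr>carrier := H\<rparr>) (subtopology \<tau> H)"
proof -
  interpret H: topgroup "G\<lparr>carrier := H\<rparr>" "subtopology \<tau> H" by (rule topological_subgroup[OF assms(2)])
  show ?thesis
    using assms H.top_group subgroup_subgroup[OF assms(2)]
    by (auto simp: hereditarily_totally_minimal_def subtopology_subtopology inf.absorb2)
qed

lemma topspace_quotient: "topspace (quotient_group_topology G \<tau> N) = carrier (G Mod N)"
proof
  have "openin (quotient_group_topology G \<tau> N) (topspace (quotient_group_topology G \<tau> N))" by simp
  then show "topspace (quotient_group_topology G \<tau> N) \<subseteq> carrier (G Mod N)"
    unfolding openin_quotient_group_topology by blast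
  have "{x \<in> carrier G. N #> x \<in> carrier (G Mod N)} = carrier G" by (auto simp: carrier_FactGroup)
  then have "openin (quotient_group_topology G \<tau> N) (carrier (G Mod N))"
    using openin_topspace[of \<tau>] by (simp add: openin_quotient_group_topology)
  then show "carrier (G Mod N) \<subseteq> topspace (quotient_group_topology G \<tau> N)" by (rule openin_subset)
qed

lemma continuous_quotient: "continuous_map \<tau> (quotient_group_topology G \<tau> N) (\<lambda>x. N #> x)"
  by (auto simp: continuous_map_def openin_quotient_group_topology carrier_FactGroup topspace_quotient)

lemma rcoset_eq_iff:
  assumes "N \<lhd> G" "x \<in> carrier G" "y \<in> carrier G"
  shows "N #> x = N #> y \<longleftrightarrow> x \<otimes> inv y \<in> N"
proof -
  interpret normal N G by fact
  show ?thesis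
  proof
    assume "N #> x = N #> y"
    then have "x \<in> N #> y" using rcos_self[OF assms(2) is_subgroup] by simp
    then obtain n where "n \<in> N" "x = n \<otimes> y" by (auto simp: r_coset_def)
    then show "x \<otimes> inv y \<in> N" using assms by (simp add: m_assoc)
  next
    assume "x \<otimes> inv y \<in> N"
    then have "x \<in> N #> y" using assms by (auto simp: r_coset_def m_assoc intro!: bexI[of _ "x \<otimes> inv y"])
    then show "N #> x = N #> y" using repr_independence[OF _ assms(3) is_subgroup] by blast
  qed
qed

lemma open_quotient:
  assumes N: "N \<lhd> G"
  shows "open_map \<tau> (quotient_group_topology G \<tau> N) (\<lambda>x. N #> x)"
  unfolding open_map_def
proof (intro allI impI)
  fix U assume U: "openin \<tau> U"
  interpret normal N G by fact
  have UG: "U \<subseteq> carrier G" by (rule openin_carrier[OF U])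
  have "openin \<tau> {x \<in> carrier G. N #> x \<in> (\<lambda>x. N #> x) ` U}"
  proof (subst openin_subopen, intro ballI)
    fix x assume "x \<in> {x \<in> carrier G. N #> x \<in> (\<lambda>x. N #> x) ` U}"
    then obtain u where u: "x \<in> carrier G" "u \<in> U" "N #> x = N #> u" by blast
    define n where "n = u \<otimes> inv x"
    have uG: "u \<in> carrier G" using u UG by blast
    have n: "n \<in> N" using rcoset_eq_iff[OF N uG u(1)] u(3) by (simp add: n_def)
    then have nG: "n \<in> carrier G" by simp
    define T where "T = {y \<in> carrier G. n \<otimes> y \<in> U}"
    have "openin \<tau> T" unfolding T_def by (rule openin_preimage[OF continuous_map_lmult[OF nG] U])
    moreover have "x \<in> T" using u uG by (simp add: T_def n_def m_assoc)
    moreover have "T \<subseteq> {x \<in> carrier G. N #> x \<in> (\<lambda>x. N #> x) ` U}"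
    proof
      fix y assume y: "y \<in> T"
      then have "y \<otimes> inv (n \<otimes> y) = inv n" using nG by (simp add: T_def group_normalize)
      then have "N #> y = N #> (n \<otimes> y)" using y nG n rcoset_eq_iff[OF N, of y "n \<otimes> y"] by (simp add: T_def)
      then show "y \<in> {x \<in> carrier G. N #> x \<in> (\<lambda>x. N #> x) ` U}" using y by (auto simp: T_def)
    qed
    ultimately show "\<exists>T. openin \<tau> T \<and> x \<in> T \<and> T \<subseteq> {x \<in> carrier G. N #> x \<in> (\<lambda>x. N #> x) ` U}" by blast
  qed
  then show "openin (quotient_group_topology G \<tau> N) ((\<lambda>x. N #> x) ` U)"
    using UG by (auto simp: openin_quotient_group_topology carrier_FactGroup)
qed

lemma locally_compact_quotient:
  assumes "N \<lhd> G" "locally_compact_space \<tau>"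
  shows "locally_compact_space (quotient_group_topology G \<tau> N)"
  by (rule locally_compact_space_continuous_open_map_image[OF continuous_quotient open_quotient])
     (use assms topspace_quotient in \<open>auto simp: carrier_FactGroup\<close>)

text \<open>\<open>\<Union>A\<close> is the full preimage of \<open>A\<close>, and an open map
  restricted to a full preimage is still open onto its image; hence restriction to \<open>A\<close>
  and formation of the quotient commute.\<close>

lemma subtopology_quotient:
  assumes N: "N \<lhd> G" and A: "subgroup A (G Mod N)"
  shows "subtopology (quotient_group_topology G \<tau> N) A =
    quotient_group_topology (G\<lparr>carrier := \<Union>A\<rparr>) (subtopology \<tau> (\<Union>A)) N"
proof -
  interpret normal N G by fact
  have HA: "\<Union>A = {x \<in> carrier G. N #> x \<in> A}" by (rule factgroup_subgroup_union_char[OF A])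
  have AG: "A \<subseteq> carrier (G Mod N)" using A by (rule subgroup.subset)
  have coset: "r_coset (G\<lparr>carrier := \<Union>A\<rparr>) N x = N #> x" for x by (simp add: r_coset_def)
  have cA: "carrier (G\<lparr>carrier := \<Union>A\<rparr> Mod N) = A"
    unfolding carrier_FactGroup coset using AG by (auto simp: HA carrier_FactGroup)
  show ?thesis
    unfolding topology_eq
  proof (intro allI iffI)
    fix S assume "openin (subtopology (quotient_group_topology G \<tau> N) A) S"
    then obtain W where W: "W \<subseteq> carrier (G Mod N)" "openin \<tau> {x \<in> carrier G. N #> x \<in> W}" "S = W \<inter> A"
      by (auto simp: openin_subtopology openin_quotient_group_topology)
    have "{x \<in> \<Union>A. N #> x \<in> S} = {x \<in> carrier G. N #> x \<in> W} \<inter> \<Union>A"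
      using W(3) HA by blast
    then have "openin (subtopology \<tau> (\<Union>A)) {x \<in> \<Union>A. N #> x \<in> S}"
      using W(2) by (auto simp: openin_subtopology)
    moreover have "\<Union>A \<inter> carrier G = \<Union>A" using HA by blast
    ultimately show "openin (quotient_group_topology (G\<lparr>carrier := \<Union>A\<rparr>) (subtopology \<tau> (\<Union>A)) N) S"
      using W(3) by (simp add: openin_quotient_group_topology coset cA Int_commute)
  next
    fix S assume S: "openin (quotient_group_topology (G\<lparr>carrier := \<Union>A\<rparr>) (subtopology \<tau> (\<Union>A)) N) S"
    have AA: "carrier G \<inter> \<Union>A = \<Union>A" using HA by blast
    have SA: "S \<subseteq> A" "openin (subtopology \<tau> (\<Union>A)) {x \<in> \<Union>A. N #> x \<in> S}"
      using S AA by (simp_all add: openin_quotient_group_topology coset cA)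
    then obtain T where T: "openin \<tau> T" "{x \<in> \<Union>A. N #> x \<in> S} = T \<inter> \<Union>A"
      by (auto simp: openin_subtopology)
    define W where "W = (\<lambda>x. N #> x) ` T"
    have "openin (quotient_group_topology G \<tau> N) W"
      unfolding W_def using open_quotient[OF N] T(1) by (simp add: open_map_def)
    moreover have "S = W \<inter> A"
    proof
      show "S \<subseteq> W \<inter> A"
      proof
        fix s assume s: "s \<in> S"
        then obtain x where x: "x \<in> carrier G" "s = N #> x" using SA AG by (auto simp: carrier_FactGroup)
        then have "x \<in> \<Union>A" using HA s SA by blast
        then have "x \<in> T" using x s T(2) by blast
        then show "s \<in> W \<inter> A" using x s SA by (auto simp: W_def)
      qed
      show "W \<inter> A \<subseteq> S"
      proof
        fix s assume s: "s \<in> W \<inter> A"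
        then obtain x where x: "x \<in> T" "s = N #> x" by (auto simp: W_def)
        then have "x \<in> \<Union>A" using HA s openin_carrier[OF T(1)] by blast
        then show "s \<in> S" using x T(2) by blast
      qed
    qed
    ultimately show "openin (subtopology (quotient_group_topology G \<tau> N) A) S"
      by (auto simp: openin_subtopology)
  qed
qed

text \<open>Every subgroup of the quotient is the quotient by \<open>N\<close> of its full preimage
  \<open>H\<close>, and total minimality of \<open>H\<close> makes it minimal.\<close>

lemma hereditarily_minimal_quotient:
  assumes htm: "hereditarily_totally_minimal G \<tau>" and N: "N \<lhd> G" "closedin \<tau> N"
  shows "hereditarily_minimal (G Mod N) (quotient_group_topology G \<tau> N)"
proof -
  interpret normal N G by fact
  have min: "minimal_group (G\<lparr>carrier := H\<rparr> Mod N) (quotient_group_topology (G\<lparr>carrier := H\<rparr>) (subtopology \<tau> H) N)"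
    if H: "subgroup H G" "N \<subseteq> H" for H
  proof -
    have "N \<lhd> G\<lparr>carrier := H\<rparr>" by (rule normal_restrict_supergroup[OF H(1) N(1) H(2)])
    moreover have "closedin (subtopology \<tau> H) N" using N(2) H(2) by (simp add: closedin_subset_topspace)
    ultimately show ?thesis
      using htm H(1) unfolding hereditarily_totally_minimal_def totally_minimal_def by blast
  qed
  have "minimal_group (G Mod N) (quotient_group_topology G \<tau> N)"
    using min[OF subgroup_self] subset by (simp add: subtopology_topspace[of \<tau>, simplified])
  moreover have "minimal_group ((G Mod N)\<lparr>carrier := A\<rparr>) (subtopology (quotient_group_topology G \<tau> N) A)"
    if A: "subgroup A (G Mod N)" for A
  proof -
    have "subgroup (\<Union>A) G" by (rule factgroup_subgroup_union_subgroup[OF A])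
    moreover have "N \<subseteq> \<Union>A" using subgroup.one_closed[OF A] by auto
    ultimately have "minimal_group (G\<lparr>carrier := \<Union>A\<rparr> Mod N)
        (quotient_group_topology (G\<lparr>carrier := \<Union>A\<rparr>) (subtopology \<tau> (\<Union>A)) N)"
      by (rule min)
    moreover have "G\<lparr>carrier := \<Union>A\<rparr> Mod N = (G Mod N)\<lparr>carrier := A\<rparr>"
      using factgroup_subgroup_union_factor[OF A]
      by (simp add: FactGroup_def set_mult_def fun_eq_iff)
    ultimately show ?thesis by (simp add: subtopology_quotient[OF N(1) A])
  qed
  ultimately show ?thesis by (simp add: hereditarily_minimal_def minimal_group_def)
qed

lemma quotient_trivial_iso:
  shows "(\<lambda>x. {\<one>} #> x) \<in> iso G (G Mod {\<one>})"
    and "homeomorphic_map \<tau> (quotient_group_topology G \<tau> {\<one>}) (\<lambda>x. {\<one>} #> x)"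
proof -
  interpret normal "{\<one>}" G by (rule one_is_normal)
  have inj: "inj_on (\<lambda>x. {\<one>} #> x) (carrier G)" by (auto simp: inj_on_def r_coset_def)
  show "(\<lambda>x. {\<one>} #> x) \<in> iso G (G Mod {\<one>})"
    using r_coset_hom_Mod inj by (simp add: iso_def bij_betw_def carrier_FactGroup)
  show "homeomorphic_map \<tau> (quotient_group_topology G \<tau> {\<one>}) (\<lambda>x. {\<one>} #> x)"
    by (rule bijective_open_imp_homeomorphic_map)
       (use continuous_quotient open_quotient one_is_normal topspace_quotient inj in
         \<open>auto simp: carrier_FactGroup\<close>)
qed

end

text \<open>Total minimality speaks about \<open>G Mod {\<one>}\<close>, whose elements are
  singletons; transport along the canonical isomorphism, in both directions, returns to
  \<open>G\<close>.\<close>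

lemma (in topgroup) minimal_group_quotient_trivial_iff:
  "minimal_group (G Mod {\<one>}) (quotient_group_topology G \<tau> {\<one>}) \<longleftrightarrow> minimal_group G \<tau>"
proof -
  have grp: "group (G Mod {\<one>})" using normal.factorgroup_is_group[OF one_is_normal] .
  let ?f = "\<lambda>x. {\<one>} #> x"
  obtain g where g: "homeomorphic_maps \<tau> (quotient_group_topology G \<tau> {\<one>}) ?f g"
    using quotient_trivial_iso(2) homeomorphic_map_maps by blast
  have gf: "g (?f x) = x" if "x \<in> carrier G" for x
    using g that by (auto simp: homeomorphic_maps_def)
  have "g \<in> iso (G Mod {\<one>}) G"
  proof -
    have "group_isomorphisms G (G Mod {\<one>}) ?f g"
    proof -
      have "g \<in> hom (G Mod {\<one>}) G"
      proof (rule homI)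
        fix X assume "X \<in> carrier (G Mod {\<one>})"
        then show "g X \<in> carrier G" using gf by (auto simp: carrier_FactGroup)
      next
        fix X Y assume "X \<in> carrier (G Mod {\<one>})" "Y \<in> carrier (G Mod {\<one>})"
        then obtain x y where "x \<in> carrier G" "X = ?f x" "y \<in> carrier G" "Y = ?f y" by (auto simp: carrier_FactGroup)
        then show "g (X \<otimes>\<^bsub>G Mod {\<one>}\<^esub> Y) = g X \<otimes> g Y"
          using gf normal.rcos_sum[OF one_is_normal, of x y] by simp
      qed
      then show ?thesis
        using quotient_trivial_iso(1) gf by (auto simp: group_isomorphisms_def iso_def carrier_FactGroup)
    qed
    then show ?thesis by (rule group_isomorphisms_imp_iso[OF group_isomorphisms_sym])
  qed
  moreover have "homeomorphic_map (quotient_group_topology G \<tau> {\<one>}) \<tau> g"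
    using g homeomorphic_maps_map homeomorphic_maps_sym by blast
  ultimately show ?thesis
    using minimal_group_transport[OF _ grp quotient_trivial_iso] minimal_group_transport[OF _ group_axioms]
    by blast
qed

lemma (in topgroup) hereditarily_minimal_if_totally:
  assumes "hereditarily_totally_minimal G \<tau>"
  shows "hereditarily_minimal G \<tau>"
  unfolding hereditarily_minimal_def
proof (intro conjI allI impI top_group)
  fix H assume H: "subgroup H G"
  interpret H: topgroup "G\<lparr>carrier := H\<rparr>" "subtopology \<tau> H" by (rule topological_subgroup[OF H])
  have "closedin (subtopology \<tau> H) {\<one>}" using H.closedin_finite[of "{\<one>}"] H.one_closed by simp
  then have "minimal_group (G\<lparr>carrier := H\<rparr> Mod {\<one>}) (quotient_group_topology (G\<lparr>carrier := H\<rparr>) (subtopology \<tau> H) {\<one>})"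
    using assms H H.one_is_normal unfolding hereditarily_totally_minimal_def totally_minimal_def by auto
  then show "minimal_group (G\<lparr>carrier := H\<rparr>) (subtopology \<tau> H)"
    using H.minimal_group_quotient_trivial_iff by simp
qed

text \<open>Otherwise the sets \<open>H \<inter> U N\<close> would be a base of a coarser Hausdorff group topology on \<open>H\<close>.\<close>

lemma (in topgroup) minimal_subgroup_essential:
  assumes H: "subgroup H G" and min: "minimal_group (G\<lparr>carrier := H\<rparr>) (subtopology \<tau> H)"
    and N: "N \<lhd> G" "closedin \<tau> N" "N \<subseteq> \<tau> closure_of H" "N \<inter> H = {\<one>}"
  shows "N = {\<one>}"
proof (rule ccontr)
  assume "N \<noteq> {\<one>}"
  interpret N: normal N G by fact
  interpret H: topgroup "G\<lparr>carrier := H\<rparr>" "subtopology \<tau> H" by (rule topological_subgroup[OF H])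
  have HG: "H \<subseteq> carrier G" using H by (rule subgroup.subset)
  \<comment> \<open>The trace on \<open>H\<close> of the product \<open>U N\<close>: as
    \<open>N\<close> is closed under inverses, \<open>h \<otimes> n \<in> U\<close> for some
    \<open>n\<close> in \<open>N\<close> says that \<open>h\<close> lies in that product.\<close>
  define B where "B U = {h \<in> H. \<exists>n\<in>N. h \<otimes> n \<in> U}" for U
  define \<B> where "\<B> = B ` {U. openin \<tau> U \<and> \<one> \<in> U}"
  obtain n0 where n0: "n0 \<in> N" "n0 \<noteq> \<one>" using \<open>N \<noteq> {\<one>}\<close> N.one_closed by blast
  have "nbhd_base (G\<lparr>carrier := H\<rparr>) \<B>"
  proof
    show "\<B> \<noteq> {}" unfolding \<B>_def using openin_topspace[of \<tau>] by auto
    show "A \<subseteq> carrier (G\<lparr>carrier := H\<rparr>)" if "A \<in> \<B>" for A using that by (auto simp: \<B>_def B_def)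
    show "\<exists>C\<in>\<B>. C \<subseteq> A \<inter> A'" if A: "A \<in> \<B>" "A' \<in> \<B>" for A A'
    proof -
      obtain U U' where "openin \<tau> U" "\<one> \<in> U" "A = B U" "openin \<tau> U'" "\<one> \<in> U'" "A' = B U'"
        using A by (auto simp: \<B>_def)
      then have "B (U \<inter> U') \<in> \<B>" "B (U \<inter> U') \<subseteq> A \<inter> A'"
        by (simp add: \<B>_def image_eqI[OF refl] openin_Int, auto simp: B_def)
      then show ?thesis by blast
    qed
    show "\<exists>A'\<in>\<B>. \<forall>x\<in>A'. \<forall>y\<in>A'. x \<otimes>\<^bsub>G\<lparr>carrier := H\<rparr>\<^esub> y \<in> A" if A: "A \<in> \<B>" for A
    proof -
      obtain U where U: "openin \<tau> U" "\<one> \<in> U" "A = B U" using A by (auto simp: \<B>_def)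
      obtain V where V: "openin \<tau> V" "\<one> \<in> V" "\<forall>x\<in>V. \<forall>y\<in>V. x \<otimes> y \<in> U" using nbhd_one[OF U(1,2)] by blast
      have "x \<otimes> y \<in> B U" if xy: "x \<in> B V" "y \<in> B V" for x y
      proof -
        obtain n m where nm: "x \<in> H" "y \<in> H" "n \<in> N" "m \<in> N" "x \<otimes> n \<in> V" "y \<otimes> m \<in> V"
          using xy unfolding B_def by blast
        then have G: "x \<in> carrier G" "y \<in> carrier G" "n \<in> carrier G" "m \<in> carrier G" using HG by auto
        have "(x \<otimes> n) \<otimes> (y \<otimes> m) = (x \<otimes> y) \<otimes> ((inv y \<otimes> n \<otimes> y) \<otimes> m)" using G by (simp add: group_normalize)
        moreover have "(inv y \<otimes> n \<otimes> y) \<otimes> m \<in> N" using N.inv_op_closed1[OF G(2) nm(3)] nm(4) by simp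
        moreover have "(x \<otimes> n) \<otimes> (y \<otimes> m) \<in> U" using V nm by blast
        moreover have "x \<otimes> y \<in> H" using nm H by (simp add: subgroup.m_closed)
        ultimately show ?thesis unfolding B_def by force
      qed
      then show ?thesis using U V by (auto simp: \<B>_def intro!: bexI[of _ "B V"])
    qed
    show "\<exists>A'\<in>\<B>. \<forall>x\<in>A'. inv\<^bsub>G\<lparr>carrier := H\<rparr>\<^esub> x \<in> A" if A: "A \<in> \<B>" for A
    proof -
      obtain U where U: "openin \<tau> U" "\<one> \<in> U" "A = B U" using A by (auto simp: \<B>_def)
      obtain V where V: "openin \<tau> V" "\<one> \<in> V" "V \<subseteq> U" "\<forall>x\<in>V. inv x \<in> V" using nbhd_one[OF U(1,2)] by blast
      have "inv x \<in> B U" if xB: "x \<in> B V" for x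
      proof -
        obtain n where nm: "x \<in> H" "n \<in> N" "x \<otimes> n \<in> V" using xB by (auto simp: B_def)
        then have G: "x \<in> carrier G" "n \<in> carrier G" using HG by auto
        have "inv (x \<otimes> n) = inv x \<otimes> (x \<otimes> inv n \<otimes> inv x)" using G by (simp add: group_normalize)
        moreover have "x \<otimes> inv n \<otimes> inv x \<in> N" using N.inv_op_closed2[OF G(1)] nm(2) by simp
        moreover have "inv (x \<otimes> n) \<in> U" using V nm by blast
        moreover have "inv x \<in> H" using nm H by (simp add: subgroup.m_inv_closed)
        ultimately show ?thesis unfolding B_def by force
      qed
      then show ?thesis using U V H by (auto simp: \<B>_def B_def intro!: bexI[of _ "B V"])
    qed
    show "\<exists>A'\<in>\<B>. \<forall>x\<in>A'. g \<otimes>\<^bsub>G\<lparr>carrier := H\<rparr>\<^esub> x \<otimes>\<^bsub>G\<lparr>carrier := H\<rparr>\<^esub> inv\<^bsub>G\<lparr>carrier := H\<rparr>\<^esub> g \<in> A"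
      if A: "A \<in> \<B>" and g: "g \<in> carrier (G\<lparr>carrier := H\<rparr>)" for A g
    proof -
      obtain U where U: "openin \<tau> U" "\<one> \<in> U" "A = B U" using A by (auto simp: \<B>_def)
      have gH: "g \<in> H" using g by simp
      have gG: "g \<in> carrier G" using g HG by auto
      define V where "V = {x \<in> carrier G. g \<otimes> x \<otimes> inv g \<in> U}"
      have V: "openin \<tau> V" "\<one> \<in> V"
        using openin_preimage[OF continuous_map_conj[OF gG] U(1)] U(2) gG by (auto simp: V_def)
      have "g \<otimes> x \<otimes> inv g \<in> B U" if xB: "x \<in> B V" for x
      proof -
        obtain n where nm: "x \<in> H" "n \<in> N" "x \<otimes> n \<in> V" using xB by (auto simp: B_def)
        then have G: "x \<in> carrier G" "n \<in> carrier G" using HG by auto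
        have "g \<otimes> (x \<otimes> n) \<otimes> inv g = (g \<otimes> x \<otimes> inv g) \<otimes> (g \<otimes> n \<otimes> inv g)" using G gG by (simp add: group_normalize)
        moreover have "g \<otimes> n \<otimes> inv g \<in> N" using N.inv_op_closed2[OF gG nm(2)] .
        moreover have "g \<otimes> (x \<otimes> n) \<otimes> inv g \<in> U" using V_def nm by blast
        moreover have "g \<otimes> x \<otimes> inv g \<in> H" using nm gH H by (simp add: subgroup.m_inv_closed subgroup.m_closed)
        ultimately show ?thesis unfolding B_def by force
      qed
      then show ?thesis using U V H gH by (auto simp: \<B>_def intro!: bexI[of _ "B V"])
    qed
    show "\<one>\<^bsub>G\<lparr>carrier := H\<rparr>\<^esub> \<in> A" if "A \<in> \<B>" for A
      using that subgroup.one_closed[OF H] N.one_closed by (auto simp: \<B>_def B_def intro!: bexI[of _ \<one>])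
    show "\<exists>A\<in>\<B>. x \<notin> A" if x: "x \<in> carrier (G\<lparr>carrier := H\<rparr>)" "x \<noteq> \<one>\<^bsub>G\<lparr>carrier := H\<rparr>\<^esub>" for x
    proof -
      \<comment> \<open>Separation of the coarser topology: \<open>x\<close> lies outside
        \<open>N\<close>, which is closed, so the complement of \<open>N\<close>, translated to the
        identity, gives a set whose trace misses \<open>x\<close>.\<close>
      have xG: "x \<in> carrier G" "x \<in> H" "x \<noteq> \<one>" using x HG by auto
      then have "inv x \<notin> N" using N(4) by (metis IntI N.m_inv_closed inv_inv singletonD)
      then have "inv x \<in> topspace \<tau> - N" using xG by simp
      moreover have "openin \<tau> (topspace \<tau> - N)" using N(2) by blast
      ultimately have "openin \<tau> {y \<in> carrier G. inv x \<otimes> y \<in> topspace \<tau> - N}" "\<one> \<in> {y \<in> carrier G. inv x \<otimes> y \<in> topspace \<tau> - N}"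
        using nbhd_translate by blast+
      then have "B {y \<in> carrier G. inv x \<otimes> y \<in> topspace \<tau> - N} \<in> \<B>" by (auto simp: \<B>_def)
      moreover have "x \<notin> B {y \<in> carrier G. inv x \<otimes> y \<in> topspace \<tau> - N}"
        using xG by (auto simp: B_def mult_inv_cancel_left)
      ultimately show ?thesis by blast
    qed
  qed
  moreover have "\<exists>U. openin (subtopology \<tau> H) U \<and> \<one>\<^bsub>G\<lparr>carrier := H\<rparr>\<^esub> \<in> U \<and> U \<subseteq> A" if A: "A \<in> \<B>" for A
  proof -
    obtain U where U: "openin \<tau> U" "\<one> \<in> U" "A = B U" using A by (auto simp: \<B>_def)
    have "openin (subtopology \<tau> H) (U \<inter> H)" using U(1) by (auto simp: openin_subtopology)
    moreover have "U \<inter> H \<subseteq> B U"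
      using HG by (auto simp: B_def intro!: bexI[OF _ N.one_closed])
    ultimately show ?thesis using U subgroup.one_closed[OF H] by auto
  qed
  moreover obtain V where V: "openin \<tau> V" "\<one> \<in> V" "\<forall>x\<in>V. inv x \<in> V" "\<forall>x\<in>V. \<forall>y\<in>V. x \<otimes> y \<noteq> n0"
    using nbhd_exclude n0 N.mem_carrier by metis
  moreover have "openin (subtopology \<tau> H) (V \<inter> H)" using V(1) by (auto simp: openin_subtopology)
  ultimately obtain A where A: "A \<in> \<B>" "A \<subseteq> V \<inter> H"
    using minimal_group_nbhd_base[OF min, of \<B> "V \<inter> H"] subgroup.one_closed[OF H] by auto
  obtain U where U: "openin \<tau> U" "\<one> \<in> U" "A = B U" using A by (auto simp: \<B>_def)
  have n0G: "n0 \<in> carrier G" using n0 by simp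
  \<comment> \<open>Density puts some \<open>h\<close> of \<open>H\<close> near \<open>n0\<close>.
    Being near an element of \<open>N\<close> it belongs to the trace of \<open>U N\<close>, hence
    to \<open>V\<close>; being near \<open>n0\<close> it is \<open>n0\<close> times an element of
    \<open>V\<close>. Then \<open>n0\<close> is a product of two elements of \<open>V\<close>,
    against the choice of \<open>V\<close>.\<close>
  define T where "T = {x \<in> carrier G. x \<otimes> inv n0 \<in> U} \<inter> {x \<in> carrier G. inv n0 \<otimes> x \<in> V}"
  have "openin \<tau> T" unfolding T_def
    using openin_preimage[OF continuous_map_rmult[of "inv n0"] U(1)] openin_lcoset[OF V(1) n0G] n0G by blast
  moreover have "n0 \<in> T" using U V n0G by (simp add: T_def)
  moreover have "n0 \<in> \<tau> closure_of H" using n0 N by blast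
  ultimately obtain h where h: "h \<in> H" "h \<in> T" by (auto simp: in_closure_of)
  then have hG: "h \<in> carrier G" using HG by blast
  have "h \<in> B U" using h n0 by (auto simp: B_def T_def intro!: bexI[of _ "inv n0"])
  then have "h \<in> V" using A U by blast
  moreover have "inv (inv n0 \<otimes> h) \<in> V" using h V by (simp add: T_def)
  ultimately have "h \<otimes> inv (inv n0 \<otimes> h) \<noteq> n0" using V by blast
  then show False using hG n0G by (simp add: group_normalize)
qed

subsection \<open>Characters of abelian groups\<close>

definition character :: "('a, 'b) monoid_scheme \<Rightarrow> ('a \<Rightarrow> complex) \<Rightarrow> bool" where
  "character G \<psi> \<longleftrightarrow> (\<forall>x\<in>carrier G. norm (\<psi> x) = 1) \<and>
     (\<forall>x\<in>carrier G. \<forall>y\<in>carrier G. \<psi> (x \<otimes>\<^bsub>G\<^esub> y) = \<psi> x * \<psi> y)"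

text \<open>A character of a subgroup, encoded as its graph, so that extension becomes inclusion and
  chains have unions. Since the graph is closed under products and inverses, single-valuedness at
  the identity gives it everywhere.\<close>

definition partial_character :: "('a, 'b) monoid_scheme \<Rightarrow> ('a \<times> complex) set \<Rightarrow> bool" where
  "partial_character G R \<longleftrightarrow> R \<subseteq> carrier G \<times> sphere 0 1 \<and> (\<one>\<^bsub>G\<^esub>, 1) \<in> R \<and>
     (\<forall>a z b w. (a, z) \<in> R \<longrightarrow> (b, w) \<in> R \<longrightarrow> (a \<otimes>\<^bsub>G\<^esub> b, z * w) \<in> R) \<and>
     (\<forall>a z. (a, z) \<in> R \<longrightarrow> (inv\<^bsub>G\<^esub> a, inverse z) \<in> R) \<and>
     (\<forall>z. (\<one>\<^bsub>G\<^esub>, z) \<in> R \<longrightarrow> z = 1)"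

text \<open>For \<open>m\<close> at least 2 there are two different roots, so one of them is not 1.
  The nontrivial value is what lets characters separate points.\<close>

lemma unit_complex_root_ne_1:
  fixes \<zeta> :: complex
  assumes "norm \<zeta> = 1" "m \<ge> (2::nat)"
  shows "\<exists>w. norm w = 1 \<and> w ^ m = \<zeta> \<and> w \<noteq> 1"
proof -
  define t where "t = Arg \<zeta>"
  have \<zeta>: "\<zeta> = cis t" using assms(1) by (metis cis_Arg norm_zero sgn_eq t_def zero_neq_one div_by_1 of_real_1)
  have m: "real m \<noteq> 0" using assms by simp
  define u v where "u = cis (t / m)" and "v = cis (2 * pi / m)"
  have "u ^ m = \<zeta>" "v ^ m = 1" using m by (simp_all add: u_def v_def Complex.DeMoivre \<zeta>)
  moreover have "v \<noteq> 1"
  proof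
    assume "v = 1"
    then have "cos (2 * pi / m) = 1" by (simp add: v_def complex_eq_iff)
    then obtain n :: int where n: "2 * pi / m = of_int n * 2 * pi" using cos_one_2pi_int by blast
    then have "1 = of_int n * real m" using m by (simp add: field_simps)
    then have "n * int m = 1" by (metis of_int_1 of_int_eq_iff of_int_mult of_int_of_nat_eq)
    then show False using assms(2) zmult_eq_1_iff by auto
  qed
  moreover have "norm u = 1" "norm v = 1" by (auto simp: u_def v_def)
  ultimately show ?thesis by (metis power_one)
qed

context comm_group
begin

lemma partial_character_pow:
  assumes R: "partial_character G R" "(a, z) \<in> R"
  shows "(a [^] (n::int), z powi n) \<in> R"
proof -
  have nat: "(a [^] (k::nat), z ^ k) \<in> R" for k
  proof (induction k)
    case 0
    then show ?case using R by (simp add: partial_character_def)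
  next
    case (Suc k)
    then have "(a [^] k \<otimes> a, z ^ k * z) \<in> R" using R unfolding partial_character_def by blast
    then show ?case by (simp add: mult.commute)
  qed
  show ?thesis
  proof (cases n rule: int_cases2)
    case (nonneg k)
    then show ?thesis using nat[of k] by (simp add: int_pow_int)
  next
    case (nonpos k)
    have "(inv (a [^] k), inverse (z ^ k)) \<in> R"
      using nat[of k] R unfolding partial_character_def by blast
    moreover have "a \<in> carrier G" using R unfolding partial_character_def by blast
    ultimately show ?thesis using nonpos by (simp add: int_pow_neg_int power_int_minus)
  qed
qed

text \<open>The value \<open>w\<close> at \<open>g\<close> has to agree with the values already
  given at powers of \<open>g\<close>. These powers are the multiples of the least positive exponent
  \<open>m\<close> in the domain, and divisibility of the circle solves
  \<open>w ^ m = \<zeta>\<close>. If there is no such exponent, the value -1 is taken.\<close>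

lemma partial_character_extend:
  assumes R: "partial_character G R" and g: "g \<in> carrier G" "g \<notin> Domain R"
  shows "\<exists>R' w. partial_character G R' \<and> R \<subseteq> R' \<and> (g, w) \<in> R' \<and> w \<noteq> 1"
proof -
  have RG: "a \<in> carrier G" "norm z = 1" if "(a, z) \<in> R" for a z
    using R that by (auto simp: partial_character_def)
  have Rm: "(a \<otimes> b, z * w) \<in> R" if "(a, z) \<in> R" "(b, w) \<in> R" for a z b w
    using R that unfolding partial_character_def by blast
  have Ri: "(inv a, inverse z) \<in> R" if "(a, z) \<in> R" for a z
    using R that unfolding partial_character_def by blast
  have R1: "(\<one>, 1) \<in> R" and R1': "\<And>z. (\<one>, z) \<in> R \<Longrightarrow> z = 1"
    using R unfolding partial_character_def by blast+
  have "\<exists>w. norm w = 1 \<and> w \<noteq> 1 \<and> (\<forall>n::int. g [^] n \<in> Domain R \<longrightarrow> (g [^] n, w powi n) \<in> R)"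
  proof (cases "\<exists>n::nat. n > 0 \<and> g [^] n \<in> Domain R")
    case False
    have "n = 0" if n: "g [^] n \<in> Domain R" for n :: int
    proof (cases n rule: int_cases2)
      case (nonneg k)
      then show ?thesis using n False by (auto simp: int_pow_int)
    next
      case (nonpos k)
      obtain z where z: "(g [^] n, z) \<in> R" using n by blast
      have "inv (g [^] n) = g [^] k" using g nonpos by (simp add: int_pow_neg_int)
      then have "g [^] k \<in> Domain R" using Ri[OF z] by (metis DomainI)
      then show ?thesis using nonpos False by auto
    qed
    then have "(g [^] n, (-1) powi n) \<in> R" if "g [^] n \<in> Domain R" for n :: int
      using that R1 by fastforce
    then show ?thesis by (intro exI[of _ "-1"]) auto
  next
    case True
    define m where "m = (LEAST n::nat. n > 0 \<and> g [^] n \<in> Domain R)"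
    have m: "m > 0" "g [^] m \<in> Domain R" using LeastI_ex[OF True] by (auto simp: m_def)
    have least: "\<not> (k > 0 \<and> g [^] k \<in> Domain R)" if "k < m" for k :: nat
      using not_less_Least that unfolding m_def by blast
    have "m \<noteq> 1" using m g by auto
    then have m2: "m \<ge> 2" using m by linarith
    obtain \<zeta> where \<zeta>: "(g [^] m, \<zeta>) \<in> R" using m by blast
    obtain w where w: "norm w = 1" "w ^ m = \<zeta>" "w \<noteq> 1" using unit_complex_root_ne_1[OF RG(2)[OF \<zeta>] m2] by blast
    have "(g [^] n, w powi n) \<in> R" if n: "g [^] n \<in> Domain R" for n :: int
    proof -
      define q r where "q = n div int m" and "r = n mod int m"
      have qr: "n = int m * q + r" "0 \<le> r" "r < int m" using m by (auto simp: q_def r_def)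
      have p: "(g [^] (int m * q), w powi (int m * q)) \<in> R"
        using partial_character_pow[OF R \<zeta>, of q] g
        by (simp add: int_pow_pow[symmetric] int_pow_int power_int_mult w)
      obtain z where z: "(g [^] n, z) \<in> R" using n by blast
      have "g [^] n \<otimes> inv (g [^] (int m * q)) = g [^] r"
        using g by (simp add: qr(1) flip: int_pow_diff)
      then have "g [^] r \<in> Domain R" using Rm[OF z Ri[OF p]] by (metis DomainI)
      then have "g [^] nat r \<in> Domain R" using qr by (simp add: pow_nat)
      then have "r = 0" using least[of "nat r"] qr by auto
      then show ?thesis using p qr by simp
    qed
    then show ?thesis using w by blast
  qed
  then obtain w where w: "norm w = 1" "w \<noteq> 1" "\<And>n::int. g [^] n \<in> Domain R \<Longrightarrow> (g [^] n, w powi n) \<in> R" by blast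
  have w0: "w \<noteq> 0" using w by auto
  define R' where "R' = {(a \<otimes> g [^] n, z * w powi n) | a z n::int. (a, z) \<in> R}"
  have R'I: "(a \<otimes> g [^] n, z * w powi n) \<in> R'" if "(a, z) \<in> R" for a z and n :: int
    using that unfolding R'_def by blast
  have "partial_character G R'"
    unfolding partial_character_def
  proof (intro conjI allI impI)
    show "R' \<subseteq> carrier G \<times> sphere 0 1"
      using RG g w by (auto simp: R'_def norm_mult norm_power_int)
    show "(\<one>, 1) \<in> R'" using R'I[OF R1, of 0] by simp
    fix a z b v assume "(a, z) \<in> R'" "(b, v) \<in> R'"
    then obtain a' z' n b' v' k where *: "(a', z') \<in> R" "a = a' \<otimes> g [^] (n::int)" "z = z' * w powi n"
      "(b', v') \<in> R" "b = b' \<otimes> g [^] (k::int)" "v = v' * w powi k" unfolding R'_def by blast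
    have "a \<otimes> b = (a' \<otimes> b') \<otimes> g [^] (n + k)"
      using * g RG by (simp add: int_pow_mult m_ac)
    moreover have "z * v = (z' * v') * w powi (n + k)" using * w0 by (simp add: power_int_add)
    ultimately show "(a \<otimes> b, z * v) \<in> R'" using R'I[OF Rm[OF *(1,4)], of "n + k"] by simp
  next
    fix a z assume "(a, z) \<in> R'"
    then obtain a' z' n where *: "(a', z') \<in> R" "a = a' \<otimes> g [^] (n::int)" "z = z' * w powi n"
      unfolding R'_def by blast
    have "inv a = inv a' \<otimes> g [^] (-n)" using * g RG by (simp add: int_pow_neg inv_mult)
    moreover have "inverse z = inverse z' * w powi (-n)" using * by (simp add: power_int_minus)
    ultimately show "(inv a, inverse z) \<in> R'" using R'I[OF Ri[OF *(1)], of "-n"] by simp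
  next
    fix z assume "(\<one>, z) \<in> R'"
    then obtain a' z' n where *: "(a', z') \<in> R" "\<one> = a' \<otimes> g [^] (n::int)" "z = z' * w powi n"
      unfolding R'_def by blast
    have "g [^] n = inv a'" using *(2) RG[OF *(1)] g by (metis inv_closed inv_equality inv_inv int_pow_closed m_comm)
    then have "g [^] n \<in> Domain R" using Ri[OF *(1)] by (metis DomainI)
    then have "(a' \<otimes> g [^] n, z' * w powi n) \<in> R" using Rm[OF *(1) w(3)] by blast
    then show "z = 1" using * R1' by metis
  qed
  moreover have "R \<subseteq> R'"
  proof
    fix p assume p: "p \<in> R"
    obtain a z where "p = (a, z)" by (cases p)
    then show "p \<in> R'" using R'I[of a z 0] p RG by auto
  qed
  moreover have "(g, w) \<in> R'" using R'I[OF R1, of 1] g by simp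
  ultimately show ?thesis using w(2) by blast
qed

text \<open>One extension step from the trivial subgroup already gives a value other than 1 at
  \<open>x\<close>; a maximal extension provided by Zorn's lemma keeps it and is defined
  everywhere.\<close>

lemma character_separates:
  assumes x: "x \<in> carrier G" "x \<noteq> \<one>"
  shows "\<exists>\<psi>. character G \<psi> \<and> \<psi> x \<noteq> 1"
proof -
  have "partial_character G {(\<one>, 1)}" by (auto simp: partial_character_def)
  moreover have "x \<notin> Domain {(\<one>, 1::complex)}" using x by auto
  ultimately obtain R0 w where R0: "partial_character G R0" "(x, w) \<in> R0" "w \<noteq> 1"
    using partial_character_extend[OF _ x(1)] by blast
  define \<A> where "\<A> = {R. partial_character G R \<and> R0 \<subseteq> R}"
  have "\<exists>M\<in>\<A>. \<forall>X\<in>\<A>. M \<subseteq> X \<longrightarrow> X = M"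
  proof (rule subset_Zorn_nonempty)
    show "\<A> \<noteq> {}" using R0 by (auto simp: \<A>_def)
    fix \<C> assume C: "\<C> \<noteq> {}" "subset.chain \<A> \<C>"
    have sub: "R \<in> \<A>" if "R \<in> \<C>" for R using C that by (auto simp: subset.chain_def)
    then have pc: "partial_character G R" if "R \<in> \<C>" for R using that by (auto simp: \<A>_def)
    obtain C0 where C0: "C0 \<in> \<C>" using C by blast
    have "partial_character G (\<Union>\<C>)"
      unfolding partial_character_def
    proof (intro conjI allI impI)
      show "\<Union>\<C> \<subseteq> carrier G \<times> sphere 0 1" using pc unfolding partial_character_def by blast
      show "(\<one>, 1) \<in> \<Union>\<C>" using pc[OF C0] C0 unfolding partial_character_def by blast
      fix a z b v assume "(a, z) \<in> \<Union>\<C>" "(b, v) \<in> \<Union>\<C>"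
      then obtain S T where ST: "S \<in> \<C>" "T \<in> \<C>" "(a, z) \<in> S" "(b, v) \<in> T" by blast
      have "S \<subseteq> T \<or> T \<subseteq> S" using C ST unfolding subset.chain_def by blast
      then obtain U where "U \<in> \<C>" "(a, z) \<in> U" "(b, v) \<in> U" using ST by blast
      then show "(a \<otimes> b, z * v) \<in> \<Union>\<C>" using pc[of U] unfolding partial_character_def by blast
    next
      fix a z assume "(a, z) \<in> \<Union>\<C>"
      then obtain U where "U \<in> \<C>" "(a, z) \<in> U" by blast
      then show "(inv a, inverse z) \<in> \<Union>\<C>" using pc[of U] unfolding partial_character_def by blast
    next
      fix z assume "(\<one>, z) \<in> \<Union>\<C>"
      then obtain U where "U \<in> \<C>" "(\<one>, z) \<in> U" by blast
      then show "z = 1" using pc[of U] unfolding partial_character_def by blast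
    qed
    moreover have "R0 \<subseteq> \<Union>\<C>" using sub[OF C0] C0 by (auto simp: \<A>_def)
    ultimately show "\<Union>\<C> \<in> \<A>" by (simp add: \<A>_def)
  qed
  then obtain M where M: "M \<in> \<A>" and max: "\<And>X. X \<in> \<A> \<Longrightarrow> M \<subseteq> X \<Longrightarrow> X = M" by blast
  have pM: "partial_character G M" "R0 \<subseteq> M" using M by (auto simp: \<A>_def)
  have dom: "g \<in> Domain M" if g: "g \<in> carrier G" for g
  proof (rule ccontr)
    assume "g \<notin> Domain M"
    then obtain R' v where R': "partial_character G R'" "M \<subseteq> R'" "(g, v) \<in> R'"
      using partial_character_extend[OF pM(1) g] by blast
    then have "R' = M" using max[of R'] pM by (auto simp: \<A>_def)
    then show False using R' \<open>g \<notin> Domain M\<close> by blast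
  qed
  have Mm: "(a \<otimes> b, z * v) \<in> M" if "(a, z) \<in> M" "(b, v) \<in> M" for a z b v
    using pM that unfolding partial_character_def by blast
  have uniq: "z = v" if "(a, z) \<in> M" "(a, v) \<in> M" for a z v
  proof -
    have "(inv a, inverse v) \<in> M" using pM that unfolding partial_character_def by blast
    then have "(a \<otimes> inv a, z * inverse v) \<in> M" using Mm that by blast
    moreover have "a \<in> carrier G" "norm v = 1" using that pM unfolding partial_character_def by auto
    ultimately have "z * inverse v = 1" "v \<noteq> 0" using pM unfolding partial_character_def by auto
    then show ?thesis by (simp add: field_simps)
  qed
  define \<psi> where "\<psi> a = (THE z. (a, z) \<in> M)" for a
  have \<psi>: "\<psi> a = z" if "(a, z) \<in> M" for a z
    unfolding \<psi>_def using that uniq by blast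
  have "character G \<psi>"
    unfolding character_def
  proof (intro conjI ballI)
    fix a assume "a \<in> carrier G"
    then obtain z where z: "(a, z) \<in> M" using dom by blast
    then show "norm (\<psi> a) = 1" using \<psi>[OF z] pM unfolding partial_character_def by auto
  next
    fix a b assume "a \<in> carrier G" "b \<in> carrier G"
    then obtain z v where "(a, z) \<in> M" "(b, v) \<in> M" using dom by blast
    then show "\<psi> (a \<otimes> b) = \<psi> a * \<psi> b" using \<psi> Mm by metis
  qed
  moreover have "\<psi> x \<noteq> 1" using \<psi>[of x w] R0 pM by blast
  ultimately show ?thesis by blast
qed

end

text \<open>Pigeonhole over a finite cover of the closure of the image by balls of half the radius.
  Applied to one character after another, it makes finitely many characters nearly constant on an
  infinite set.\<close>

lemma infinite_subset_small_diameter: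
  fixes f :: "'a \<Rightarrow> complex"
  assumes "infinite S" "bounded (f ` S)" "\<epsilon> > 0"
  shows "\<exists>T\<subseteq>S. infinite T \<and> (\<forall>x\<in>T. \<forall>y\<in>T. dist (f x) (f y) < \<epsilon>)"
proof -
  have "compact (closure (f ` S))" using assms(2) by (simp add: compact_closure)
  then obtain K where K: "finite K" "closure (f ` S) \<subseteq> (\<Union>k\<in>K. ball k (\<epsilon> / 2))"
    using assms(3) unfolding compact_eq_totally_bounded by (metis half_gt_zero)
  have fS: "\<exists>k\<in>K. f x \<in> ball k (\<epsilon> / 2)" if "x \<in> S" for x
    using K(2) closure_subset[of "f ` S"] that by blast
  define c where "c x = (SOME k. k \<in> K \<and> f x \<in> ball k (\<epsilon> / 2))" for x
  have c: "c x \<in> K" "f x \<in> ball (c x) (\<epsilon> / 2)" if "x \<in> S" for x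
    using someI_ex[of "\<lambda>k. k \<in> K \<and> f x \<in> ball k (\<epsilon> / 2)"] fS[OF that] unfolding c_def by blast+
  have "finite (c ` S)" by (rule finite_subset[OF _ K(1)]) (use c in auto)
  then obtain a where a: "a \<in> S" "infinite {b \<in> S. c b = c a}" using pigeonhole_infinite[OF assms(1)] by blast
  have "dist (f x) (f y) < \<epsilon>" if "x \<in> {b \<in> S. c b = c a}" "y \<in> {b \<in> S. c b = c a}" for x y
  proof -
    have "f x \<in> ball (c a) (\<epsilon> / 2)" "f y \<in> ball (c a) (\<epsilon> / 2)" using that c(2)[of x] c(2)[of y] by auto
    then show ?thesis by (metis dist_commute dist_triangle_half_r mem_ball)
  qed
  then show ?thesis using a(2) by (intro exI[of _ "{b \<in> S. c b = c a}"]) auto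
qed

text \<open>The characters of an abelian group define a coarser totally bounded Hausdorff group topology.\<close>

lemma discrete_minimal_imp_finite:
  fixes G (structure)
  assumes "comm_group G" and min: "minimal_group G \<tau>" and disc: "openin \<tau> {\<one>}"
  shows "finite (carrier G)"
proof (rule ccontr)
  assume inf: "infinite (carrier G)"
  interpret comm_group G by fact
  interpret topgroup G \<tau> using min by unfold_locales (simp add: minimal_group_def)
  define B where "B X \<epsilon> = {x \<in> carrier G. \<forall>\<psi>\<in>X. dist (\<psi> x) 1 < \<epsilon>}" for X :: "('a \<Rightarrow> complex) set" and \<epsilon>
  define \<B> where "\<B> = {B X \<epsilon> | X \<epsilon>. finite X \<and> (\<forall>\<psi>\<in>X. character G \<psi>) \<and> \<epsilon> > 0}"
  have BI: "B X \<epsilon> \<in> \<B>" if "finite X" "\<And>\<psi>. \<psi> \<in> X \<Longrightarrow> character G \<psi>" "\<epsilon> > 0" for X \<epsilon>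
    using that unfolding \<B>_def by blast
  have \<psi>1: "\<psi> \<one> = 1" if "character G \<psi>" for \<psi>
  proof -
    have "\<psi> \<one> * \<psi> \<one> = \<psi> \<one>" "norm (\<psi> \<one>) = 1"
      using that unfolding character_def by (metis one_closed l_one, simp)
    moreover from this have "\<psi> \<one> \<noteq> 0" by auto
    ultimately show ?thesis by simp
  qed
  have \<psi>i: "\<psi> (inv x) * \<psi> x = 1" if "character G \<psi>" "x \<in> carrier G" for \<psi> x
    using that \<psi>1[OF that(1)] unfolding character_def by (metis inv_closed l_inv)
  have "nbhd_base G \<B>"
  proof
    show "\<B> \<noteq> {}" using BI[of "{}" 1] by auto
    show "A \<subseteq> carrier G" if "A \<in> \<B>" for A using that by (auto simp: \<B>_def B_def)
    show "\<exists>C\<in>\<B>. C \<subseteq> A \<inter> A'" if A: "A \<in> \<B>" "A' \<in> \<B>" for A A'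
    proof -
      obtain X \<epsilon> X' \<epsilon>' where *: "A = B X \<epsilon>" "finite X" "\<forall>\<psi>\<in>X. character G \<psi>" "\<epsilon> > 0"
        "A' = B X' \<epsilon>'" "finite X'" "\<forall>\<psi>\<in>X'. character G \<psi>" "\<epsilon>' > 0"
        using A by (auto simp: \<B>_def)
      then have "B (X \<union> X') (min \<epsilon> \<epsilon>') \<in> \<B>" by (intro BI) auto
      moreover have "B (X \<union> X') (min \<epsilon> \<epsilon>') \<subseteq> A \<inter> A'" using * by (auto simp: B_def)
      ultimately show ?thesis by blast
    qed
    show "\<exists>A'\<in>\<B>. \<forall>x\<in>A'. \<forall>y\<in>A'. x \<otimes> y \<in> A" if A: "A \<in> \<B>" for A
    proof -
      obtain X \<epsilon> where *: "A = B X \<epsilon>" "finite X" "\<forall>\<psi>\<in>X. character G \<psi>" "\<epsilon> > 0" using A by (auto simp: \<B>_def)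
      have "B X (\<epsilon>/2) \<in> \<B>" using * by (intro BI) auto
      moreover have "x \<otimes> y \<in> A" if "x \<in> B X (\<epsilon>/2)" "y \<in> B X (\<epsilon>/2)" for x y
      proof -
        have "dist (\<psi> (x \<otimes> y)) 1 < \<epsilon>" if \<psi>: "\<psi> \<in> X" for \<psi>
        proof -
          have "\<psi> (x \<otimes> y) - 1 = \<psi> x * (\<psi> y - 1) + (\<psi> x - 1)" "norm (\<psi> x) = 1"
            using * \<psi> \<open>x \<in> B X (\<epsilon>/2)\<close> \<open>y \<in> B X (\<epsilon>/2)\<close> by (auto simp: character_def B_def algebra_simps)
          then have "norm (\<psi> (x \<otimes> y) - 1) \<le> norm (\<psi> y - 1) + norm (\<psi> x - 1)"
            by (metis norm_triangle_ineq norm_mult mult_1)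
          moreover have "norm (\<psi> x - 1) < \<epsilon>/2" "norm (\<psi> y - 1) < \<epsilon>/2"
            using \<psi> \<open>x \<in> B X (\<epsilon>/2)\<close> \<open>y \<in> B X (\<epsilon>/2)\<close> by (auto simp: B_def dist_norm)
          ultimately show ?thesis by (simp add: dist_norm)
        qed
        then show ?thesis using that * by (auto simp: B_def)
      qed
      ultimately show ?thesis by blast
    qed
    show "\<exists>A'\<in>\<B>. \<forall>x\<in>A'. inv x \<in> A" if A: "A \<in> \<B>" for A
    proof -
      obtain X \<epsilon> where *: "A = B X \<epsilon>" "finite X" "\<forall>\<psi>\<in>X. character G \<psi>" "\<epsilon> > 0" using A by (auto simp: \<B>_def)
      have "inv x \<in> A" if x: "x \<in> A" for x
      proof -
        have "dist (\<psi> (inv x)) 1 < \<epsilon>" if \<psi>: "\<psi> \<in> X" for \<psi>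
        proof -
          have xG: "x \<in> carrier G" using x * by (auto simp: B_def)
          have "\<psi> (inv x) - 1 = \<psi> (inv x) * (1 - \<psi> x)"
            using \<psi>i[of \<psi> x] * \<psi> xG by (simp add: algebra_simps)
          moreover have "norm (\<psi> (inv x)) = 1" using * \<psi> xG by (auto simp: character_def)
          ultimately have "norm (\<psi> (inv x) - 1) = norm (1 - \<psi> x)" by (simp add: norm_mult)
          then show ?thesis using x * \<psi> by (simp add: B_def dist_norm norm_minus_commute)
        qed
        then show ?thesis using x * by (auto simp: B_def)
      qed
      then show ?thesis using A by blast
    qed
    show "\<exists>A'\<in>\<B>. \<forall>x\<in>A'. g \<otimes> x \<otimes> inv g \<in> A" if A: "A \<in> \<B>" and g: "g \<in> carrier G" for A g
    proof -
      have "g \<otimes> x \<otimes> inv g = x" if "x \<in> A" for x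
        using that A g by (auto simp: \<B>_def B_def m_comm[of g] m_assoc)
      then show ?thesis using A by metis
    qed
    show "\<one> \<in> A" if "A \<in> \<B>" for A using that \<psi>1 by (fastforce simp: \<B>_def B_def)
    show "\<exists>A\<in>\<B>. x \<notin> A" if x: "x \<in> carrier G" "x \<noteq> \<one>" for x
    proof -
      obtain \<psi> where \<psi>: "character G \<psi>" "\<psi> x \<noteq> 1" using character_separates[OF x] by blast
      have "B {\<psi>} (dist (\<psi> x) 1) \<in> \<B>" using \<psi> by (intro BI) auto
      moreover have "x \<notin> B {\<psi>} (dist (\<psi> x) 1)" by (auto simp: B_def)
      ultimately show ?thesis by blast
    qed
  qed
  moreover have "\<exists>U. openin \<tau> U \<and> \<one> \<in> U \<and> U \<subseteq> A" if "A \<in> \<B>" for A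
    using disc that \<psi>1 by (intro exI[of _ "{\<one>}"]) (fastforce simp: \<B>_def B_def)
  ultimately obtain A where "A \<in> \<B>" "A \<subseteq> {\<one>}" using minimal_group_nbhd_base[OF min _ _ disc] by blast
  then obtain X \<epsilon> where *: "finite X" "\<forall>\<psi>\<in>X. character G \<psi>" "\<epsilon> > 0" "B X \<epsilon> \<subseteq> {\<one>}" by (auto simp: \<B>_def)
  \<comment> \<open>Finitely many characters cannot keep infinitely many points apart by \<epsilon>.
    Two distinct points on which they nearly agree have a nontrivial quotient in
    \<open>B X \<epsilon>\<close>, which was supposed to be trivial.\<close>
  have "\<exists>T\<subseteq>carrier G. infinite T \<and> (\<forall>\<psi>\<in>X. \<forall>x\<in>T. \<forall>y\<in>T. dist (\<psi> x) (\<psi> y) < \<epsilon>)"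
    using *(1,2)
  proof (induction X rule: finite_induct)
    case empty
    then show ?case using inf by auto
  next
    case (insert \<psi> X)
    then obtain T where T: "T \<subseteq> carrier G" "infinite T" "\<forall>\<psi>\<in>X. \<forall>x\<in>T. \<forall>y\<in>T. dist (\<psi> x) (\<psi> y) < \<epsilon>" by auto
    have "bounded (\<psi> ` T)" using insert.prems T(1) by (auto simp: bounded_iff character_def intro!: exI[of _ 1])
    then obtain S where "S \<subseteq> T" "infinite S" "\<forall>x\<in>S. \<forall>y\<in>S. dist (\<psi> x) (\<psi> y) < \<epsilon>"
      using infinite_subset_small_diameter[OF T(2) _ *(3)] by metis
    then show ?case using T by (intro exI[of _ S]) blast
  qed
  then obtain T where T: "T \<subseteq> carrier G" "infinite T" "\<forall>\<psi>\<in>X. \<forall>x\<in>T. \<forall>y\<in>T. dist (\<psi> x) (\<psi> y) < \<epsilon>" by blast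
  obtain x where x: "x \<in> T" using T(2) by fastforce
  have "infinite (T - {x})" using T(2) by simp
  then obtain y where y: "y \<in> T" "y \<noteq> x" using infinite_imp_nonempty by blast
  have G: "x \<in> carrier G" "y \<in> carrier G" using T x y by auto
  have "dist (\<psi> (x \<otimes> inv y)) 1 < \<epsilon>" if \<psi>: "\<psi> \<in> X" for \<psi>
  proof -
    have "\<psi> (x \<otimes> inv y) - 1 = \<psi> (inv y) * (\<psi> x - \<psi> y)" "norm (\<psi> (inv y)) = 1"
      using \<psi>i[of \<psi> y] * \<psi> G by (auto simp: algebra_simps character_def)
    then have "norm (\<psi> (x \<otimes> inv y) - 1) = norm (\<psi> x - \<psi> y)" by (simp add: norm_mult)
    then show ?thesis using T x y \<psi> by (simp add: dist_norm)
  qed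
  then have "x \<otimes> inv y \<in> B X \<epsilon>" using G by (simp add: B_def)
  then have "x \<otimes> inv y = \<one>" using * by blast
  then show False using G y by (metis inv_equality inv_inv inv_closed)
qed

subsection \<open>Compact and monothetic groups\<close>

lemma (in group) mult_inv_eq_one_iff:
  assumes "x \<in> carrier G" "y \<in> carrier G"
  shows "x \<otimes> inv y = \<one> \<longleftrightarrow> x = y"
  using assms by (metis inv_equality inv_inv inv_closed r_inv)

text \<open>The finite intersection property for the decreasing closed sets \<open>F n - U\<close>,
  whose intersection is empty.\<close>

lemma compact_space_nested:
  fixes F :: "nat \<Rightarrow> 'a set"
  assumes "compact_space X" "\<And>n. closedin X (F n)" "antimono F" "openin X U" "(\<Inter>n. F n) \<subseteq> U"
  shows "\<exists>n. F n \<subseteq> U"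
proof (rule ccontr)
  assume "\<nexists>n. F n \<subseteq> U"
  then have ne: "F n - U \<noteq> {}" for n by blast
  let ?\<C> = "range (\<lambda>n. F n - U)"
  have "\<Inter>\<F> \<noteq> {}" if \<F>: "finite \<F>" "\<F> \<subseteq> ?\<C>" for \<F>
  proof -
    obtain C where C: "finite C" "\<F> = (\<lambda>n. F n - U) ` C" using finite_subset_image[OF \<F>] by blast
    define N where "N = Max (insert 0 C)"
    have "F N \<subseteq> F n" if "n \<in> C" for n
      using C(1) that assms(3) by (intro antimonoD[OF assms(3)]) (simp add: N_def)
    then have "F N - U \<subseteq> \<Inter>\<F>" using C by blast
    then show ?thesis using ne[of N] by blast
  qed
  moreover have "closedin X C" if "C \<in> ?\<C>" for C
    using that assms(2,4) by (auto intro: closedin_diff)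
  ultimately have "\<Inter>?\<C> \<noteq> {}" using assms(1) unfolding compact_space_fip by meson
  then show False using assms(5) by blast
qed

context topgroup
begin

text \<open>A point \<open>x\<close> in the closure of a symmetric \<open>V\<close> has a translate
  \<open>x V\<close> that meets \<open>V\<close>, so \<open>x\<close> lies in \<open>V V\<close>.
  This is regularity with symmetry retained.\<close>

lemma nbhd_closed:
  assumes "openin \<tau> U" "\<one> \<in> U"
  shows "\<exists>V C. openin \<tau> V \<and> \<one> \<in> V \<and> V \<subseteq> C \<and> closedin \<tau> C \<and> C \<subseteq> U \<and> (\<forall>x\<in>C. inv x \<in> C)"
proof -
  obtain V where V: "openin \<tau> V" "\<one> \<in> V" "V \<subseteq> U" "\<forall>x\<in>V. inv x \<in> V" "\<forall>x\<in>V. \<forall>y\<in>V. x \<otimes> y \<in> U"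
    using nbhd_one[OF assms] by blast
  have VG: "V \<subseteq> carrier G" by (rule openin_carrier[OF V(1)])
  have "\<tau> closure_of V \<subseteq> U"
  proof
    fix x assume x: "x \<in> \<tau> closure_of V"
    then have xG: "x \<in> carrier G" using closure_subset by blast
    then obtain s where s: "s \<in> V" "inv x \<otimes> s \<in> V" using x V in_closure_iff[OF xG VG] by blast
    then have "inv (inv x \<otimes> s) \<in> V" "s \<in> carrier G" using V VG by auto
    then have "s \<otimes> inv (inv x \<otimes> s) \<in> U" using V s by blast
    then show "x \<in> U" using xG \<open>s \<in> carrier G\<close> by (simp add: group_normalize)
  qed
  moreover have "inv x \<in> \<tau> closure_of V" if x: "x \<in> \<tau> closure_of V" for x
  proof -
    have "(\<lambda>x. inv x) ` (\<tau> closure_of V) \<subseteq> \<tau> closure_of ((\<lambda>x. inv x) ` V)"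
      by (rule continuous_map_image_closure_subset) (simp add: continuous_map_inv)
    moreover have "(\<lambda>x. inv x) ` V \<subseteq> V" using V by auto
    ultimately show ?thesis using x closure_of_mono by blast
  qed
  moreover have "V \<subseteq> \<tau> closure_of V" using VG by (simp add: closure_of_subset)
  ultimately show ?thesis using V(1,2) by (intro exI[of _ V] exI[of _ "\<tau> closure_of V"]) auto
qed

lemma compact_finite_translates:
  assumes "compact_space \<tau>" "openin \<tau> U" "\<one> \<in> U"
  shows "\<exists>T. finite T \<and> T \<subseteq> carrier G \<and> (\<forall>x\<in>carrier G. \<exists>t\<in>T. inv t \<otimes> x \<in> U)"
proof -
  let ?W = "\<lambda>t. {x \<in> carrier G. inv t \<otimes> x \<in> U}"
  have "compactin \<tau> (carrier G)" using assms(1) by (simp add: compact_space_def)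
  moreover have "openin \<tau> W" if "W \<in> ?W ` carrier G" for W using that openin_lcoset[OF assms(2)] by auto
  moreover have "carrier G \<subseteq> \<Union>(?W ` carrier G)" using assms(3) by auto
  ultimately obtain \<F> where \<F>: "finite \<F>" "\<F> \<subseteq> ?W ` carrier G" "carrier G \<subseteq> \<Union>\<F>"
    using compactinD[of \<tau> "carrier G" "?W ` carrier G"] by blast
  obtain T where T: "finite T" "T \<subseteq> carrier G" "\<F> = ?W ` T"
    using finite_subset_image[OF \<F>(1,2)] by blast
  then show ?thesis using \<F>(3) by (intro exI[of _ T]) auto
qed

lemma closed_subgroup_pow_image:
  assumes "comm_group G" "compact_space \<tau>"
  shows "subgroup ((\<lambda>g. g [^] (m::nat)) ` carrier G) G" "closedin \<tau> ((\<lambda>g. g [^] m) ` carrier G)"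
proof -
  interpret comm_group G by fact
  show "subgroup ((\<lambda>g. g [^] m) ` carrier G) G"
  proof (rule subgroupI)
    fix a b assume "a \<in> (\<lambda>g. g [^] m) ` carrier G" "b \<in> (\<lambda>g. g [^] m) ` carrier G"
    then obtain g h where g: "g \<in> carrier G" "h \<in> carrier G" "a = g [^] m" "b = h [^] m" by blast
    show "inv a \<in> (\<lambda>g. g [^] m) ` carrier G"
      using g by (intro image_eqI[of _ _ "inv g"]) (simp_all add: nat_pow_inv)
    show "a \<otimes> b \<in> (\<lambda>g. g [^] m) ` carrier G"
      using g by (intro image_eqI[of _ _ "g \<otimes> h"]) (simp_all add: nat_pow_distrib)
  qed auto
  have "compactin \<tau> (carrier G)" using assms(2) by (simp add: compact_space_def)
  then have "compactin \<tau> ((\<lambda>g. g [^] m) ` carrier G)"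
    by (rule image_compactin) (intro continuous_map_pow, simp)
  then show "closedin \<tau> ((\<lambda>g. g [^] m) ` carrier G)" by (rule compactin_imp_closedin[OF hausdorff])
qed

text \<open>Weil's lemma.\<close>

lemma monothetic_compact:
  assumes "comm_group G" "locally_compact_space \<tau>" and x: "x \<in> carrier G"
    and dense: "\<tau> closure_of (range (\<lambda>i::int. x [^] i)) = carrier G"
    and rec: "\<And>U k. openin \<tau> U \<Longrightarrow> \<one> \<in> U \<Longrightarrow> \<exists>n>k. x [^] (n::nat) \<in> U"
  shows "compact_space \<tau>"
proof -
  interpret comm_group G by fact
  obtain U K where K: "openin \<tau> U" "compactin \<tau> K" "\<one> \<in> U" "U \<subseteq> K"
    using assms(2) unfolding locally_compact_space_def by (metis one_closed topspace_eq)
  obtain V where V: "openin \<tau> V" "\<one> \<in> V" "V \<subseteq> U" "\<forall>x\<in>V. inv x \<in> V" using nbhd_one[OF K(1,3)] by blast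
  have KG: "K \<subseteq> carrier G" using K(2) compactin_subset_topspace by fastforce
  \<comment> \<open>Density gives an integer power that moves \<open>g\<close> into
    \<open>V\<close>; recurrence near the identity adds an exponent so large that the total is
    positive, without leaving \<open>V\<close>.\<close>
  have A: "\<exists>k\<ge>1. x [^] (k::nat) \<otimes> g \<in> V" if g: "g \<in> carrier G" for g
  proof -
    define T where "T = {y \<in> carrier G. y \<otimes> g \<in> V}"
    have "openin \<tau> T" unfolding T_def by (rule openin_preimage[OF continuous_map_rmult[OF g] V(1)])
    moreover have "inv g \<in> T" using g V by (simp add: T_def)
    moreover have "inv g \<in> \<tau> closure_of (range (\<lambda>i::int. x [^] i))" using dense g by simp
    ultimately obtain i :: int where i: "x [^] i \<in> T" by (auto simp: in_closure_of)
    define h where "h = x [^] i \<otimes> g"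
    have h: "h \<in> carrier G" "h \<in> V" using i g x by (auto simp: h_def T_def)
    define S where "S = {y \<in> carrier G. y \<otimes> h \<in> V}"
    have "openin \<tau> S" unfolding S_def by (rule openin_preimage[OF continuous_map_rmult[OF h(1)] V(1)])
    moreover have "\<one> \<in> S" using h by (simp add: S_def)
    ultimately obtain n where n: "n > nat \<bar>i\<bar>" "x [^] (n::nat) \<in> S" using rec by blast
    have "x [^] (nat (int n + i)) \<otimes> g = x [^] n \<otimes> h"
      using n x g by (simp add: pow_nat int_pow_mult int_pow_int h_def m_assoc)
    then have "x [^] (nat (int n + i)) \<otimes> g \<in> V" using n by (simp add: S_def)
    moreover have "nat (int n + i) \<ge> 1" using n by linarith
    ultimately show ?thesis by blast
  qed
  let ?W = "\<lambda>j::nat. {g \<in> carrier G. inv (x [^] j) \<otimes> g \<in> V}"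
  have "K \<subseteq> \<Union>(?W ` {1..})"
  proof
    fix g assume "g \<in> K"
    then have g: "g \<in> carrier G" using KG by blast
    then obtain j where j: "j \<ge> 1" "x [^] (j::nat) \<otimes> inv g \<in> V" using A[of "inv g"] by auto
    then have "inv (x [^] j \<otimes> inv g) \<in> V" using V by blast
    then have "inv (x [^] j) \<otimes> g \<in> V" using g x by (simp add: inv_mult)
    then show "g \<in> \<Union>(?W ` {1..})" using g j by auto
  qed
  moreover have "openin \<tau> W" if "W \<in> ?W ` {1..}" for W using that openin_lcoset[OF V(1)] x by auto
  ultimately obtain \<F> where \<F>: "finite \<F>" "\<F> \<subseteq> ?W ` {1..}" "K \<subseteq> \<Union>\<F>"
    using compactinD[OF K(2), of "?W ` {1..}"] by blast
  obtain J where J: "finite J" "J \<subseteq> {1..}" "\<F> = ?W ` J" using finite_subset_image[OF \<F>(1,2)] by blast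
  \<comment> \<open>A bound for return times. The point \<open>x [^] k \<otimes> g\<close> with
    \<open>k\<close> least lies in \<open>K\<close>, hence in a translate of \<open>V\<close> by
    some \<open>x [^] j\<close> of the finite cover; for \<open>k > n\<close> the exponent
    \<open>k - j\<close> would be a smaller return time. So finitely many translates of
    \<open>K\<close> exhaust the group.\<close>
  define n where "n = Max (insert 0 J)"
  have Jn: "j \<le> n" if "j \<in> J" for j using that J(1) by (simp add: n_def)
  have cov: "\<exists>k\<le>n. x [^] (k::nat) \<otimes> g \<in> K" if g: "g \<in> carrier G" for g
  proof -
    define k where "k = (LEAST k::nat. k \<ge> 1 \<and> x [^] k \<otimes> g \<in> V)"
    have k: "k \<ge> 1" "x [^] k \<otimes> g \<in> V" using LeastI_ex[of "\<lambda>k::nat. k \<ge> 1 \<and> x [^] k \<otimes> g \<in> V"] A[OF g]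
      by (auto simp: k_def)
    then have "x [^] k \<otimes> g \<in> \<Union>\<F>" using V K \<F> by blast
    then obtain j where j: "j \<in> J" "inv (x [^] j) \<otimes> (x [^] k \<otimes> g) \<in> V" using J by auto
    have "k \<le> n"
    proof (rule ccontr)
      assume "\<not> k \<le> n"
      then have jk: "j < k" "j \<ge> 1" using Jn[OF j(1)] J(2) j(1) by auto
      have "x [^] k = x [^] j \<otimes> x [^] (k - j)" using x jk by (simp add: nat_pow_mult)
      then have "inv (x [^] j) \<otimes> (x [^] k \<otimes> g) = x [^] (k - j) \<otimes> g" using x g by (simp add: m_assoc mult_inv_cancel_left)
      then have "k - j \<ge> 1 \<and> x [^] (k - j) \<otimes> g \<in> V" using j jk by auto
      then have "k \<le> k - j" unfolding k_def by (rule Least_le)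
      then show False using jk by linarith
    qed
    then show ?thesis using k V K by blast
  qed
  have "carrier G \<subseteq> (\<Union>k\<le>n. (\<lambda>g. inv (x [^] k) \<otimes> g) ` K)"
  proof
    fix g assume g: "g \<in> carrier G"
    obtain k where k: "k \<le> n" "x [^] k \<otimes> g \<in> K" using cov[OF g] by blast
    have "g = inv (x [^] k) \<otimes> (x [^] k \<otimes> g)" using x g by (simp add: mult_inv_cancel_left)
    then show "g \<in> (\<Union>k\<le>n. (\<lambda>g. inv (x [^] k) \<otimes> g) ` K)" using k by blast
  qed
  moreover have "(\<Union>k\<le>n. (\<lambda>g. inv (x [^] k) \<otimes> g) ` K) \<subseteq> carrier G" using KG x by auto
  ultimately have "carrier G = (\<Union>k\<le>n. (\<lambda>g. inv (x [^] k) \<otimes> g) ` K)" by blast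
  moreover have "compactin \<tau> (\<Union>k\<le>n. (\<lambda>g. inv (x [^] k) \<otimes> g) ` K)"
    by (intro compactin_Union) (auto intro!: image_compactin[OF K(2)] continuous_map_lmult x)
  ultimately show ?thesis by (simp add: compact_space_def)
qed

text \<open>
  Such a group would have no small subgroups, which makes squaring a positively expansive
  automorphism; a compact space with a positively expansive homeomorphism is finite.
\<close>

lemma torsion_free_divisible_simple_trivial:
  assumes "comm_group G" and compact: "compact_space \<tau>"
    and torsion_free: "\<And>x k. x \<in> carrier G \<Longrightarrow> k > 0 \<Longrightarrow> x [^] (k::nat) = \<one> \<Longrightarrow> x = \<one>"
    and square: "\<And>x. x \<in> carrier G \<Longrightarrow> \<exists>y\<in>carrier G. y [^] (2::nat) = x"
    and simple: "\<And>N. subgroup N G \<Longrightarrow> closedin \<tau> N \<Longrightarrow> N = {\<one>} \<or> N = carrier G"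
  shows "carrier G = {\<one>}"
proof (rule ccontr)
  interpret comm_group G by fact
  assume "carrier G \<noteq> {\<one>}"
  then obtain g0 where g0: "g0 \<in> carrier G" "g0 \<noteq> \<one>" by blast
  have root_unique: "x = y" if "x \<in> carrier G" "y \<in> carrier G" "x [^] (2::nat) = y [^] (2::nat)" for x y
  proof -
    have "(x \<otimes> inv y) [^] (2::nat) = \<one>" using that by (simp add: nat_pow_distrib nat_pow_inv)
    then have "x \<otimes> inv y = \<one>" using torsion_free[of "x \<otimes> inv y" 2] that by simp
    then show ?thesis using that by (simp add: mult_inv_eq_one_iff)
  qed
  have "openin \<tau> (carrier G - {g0})" using closedin_finite[of "{g0}"] g0 by (simp add: closedin_def)
  then obtain V V1 where V: "openin \<tau> V1" "\<one> \<in> V1" "V1 \<subseteq> V" "closedin \<tau> V" "V \<subseteq> carrier G - {g0}" "\<forall>x\<in>V. inv x \<in> V"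
    using nbhd_closed[of "carrier G - {g0}"] g0 by auto
  \<comment> \<open>All powers of \<open>x\<close> stay in the closed set \<open>V\<close>, hence so
    does the closure of the group they form. It misses \<open>g0\<close>, so simplicity leaves only
    the trivial group.\<close>
  have nss: "x = \<one>" if x: "x \<in> carrier G" "\<And>k::nat. x [^] k \<in> V" for x
  proof -
    let ?H = "range (\<lambda>i::int. x [^] i)"
    have H: "subgroup ?H G" using generate_pow[OF x(1)] generate_is_subgroup[of "{x}"] x(1)
      by (simp add: full_SetCompr_eq)
    have "x [^] i \<in> V" for i :: int
      by (cases i rule: int_cases2) (use x V in \<open>auto simp: int_pow_int int_pow_neg_int\<close>)
    then have "\<tau> closure_of ?H \<subseteq> V" using V(4) by (intro closure_of_minimal) auto
    then have "\<tau> closure_of ?H \<noteq> carrier G" using V(5) g0 by blast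
    then have "\<tau> closure_of ?H = {\<one>}" using simple[OF subgroup_closure[OF H]] by simp
    moreover have "x \<in> \<tau> closure_of ?H"
      using closure_of_subset[of ?H \<tau>] x(1) rangeI[of "\<lambda>i::int. x [^] i" 1] by auto
    ultimately show ?thesis by blast
  qed
  have cpow: "continuous_map \<tau> \<tau> (\<lambda>x. x [^] (j::nat))" for j by (intro continuous_map_pow) simp
  \<comment> \<open>The uniform version of the previous fact: by compactness, finitely many powers
    decide.\<close>
  have small: "\<exists>N. \<forall>x\<in>carrier G. (\<forall>j\<le>N. x [^] (j::nat) \<in> V) \<longrightarrow> x \<in> W" if W: "openin \<tau> W" "\<one> \<in> W" for W
  proof -
    define F where "F k = (\<Inter>j\<in>{..k}. {x \<in> carrier G. x [^] (j::nat) \<in> V})" for k :: nat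
    have "closedin \<tau> (F k)" for k
      unfolding F_def by (rule closedin_INT) (use closedin_preimage[OF cpow V(4)] in auto)
    moreover have "antimono F" by (rule antimonoI) (auto simp: F_def)
    moreover have "(\<Inter>n. F n) \<subseteq> W"
    proof
      fix x assume "x \<in> (\<Inter>n. F n)"
      then have "x \<in> carrier G" "\<And>k::nat. x [^] k \<in> V" by (auto simp: F_def)
      then show "x \<in> W" using nss W by blast
    qed
    ultimately obtain N where "F N \<subseteq> W" using compact_space_nested[OF compact, of F W] W by blast
    then show ?thesis by (intro exI[of _ N]) (auto simp: F_def)
  qed
  obtain W where W: "openin \<tau> W" "\<one> \<in> W" "W \<subseteq> V1" "\<forall>x\<in>W. \<forall>y\<in>W. x \<otimes> y \<in> V1" using nbhd_one[OF V(1,2)] by blast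
  obtain N' where N': "\<forall>x\<in>carrier G. (\<forall>j\<le>N'. x [^] (j::nat) \<in> V) \<longrightarrow> x \<in> W" using small[OF W(1,2)] by blast
  define N where "N = Suc N'"
  have N: "N \<ge> 1" "x \<in> W" if "x \<in> carrier G" "\<And>j. j \<le> N \<Longrightarrow> x [^] (j::nat) \<in> V" for x
    using N' that by (auto simp: N_def)
  \<comment> \<open>The bound \<open>2 * N\<close> is the one obtained below for the quotient
    \<open>a\<close> when the escape exponent is divided by a suitable power of two.\<close>
  define W0 where "W0 = (\<Inter>a\<in>{..2*N}. {x \<in> carrier G. x [^] (a::nat) \<in> W})"
  have W0: "openin \<tau> W0" "\<one> \<in> W0"
    unfolding W0_def using openin_preimage[OF cpow W(1)] W(2) by (auto intro!: openin_INT2)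
  \<comment> \<open>Let \<open>n\<close> be the first exponent at which the powers of
    \<open>x\<close> leave \<open>V\<close>, and choose \<open>j\<close> with
    \<open>N * 2 ^ j < n \<le> N * 2 ^ Suc j\<close>. Dividing \<open>n\<close> by
    \<open>2 ^ j\<close> splits \<open>x [^] n\<close> into a power of \<open>x [^] (2 ^ j)\<close>
    with exponent at most \<open>2 * N\<close>, small by the choice of \<open>W0\<close>, and
    \<open>x [^] r\<close>, whose first \<open>N\<close> powers have exponents below
    \<open>n\<close> in \<open>x\<close>. Both factors lie in \<open>W\<close>, so the product is in
    \<open>V\<close> after all.\<close>
  have expansive: "x = \<one>" if x: "x \<in> carrier G" "\<And>i::nat. x [^] ((2::nat) ^ i) \<in> W0" for x
  proof (rule ccontr)
    assume "x \<noteq> \<one>"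
    then have ex: "\<exists>k::nat. x [^] k \<notin> V" using nss x by blast
    define n where "n = (LEAST k::nat. x [^] k \<notin> V)"
    have n: "x [^] n \<notin> V" using LeastI_ex[OF ex] by (simp add: n_def)
    have nl: "x [^] k \<in> V" if "k < n" for k :: nat using not_less_Least that unfolding n_def by blast
    have "x \<in> W0" using x(2)[of 0] x(1) by simp
    then have "x [^] k \<in> V" if "k \<le> 2 * N" for k :: nat using that W V by (auto simp: W0_def)
    then have nN: "n > 2 * N" using n by (meson not_le)
    have N1: "N \<ge> 1" by (simp add: N_def)
    define j where "j = (LEAST j::nat. n \<le> N * 2 ^ Suc j)"
    have "n \<le> 2 ^ Suc n" using less_exp[of "Suc n"] by linarith
    also have "\<dots> \<le> N * 2 ^ Suc n" using N1 by simp
    finally have "n \<le> N * 2 ^ Suc n" .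
    then have j1: "n \<le> N * 2 ^ Suc j" unfolding j_def by (rule LeastI)
    have j2: "N * 2 ^ j < n"
    proof (cases j)
      case 0
      then show ?thesis using nN by simp
    next
      case (Suc i)
      then have "\<not> n \<le> N * 2 ^ Suc i" using not_less_Least[of i "\<lambda>j. n \<le> N * 2 ^ Suc j"] by (simp add: j_def)
      then show ?thesis using Suc by simp
    qed
    define a r where "a = n div 2 ^ j" and "r = n mod 2 ^ j"
    have ar: "n = 2 ^ j * a + r" "r < 2 ^ j" by (auto simp: a_def r_def)
    have "a \<le> 2 * N"
    proof -
      have "a \<le> (2 * N * 2 ^ j) div 2 ^ j" unfolding a_def using j1 by (intro div_le_mono) simp
      then show ?thesis by simp
    qed
    then have "(x [^] ((2::nat) ^ j)) [^] a \<in> W" using x(2)[of j] by (auto simp: W0_def)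
    moreover have "x [^] r \<in> W"
    proof (rule N(2))
      show "x [^] r \<in> carrier G" using x by simp
      fix k assume k: "k \<le> N"
      have "r * k \<le> 2 ^ j * N" using ar k by (intro mult_le_mono) auto
      then have "r * k < n" using j2 by (simp add: mult.commute)
      then show "(x [^] r) [^] k \<in> V" using nl x by (simp add: nat_pow_pow)
    qed
    ultimately have "(x [^] ((2::nat) ^ j)) [^] a \<otimes> x [^] r \<in> V1" using W by blast
    then show False using n V(3) x(1) ar(1) by (simp add: nat_pow_pow nat_pow_mult subset_iff)
  qed
  obtain V' W1 where W1: "openin \<tau> V'" "\<one> \<in> V'" "V' \<subseteq> W1" "closedin \<tau> W1" "W1 \<subseteq> W0" using nbhd_closed[OF W0] by blast
  \<comment> \<open>Compactness again: a point for which sufficiently many iterated squares lie in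
    \<open>W1\<close> is close to the identity, in the precise form that it is the square of an
    element of \<open>V'\<close>.\<close>
  define F where "F k = (\<Inter>i\<in>{..k}. {x \<in> carrier G. x [^] ((2::nat) ^ i) \<in> W1})" for k :: nat
  let ?s = "\<lambda>x. x [^] (2::nat)"
  have "homeomorphic_map \<tau> \<tau> ?s"
    by (rule continuous_imp_homeomorphic_map[OF cpow compact hausdorff])
       (use square root_unique in \<open>auto simp: inj_on_def image_iff Bex_def\<close>)
  then have "openin \<tau> (?s ` V')" using W1(1) by (simp add: homeomorphic_eq_everything_map open_map_def)
  moreover have "closedin \<tau> (F k)" for k
    unfolding F_def by (rule closedin_INT) (use closedin_preimage[OF cpow W1(4)] in auto)
  moreover have "antimono F" by (rule antimonoI) (auto simp: F_def)
  moreover have "(\<Inter>n. F n) \<subseteq> ?s ` V'"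
  proof
    fix x assume "x \<in> (\<Inter>n. F n)"
    then have "x \<in> carrier G" "\<And>i::nat. x [^] ((2::nat) ^ i) \<in> W0" using W1 by (auto simp: F_def)
    then have "x = \<one>" by (rule expansive)
    moreover have "\<one> = \<one> [^] (2::nat)" by simp
    ultimately show "x \<in> ?s ` V'" using W1 by blast
  qed
  ultimately obtain M where M: "F M \<subseteq> ?s ` V'" using compact_space_nested[OF compact, of F] by blast
  \<comment> \<open>Smallness propagates backwards: if a square lies in \<open>B\<close>, uniqueness
    of square roots forces its root into \<open>B\<close>. So two points that are close at time
    \<open>k\<close> under iterated squaring are close at all earlier times.\<close>
  define B where "B = F M"
  have BW: "x \<in> carrier G" "x \<in> W1" if "x \<in> B" for x using that by (force simp: B_def F_def)+
  have descend: "z \<in> B" if z: "z \<in> carrier G" "z [^] (2::nat) \<in> B" for z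
  proof -
    obtain y where y: "y \<in> V'" "z [^] (2::nat) = y [^] (2::nat)" using M z by (auto simp: B_def)
    then have "y \<in> carrier G" using openin_carrier[OF W1(1)] by blast
    then have "z = y" using root_unique z y by blast
    have "z [^] ((2::nat) ^ i) \<in> W1" if "i \<le> M" for i
    proof (cases i)
      case 0
      then show ?thesis using y z \<open>z = y\<close> W1 by auto
    next
      case (Suc k)
      then have "(z [^] (2::nat)) [^] ((2::nat) ^ k) \<in> W1" using z that by (auto simp: B_def F_def)
      then show ?thesis using Suc z by (simp add: nat_pow_pow)
    qed
    then show ?thesis using z by (auto simp: B_def F_def)
  qed
  have descend': "z [^] ((2::nat) ^ i) \<in> B" if "z \<in> carrier G" "z [^] ((2::nat) ^ k) \<in> B" "i \<le> k" for z i k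
    using that(3,2)
  proof (induction k rule: dec_induct)
    case (step k)
    have "(z [^] ((2::nat) ^ k)) [^] (2::nat) \<in> B" using step.prems that(1) by (simp add: nat_pow_pow mult.commute)
    then have "z [^] ((2::nat) ^ k) \<in> B" using descend[of "z [^] ((2::nat) ^ k)"] that(1) by blast
    then show ?case by (rule step.IH)
  qed
  define B0 where "B0 = (\<Inter>i\<in>{..M}. {x \<in> carrier G. x [^] ((2::nat) ^ i) \<in> V'})"
  have B0: "openin \<tau> B0" "\<one> \<in> B0"
    unfolding B0_def using openin_preimage[OF cpow W1(1)] W1(2) by (auto intro!: openin_INT2)
  have "B0 \<subseteq> B" using W1(3) by (auto simp: B0_def B_def F_def)
  obtain Q where Q: "openin \<tau> Q" "\<one> \<in> Q" "\<forall>x\<in>Q. inv x \<in> Q" "\<forall>x\<in>Q. \<forall>y\<in>Q. x \<otimes> y \<in> B0" using nbhd_one[OF B0] by blast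
  obtain T where T: "finite T" "T \<subseteq> carrier G" "\<forall>x\<in>carrier G. \<exists>t\<in>T. inv t \<otimes> x \<in> Q"
    using compact_finite_translates[OF compact Q(1,2)] by blast
  have "finite (carrier G)"
  proof (rule ccontr)
    assume "infinite (carrier G)"
    then obtain S where S: "finite S" "card S = Suc (card T)" "S \<subseteq> carrier G" using infinite_arbitrarily_large by blast
    \<comment> \<open>Pairs of distinct points of \<open>S\<close> that are close at time
      \<open>k\<close>. None of these finite sets is empty, by pigeonhole, and they decrease with
      \<open>k\<close>; a pair common to all of them contradicts expansivity.\<close>
    define P where "P k = {(g, h) \<in> S \<times> S. g \<noteq> h \<and> (inv g \<otimes> h) [^] ((2::nat) ^ k) \<in> B}" for k :: nat
    have "P k \<noteq> {}" for k
    proof -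
      define c where "c g = (SOME t. t \<in> T \<and> inv t \<otimes> g [^] ((2::nat) ^ k) \<in> Q)" for g
      have c: "c g \<in> T" "inv (c g) \<otimes> g [^] ((2::nat) ^ k) \<in> Q" if "g \<in> S" for g
      proof -
        have "\<exists>t. t \<in> T \<and> inv t \<otimes> g [^] ((2::nat) ^ k) \<in> Q" using T(3) S(3) that by blast
        from someI_ex[OF this] show "c g \<in> T" "inv (c g) \<otimes> g [^] ((2::nat) ^ k) \<in> Q" by (auto simp: c_def)
      qed
      have "\<not> inj_on c S"
      proof
        assume "inj_on c S"
        then have "card S \<le> card T" using T(1) c(1) by (intro card_inj_on_le) auto
        then show False using S(2) by simp
      qed
      then obtain g h where gh: "g \<in> S" "h \<in> S" "g \<noteq> h" "c g = c h" by (auto simp: inj_on_def)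
      have G: "g \<in> carrier G" "h \<in> carrier G" "c g \<in> carrier G" using gh S T c by auto
      have "inv (inv (c g) \<otimes> g [^] ((2::nat) ^ k)) \<otimes> (inv (c g) \<otimes> h [^] ((2::nat) ^ k)) \<in> B0"
        using Q c gh by metis
      moreover have "inv (inv (c g) \<otimes> g [^] ((2::nat) ^ k)) \<otimes> (inv (c g) \<otimes> h [^] ((2::nat) ^ k)) = (inv g \<otimes> h) [^] ((2::nat) ^ k)"
        using G by (simp add: group_normalize nat_pow_distrib nat_pow_inv)
      ultimately show ?thesis using gh \<open>B0 \<subseteq> B\<close> by (auto simp: P_def)
    qed
    moreover have Pmono: "P k \<subseteq> P i" if ik: "i \<le> k" for i k
    proof
      fix q assume "q \<in> P k"
      then obtain g h where gh: "q = (g, h)" "g \<in> S" "h \<in> S" "g \<noteq> h" "(inv g \<otimes> h) [^] ((2::nat) ^ k) \<in> B"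
        by (auto simp: P_def)
      then have "inv g \<otimes> h \<in> carrier G" using S(3) by auto
      from descend'[OF this gh(5) ik] show "q \<in> P i" using gh by (simp add: P_def)
    qed
    moreover have "finite (P 0)" using S(1) by (auto simp: P_def intro: finite_subset[of _ "S \<times> S"])
    ultimately obtain q where q: "\<And>k. q \<in> P k"
    proof -
      assume q: "\<And>q. (\<And>k. q \<in> P k) \<Longrightarrow> thesis"
      show thesis
      proof (rule ccontr)
        assume "\<not> thesis"
        then have "\<forall>q. \<exists>k. q \<notin> P k" using q by blast
        then obtain f where f: "\<And>q. q \<notin> P (f q)" by metis
        define K where "K = Max (insert 0 (f ` P 0))"
        obtain p where p: "p \<in> P K" using \<open>\<And>k. P k \<noteq> {}\<close> by blast
        then have "p \<in> P 0" using Pmono[of 0 K] by blast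
        then have "f p \<le> K" using \<open>finite (P 0)\<close> by (simp add: K_def)
        then show False using f p Pmono by blast
      qed
    qed
    obtain g h where gh: "q = (g, h)" by (cases q)
    have "g \<in> S" "h \<in> S" "g \<noteq> h" "\<And>k::nat. (inv g \<otimes> h) [^] ((2::nat) ^ k) \<in> B" using q by (auto simp: P_def gh)
    moreover from this have "g \<in> carrier G" "h \<in> carrier G" using S by auto
    ultimately have "inv g \<otimes> h = \<one>" using BW W1 by (intro expansive) blast+
    then have "h \<otimes> inv g = \<one>" using \<open>g \<in> carrier G\<close> \<open>h \<in> carrier G\<close> by (simp add: m_comm)
    then show False using \<open>g \<noteq> h\<close> \<open>g \<in> carrier G\<close> \<open>h \<in> carrier G\<close> by (simp add: mult_inv_eq_one_iff)
  qed
  then have "g0 [^] order G = \<one>" "order G > 0" using g0(1) pow_order_eq_1 order_gt_0_iff_finite by auto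
  then show False using torsion_free g0 by blast
qed

end

subsection \<open>The \<open>p\<close>-adic coordinate of a monothetic group\<close>

lemma (in group) comm_group_subgroup:
  assumes "subgroup H G" "\<And>x y. x \<in> H \<Longrightarrow> y \<in> H \<Longrightarrow> x \<otimes> y = y \<otimes> x"
  shows "comm_group (G\<lparr>carrier := H\<rparr>)"
  by (rule group.group_comm_groupI[OF subgroup_imp_group[OF assms(1)]]) (simp add: assms(2))

lemma (in group) subgroup_div_closed:
  "subgroup H G \<Longrightarrow> a \<in> H \<Longrightarrow> b \<in> H \<Longrightarrow> a \<otimes> inv b \<in> H"
  by (simp add: subgroup.m_closed subgroup.m_inv_closed)

section \<open>The p-adic topology as a Hausdorff space\<close>

lemma topspace_padic_topology: "p > 0 \<Longrightarrow> topspace (padic_topology p) = carrier (padic_int p)"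
  using openin_padic_topology[of p "topspace (padic_topology p)"]
    openin_subset[of "padic_topology p" "carrier (padic_int p)"]
  by (simp add: openin_padic_topology subset_antisym)

lemma openin_padic_ball: "p > 0 \<Longrightarrow> openin (padic_topology p) {y \<in> carrier (padic_int p). y n = k}"
  by (auto simp: openin_padic_topology)

lemma Hausdorff_padic_topology:
  assumes "p > 0"
  shows "Hausdorff_space (padic_topology p)"
  unfolding Hausdorff_space_def
proof (intro allI impI)
  fix x y assume xy: "x \<in> topspace (padic_topology p) \<and> y \<in> topspace (padic_topology p) \<and> x \<noteq> y"
  then obtain n where n: "x n \<noteq> y n" by blast
  let ?B = "\<lambda>z. {y \<in> carrier (padic_int p). y n = z n}"
  have "openin (padic_topology p) (?B x)" "openin (padic_topology p) (?B y)" by (rule openin_padic_ball[OF assms])+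
  moreover have "x \<in> ?B x" "y \<in> ?B y" using xy assms by (auto simp: topspace_padic_topology)
  moreover have "disjnt (?B x) (?B y)" using n by (auto simp: disjnt_iff)
  ultimately show "\<exists>U V. openin (padic_topology p) U \<and> openin (padic_topology p) V \<and> x \<in> U \<and> y \<in> V \<and> disjnt U V"
    by blast
qed

definition padic_isomorphism :: "nat \<Rightarrow> ('a, 'b) monoid_scheme \<Rightarrow> 'a topology \<Rightarrow> ('a \<Rightarrow> nat \<Rightarrow> int) \<Rightarrow> bool" where
  "padic_isomorphism p G \<tau> f \<longleftrightarrow>
     prime p \<and> f \<in> iso G (add_monoid (padic_int p)) \<and> homeomorphic_map \<tau> (padic_topology p) f"

text \<open>What Weil's lemma makes of the closure of an infinite cyclic subgroup. The aim is an
  isomorphism with Z_p that takes \<open>x\<close> to 1.\<close>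

locale monothetic = topgroup G \<tau> + comm_group G for G (structure) and \<tau> +
  fixes x
  assumes compact: "compact_space \<tau>"
    and hmin: "hereditarily_minimal G \<tau>"
    and gen: "x \<in> carrier G"
    and inf_order: "n > 0 \<Longrightarrow> x [^] (n::nat) \<noteq> \<one>"
    and dense: "\<tau> closure_of (range (\<lambda>i::int. x [^] i)) = carrier G"
begin

section \<open>Closed subgroups and subgroups of powers in a monothetic group\<close>

abbreviation pow_image ("P") where "pow_image m \<equiv> (\<lambda>g. g [^] (m::nat)) ` carrier G"

lemma subgroup_cyclic: "subgroup (range (\<lambda>i::int. x [^] i)) G"
  using generate_pow[OF gen] generate_is_subgroup[of "{x}"] gen by (simp add: full_SetCompr_eq)

lemma pow_image_closed_subgroup: "subgroup (P m) G" "closedin \<tau> (P m)"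
  using closed_subgroup_pow_image[OF comm_group_axioms compact] by blast+

lemma contains_cyclic_closed:
  assumes "closedin \<tau> S" "\<And>i::int. x [^] i \<in> S"
  shows "carrier G \<subseteq> S"
  using closure_of_minimal[OF _ assms(1), of "range (\<lambda>i::int. x [^] i)"] assms(2) dense by auto

lemma gen_in_closed_subgroup:
  assumes "subgroup N G" "closedin \<tau> N" "x \<in> N"
  shows "N = carrier G"
  using contains_cyclic_closed[OF assms(2)] subgroup_int_pow_closed[OF assms(1,3)] subgroup.subset[OF assms(1)]
  by blast

text \<open>The powers of \<open>x\<close> form a dense minimal subgroup, which must meet
  \<open>N\<close> nontrivially; passing to the inverse makes the exponent positive.\<close>

lemma closed_subgroup_gen_pow:
  assumes N: "subgroup N G" "closedin \<tau> N" "N \<noteq> {\<one>}"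
  shows "\<exists>m>0. x [^] (m::nat) \<in> N"
proof -
  let ?H = "range (\<lambda>i::int. x [^] i)"
  have "minimal_group (G\<lparr>carrier := ?H\<rparr>) (subtopology \<tau> ?H)"
    using hmin subgroup_cyclic unfolding hereditarily_minimal_def by blast
  moreover have "N \<lhd> G" using N(1) by (simp add: normal_iff_subgroup)
  moreover have "N \<subseteq> \<tau> closure_of ?H" using subgroup.subset[OF N(1)] dense by simp
  ultimately have "N \<inter> ?H \<noteq> {\<one>}" using minimal_subgroup_essential[OF subgroup_cyclic] N by blast
  moreover have "\<one> \<in> N \<inter> ?H" using subgroup.one_closed[OF N(1)] subgroup.one_closed[OF subgroup_cyclic] by blast
  ultimately obtain i :: int where i: "x [^] i \<in> N" "x [^] i \<noteq> \<one>" by blast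
  show ?thesis
  proof (cases i rule: int_cases2)
    case (nonneg n)
    then show ?thesis using i by (intro exI[of _ n]) (auto simp: int_pow_int intro!: Nat.gr0I)
  next
    case (nonpos n)
    then have "inv (x [^] i) = x [^] n" using gen by (simp add: int_pow_neg_int)
    moreover have "inv (x [^] i) \<in> N" using i(1) N(1) by (simp add: subgroup.m_inv_closed)
    ultimately show ?thesis using i nonpos by (intro exI[of _ n]) (auto intro!: Nat.gr0I)
  qed
qed

text \<open>Having an \<open>m\<close>-th power in \<open>N\<close> is a closed condition; satisfied
  by the powers of \<open>x\<close>, it holds everywhere.\<close>

lemma closed_subgroup_pow:
  assumes N: "subgroup N G" "closedin \<tau> N" "N \<noteq> {\<one>}"
  shows "\<exists>m>0. P m \<subseteq> N"
proof -
  obtain m where m: "m > 0" "x [^] (m::nat) \<in> N" using closed_subgroup_gen_pow[OF N] by blast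
  have "closedin \<tau> {g \<in> carrier G. g [^] m \<in> N}"
    by (rule closedin_preimage[OF continuous_map_pow N(2)]) simp
  moreover have "x [^] i \<in> {g \<in> carrier G. g [^] m \<in> N}" for i :: int
  proof -
    have "(x [^] i) [^] m = (x [^] m) [^] i"
      using gen by (simp add: int_pow_pow mult.commute flip: int_pow_int)
    then show ?thesis using subgroup_int_pow_closed[OF N(1) m(2)] gen by simp
  qed
  ultimately have "carrier G \<subseteq> {g \<in> carrier G. g [^] m \<in> N}" by (rule contains_cyclic_closed)
  then show ?thesis using m by (intro exI[of _ m]) auto
qed

text \<open>A nontrivial torsion element would generate a finite, hence closed, subgroup. This would
  contain a positive power of \<open>x\<close>, which would then have finite order.\<close>

lemma torsion_free:
  assumes g: "g \<in> carrier G" "k > 0" "g [^] (k::nat) = \<one>"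
  shows "g = \<one>"
proof (rule ccontr)
  assume ne: "g \<noteq> \<one>"
  let ?N = "(\<lambda>j::nat. g [^] j) ` {..<k}"
  have eq: "range (\<lambda>i::int. g [^] i) = ?N"
  proof
    show "range (\<lambda>i::int. g [^] i) \<subseteq> ?N"
    proof
      fix h assume "h \<in> range (\<lambda>i::int. g [^] i)"
      then obtain i :: int where i: "h = g [^] i" by blast
      have "g [^] i = g [^] (int k * (i div int k) + i mod int k)" by simp
      also have "\<dots> = (g [^] k) [^] (i div int k) \<otimes> g [^] (i mod int k)"
        using g(1) by (simp only: int_pow_mult flip: int_pow_pow int_pow_int)
      also have "\<dots> = g [^] nat (i mod int k)" using g by (simp add: pow_nat)
      finally have "h = g [^] nat (i mod int k)" using i by simp
      moreover have "nat (i mod int k) < k" using g(2) by (simp add: nat_less_iff)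
      ultimately show "h \<in> ?N" by blast
    qed
  qed (auto simp flip: int_pow_int)
  have N: "subgroup ?N G"
    using generate_pow[OF g(1)] generate_is_subgroup[of "{g}"] g(1) by (simp add: full_SetCompr_eq eq)
  have "closedin \<tau> ?N" by (rule closedin_finite) (use g in auto)
  moreover have "?N \<noteq> {\<one>}" using ne g(1) eq by (metis int_pow_1 rangeI singletonD)
  ultimately obtain m where m: "m > 0" "x [^] (m::nat) \<in> ?N" using closed_subgroup_gen_pow N by blast
  then obtain j :: nat where "x [^] m = g [^] j" by blast
  have "x [^] (m * k) = (x [^] m) [^] k" using gen by (simp add: nat_pow_pow)
  also have "\<dots> = (g [^] k) [^] j" using g(1) \<open>x [^] m = g [^] j\<close> by (simp add: nat_pow_pow mult.commute)
  finally have "x [^] (m * k) = (g [^] k) [^] j" .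
  then show False using inf_order[of "m * k"] m g by simp
qed

lemma pow_cancel:
  assumes "g \<in> carrier G" "h \<in> carrier G" "k > 0" "g [^] (k::nat) = h [^] k"
  shows "g = h"
proof -
  have "(g \<otimes> inv h) [^] k = \<one>" using assms by (simp add: nat_pow_distrib nat_pow_inv)
  then have "g \<otimes> inv h = \<one>" using torsion_free[of "g \<otimes> inv h" k] assms by simp
  then show ?thesis using assms by (simp add: mult_inv_eq_one_iff)
qed

text \<open>Finitely many closed cosets of \<open>P m\<close> cover the powers of \<open>x\<close>,
  hence the whole group.\<close>

lemma coset_representative:
  assumes m: "m > 0" and g: "g \<in> carrier G"
  shows "\<exists>i<m. inv (x [^] (i::nat)) \<otimes> g \<in> P m"
proof -
  let ?C = "\<lambda>i::nat. {g \<in> carrier G. inv (x [^] i) \<otimes> g \<in> P m}"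
  have "closedin \<tau> (?C i)" for i
    by (rule closedin_preimage[OF continuous_map_lmult pow_image_closed_subgroup(2)]) (use gen in simp)
  then have "closedin \<tau> (\<Union>i\<in>{..<m}. ?C i)" by (intro closedin_Union) auto
  moreover have "x [^] i \<in> (\<Union>i\<in>{..<m}. ?C i)" for i :: int
  proof -
    define j where "j = nat (i mod int m)"
    have j: "j < m" "int j = i mod int m" using m by (auto simp: j_def nat_less_iff)
    have "inv (x [^] j) \<otimes> x [^] i = x [^] (i - int j)"
      using gen by (simp add: int_pow_diff int_pow_int m_comm)
    also have "i - int j = (i div int m) * int m" using j by (simp add: minus_mod_eq_div_mult)
    also have "x [^] ((i div int m) * int m) = (x [^] (i div int m)) [^] m"
      using gen by (simp add: int_pow_pow flip: int_pow_int)
    finally show ?thesis using j gen by auto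
  qed
  ultimately have "carrier G \<subseteq> (\<Union>i\<in>{..<m}. ?C i)" by (rule contains_cyclic_closed)
  then show ?thesis using g by blast
qed

text \<open>The complement is a union of finitely many closed cosets.\<close>

lemma pow_image_open:
  assumes m: "m > 0"
  shows "openin \<tau> (P m)"
proof -
  note sub = pow_image_closed_subgroup(1)[of m]
  define C where "C i = {g \<in> carrier G. inv (x [^] i) \<otimes> g \<in> P m}" for i :: nat
  define I where "I = {i. i < m \<and> x [^] (i::nat) \<notin> P m}"
  have C: "x [^] i \<in> P m \<longleftrightarrow> g \<in> P m" if "g \<in> C i" for g i
  proof
    have g: "g \<in> carrier G" "inv (x [^] i) \<otimes> g \<in> P m" using that by (auto simp: C_def)
    assume "x [^] i \<in> P m"
    then have "x [^] i \<otimes> (inv (x [^] i) \<otimes> g) \<in> P m" using g(2) by (rule subgroup.m_closed[OF sub])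
    then show "g \<in> P m" using gen g(1) by (simp add: mult_inv_cancel_left)
  next
    have g: "g \<in> carrier G" "inv (x [^] i) \<otimes> g \<in> P m" using that by (auto simp: C_def)
    assume "g \<in> P m"
    then have "g \<otimes> inv (inv (x [^] i) \<otimes> g) \<in> P m" using g(2) by (rule subgroup_div_closed[OF sub])
    then show "x [^] i \<in> P m" using gen g(1) by (simp add: group_normalize)
  qed
  have "closedin \<tau> (C i)" for i
    unfolding C_def
    by (rule closedin_preimage[OF continuous_map_lmult pow_image_closed_subgroup(2)]) (use gen in simp)
  then have "closedin \<tau> (\<Union>i\<in>I. C i)" by (intro closedin_Union) (auto simp: I_def)
  moreover have "g \<in> P m \<longleftrightarrow> g \<notin> (\<Union>i\<in>I. C i)" if g: "g \<in> carrier G" for g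
  proof -
    obtain i where i: "i < m" "g \<in> C i" using coset_representative[OF m g] g by (auto simp: C_def)
    show ?thesis
    proof
      assume gP: "g \<in> P m"
      show "g \<notin> (\<Union>i\<in>I. C i)"
      proof
        assume "g \<in> (\<Union>i\<in>I. C i)"
        then obtain j where j: "j \<in> I" "g \<in> C j" by (rule UN_E)
        then show False using C[OF j(2)] gP by (simp add: I_def)
      qed
    next
      assume "g \<notin> (\<Union>i\<in>I. C i)"
      then have "i \<notin> I" using UN_I[of i I g C] i(2) by argo
      then show "g \<in> P m" using C[OF i(2)] i(1) by (simp add: I_def)
    qed
  qed
  then have "P m = carrier G - (\<Union>i\<in>I. C i)" using subgroup.subset[OF sub] by blast
  ultimately show ?thesis by (metis openin_diff openin_topspace topspace_eq)
qed

text \<open>The intersection \<open>D\<close> is the divisible part, the obstruction to being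
  profinite. A nontrivial closed subgroup of \<open>D\<close> contains some \<open>P k\<close> and
  therefore all of \<open>D\<close>, so the dynamical lemma above applies to
  \<open>D\<close>.\<close>

lemma inter_pow_images_trivial:
  assumes "g \<in> carrier G" "\<And>m. m > 0 \<Longrightarrow> g \<in> P m"
  shows "g = \<one>"
proof (rule ccontr)
  assume ne: "g \<noteq> \<one>"
  define D where "D = (\<Inter>m\<in>{0<..}. P m)"
  have D: "subgroup D G" unfolding D_def
    by (rule subgroups_Inter) (use pow_image_closed_subgroup(1) in auto)
  have Dc: "closedin \<tau> D" unfolding D_def
    by (rule closedin_INT) (use pow_image_closed_subgroup(2) in auto)
  have gD: "g \<in> D" using assms by (auto simp: D_def)
  interpret D: topgroup "G\<lparr>carrier := D\<rparr>" "subtopology \<tau> D" by (rule topological_subgroup[OF D])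
  have DG: "D \<subseteq> carrier G" using D by (rule subgroup.subset)
  note pow = nat_pow_consistent[of _ _ D, symmetric]
  have "carrier (G\<lparr>carrier := D\<rparr>) = {\<one>\<^bsub>G\<lparr>carrier := D\<rparr>\<^esub>}"
  proof (rule D.torsion_free_divisible_simple_trivial)
    show "comm_group (G\<lparr>carrier := D\<rparr>)" using DG by (intro comm_group_subgroup[OF D]) (auto intro: m_comm)
    show "compact_space (subtopology \<tau> D)"
      using closedin_compact_space[OF compact Dc] by (simp add: compact_space_subtopology)
    show "y = \<one>\<^bsub>G\<lparr>carrier := D\<rparr>\<^esub>"
      if "y \<in> carrier (G\<lparr>carrier := D\<rparr>)" "k > 0" "y [^]\<^bsub>G\<lparr>carrier := D\<rparr>\<^esub> k = \<one>\<^bsub>G\<lparr>carrier := D\<rparr>\<^esub>" for y and k :: nat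
      using that DG torsion_free[of y k] by (auto simp: pow)
    show "\<exists>z\<in>carrier (G\<lparr>carrier := D\<rparr>). z [^]\<^bsub>G\<lparr>carrier := D\<rparr>\<^esub> (2::nat) = y"
      if "y \<in> carrier (G\<lparr>carrier := D\<rparr>)" for y
    proof -
      \<comment> \<open>The square root has to lie in \<open>D\<close> itself. With
        \<open>P m\<close> inside \<open>D\<close> and \<open>y\<close> written as the
        \<open>2 m\<close>-th power of \<open>h\<close>, the element \<open>h [^] m\<close> is in
        \<open>D\<close> and squares to \<open>y\<close>.\<close>
      obtain m where m: "m > 0" "P m \<subseteq> D" using closed_subgroup_pow[OF D Dc] gD ne by blast
      have "y \<in> P (m * 2)" using that m(1) by (auto simp: D_def)
      then obtain h where h: "h \<in> carrier G" "y = h [^] (m * 2)" by blast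
      then have "h [^] m \<in> D" using m by blast
      then show ?thesis using h by (auto simp: pow nat_pow_pow intro!: bexI[of _ "h [^] m"])
    qed
    show "N = {\<one>\<^bsub>G\<lparr>carrier := D\<rparr>\<^esub>} \<or> N = carrier (G\<lparr>carrier := D\<rparr>)"
      if N: "subgroup N (G\<lparr>carrier := D\<rparr>)" "closedin (subtopology \<tau> D) N" for N
    proof (cases "N = {\<one>}")
      case False
      have N': "subgroup N G" "N \<subseteq> D" using subgroup_subgroup[OF D N(1)] by auto
      moreover have "closedin \<tau> N" using N(2) Dc closedin_trans_full by blast
      ultimately obtain k where k: "k > 0" "P k \<subseteq> N" using closed_subgroup_pow False by blast
      then have "D \<subseteq> N" by (auto simp: D_def)
      then show ?thesis using N' by auto
    qed simp
  qed
  then show False using gD ne by simp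
qed

text \<open>If \<open>P p\<close> were everything for all primes, so would be \<open>P m\<close> for
  all positive \<open>m\<close>, and \<open>x\<close> would lie in the intersection, which is
  trivial.\<close>

lemma proper_prime_pow_image: "\<exists>p. prime p \<and> P p \<noteq> carrier G"
proof (rule ccontr)
  assume "\<nexists>p. prime p \<and> P p \<noteq> carrier G"
  then have all: "P p = carrier G" if "prime p" for p using that by blast
  have "P m = carrier G" if "m > 0" for m :: nat
    using that
  proof (induction m rule: less_induct)
    case (less m)
    show ?case
    proof (cases "m = 1")
      case True
      then show ?thesis by auto
    next
      case False
      then obtain p where p: "prime p" "p dvd m" using prime_factor_nat by blast
      then obtain k where k: "m = k * p" by (metis dvd_def mult.commute)
      then have "k < m" "k > 0" using less.prems prime_gt_1_nat[OF p(1)] by auto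
      then have "P k = carrier G" using less.IH by blast
      then have "P m = P p"
        unfolding k using image_image[of "\<lambda>g. g [^] p" "\<lambda>g. g [^] k" "carrier G"] by (simp add: nat_pow_pow cong: image_cong)
      then show ?thesis using all[OF p(1)] by simp
    qed
  qed
  then have "x = \<one>" using inter_pow_images_trivial[OF gen] gen by blast
  then show False using inf_order[of 1] gen by simp
qed

text \<open>If \<open>p\<close> did not divide \<open>i\<close>, Bezout's identity would make
  \<open>x\<close> a \<open>p\<close>-th power and \<open>P p\<close> the whole group. A factor
  \<open>p\<close> can thus be cancelled, by torsion-freeness, and induction continues.\<close>

lemma gen_pow_in_pow_image:
  assumes p: "prime p" "P p \<noteq> carrier G" and i: "x [^] (i::int) \<in> P (p ^ n)"
  shows "int p ^ n dvd i"
  using i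
proof (induction n arbitrary: i)
  case 0
  then show ?case by simp
next
  case (Suc n)
  then obtain g where g: "g \<in> carrier G" "x [^] i = g [^] (p ^ Suc n)" by blast
  then have gp: "x [^] i = (g [^] (p ^ n)) [^] p" by (simp add: nat_pow_pow mult.commute)
  have "int p dvd i"
  proof (rule ccontr)
    assume "\<not> int p dvd i"
    then have "coprime i (int p)" using p(1) by (metis coprime_commute prime_imp_coprime prime_int_nat_transfer prime_nat_int_transfer)
    then obtain u v where uv: "u * i + v * int p = 1" by (metis bezout_int coprime_iff_gcd_eq_1)
    have "x = x [^] (i * u + v * int p)" using uv gen by (simp add: mult.commute)
    also have "\<dots> = ((g [^] (p ^ n)) [^] p) [^] u \<otimes> (x [^] v) [^] p"
      using gen by (simp only: int_pow_mult gp flip: int_pow_pow int_pow_int)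
    also have "\<dots> = ((g [^] (p ^ n)) [^] u \<otimes> x [^] v) [^] p"
    proof -
      have "((g [^] (p ^ n)) [^] p) [^] u = ((g [^] (p ^ n)) [^] u) [^] p" "(x [^] v) [^] p = (x [^] v) [^] p"
        using g by (simp_all add: int_pow_pow mult_ac flip: int_pow_int)
      then show ?thesis using gen g by (simp add: nat_pow_distrib)
    qed
    finally have "x \<in> P p" using gen g by (metis imageI int_pow_closed m_closed nat_pow_closed)
    then show False using gen_in_closed_subgroup pow_image_closed_subgroup p(2) by blast
  qed
  then obtain j where j: "i = j * int p" by (metis dvd_def mult.commute)
  then have "(x [^] j) [^] p = (g [^] (p ^ n)) [^] p"
    using gp gen by (simp add: int_pow_pow flip: int_pow_int)
  then have "x [^] j = g [^] (p ^ n)" using pow_cancel[of "x [^] j" "g [^] (p ^ n)" p] gen g prime_gt_0_nat[OF p(1)] by simp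
  then have "int p ^ n dvd j" using Suc.IH g by blast
  then show ?case using j by (simp add: mult.commute)
qed

text \<open>A nontrivial intersection would contain \<open>x [^] m\<close> with
  \<open>m > 0\<close>, so \<open>p ^ m\<close> would divide the smaller positive number
  \<open>m\<close>. Hence the powers of a single prime suffice to separate points.\<close>

lemma inter_prime_pow_images_trivial:
  assumes p: "prime p" "P p \<noteq> carrier G" and g: "g \<in> carrier G" "\<And>n. g \<in> P (p ^ n)"
  shows "g = \<one>"
proof (rule ccontr)
  assume "g \<noteq> \<one>"
  define N where "N = (\<Inter>n. P (p ^ n))"
  have "subgroup N G" unfolding N_def
    by (rule subgroups_Inter) (use pow_image_closed_subgroup(1) in auto)
  moreover have "closedin \<tau> N" unfolding N_def
    by (rule closedin_INT) (use pow_image_closed_subgroup(2) in auto)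
  moreover have "g \<in> N" using g by (simp add: N_def)
  ultimately obtain m where m: "m > 0" "x [^] (m::nat) \<in> N" using closed_subgroup_gen_pow \<open>g \<noteq> \<one>\<close> by blast
  have "x [^] int m \<in> P (p ^ m)" using m(2) by (auto simp: N_def int_pow_int)
  then have "int p ^ m dvd int m" by (rule gen_pow_in_pow_image[OF p])
  then have "p ^ m dvd m" by (metis int_dvd_int_iff of_nat_power)
  then have "p ^ m \<le> m" using m by (simp add: dvd_imp_le)
  moreover have "m < p ^ m" using prime_gt_1_nat[OF p(1)] by (simp add: power_gt_expt)
  ultimately show False by simp
qed

lemma prime_pow_image_nbhd:
  assumes p: "prime p" "P p \<noteq> carrier G" and U: "openin \<tau> U" "\<one> \<in> U"
  shows "\<exists>n. P (p ^ n) \<subseteq> U"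
proof (rule compact_space_nested[OF compact _ _ U(1)])
  show "closedin \<tau> (P (p ^ n))" for n by (rule pow_image_closed_subgroup)
  show "antimono (\<lambda>n. P (p ^ n))"
  proof (rule antimonoI, rule subsetI)
    fix m n :: nat and g assume mn: "m \<le> n" and "g \<in> P (p ^ n)"
    then obtain h where h: "h \<in> carrier G" "g = h [^] (p ^ n)" by blast
    have "p ^ n = p ^ (n - m) * p ^ m" using mn by (simp flip: power_add)
    then have "g = (h [^] (p ^ (n - m))) [^] (p ^ m)" using h by (simp add: nat_pow_pow)
    then show "g \<in> P (p ^ m)" using h by blast
  qed
  show "(\<Inter>n. P (p ^ n)) \<subseteq> U"
  proof
    fix g assume "g \<in> (\<Inter>n. P (p ^ n))"
    then have g: "g \<in> P (p ^ n)" for n by (rule INT_D) simp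
    then have "g \<in> carrier G" using subgroup.mem_carrier[OF pow_image_closed_subgroup(1)] by metis
    then show "g \<in> U" using inter_prime_pow_images_trivial[OF p _ g] U(2) by simp
  qed
qed

text \<open>The coordinate of \<open>g\<close> modulo \<open>p ^ n\<close> is the \<open>i\<close> with \<open>g\<close> in \<open>x ^ i G ^ (p ^ n)\<close>.\<close>

theorem padic_coordinates:
  assumes p: "prime p" "P p \<noteq> carrier G"
  shows "\<exists>f. padic_isomorphism p G \<tau> f \<and> f x = \<one>\<^bsub>padic_int p\<^esub>"
proof -
  have p0: "p > 0" using prime_gt_0_nat[OF p(1)] .
  note sub = pow_image_closed_subgroup(1)
  have PG: "P m \<subseteq> carrier G" for m using subgroup.subset[OF sub] .
  define f where "f g n = (SOME i. 0 \<le> i \<and> i < int p ^ n \<and> inv (x [^] (i::int)) \<otimes> g \<in> P (p ^ n))" for g n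
  have f: "0 \<le> f g n" "f g n < int p ^ n" "inv (x [^] f g n) \<otimes> g \<in> P (p ^ n)" if "g \<in> carrier G" for g n
  proof -
    obtain i where i: "i < p ^ n" "inv (x [^] (i::nat)) \<otimes> g \<in> P (p ^ n)"
      using coset_representative[of "p ^ n" g] p0 \<open>g \<in> carrier G\<close> by auto
    then have "0 \<le> int i \<and> int i < int p ^ n \<and> inv (x [^] int i) \<otimes> g \<in> P (p ^ n)"
      by (simp add: int_pow_int)
    then have "\<exists>i::int. 0 \<le> i \<and> i < int p ^ n \<and> inv (x [^] i) \<otimes> g \<in> P (p ^ n)" by blast
    from someI_ex[OF this] show "0 \<le> f g n" "f g n < int p ^ n" "inv (x [^] f g n) \<otimes> g \<in> P (p ^ n)"
      unfolding f_def by blast+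
  qed
  have f_eq: "f g n = i mod int p ^ n" if g: "g \<in> carrier G" and i: "inv (x [^] (i::int)) \<otimes> g \<in> P (p ^ n)" for g n i
  proof -
    have "(inv (x [^] i) \<otimes> g) \<otimes> inv (inv (x [^] f g n) \<otimes> g) \<in> P (p ^ n)"
      by (rule subgroup_div_closed[OF sub i f(3)[OF g]])
    also have "(inv (x [^] i) \<otimes> g) \<otimes> inv (inv (x [^] f g n) \<otimes> g) = x [^] (f g n - i)"
      using gen g m_comm[of "inv (x [^] i)" "x [^] f g n"] by (simp add: group_normalize int_pow_diff)
    finally have "int p ^ n dvd f g n - i" by (rule gen_pow_in_pow_image[OF p])
    then have "f g n mod int p ^ n = i mod int p ^ n" by (simp add: mod_eq_dvd_iff)
    then show ?thesis using f[OF g] by simp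
  qed
  have mono: "P (p ^ n) \<subseteq> P (p ^ m)" if mn: "m \<le> n" for m n
  proof
    fix g assume "g \<in> P (p ^ n)"
    then obtain h where h: "h \<in> carrier G" "g = h [^] (p ^ n)" by blast
    have "p ^ n = p ^ (n - m) * p ^ m" using mn by (simp flip: power_add)
    then have "g = (h [^] (p ^ (n - m))) [^] (p ^ m)" using h by (simp add: nat_pow_pow)
    then show "g \<in> P (p ^ m)" using h by blast
  qed
  have fZ: "f g \<in> carrier (padic_int p)" if g: "g \<in> carrier G" for g
  proof -
    have "f g (Suc n) mod int p ^ n = f g n" for n
      using f_eq[OF g subsetD[OF mono f(3)[OF g]], of n "Suc n"] by simp
    then show ?thesis using f[OF g] by (simp add: padic_int_def)
  qed
  have f_mult: "f (g \<otimes> h) = f g \<oplus>\<^bsub>padic_int p\<^esub> f h" if "g \<in> carrier G" "h \<in> carrier G" for g h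
  proof
    fix n
    have "(inv (x [^] f g n) \<otimes> g) \<otimes> (inv (x [^] f h n) \<otimes> h) \<in> P (p ^ n)"
      by (rule subgroup.m_closed[OF sub f(3)[OF that(1)] f(3)[OF that(2)]])
    also have "(inv (x [^] f g n) \<otimes> g) \<otimes> (inv (x [^] f h n) \<otimes> h) = inv (x [^] (f g n + f h n)) \<otimes> (g \<otimes> h)"
      using gen that by (simp add: int_pow_mult inv_mult m_ac)
    finally show "f (g \<otimes> h) n = (f g \<oplus>\<^bsub>padic_int p\<^esub> f h) n"
      using f_eq[of "g \<otimes> h"] that by (simp add: padic_int_def)
  qed
  have inj: "g = h" if gh: "g \<in> carrier G" "h \<in> carrier G" "f g = f h" for g h
  proof -
    have "g \<otimes> inv h \<in> P (p ^ n)" for n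
    proof -
      have "(inv (x [^] f g n) \<otimes> g) \<otimes> inv (inv (x [^] f h n) \<otimes> h) \<in> P (p ^ n)"
        by (rule subgroup_div_closed[OF sub f(3)[OF gh(1)] f(3)[OF gh(2)]])
      moreover have "(inv (x [^] f g n) \<otimes> g) \<otimes> inv (inv (x [^] f h n) \<otimes> h) = g \<otimes> inv h"
        using gen gh by (simp add: inv_mult m_ac mult_inv_cancel_left)
      ultimately show ?thesis by simp
    qed
    then have "g \<otimes> inv h = \<one>" using inter_prime_pow_images_trivial[OF p, of "g \<otimes> inv h"] gh by simp
    then show ?thesis using gh by (simp add: mult_inv_eq_one_iff)
  qed
  have surj: "\<exists>g\<in>carrier G. f g = z" if z: "z \<in> carrier (padic_int p)" for z
  proof -
    \<comment> \<open>The nested closed cosets prescribed by the residues of \<open>z\<close>. Each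
      contains a power of \<open>x\<close>, so compactness provides a common point.\<close>
    define F where "F n = {g \<in> carrier G. inv (x [^] z n) \<otimes> g \<in> P (p ^ n)}" for n
    have "closedin \<tau> (F n)" for n
      unfolding F_def by (rule closedin_preimage[OF continuous_map_lmult pow_image_closed_subgroup(2)]) (use gen in simp)
    moreover have "F n \<subseteq> F m" if mn: "m \<le> n" for m n
    proof
      fix g assume "g \<in> F n"
      then have g: "g \<in> carrier G" "inv (x [^] z n) \<otimes> g \<in> P (p ^ n)" by (auto simp: F_def)
      obtain k where "z n = z m + int p ^ m * k"
        using padic_compat[OF z mn] by (metis mod_div_mult_eq mult.commute)
      then have "x [^] z n = x [^] z m \<otimes> (x [^] k) [^] (p ^ m)"
        using gen by (simp add: int_pow_mult int_pow_pow mult.commute flip: int_pow_int)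
      then have "inv (x [^] z m) \<otimes> g = (x [^] k) [^] (p ^ m) \<otimes> (inv (x [^] z n) \<otimes> g)"
        using gen g by (simp add: inv_mult m_ac mult_inv_cancel_left)
      also have "\<dots> \<in> P (p ^ m)"
        by (rule subgroup.m_closed[OF sub _ subsetD[OF mono[OF mn] g(2)]]) (use gen in simp)
      finally show "g \<in> F m" using g by (simp add: F_def)
    qed
    then have "antimono F" by (simp add: antimonoI)
    moreover have "x [^] z n \<in> F n" for n
      using gen subgroup.one_closed[OF sub] by (simp add: F_def)
    then have "\<nexists>n. F n \<subseteq> {}" by blast
    ultimately have "\<not> (\<Inter>n. F n) \<subseteq> {}"
      using compact_space_nested[OF compact, of F "{}"] by (metis openin_empty)
    then obtain g where "g \<in> (\<Inter>n. F n)" by blast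
    then have g: "g \<in> carrier G" "\<And>n. inv (x [^] z n) \<otimes> g \<in> P (p ^ n)" by (auto simp: F_def)
    then have "f g = z" using f_eq[OF g(1) g(2)] padic_mod[OF z] by auto
    then show ?thesis using g by blast
  qed
  have "f \<in> hom G (add_monoid (padic_int p))" using fZ f_mult by (auto simp: hom_def)
  moreover have bij: "bij_betw f (carrier G) (carrier (padic_int p))"
    unfolding bij_betw_def
  proof (intro conjI equalityI subsetI)
    show "inj_on f (carrier G)" using inj by (rule inj_onI)
    show "z \<in> f ` carrier G" if "z \<in> carrier (padic_int p)" for z using surj[OF that] by blast
  qed (use fZ in blast)
  ultimately have "f \<in> iso G (add_monoid (padic_int p))" by (simp add: iso_def)
  moreover have "continuous_map \<tau> (padic_topology p) f"
    unfolding continuous_map_def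
  proof (intro conjI allI impI)
    show "f \<in> topspace \<tau> \<rightarrow> topspace (padic_topology p)" using fZ p0 by (auto simp: topspace_padic_topology)
    fix U assume U: "openin (padic_topology p) U"
    show "openin \<tau> {g \<in> topspace \<tau>. f g \<in> U}"
    proof (subst openin_subopen, intro ballI)
      fix g assume "g \<in> {g \<in> topspace \<tau>. f g \<in> U}"
      then have g: "g \<in> carrier G" "f g \<in> U" by auto
      then obtain n where n: "\<forall>y\<in>carrier (padic_int p). y n = f g n \<longrightarrow> y \<in> U"
        using U p0 openin_padic_topology by metis
      define T where "T = {h \<in> carrier G. inv g \<otimes> h \<in> P (p ^ n)}"
      have "openin \<tau> T" unfolding T_def using openin_lcoset[OF pow_image_open g(1)] p0 by simp
      moreover have "g \<in> T" using g subgroup.one_closed[OF sub] by (simp add: T_def)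
      moreover have "T \<subseteq> {g \<in> topspace \<tau>. f g \<in> U}"
      proof
        fix h assume "h \<in> T"
        then have h: "h \<in> carrier G" "inv g \<otimes> h \<in> P (p ^ n)" by (auto simp: T_def)
        have "(inv (x [^] f g n) \<otimes> g) \<otimes> (inv g \<otimes> h) \<in> P (p ^ n)"
          by (rule subgroup.m_closed[OF sub f(3)[OF g(1)] h(2)])
        then have "inv (x [^] f g n) \<otimes> h \<in> P (p ^ n)" using gen g h by (simp add: m_assoc mult_inv_cancel_left)
        then have "f h n = f g n" using f_eq[OF h(1)] f[OF g(1)] by simp
        then show "h \<in> {g \<in> topspace \<tau>. f g \<in> U}" using n fZ h by simp
      qed
      ultimately show "\<exists>T. openin \<tau> T \<and> g \<in> T \<and> T \<subseteq> {g \<in> topspace \<tau>. f g \<in> U}" by blast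
    qed
  qed
  then have "homeomorphic_map \<tau> (padic_topology p) f"
    by (rule continuous_imp_homeomorphic_map[OF _ compact Hausdorff_padic_topology])
       (use bij p0 in \<open>auto simp: topspace_padic_topology bij_betw_def\<close>)
  moreover have "f x = \<one>\<^bsub>padic_int p\<^esub>"
  proof
    fix n
    have "inv (x [^] (1::int)) \<otimes> x \<in> P (p ^ n)" using gen subgroup.one_closed[OF sub] by simp
    then show "f x n = \<one>\<^bsub>padic_int p\<^esub> n" using f_eq[OF gen] by (simp add: padic_int_def)
  qed
  ultimately show ?thesis using p(1) by (auto simp: padic_isomorphism_def)
qed

end

subsection \<open>Elements commuting with an element of infinite order\<close>

text \<open>A set \<open>S\<close> of natural numbers is sent to the sum of \<open>p ^ k\<close>
  over \<open>k \<in> S\<close>; the differences of consecutive partial sums recover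
  \<open>S\<close>.\<close>

lemma uncountable_padic_int:
  assumes "p > 1"
  shows "uncountable (carrier (padic_int p))"
proof
  assume cnt: "countable (carrier (padic_int p))"
  define z where "z S n = (\<Sum>k<n. if k \<in> S then int p ^ k else 0)" for S n
  have z0: "0 \<le> z S n" for S n by (auto simp: z_def intro!: sum_nonneg)
  have zlt: "z S n < int p ^ n" for S n
  proof (induction n)
    case (Suc n)
    have "z S (Suc n) \<le> z S n + int p ^ n" by (simp add: z_def)
    also have "\<dots> < 2 * int p ^ n" using Suc by simp
    also have "\<dots> \<le> int p ^ Suc n" using assms by simp
    finally show ?case .
  qed (simp add: z_def)
  have "z S (Suc n) mod int p ^ n = z S n" for S n
    using z0[of S n] zlt[of S n] by (auto simp: z_def)
  then have zZ: "z S \<in> carrier (padic_int p)" for S using z0 zlt by (simp add: padic_int_def)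
  have "inj z"
  proof (rule injI)
    fix S T assume eq: "z S = z T"
    have "n \<in> S \<longleftrightarrow> n \<in> T" for n
    proof -
      have "z S (Suc n) - z S n = z T (Suc n) - z T n" using eq by simp
      then show ?thesis using assms by (auto simp: z_def split: if_splits)
    qed
    then show "S = T" by blast
  qed
  moreover have "countable (range z)" using countable_subset[OF _ cnt] zZ by blast
  ultimately have "countable (UNIV :: nat set set)" by (metis countable_image_inj_on)
  then have "range (from_nat_into (UNIV :: nat set set)) = Pow UNIV"
    using range_from_nat_into[of "UNIV :: nat set set"] by simp
  then show False using Cantors_theorem[of "UNIV :: nat set"] by blast
qed

text \<open>For given \<open>i\<close> and \<open>j \<noteq> 0\<close> at most one \<open>y\<close>
  satisfies the relation, because the group is torsion-free. Countably many relations cannot exhaust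
  a group in bijection with Z_p.\<close>

lemma (in monothetic) independent_element:
  "\<exists>y\<in>carrier G. \<forall>(i::int) (j::int). x [^] i \<otimes> y [^] j = \<one> \<longrightarrow> i = 0 \<and> j = 0"
proof -
  obtain p f where p: "padic_isomorphism p G \<tau> f"
    using proper_prime_pow_image padic_coordinates by blast
  then have "bij_betw f (carrier G) (carrier (padic_int p))" "p > 1"
    using prime_gt_1_nat by (auto simp: padic_isomorphism_def iso_def)
  then have unc: "uncountable (carrier G)"
    using uncountable_padic_int uncountable_bij_betw by blast
  have pow0: "g = \<one>" if "g \<in> carrier G" "g [^] (j::int) = \<one>" "j \<noteq> 0" for g j
  proof (cases j rule: int_cases2)
    case (nonneg n)
    then show ?thesis using torsion_free[of g n] that by (simp add: int_pow_int)
  next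
    case (nonpos n)
    then have "g [^] n = \<one>" using that by (simp add: int_pow_neg_int)
    then show ?thesis using torsion_free[of g n] that nonpos by simp
  qed
  define R where "R i j = {y \<in> carrier G. x [^] (i::int) \<otimes> y [^] (j::int) = \<one>}" for i j
  have "countable (R i j)" if j: "j \<noteq> 0" for i j
  proof (cases "R i j = {}")
    case False
    then obtain y where y: "y \<in> R i j" by blast
    have "w = y" if w: "w \<in> R i j" for w
    proof -
      have G: "y \<in> carrier G" "w \<in> carrier G" using y w by (auto simp: R_def)
      have "x [^] i \<otimes> w [^] j = x [^] i \<otimes> y [^] j" using y w by (simp add: R_def)
      then have "w [^] j = y [^] j" using gen G by simp
      then have "(w \<otimes> inv y) [^] j = \<one>" using G by (simp add: int_pow_distrib int_pow_inv)
      then show ?thesis using pow0[of "w \<otimes> inv y" j] j G by (simp add: mult_inv_eq_one_iff)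
    qed
    then have "R i j \<subseteq> {y}" by blast
    then show ?thesis by (rule countable_subset) simp
  qed simp
  then have "countable (\<Union>j\<in>-{0}. \<Union>i. R i j)" by (intro countable_UN) auto
  then have "\<not> carrier G \<subseteq> (\<Union>j\<in>-{0}. \<Union>i. R i j)" using unc countable_subset by blast
  then obtain y where y: "y \<in> carrier G" "y \<notin> (\<Union>j\<in>-{0}. \<Union>i. R i j)" by (meson subsetI)
  have "i = 0 \<and> j = 0" if "x [^] i \<otimes> y [^] j = \<one>" for i j :: int
  proof -
    have "j = 0" using y that by (auto simp: R_def)
    then have "x [^] i = \<one>" using that gen by simp
    moreover have "x \<noteq> \<one>" using inf_order[of 1] gen by simp
    ultimately show ?thesis using pow0[OF gen] \<open>j = 0\<close> by blast
  qed
  with y(1) show ?thesis by (intro bexI[of _ y]) auto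
qed

lemma (in group) subgroup_cyclic:
  assumes "x \<in> carrier G"
  shows "subgroup (range (\<lambda>i::int. x [^] i)) G"
  using generate_pow[OF assms] generate_is_subgroup[of "{x}"] assms by (simp add: full_SetCompr_eq)

definition centralizer :: "('a, 'b) monoid_scheme \<Rightarrow> 'a set \<Rightarrow> 'a set" where
  "centralizer G S = {g \<in> carrier G. \<forall>s\<in>S. g \<otimes>\<^bsub>G\<^esub> s = s \<otimes>\<^bsub>G\<^esub> g}"

lemma (in group) subgroup_centralizer:
  assumes "S \<subseteq> carrier G"
  shows "subgroup (centralizer G S) G"
proof (rule subgroupI)
  fix a b assume ab: "a \<in> centralizer G S" "b \<in> centralizer G S"
  then have G: "a \<in> carrier G" "b \<in> carrier G" by (auto simp: centralizer_def)
  have "a \<otimes> b \<otimes> s = s \<otimes> (a \<otimes> b)" "inv a \<otimes> s = s \<otimes> inv a" if s: "s \<in> S" for s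
  proof -
    have sG: "s \<in> carrier G" using s assms by blast
    have as: "a \<otimes> s = s \<otimes> a" "b \<otimes> s = s \<otimes> b" using ab s by (auto simp: centralizer_def)
    have "a \<otimes> b \<otimes> s = a \<otimes> s \<otimes> b" using as(2) G sG by (simp add: m_assoc)
    then show "a \<otimes> b \<otimes> s = s \<otimes> (a \<otimes> b)" using as(1) G sG by (simp add: m_assoc)
    have "inv a \<otimes> s = inv a \<otimes> (s \<otimes> a) \<otimes> inv a" using G sG by (simp add: m_assoc)
    also have "\<dots> = s \<otimes> inv a" using G sG by (simp add: m_assoc mult_inv_cancel_left flip: as(1))
    finally show "inv a \<otimes> s = s \<otimes> inv a" .
  qed
  then show "a \<otimes> b \<in> centralizer G S" "inv a \<in> centralizer G S" using G by (simp_all add: centralizer_def)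
qed (use assms in \<open>auto simp: centralizer_def subset_iff intro!: exI[of _ \<one>]\<close>)

lemma (in group) int_pow_commute:
  assumes "a \<otimes> b = b \<otimes> a" "a \<in> carrier G" "b \<in> carrier G"
  shows "a [^] (i::int) \<otimes> b [^] (j::int) = b [^] j \<otimes> a [^] i"
proof -
  have "a [^] i \<in> centralizer G {b}"
    by (rule subgroup_int_pow_closed[OF subgroup_centralizer]) (use assms in \<open>auto simp: centralizer_def\<close>)
  then have "b [^] j \<in> centralizer G {a [^] i}"
    by (intro subgroup_int_pow_closed[OF subgroup_centralizer]) (use assms in \<open>auto simp: centralizer_def\<close>)
  then show ?thesis by (simp add: centralizer_def)
qed

section \<open>Closures of infinite cyclic subgroups and the torsion commuting with them\<close>

context topgroup
begin

lemma closedin_centralizer: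
  assumes "S \<subseteq> carrier G"
  shows "closedin \<tau> (centralizer G S)"
proof -
  have "centralizer G S = carrier G \<inter> (\<Inter>s\<in>S. {g \<in> carrier G. g \<otimes> s = s \<otimes> g})"
    by (auto simp: centralizer_def)
  moreover have "closedin \<tau> {g \<in> carrier G. g \<otimes> s = s \<otimes> g}" if "s \<in> S" for s
    using that assms by (intro closedin_equalizer continuous_map_lmult continuous_map_rmult) auto
  ultimately show ?thesis
    by (cases "S = {}") (auto simp: closedin_INT closedin_Int closedin_topspace[of \<tau>, simplified])
qed

lemma comm_group_closure:
  assumes "subgroup H G" "\<And>x y. x \<in> H \<Longrightarrow> y \<in> H \<Longrightarrow> x \<otimes> y = y \<otimes> x"
  shows "comm_group (G\<lparr>carrier := \<tau> closure_of H\<rparr>)"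
  by (rule comm_group_subgroup[OF subgroup_closure[OF assms(1)]])
     (rule closure_commute[OF subgroup.subset[OF assms(1)] subgroup.subset[OF assms(1)] assms(2)])

text \<open>Weil's lemma asks for powers of \<open>x\<close> with large exponents near the identity.
  The infinite cyclic subgroup is minimal by heredity and hence not discrete, and this supplies
  them.\<close>

lemma monothetic_closure:
  assumes lc: "locally_compact_space \<tau>" and hm: "hereditarily_minimal G \<tau>"
    and x: "x \<in> carrier G" "\<And>n. n > 0 \<Longrightarrow> x [^] (n::nat) \<noteq> \<one>"
  defines "K \<equiv> \<tau> closure_of (range (\<lambda>i::int. x [^] i))"
  shows "monothetic (G\<lparr>carrier := K\<rparr>) (subtopology \<tau> K) x"
proof -
  let ?C = "range (\<lambda>i::int. x [^] i)"
  have C: "subgroup ?C G" by (rule subgroup_cyclic[OF x(1)])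
  have CG: "?C \<subseteq> carrier G" using x(1) by blast
  have Ccomm: "a \<otimes> b = b \<otimes> a" if "a \<in> ?C" "b \<in> ?C" for a b
    using that x(1) by (auto simp: add.commute simp flip: int_pow_mult)
  have CK: "?C \<subseteq> K" unfolding K_def using CG by (simp add: closure_of_subset)
  have K: "subgroup K G" unfolding K_def by (rule subgroup_closure[OF C])
  interpret C: topgroup "G\<lparr>carrier := ?C\<rparr>" "subtopology \<tau> ?C" by (rule topological_subgroup[OF C])
  interpret K: topgroup "G\<lparr>carrier := K\<rparr>" "subtopology \<tau> K" by (rule topological_subgroup[OF K])
  have KC: "comm_group (G\<lparr>carrier := K\<rparr>)" unfolding K_def by (rule comm_group_closure[OF C Ccomm])
  interpret K: comm_group "G\<lparr>carrier := K\<rparr>" by (rule KC)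
  have xK: "x \<in> K" using CK rangeI[of "\<lambda>i::int. x [^] i" 1] x(1) by auto
  have powK: "x [^]\<^bsub>G\<lparr>carrier := K\<rparr>\<^esub> (i::int) = x [^] i" for i using int_pow_consistent[OF K xK] by simp
  have npowK: "x [^]\<^bsub>G\<lparr>carrier := K\<rparr>\<^esub> (n::nat) = x [^] n" for n by (simp flip: nat_pow_consistent)
  have inj: "inj (\<lambda>i::int. x [^] i)"
  proof (rule injI)
    fix i j :: int assume "x [^] i = x [^] j"
    then have "int (ord x) dvd j - i" using int_pow_eq[OF x(1)] by simp
    moreover have "ord x = 0" using ord_eq_0[OF x(1)] x(2) by blast
    ultimately show "i = j" by simp
  qed
  then have infC: "infinite ?C" using finite_imageD infinite_UNIV_int by blast
  have nd: "\<not> openin (subtopology \<tau> ?C) {\<one>}"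
  proof
    assume "openin (subtopology \<tau> ?C) {\<one>}"
    moreover have "comm_group (G\<lparr>carrier := ?C\<rparr>)" by (rule comm_group_subgroup[OF C Ccomm])
    moreover have "minimal_group (G\<lparr>carrier := ?C\<rparr>) (subtopology \<tau> ?C)"
      using hm C unfolding hereditarily_minimal_def by blast
    ultimately have "finite (carrier (G\<lparr>carrier := ?C\<rparr>))" using discrete_minimal_imp_finite by fastforce
    then show False using infC by simp
  qed
  have rec: "\<exists>n>k. x [^] (n::nat) \<in> U" if U: "openin \<tau> U" "\<one> \<in> U" for U k
  proof -
    \<comment> \<open>With the first \<open>k\<close> positive powers deleted from the neighbourhood
      and a symmetric one taken inside the rest, any nontrivial power found there has an exponent of
      absolute value above \<open>k\<close>.\<close>
    define F where "F = (\<lambda>j::nat. x [^] j) ` {1..k}"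
    have "closedin \<tau> F" unfolding F_def by (rule closedin_finite) (use x in auto)
    moreover have "\<one> \<notin> F"
    proof
      assume "\<one> \<in> F"
      then obtain j :: nat where "j \<in> {1..k}" "\<one> = x [^] j" by (auto simp: F_def)
      then show False using x(2)[of j] by simp
    qed
    ultimately have "openin \<tau> (U - F)" "\<one> \<in> U - F" using U by (simp_all add: openin_diff)
    from nbhd_one[OF this] obtain V where V: "openin \<tau> V" "\<one> \<in> V" "V \<subseteq> U - F" "\<forall>x\<in>V. inv x \<in> V" by auto
    have "openin (subtopology \<tau> ?C) (V \<inter> ?C)" using V(1) by (auto simp: openin_subtopology)
    then have "V \<inter> ?C \<noteq> {\<one>}" using nd by metis
    moreover have "\<one> \<in> V \<inter> ?C" using V(2) subgroup.one_closed[OF C] by blast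
    ultimately obtain i :: int where i: "x [^] i \<in> V" "x [^] i \<noteq> \<one>" by blast
    define n where "n = nat \<bar>i\<bar>"
    have "x [^] n \<in> V"
    proof (cases i rule: int_cases2)
      case (nonneg m)
      then show ?thesis using i by (simp add: n_def int_pow_int)
    next
      case (nonpos m)
      then have "inv (x [^] i) = x [^] m" using x(1) by (simp add: int_pow_neg_int)
      then show ?thesis using i V nonpos by (metis n_def abs_minus_cancel abs_of_nat nat_int)
    qed
    moreover have "i \<noteq> 0" using i(2) by auto
    then have "n \<ge> 1" by (simp add: n_def)
    moreover have "x [^] n \<in> F" if "n \<le> k" using that \<open>n \<ge> 1\<close> by (simp add: F_def)
    ultimately show ?thesis using V(3) by (intro exI[of _ n]) force
  qed
  have dense: "subtopology \<tau> K closure_of ?C = K"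
    using CK by (simp add: closure_of_subtopology inf.absorb2 K_def)
  show ?thesis
  proof
    show "hereditarily_minimal (G\<lparr>carrier := K\<rparr>) (subtopology \<tau> K)"
      by (rule hereditarily_minimal_subgroup[OF hm K])
    show "subtopology \<tau> K closure_of range (\<lambda>i::int. x [^]\<^bsub>G\<lparr>carrier := K\<rparr>\<^esub> i) = carrier (G\<lparr>carrier := K\<rparr>)"
      by (simp add: powK dense)
    show "compact_space (subtopology \<tau> K)"
    proof (rule K.monothetic_compact[OF KC])
      show "locally_compact_space (subtopology \<tau> K)"
        by (rule locally_compact_space_closed_subset[OF lc]) (simp add: K_def)
      show "\<exists>n>k. x [^]\<^bsub>G\<lparr>carrier := K\<rparr>\<^esub> n \<in> U"
        if "openin (subtopology \<tau> K) U" "\<one>\<^bsub>G\<lparr>carrier := K\<rparr>\<^esub> \<in> U" for U and k :: nat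
      proof -
        obtain T where T: "openin \<tau> T" "U = T \<inter> K" using \<open>openin (subtopology \<tau> K) U\<close> by (auto simp: openin_subtopology)
        then obtain n where "n > k" "x [^] n \<in> T" using rec[of T k] \<open>\<one>\<^bsub>G\<lparr>carrier := K\<rparr>\<^esub> \<in> U\<close> by auto
        moreover have "x [^] n \<in> K" using subgroup_int_pow_closed[OF K xK, of "int n"] by (simp add: int_pow_int)
        ultimately show ?thesis using T npowK by auto
      qed
    qed (use xK powK dense in simp_all)
  qed (use xK x(2) npowK in simp_all)
qed

text \<open>The dense subgroup is generated by \<open>x\<close> and
  \<open>w = y \<otimes> c\<close>, where \<open>y\<close>, in the closure of the powers of
  \<open>x\<close>, is independent of \<open>x\<close>. Powers of \<open>x\<close> approximate
  \<open>inv y\<close>, so multiples of \<open>w\<close> by them approximate \<open>c\<close>, which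
  therefore lies in the closure. A power of \<open>c\<close> in the subgroup makes some
  \<open>x [^] a \<otimes> y [^] b\<close> a torsion element of a torsion-free group, so
  \<open>a = b = 0\<close> by independence and that power is trivial.\<close>

lemma torsion_commuting_trivial:
  assumes lc: "locally_compact_space \<tau>" and hm: "hereditarily_minimal G \<tau>"
    and x: "x \<in> carrier G" "\<And>n. n > 0 \<Longrightarrow> x [^] (n::nat) \<noteq> \<one>"
    and c: "c \<in> carrier G" "k > 0" "c [^] (k::nat) = \<one>" and comm: "x \<otimes> c = c \<otimes> x"
  shows "c = \<one>"
proof -
  let ?C = "range (\<lambda>i::int. x [^] i)"
  define K where "K = \<tau> closure_of ?C"
  have C: "subgroup ?C G" by (rule subgroup_cyclic[OF x(1)])
  have K: "subgroup K G" unfolding K_def by (rule subgroup_closure[OF C])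
  have KG: "K \<subseteq> carrier G" using K by (rule subgroup.subset)
  interpret K: monothetic "G\<lparr>carrier := K\<rparr>" "subtopology \<tau> K" x
    unfolding K_def by (rule monothetic_closure[OF lc hm x])
  have xK: "x \<in> K" using K.gen by simp
  obtain y where y: "y \<in> K"
    and "\<forall>(i::int) (j::int). x [^]\<^bsub>G\<lparr>carrier := K\<rparr>\<^esub> i \<otimes> y [^]\<^bsub>G\<lparr>carrier := K\<rparr>\<^esub> j = \<one> \<longrightarrow> i = 0 \<and> j = 0"
    using K.independent_element by auto
  then have indep: "i = 0 \<and> j = 0" if "x [^] i \<otimes> y [^] j = \<one>" for i j :: int
    using that unfolding int_pow_consistent[OF K xK] int_pow_consistent[OF K y] by blast
  have yG: "y \<in> carrier G" using y KG by blast
  have Kcomm: "a \<otimes> b = b \<otimes> a" if "a \<in> K" "b \<in> K" for a b using K.m_comm that by simp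
  have xy: "x \<otimes> y = y \<otimes> x" by (rule Kcomm[OF xK y])
  have yc: "y \<otimes> c = c \<otimes> y"
  proof -
    have "?C \<subseteq> centralizer G {c}"
      using subgroup_int_pow_closed[OF subgroup_centralizer[of "{c}"], of x] x(1) c(1) comm
      by (auto simp: centralizer_def)
    then have "K \<subseteq> centralizer G {c}"
      unfolding K_def using closedin_centralizer[of "{c}"] c(1) by (intro closure_of_minimal) auto
    then show ?thesis using y by (auto simp: centralizer_def)
  qed
  define w where "w = y \<otimes> c"
  have wG: "w \<in> carrier G" using yG c by (simp add: w_def)
  have xw: "x \<otimes> w = w \<otimes> x"
    unfolding w_def using x yG c xy comm by (metis m_assoc)
  define h where "h i j = x [^] i \<otimes> w [^] j" for i j :: int
  define H where "H = (\<lambda>(i, j). h i j) ` UNIV"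
  have wp: "w [^] j = y [^] j \<otimes> c [^] j" for j :: int unfolding w_def by (rule int_pow_mult_distrib[OF yc yG c(1)])
  have hm1: "h i j \<otimes> h i' j' = h (i + i') (j + j')" for i j i' j'
  proof -
    have "x [^] i \<otimes> w [^] j \<otimes> (x [^] i' \<otimes> w [^] j') = x [^] i \<otimes> (w [^] j \<otimes> x [^] i') \<otimes> w [^] j'"
      using x wG by (simp add: m_assoc)
    also have "w [^] j \<otimes> x [^] i' = x [^] i' \<otimes> w [^] j" using int_pow_commute[OF xw x(1) wG] by simp
    finally show ?thesis using x wG by (simp add: h_def int_pow_mult m_assoc)
  qed
  have hG: "h i j \<in> carrier G" for i j using x wG by (simp add: h_def)
  have h0: "h 0 0 = \<one>" by (simp add: h_def)
  have H: "subgroup H G"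
  proof (rule subgroupI)
    fix a b assume ab: "a \<in> H" "b \<in> H"
    then obtain i j i' j' where *: "a = h i j" "b = h i' j'" by (auto simp: H_def)
    show "a \<otimes> b \<in> H" unfolding * hm1 by (auto simp: H_def)
    have "h (-i) (-j) \<otimes> h i j = \<one>" by (simp add: hm1 h0)
    then have "inv a = h (-i) (-j)" unfolding * using hG by (metis inv_equality)
    then show "inv a \<in> H" by (auto simp: H_def)
  qed (use hG in \<open>auto simp: H_def\<close>)
  have HG: "H \<subseteq> carrier G" using H by (rule subgroup.subset)
  have Hcomm: "a \<otimes> b = b \<otimes> a" if "a \<in> H" "b \<in> H" for a b
    using that by (auto simp: H_def hm1 add.commute)
  define L where "L = \<tau> closure_of H"
  have L: "subgroup L G" unfolding L_def by (rule subgroup_closure[OF H])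
  interpret L: topgroup "G\<lparr>carrier := L\<rparr>" "subtopology \<tau> L" by (rule topological_subgroup[OF L])
  interpret L: comm_group "G\<lparr>carrier := L\<rparr>" unfolding L_def by (rule comm_group_closure[OF H Hcomm])
  have HL: "H \<subseteq> L" unfolding L_def using HG by (simp add: closure_of_subset)
  have HL': "subgroup H (G\<lparr>carrier := L\<rparr>)" by (rule subgroup_incl[OF H L HL])
  have cL: "c \<in> L"
    unfolding L_def in_closure_iff[OF c(1) HG]
  proof (intro allI impI)
    fix U assume U: "openin \<tau> U \<and> \<one> \<in> U"
    have iy: "inv y \<in> carrier G" "inv y \<in> K" using yG y K by (auto simp: subgroup.m_inv_closed)
    have "\<exists>s\<in>?C. inv (inv y) \<otimes> s \<in> U"
      using iy(2) U in_closure_iff[OF iy(1) subgroup.subset[OF C]] unfolding K_def by blast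
    then obtain i :: int where i: "y \<otimes> x [^] i \<in> U" using yG by auto
    have "inv c \<otimes> h i 1 = inv c \<otimes> (x [^] i \<otimes> (y \<otimes> c))" using wG by (simp add: h_def w_def)
    also have "\<dots> = inv c \<otimes> (x [^] i \<otimes> (c \<otimes> y))" using yc by simp
    also have "\<dots> = inv c \<otimes> ((x [^] i \<otimes> c) \<otimes> y)" using x c yG by (simp add: m_assoc)
    also have "x [^] i \<otimes> c = c \<otimes> x [^] i" using int_pow_commute[OF comm x(1) c(1), of i 1] c by simp
    also have "inv c \<otimes> ((c \<otimes> x [^] i) \<otimes> y) = x [^] i \<otimes> y" using x c yG by (simp add: m_assoc mult_inv_cancel_left)
    also have "\<dots> = y \<otimes> x [^] i" using int_pow_commute[OF xy x(1) yG, of i 1] yG by simp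
    finally have "inv c \<otimes> h i 1 \<in> U" using i by simp
    then show "\<exists>s\<in>H. inv c \<otimes> s \<in> U" by (auto simp: H_def)
  qed
  define N where "N = range (\<lambda>i::int. c [^] i)"
  have N: "subgroup N G" unfolding N_def by (rule subgroup_cyclic[OF c(1)])
  have NL: "N \<subseteq> L" using subgroup_int_pow_closed[OF L cL] by (auto simp: N_def)
  have "c [^] i = \<one>" if ciH: "c [^] i \<in> H" for i :: int
  proof -
    obtain a b :: int where ab: "c [^] i = x [^] a \<otimes> (y [^] b \<otimes> c [^] b)" using ciH by (auto simp: H_def h_def wp)
    define u where "u = x [^] a \<otimes> y [^] b"
    have uK: "u \<in> K" unfolding u_def
      using subgroup_int_pow_closed[OF K] xK y K by (simp add: subgroup.m_closed)
    have uG: "u \<in> carrier G" using uK KG by blast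
    have "u = c [^] (i - b)"
    proof -
      have "u \<otimes> c [^] b = c [^] i" using ab x yG c by (simp add: u_def m_assoc)
      then have "u = c [^] i \<otimes> inv (c [^] b)" using uG c by (metis int_pow_closed inv_solve_right)
      then show ?thesis using c by (simp add: int_pow_diff)
    qed
    then have "u [^] k = (c [^] k) [^] (i - b)" using c(1) by (simp add: int_pow_pow mult.commute flip: int_pow_int)
    then have "u [^] k = \<one>" using c by simp
    then have "u = \<one>" using K.torsion_free[of u k] uK c(2) nat_pow_consistent[of u k K] by simp
    then have "a = 0" "b = 0" using indep unfolding u_def by blast+
    then show ?thesis using ab by simp
  qed
  then have NH: "N \<inter> H = {\<one>}" using subgroup.one_closed[OF N] subgroup.one_closed[OF H] by (auto simp: N_def)
  have "finite N"
  proof (rule finite_subset)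
    show "N \<subseteq> (\<lambda>j::nat. c [^] j) ` {..<k}"
    proof
      fix g assume "g \<in> N"
      then obtain i :: int where i: "g = c [^] i" by (auto simp: N_def)
      have "c [^] i = c [^] (int k * (i div int k) + i mod int k)" by simp
      also have "\<dots> = (c [^] k) [^] (i div int k) \<otimes> c [^] (i mod int k)"
        using c(1) by (simp only: int_pow_mult flip: int_pow_pow int_pow_int)
      also have "\<dots> = c [^] nat (i mod int k)" using c by (simp add: pow_nat)
      finally have "g = c [^] nat (i mod int k)" using i by simp
      moreover have "nat (i mod int k) < k" using c(2) by (simp add: nat_less_iff)
      ultimately show "g \<in> (\<lambda>j::nat. c [^] j) ` {..<k}" by blast
    qed
  qed simp
  then have Nc: "closedin (subtopology \<tau> L) N" using L.closedin_finite NL by simp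
  have Nn: "N \<lhd> G\<lparr>carrier := L\<rparr>" using subgroup_incl[OF N L NL] L.normal_iff_subgroup by blast
  have Hm: "minimal_group (G\<lparr>carrier := L\<rparr>\<lparr>carrier := H\<rparr>) (subtopology (subtopology \<tau> L) H)"
    using hereditarily_minimal_subgroup[OF hm L] HL' unfolding hereditarily_minimal_def by blast
  have Ncl: "N \<subseteq> subtopology \<tau> L closure_of H"
    using NL HL by (simp add: closure_of_subtopology inf.absorb2 L_def)
  have "N = {\<one>\<^bsub>G\<lparr>carrier := L\<rparr>\<^esub>}"
    by (rule L.minimal_subgroup_essential[OF HL' Hm Nn Nc Ncl]) (simp add: NH)
  moreover have "c \<in> N" unfolding N_def using rangeI[of "\<lambda>i::int. c [^] i" 1] c(1) by simp
  ultimately show ?thesis by simp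
qed

end

subsection \<open>Torsion quotients\<close>

text \<open>Elements of the subgroup generated by a countably infinite set are products of finite
  words in the generators and their inverses. Countability prepares for Baire's theorem.\<close>

lemma (in group) infinite_imp_countable_infinite_subgroup:
  assumes "infinite (carrier G)"
  shows "\<exists>C. subgroup C G \<and> countable C \<and> infinite C"
proof -
  obtain S where S: "S \<subseteq> carrier G" "countable S" "infinite S"
    using infinite_countable_subset'[OF assms] by blast
  let ?T = "S \<union> (\<lambda>x. inv x) ` S"
  let ?D = "(\<lambda>xs. foldr (\<otimes>) xs \<one>) ` lists ?T"
  have T: "?T \<subseteq> carrier G" using S(1) by auto
  have closed: "foldr (\<otimes>) xs \<one> \<in> carrier G" if "xs \<in> lists ?T" for xs
    using that T by (induction xs) auto
  have app: "foldr (\<otimes>) (xs @ ys) \<one> = foldr (\<otimes>) xs \<one> \<otimes> foldr (\<otimes>) ys \<one>"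
    if "xs \<in> lists ?T" "ys \<in> lists ?T" for xs ys
    using that(1)
  proof (induction xs)
    case Nil
    then show ?case using closed[OF that(2)] by simp
  next
    case (Cons a xs)
    then have "a \<in> carrier G" "foldr (\<otimes>) xs \<one> \<in> carrier G" using T closed by auto
    then show ?case using Cons.IH closed[OF that(2)] by (simp add: m_assoc)
  qed
  have "generate G S \<subseteq> ?D"
  proof
    fix g assume "g \<in> generate G S"
    then show "g \<in> ?D"
    proof induction
      case one
      show ?case by (rule image_eqI[of _ _ "[]"]) auto
    next
      case (incl h)
      then show ?case using S(1) by (intro image_eqI[of _ _ "[h]"]) auto
    next
      case (inv h)
      then show ?case using S(1) by (intro image_eqI[of _ _ "[inv h]"]) auto
    next
      case (eng a b)
      then obtain xs ys where "xs \<in> lists ?T" "ys \<in> lists ?T" "a = foldr (\<otimes>) xs \<one>" "b = foldr (\<otimes>) ys \<one>" by blast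
      then show ?case using app by (intro image_eqI[of _ _ "xs @ ys"]) auto
    qed
  qed
  moreover have "countable ?D" using S(2) by (intro countable_image countable_lists) simp
  ultimately have "countable (generate G S)" using countable_subset by blast
  moreover have "infinite (generate G S)" using S(3) generate.incl by (metis infinite_super subsetI)
  ultimately show ?thesis using generate_is_subgroup[OF S(1)] by blast
qed

context topgroup
begin

text \<open>By Baire's theorem a countably infinite closed subgroup would be discrete.\<close>

lemma all_subgroups_closed_imp_finite:
  assumes "comm_group G" and lc: "locally_compact_space \<tau>" and hm: "hereditarily_minimal G \<tau>"
    and closed: "\<And>H. subgroup H G \<Longrightarrow> closedin \<tau> H"
  shows "finite (carrier G)"
proof (rule ccontr)
  assume "infinite (carrier G)"
  then obtain C where C: "subgroup C G" "countable C" "infinite C"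
    using infinite_imp_countable_infinite_subgroup by blast
  interpret comm_group G by fact
  interpret C: topgroup "G\<lparr>carrier := C\<rparr>" "subtopology \<tau> C" by (rule topological_subgroup[OF C(1)])
  let ?X = "subtopology \<tau> C"
  have lcC: "locally_compact_space ?X" using locally_compact_space_closed_subset[OF lc closed[OF C(1)]] .
  have "\<exists>a\<in>C. openin ?X {a}"
  proof (rule ccontr)
    assume no: "\<not> (\<exists>a\<in>C. openin ?X {a})"
    have "?X interior_of \<Union>((\<lambda>a. {a}) ` C) = {}"
    proof (rule Baire_category_alt)
      show "completely_metrizable_space ?X \<or> locally_compact_space ?X \<and> regular_space ?X"
        using lcC locally_compact_Hausdorff_imp_regular_space C.hausdorff by blast
      show "countable ((\<lambda>a. {a}) ` C)" using C(2) by simp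
      fix T assume "T \<in> (\<lambda>a. {a}) ` C"
      then obtain a where a: "a \<in> C" "T = {a}" by blast
      have "?X interior_of {a} \<noteq> {a}" using no a openin_interior_of by metis
      then have "?X interior_of {a} = {}" using interior_of_subset[of ?X "{a}"] by blast
      then show "closedin ?X T \<and> ?X interior_of T = {}" using a C.closedin_finite[of T] by simp
    qed
    moreover have "?X interior_of C = C"
      using interior_of_topspace[of ?X] C.topspace_eq by simp
    ultimately show False using subgroup.one_closed[OF C(1)] by auto
  qed
  then obtain a where a: "a \<in> C" "openin ?X {a}" by blast
  have "{x \<in> C. a \<otimes> x \<in> {a}} = {\<one>}"
    using a(1) subgroup.mem_carrier[OF C(1)] subgroup.one_closed[OF C(1)] by auto
  then have "openin ?X {\<one>}" using C.nbhd_translate(1)[OF a(2)] by simp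
  moreover have "comm_group (G\<lparr>carrier := C\<rparr>)"
    using subgroup.mem_carrier[OF C(1)] by (intro comm_group_subgroup[OF C(1)] m_comm)
  moreover have "minimal_group (G\<lparr>carrier := C\<rparr>) ?X" using hm C(1) unfolding hereditarily_minimal_def by blast
  ultimately have "finite (carrier (G\<lparr>carrier := C\<rparr>))" using discrete_minimal_imp_finite by fastforce
  then show False using C(3) by simp
qed

lemma closedin_lcoset:
  "closedin \<tau> S \<Longrightarrow> a \<in> carrier G \<Longrightarrow> closedin \<tau> {g \<in> carrier G. inv a \<otimes> g \<in> S}"
  by (rule closedin_preimage[OF continuous_map_lmult]) auto

lemma comm_group_quotient:
  assumes N: "N \<lhd> G" and comm: "\<And>g h. g \<in> carrier G \<Longrightarrow> h \<in> carrier G \<Longrightarrow> g \<otimes> h \<otimes> inv (h \<otimes> g) \<in> N"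
  shows "comm_group (G Mod N)"
proof (rule group.group_comm_groupI[OF normal.factorgroup_is_group[OF N]])
  fix X Y assume "X \<in> carrier (G Mod N)" "Y \<in> carrier (G Mod N)"
  then obtain g h where gh: "g \<in> carrier G" "h \<in> carrier G" "X = N #> g" "Y = N #> h"
    by (auto simp: carrier_FactGroup)
  then have "N #> (g \<otimes> h) = N #> (h \<otimes> g)" using rcoset_eq_iff[OF N] comm by simp
  then show "X \<otimes>\<^bsub>G Mod N\<^esub> Y = Y \<otimes>\<^bsub>G Mod N\<^esub> X" using gh normal.rcos_sum[OF N] by simp
qed

text \<open>
  If \<open>y\<close> were in the closure of \<open>H\<close> but only \<open>y ^ q\<close> in \<open>H\<close>, then modulo the closed normal
  subgroup generated by \<open>K\<close> and \<open>y ^ q\<close> the element \<open>y\<close> would generate a subgroup of prime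
  order avoiding \<open>H\<close>.
\<close>

lemma subgroup_closed_if_torsion_quotient:
  assumes htm: "hereditarily_totally_minimal G \<tau>" and K: "K \<lhd> G" "closedin \<tau> K"
    and comm: "\<And>g h. g \<in> carrier G \<Longrightarrow> h \<in> carrier G \<Longrightarrow> g \<otimes> h \<otimes> inv (h \<otimes> g) \<in> K"
    and torsion: "\<And>g. g \<in> carrier G \<Longrightarrow> \<exists>n>0. g [^] (n::nat) \<in> K"
    and H: "subgroup H G" "K \<subseteq> H"
  shows "closedin \<tau> H"
proof (rule ccontr)
  assume "\<not> closedin \<tau> H"
  interpret K: normal K G by fact
  have HG: "H \<subseteq> carrier G" using H(1) by (rule subgroup.subset)
  define L where "L = \<tau> closure_of H"
  have L: "subgroup L G" unfolding L_def by (rule subgroup_closure[OF H(1)])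
  have HL: "H \<subseteq> L" unfolding L_def using HG by (simp add: closure_of_subset)
  have "L \<noteq> H" using \<open>\<not> closedin \<tau> H\<close> closedin_closure_of unfolding L_def by metis
  then obtain z where z: "z \<in> L" "z \<notin> H" using HL by blast
  have zG: "z \<in> carrier G" using z L by (rule_tac subgroup.mem_carrier)
  define n where "n = (LEAST n::nat. n > 0 \<and> z [^] n \<in> H)"
  have "\<exists>n::nat. n > 0 \<and> z [^] n \<in> H" using torsion[OF zG] H(2) by blast
  then have n: "n > 0" "z [^] n \<in> H" unfolding n_def by (metis (mono_tags, lifting) LeastI)+
  have nl: "\<not> (m > 0 \<and> z [^] m \<in> H)" if "m < n" for m :: nat using not_less_Least that unfolding n_def by blast
  have "n \<noteq> 1" using n z zG by auto
  then obtain q where q: "prime q" "q dvd n" using prime_factor_nat by blast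
  then obtain m where m: "n = m * q" by (metis dvd_def mult.commute)
  then have m0: "m > 0" "m < n" using n(1) prime_gt_1_nat[OF q(1)] by auto
  \<comment> \<open>Here \<open>n\<close> is the least positive exponent that takes \<open>z\<close>
    into \<open>H\<close> and \<open>m\<close> is \<open>n\<close> divided by its prime factor
    \<open>q\<close>; so \<open>y\<close> is outside \<open>H\<close> and its \<open>q\<close>-th
    power is inside.\<close>
  define y where "y = z [^] m"
  define w where "w = y [^] q"
  have yG: "y \<in> carrier G" using zG by (simp add: y_def)
  have yL: "y \<in> L" using subgroup_int_pow_closed[OF L z(1), of "int m"] by (simp add: y_def int_pow_int)
  have yH: "y \<notin> H" using nl[OF m0(2)] m0(1) by (simp add: y_def)
  have wH: "w \<in> H" using n m zG by (simp add: w_def y_def nat_pow_pow)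
  have wG: "w \<in> carrier G" using wH HG by blast
  obtain r where r: "r > 0" "w [^] (r::nat) \<in> K" using torsion[OF wG] by blast
  \<comment> \<open>The product of \<open>K\<close> with the powers of \<open>w\<close>. Since
    \<open>w\<close> is torsion modulo \<open>K\<close>, it is a finite union of cosets of
    \<open>K\<close> and so closed; since commutators lie in \<open>K\<close>, it is normal.\<close>
  define N where "N = {g \<in> carrier G. \<exists>j::int. inv (w [^] j) \<otimes> g \<in> K}"
  have KN: "K \<subseteq> N" using K.subset by (auto simp: N_def intro!: exI[of _ "0::int"])
  have Nsub: "subgroup N G"
  proof (rule subgroupI)
    fix a b assume "a \<in> N" "b \<in> N"
    then obtain i j :: int where ab: "a \<in> carrier G" "b \<in> carrier G" "inv (w [^] i) \<otimes> a \<in> K" "inv (w [^] j) \<otimes> b \<in> K"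
      by (auto simp: N_def)
    have "inv b \<otimes> (inv (w [^] i) \<otimes> a) \<otimes> b \<in> K" using K.inv_op_closed1 ab by simp
    have "(inv (w [^] j) \<otimes> (inv (w [^] i) \<otimes> a) \<otimes> w [^] j) \<otimes> (inv (w [^] j) \<otimes> b) \<in> K"
      using K.inv_op_closed1[OF _ ab(3), of "w [^] j"] ab(4) wG by simp
    also have "(inv (w [^] j) \<otimes> (inv (w [^] i) \<otimes> a) \<otimes> w [^] j) \<otimes> (inv (w [^] j) \<otimes> b) = inv (w [^] (i + j)) \<otimes> (a \<otimes> b)"
      using ab wG by (simp add: group_normalize int_pow_mult)
    finally show "a \<otimes> b \<in> N" using ab by (auto simp: N_def)
    have "w [^] i \<otimes> inv (inv (w [^] i) \<otimes> a) \<otimes> inv (w [^] i) \<in> K"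
      using K.inv_op_closed2[of "w [^] i" "inv (inv (w [^] i) \<otimes> a)"] ab(3) wG by simp
    also have "w [^] i \<otimes> inv (inv (w [^] i) \<otimes> a) \<otimes> inv (w [^] i) = inv (w [^] (- i)) \<otimes> inv a \<otimes> (w [^] i \<otimes> inv (w [^] i))"
      using ab wG by (simp add: group_normalize int_pow_neg)
    finally have "inv (w [^] (- i)) \<otimes> inv a \<in> K" using wG ab by simp
    then show "inv a \<in> N" using ab(1) by (auto simp: N_def)
  next
    show "N \<noteq> {}" using KN K.one_closed by blast
  qed (auto simp: N_def)
  have N: "N \<lhd> G"
    unfolding normal_inv_iff
  proof (intro conjI ballI Nsub)
    fix g a assume ga: "g \<in> carrier G" "a \<in> N"
    then have aG: "a \<in> carrier G" by (simp add: N_def)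
    have "g \<otimes> a \<otimes> inv (a \<otimes> g) \<in> N" using comm[OF ga(1) aG] KN by blast
    then have "(g \<otimes> a \<otimes> inv (a \<otimes> g)) \<otimes> a \<in> N" using ga(2) subgroup.m_closed[OF Nsub] by blast
    then show "g \<otimes> a \<otimes> inv g \<in> N" using ga(1) aG by (simp add: group_normalize)
  qed
  have NH: "N \<subseteq> H"
  proof
    fix g assume "g \<in> N"
    then obtain j :: int where g: "g \<in> carrier G" "inv (w [^] j) \<otimes> g \<in> K" by (auto simp: N_def)
    have "w [^] j \<otimes> (inv (w [^] j) \<otimes> g) \<in> H"
      by (rule subgroup.m_closed[OF H(1) subgroup_int_pow_closed[OF H(1) wH] subsetD[OF H(2) g(2)]])
    then show "g \<in> H" using g wG by (simp add: mult_inv_cancel_left)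
  qed
  have Nc: "closedin \<tau> N"
  proof -
    have "N = (\<Union>j\<in>{..<r}. {g \<in> carrier G. inv (w [^] j) \<otimes> g \<in> K})"
    proof (intro equalityI subsetI)
      fix g assume "g \<in> N"
      then obtain j :: int where g: "g \<in> carrier G" "inv (w [^] j) \<otimes> g \<in> K" by (auto simp: N_def)
      define i where "i = nat (j mod int r)"
      have i: "i < r" "int i = j mod int r" using r by (auto simp: i_def nat_less_iff)
      have jr: "j = int i + int r * (j div int r)" using i by simp
      have "w [^] j = w [^] int i \<otimes> (w [^] int r) [^] (j div int r)"
        using wG by (subst jr) (simp only: int_pow_mult int_pow_pow)
      then have wj: "w [^] j = w [^] i \<otimes> (w [^] r) [^] (j div int r)" by (simp add: int_pow_int)
      have "(w [^] r) [^] (j div int r) \<otimes> (inv (w [^] j) \<otimes> g) \<in> K"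
        using subgroup_int_pow_closed[OF K.is_subgroup r(2)] g(2) by simp
      then have "inv (w [^] i) \<otimes> g \<in> K" using wG g(1) by (simp add: wj group_normalize)
      then show "g \<in> (\<Union>j\<in>{..<r}. {g \<in> carrier G. inv (w [^] j) \<otimes> g \<in> K})" using i(1) g(1) by auto
    next
      fix g assume "g \<in> (\<Union>j\<in>{..<r}. {g \<in> carrier G. inv (w [^] j) \<otimes> g \<in> K})"
      then show "g \<in> N" by (auto simp: N_def simp flip: int_pow_int)
    qed
    moreover have "closedin \<tau> (\<Union>j\<in>{..<r}. {g \<in> carrier G. inv (w [^] j) \<otimes> g \<in> K})"
      using closedin_lcoset[OF K(2)] wG by (intro closedin_Union) auto
    ultimately show ?thesis by simp
  qed
  let ?Q = "G Mod N" and ?\<sigma> = "quotient_group_topology G \<tau> N" and ?q = "\<lambda>g. N #> g"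
  have hmQ: "hereditarily_minimal ?Q ?\<sigma>" by (rule hereditarily_minimal_quotient[OF htm N Nc])
  interpret Q: topgroup ?Q ?\<sigma> using hmQ by unfold_locales (simp add: hereditarily_minimal_def)
  interpret Q: comm_group ?Q by (rule comm_group_quotient[OF N]) (use comm KN in blast)
  define HH where "HH = ?q ` H"
  have "subgroup (rcosets\<^bsub>G\<lparr>carrier := H\<rparr>\<^esub> N) ?Q" by (rule normal_subgroup_factorize[OF N NH H(1)])
  moreover have "rcosets\<^bsub>G\<lparr>carrier := H\<rparr>\<^esub> N = HH" by (auto simp: HH_def RCOSETS_def r_coset_def)
  ultimately have HH: "subgroup HH ?Q" by simp
  have qy: "?q y \<in> carrier ?Q" using yG by (auto simp: carrier_FactGroup)
  define M where "M = range (\<lambda>i::int. ?q y [^]\<^bsub>?Q\<^esub> i)"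
  have pow: "?q y [^]\<^bsub>?Q\<^esub> i = ?q (y [^] i)" for i :: int by (rule normal.FactGroup_int_pow[OF N yG])
  have M: "subgroup M ?Q" unfolding M_def by (rule Q.subgroup_cyclic[OF qy])
  have qN: "?q g = N \<longleftrightarrow> g \<in> N" if "g \<in> carrier G" for g
    using rcoset_eq_iff[OF N that one_closed] that by (simp add: coset_mult_one subgroup.subset[OF Nsub])
  have wN: "w \<in> N" using wG K.one_closed by (auto simp: N_def intro!: exI[of _ "1::int"])
  have red: "?q (y [^] i) = ?q (y [^] (i mod int q))" for i :: int
  proof -
    have "y [^] i \<otimes> inv (y [^] (i mod int q)) = y [^] (i - i mod int q)" using yG by (simp add: int_pow_diff)
    also have "i - i mod int q = int q * (i div int q)" by (simp add: minus_mod_eq_mult_div)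
    also have "y [^] (int q * (i div int q)) = w [^] (i div int q)" using yG by (simp add: w_def flip: int_pow_pow int_pow_int)
    finally have "y [^] i \<otimes> inv (y [^] (i mod int q)) \<in> N" using subgroup_int_pow_closed[OF Nsub wN] by simp
    then show ?thesis using rcoset_eq_iff[OF N] yG by simp
  qed
  have "finite M"
  proof (rule finite_subset)
    show "M \<subseteq> (\<lambda>j. ?q (y [^] j)) ` {0..<int q}"
      using red prime_gt_0_nat[OF q(1)] by (auto simp: M_def pow intro!: image_eqI[of _ _ "_ mod int q"])
  qed simp
  then have Mc: "closedin ?\<sigma> M" using Q.closedin_finite subgroup.subset[OF M] by blast
  have Mn: "M \<lhd> ?Q" using M by (simp add: Q.normal_iff_subgroup)
  have Mcl: "M \<subseteq> ?\<sigma> closure_of HH"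
  proof -
    have "?q ` L \<subseteq> ?\<sigma> closure_of HH"
      unfolding L_def HH_def by (rule continuous_map_image_closure_subset[OF continuous_quotient])
    moreover have "y [^] i \<in> L" for i :: int by (rule subgroup_int_pow_closed[OF L yL])
    ultimately show ?thesis by (auto simp: M_def pow)
  qed
  have MHH: "M \<inter> HH = {\<one>\<^bsub>?Q\<^esub>}"
  proof -
    have "?q (y [^] i) = N" if i: "?q (y [^] i) \<in> HH" for i :: int
    proof -
      obtain h where h: "h \<in> H" "?q (y [^] i) = ?q h" using i by (auto simp: HH_def)
      then have hG: "h \<in> carrier G" using HG by blast
      have "y [^] i \<otimes> inv h \<in> H" using rcoset_eq_iff[OF N _ hG] h(2) yG NH by auto
      then have "(y [^] i \<otimes> inv h) \<otimes> h \<in> H" using h(1) by (rule subgroup.m_closed[OF H(1)])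
      then have yi: "y [^] i \<in> H" using yG hG by (simp add: m_assoc)
      \<comment> \<open>Otherwise Bezout's identity expresses \<open>y\<close> through
        \<open>y [^] i\<close> and \<open>w\<close>, both of which are in \<open>H\<close>.\<close>
      have "int q dvd i"
      proof (rule ccontr)
        assume "\<not> int q dvd i"
        then have "coprime i (int q)" using q(1) by (metis coprime_commute prime_imp_coprime prime_int_nat_transfer prime_nat_int_transfer)
        then obtain u v where uv: "u * i + v * int q = 1" by (metis bezout_int coprime_iff_gcd_eq_1)
        have "(y [^] i) [^] u \<otimes> w [^] v \<in> H"
          using subgroup_int_pow_closed[OF H(1)] yi wH subgroup.m_closed[OF H(1)] by blast
        moreover have "(y [^] i) [^] u \<otimes> w [^] v = y [^] (u * i + v * int q)"
          using yG by (simp add: w_def int_pow_mult int_pow_pow mult.commute flip: int_pow_int)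
        ultimately show False using uv yH yG by simp
      qed
      then show ?thesis using red[of i] yG subgroup.subset[OF Nsub] by (simp add: coset_mult_one)
    qed
    then show ?thesis using subgroup.one_closed[OF M] subgroup.one_closed[OF HH] by (auto simp: M_def pow)
  qed
  have HHm: "minimal_group (?Q\<lparr>carrier := HH\<rparr>) (subtopology ?\<sigma> HH)"
    using hmQ HH unfolding hereditarily_minimal_def by blast
  have "M = {\<one>\<^bsub>?Q\<^esub>}" by (rule Q.minimal_subgroup_essential[OF HH HHm Mn Mc Mcl MHH])
  moreover have "?q y \<in> M" using pow[of 1] yG by (auto simp: M_def intro!: image_eqI[of _ _ "1::int"])
  ultimately have "?q y = N" by simp
  then show False using qN[OF yG] NH yH by blast
qed

text \<open>Subgroups of the quotient have closed preimages by the previous lemma, so all of them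
  are closed, and the consequence of Baire's theorem above applies to the quotient.\<close>

lemma torsion_quotient_finite:
  assumes htm: "hereditarily_totally_minimal G \<tau>" and lc: "locally_compact_space \<tau>" and K: "K \<lhd> G" "closedin \<tau> K"
    and comm: "\<And>g h. g \<in> carrier G \<Longrightarrow> h \<in> carrier G \<Longrightarrow> g \<otimes> h \<otimes> inv (h \<otimes> g) \<in> K"
    and torsion: "\<And>g. g \<in> carrier G \<Longrightarrow> \<exists>n>0. g [^] (n::nat) \<in> K"
  shows "finite (carrier (G Mod K))"
proof -
  interpret K: normal K G by fact
  let ?Q = "G Mod K" and ?\<sigma> = "quotient_group_topology G \<tau> K"
  have hmQ: "hereditarily_minimal ?Q ?\<sigma>" by (rule hereditarily_minimal_quotient[OF htm K])
  interpret Q: topgroup ?Q ?\<sigma> using hmQ by unfold_locales (simp add: hereditarily_minimal_def)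
  show ?thesis
  proof (rule Q.all_subgroups_closed_imp_finite[OF comm_group_quotient[OF K(1) comm] locally_compact_quotient[OF K(1) lc] hmQ])
    fix A assume A: "subgroup A ?Q"
    have "K \<subseteq> \<Union>A" using subgroup.one_closed[OF A] by auto
    then have "closedin \<tau> (\<Union>A)"
      using subgroup_closed_if_torsion_quotient[OF htm K comm torsion K.factgroup_subgroup_union_subgroup[OF A]] by blast
    then have "openin \<tau> (carrier G - \<Union>A)" by (simp add: closedin_def)
    moreover have "{x \<in> carrier G. K #> x \<in> carrier ?Q - A} = carrier G - \<Union>A"
      using K.factgroup_subgroup_union_char[OF A] by (auto simp: carrier_FactGroup)
    ultimately have "openin ?\<sigma> (carrier ?Q - A)" by (simp add: openin_quotient_group_topology)
    then show "closedin ?\<sigma> A" using subgroup.subset[OF A] by (simp add: closedin_def)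
  qed
qed

end

subsection \<open>Abelian groups\<close>

text \<open>In Z_p an element that is not a multiple of \<open>p\<close> is a unit and generates a
  dense subgroup. Without coordinates: \<open>k\<close> is \<open>x [^] i\<close> times a
  \<open>p ^ n\<close>-th power lying in \<open>N\<close>, so \<open>p\<close> does not divide
  \<open>i\<close>, and Bezout's identity for \<open>i\<close> and \<open>p ^ n\<close> puts
  \<open>x\<close> into \<open>N\<close>.\<close>

lemma (in monothetic) closed_subgroup_not_pow:
  assumes p: "prime p" and k: "k \<in> N" "k \<notin> P p" and N: "subgroup N G" "closedin \<tau> N"
  shows "N = carrier G"
proof -
  have kG: "k \<in> carrier G" using k N by (simp add: subgroup.mem_carrier)
  have Pp: "P p \<noteq> carrier G" using k kG by blast
  have "k \<noteq> \<one>" using k(2) subgroup.one_closed[OF pow_image_closed_subgroup(1)] by metis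
  then have "N \<noteq> {\<one>}" using k(1) by blast
  then obtain m where m: "m > 0" "P m \<subseteq> N" using closed_subgroup_pow[OF N] by blast
  obtain n' where n': "P (p ^ n') \<subseteq> P m"
    using prime_pow_image_nbhd[OF p Pp pow_image_open[OF m(1)] subgroup.one_closed[OF pow_image_closed_subgroup(1)]] by blast
  \<comment> \<open>One more than \<open>n'\<close>, so that a \<open>p ^ n\<close>-th power is in
    \<open>N\<close> and is at the same time a \<open>p\<close>-th power.\<close>
  define n where "n = Suc n'"
  have sq: "h [^] (p ^ n) = (h [^] p) [^] (p ^ n')" "h [^] (p ^ n) = (h [^] (p ^ n')) [^] p"
    if "h \<in> carrier G" for h
    using that by (simp_all add: n_def nat_pow_pow mult.commute)
  have PN: "h [^] (p ^ n) \<in> N" if "h \<in> carrier G" for h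
    using n' m(2) sq(1)[OF that] that by blast
  obtain i where i: "inv (x [^] (i::nat)) \<otimes> k \<in> P (p ^ n)"
    using coset_representative[of "p ^ n" k] prime_gt_0_nat[OF p] kG by auto
  then obtain h where h: "h \<in> carrier G" "inv (x [^] i) \<otimes> k = h [^] (p ^ n)" by blast
  then have kx: "k = x [^] i \<otimes> h [^] (p ^ n)" using gen kG by (metis mult_inv_cancel_left(1) nat_pow_closed)
  have "\<not> p dvd i"
  proof
    assume "p dvd i"
    then obtain j where "i = j * p" by (metis dvd_def mult.commute)
    then have "k = (x [^] j \<otimes> h [^] (p ^ n')) [^] p" using gen h(1) kx sq(2) by (simp add: nat_pow_distrib nat_pow_pow)
    then show False using k(2) gen h(1) by blast
  qed
  then have "coprime (int i) (int p ^ n)" using p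
    by (metis coprime_commute coprime_int_iff coprime_power_right_iff of_nat_power prime_imp_coprime_nat)
  then obtain u v where uv: "u * int i + v * int p ^ n = 1" by (metis bezout_int coprime_iff_gcd_eq_1)
  have "x [^] i = k \<otimes> inv (h [^] (p ^ n))" using kx gen h(1) by (simp add: m_assoc)
  then have "x [^] i \<in> N" using subgroup_div_closed[OF N(1) k(1) PN[OF h(1)]] by simp
  then have "(x [^] i) [^] u \<otimes> (x [^] (p ^ n)) [^] v \<in> N"
    using subgroup_int_pow_closed[OF N(1)] PN[OF gen] by (simp add: subgroup.m_closed[OF N(1)])
  also have "(x [^] i) [^] u \<otimes> (x [^] (p ^ n)) [^] v = x [^] (u * int i + v * int p ^ n)"
    using gen by (simp add: int_pow_mult int_pow_pow mult.commute flip: int_pow_int)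
  finally have "x \<in> N" using uv gen by simp
  then show ?thesis by (rule gen_in_closed_subgroup[OF N])
qed

context topgroup
begin

abbreviation cyclic_closure where "cyclic_closure x \<equiv> \<tau> closure_of (range (\<lambda>i::int. x [^] i))"

lemma cyclic_closure:
  assumes "x \<in> carrier G"
  shows "subgroup (cyclic_closure x) G" "closedin \<tau> (cyclic_closure x)" "x \<in> cyclic_closure x"
proof -
  show "subgroup (cyclic_closure x) G" by (rule subgroup_closure[OF subgroup_cyclic[OF assms]])
  have "x \<in> range (\<lambda>i::int. x [^] i)" using assms by (intro image_eqI[of _ _ 1]) auto
  then show "x \<in> cyclic_closure x" using closure_of_subset[of "range (\<lambda>i::int. x [^] i)" \<tau>] assms by auto
qed simp

text \<open>Cyclic closures of nontrivial elements are commensurable, so the quotient by one of them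
  is torsion and therefore finite. Hence only finitely many cyclic closures contain it, and a
  maximal one is the whole group: otherwise some \<open>y\<close> outside has a \<open>q\<close>-th
  power inside that is not a \<open>q\<close>-th power of an element inside, and the cyclic closure
  of \<open>y\<close> is larger.\<close>

theorem abelian_monothetic:
  assumes "comm_group G" and htm: "hereditarily_totally_minimal G \<tau>"
    and lc: "locally_compact_space \<tau>" and inf: "infinite (carrier G)"
  shows "\<exists>x. monothetic G \<tau> x"
proof -
  interpret comm_group G by fact
  have hm: "hereditarily_minimal G \<tau>" by (rule hereditarily_minimal_if_totally[OF htm])
  have comm1: "g \<otimes> h \<otimes> inv (h \<otimes> g) = \<one>" if "g \<in> carrier G" "h \<in> carrier G" for g h
    using that by (simp add: m_comm)
  obtain a where a: "a \<in> carrier G" "\<And>n. n > 0 \<Longrightarrow> a [^] (n::nat) \<noteq> \<one>"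
  proof -
    have "\<not> (\<forall>g\<in>carrier G. \<exists>n::nat>0. g [^] n = \<one>)"
    proof
      assume tor: "\<forall>g\<in>carrier G. \<exists>n::nat>0. g [^] n = \<one>"
      have "finite (carrier (G Mod {\<one>}))"
        by (rule torsion_quotient_finite[OF htm lc one_is_normal])
           (use closedin_finite[of "{\<one>}"] comm1 tor in auto)
      moreover have "bij_betw (\<lambda>x. {\<one>} #> x) (carrier G) (carrier (G Mod {\<one>}))"
        using quotient_trivial_iso(1) by (simp add: iso_def)
      ultimately show False using inf bij_betw_finite by blast
    qed
    then show thesis using that by blast
  qed
  have tf: "c = \<one>" if "c \<in> carrier G" "k > 0" "c [^] (k::nat) = \<one>" for c k
    using torsion_commuting_trivial[OF lc hm a that] m_comm[OF a(1) that(1)] by blast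
  have mono: "monothetic (G\<lparr>carrier := cyclic_closure y\<rparr>) (subtopology \<tau> (cyclic_closure y)) y"
    if "y \<in> carrier G" "y \<noteq> \<one>" for y
    using monothetic_closure[OF lc hm that(1)] tf that by blast
  have subcl: "subgroup N (G\<lparr>carrier := cyclic_closure y\<rparr>)" "closedin (subtopology \<tau> (cyclic_closure y)) N"
    if "y \<in> carrier G" "subgroup N G" "closedin \<tau> N" "N \<subseteq> cyclic_closure y" for y N
    using that subgroup_incl[OF that(2) cyclic_closure(1)[OF that(1)]] by (auto simp: closedin_subset_topspace)
  \<comment> \<open>Suppose no positive power of \<open>y\<close> lies in the cyclic closure of
    \<open>x\<close>. Let \<open>N\<close> consist of the \<open>q\<close>-th powers in the cyclic
    closure of \<open>y\<close>, where \<open>q\<close> is the prime for which they form a proper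
    subgroup. Modulo \<open>N\<close> the element \<open>x\<close> still has infinite order, while
    \<open>y\<close> has become a torsion element that is not trivial.\<close>
  have commensurable: "\<exists>m>0. y [^] (m::nat) \<in> cyclic_closure x"
    if x: "x \<in> carrier G" "x \<noteq> \<one>" and y: "y \<in> carrier G" "y \<noteq> \<one>" for x y
  proof (rule ccontr)
    assume no: "\<not> (\<exists>m>0. y [^] (m::nat) \<in> cyclic_closure x)"
    let ?K = "cyclic_closure y"
    interpret K: monothetic "G\<lparr>carrier := ?K\<rparr>" "subtopology \<tau> ?K" y by (rule mono[OF y])
    note pK = nat_pow_consistent[of _ _ ?K, symmetric]
    obtain q where q: "prime q" "K.pow_image q \<noteq> carrier (G\<lparr>carrier := ?K\<rparr>)" using K.proper_prime_pow_image by blast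
    define N where "N = K.pow_image q"
    have N: "subgroup N G" "N \<subseteq> ?K" "closedin \<tau> N"
      using subgroup_subgroup[OF cyclic_closure(1)[OF y(1)] K.pow_image_closed_subgroup(1)[of q]]
        closedin_trans_full[OF K.pow_image_closed_subgroup(2)[of q] cyclic_closure(2)[OF y(1)]]
      by (simp_all add: N_def)
    have yN: "y \<notin> N"
      using K.gen_in_closed_subgroup[OF K.pow_image_closed_subgroup] q(2) unfolding N_def by blast
    have yq: "y [^] q \<in> N" using cyclic_closure(3)[OF y(1)] by (auto simp: N_def pK)
    have xN: "x [^] n \<notin> N" if n: "n > 0" for n :: nat
    proof
      assume xn: "x [^] n \<in> N"
      define J where "J = cyclic_closure x \<inter> ?K"
      have "x [^] n \<in> cyclic_closure x"
        using subgroup_int_pow_closed[OF cyclic_closure(1,3)[OF x(1)], of "int n"] x(1) cyclic_closure(3) by (simp add: int_pow_int)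
      then have "x [^] n \<in> J" using xn N(2) by (auto simp: J_def)
      moreover have "x [^] n \<noteq> \<one>" using tf x n by blast
      ultimately have "J \<noteq> {\<one>}" by blast
      moreover have "subgroup J G" "closedin \<tau> J" "J \<subseteq> ?K"
        unfolding J_def using cyclic_closure x(1) y(1) by (auto intro: subgroups_Inter_pair)
      ultimately obtain m :: nat where m: "m > 0" "y [^] m \<in> J"
        using K.closed_subgroup_gen_pow[of J] subcl[OF y(1), of J] by (auto simp: pK)
      then have "y [^] m \<in> cyclic_closure x" by (simp add: J_def)
      then show False using no m(1) by blast
    qed
    have Nn: "N \<lhd> G" using N(1) by (simp add: normal_iff_subgroup)
    let ?Q = "G Mod N" and ?\<sigma> = "quotient_group_topology G \<tau> N"
    have hmQ: "hereditarily_minimal ?Q ?\<sigma>" by (rule hereditarily_minimal_quotient[OF htm Nn N(3)])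
    interpret Q: topgroup ?Q ?\<sigma> using hmQ by unfold_locales (simp add: hereditarily_minimal_def)
    interpret Q: comm_group ?Q by (rule abelian_FactGroup[OF N(1)])
    have qN: "N #> g = N \<longleftrightarrow> g \<in> N" if "g \<in> carrier G" for g
      using rcoset_eq_iff[OF Nn that one_closed] that by (simp add: coset_mult_one subgroup.subset[OF N(1)])
    have pow: "(N #> g) [^]\<^bsub>?Q\<^esub> (n::nat) = N #> (g [^] n)" if "g \<in> carrier G" for g n
      using normal.FactGroup_pow[OF Nn that] .
    have "N #> y = \<one>\<^bsub>?Q\<^esub>"
    proof (rule Q.torsion_commuting_trivial[OF locally_compact_quotient[OF Nn lc] hmQ, of "N #> x" _ q])
      show "N #> x \<in> carrier ?Q" "N #> y \<in> carrier ?Q" using x y by (auto simp: carrier_FactGroup)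
      then show "(N #> x) \<otimes>\<^bsub>?Q\<^esub> (N #> y) = (N #> y) \<otimes>\<^bsub>?Q\<^esub> (N #> x)" by (rule Q.m_comm)
      show "(N #> x) [^]\<^bsub>?Q\<^esub> n \<noteq> \<one>\<^bsub>?Q\<^esub>" if "n > 0" for n :: nat
        using xN[OF that] x qN by (simp add: pow)
      show "q > 0" by (rule prime_gt_0_nat[OF q(1)])
      show "(N #> y) [^]\<^bsub>?Q\<^esub> q = \<one>\<^bsub>?Q\<^esub>" using y qN yq by (simp add: pow)
    qed
    then show False using qN[OF y(1)] yN by simp
  qed
  have a1: "a \<noteq> \<one>" using a(2)[of 1] a(1) by auto
  define K0 where "K0 = cyclic_closure a"
  have K0: "subgroup K0 G" "closedin \<tau> K0" using cyclic_closure[OF a(1)] by (auto simp: K0_def)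
  have K0n: "K0 \<lhd> G" using K0 by (simp add: normal_iff_subgroup)
  have fin: "finite (carrier (G Mod K0))"
  proof (rule torsion_quotient_finite[OF htm lc K0n K0(2)])
    show "g \<otimes> h \<otimes> inv (h \<otimes> g) \<in> K0" if "g \<in> carrier G" "h \<in> carrier G" for g h
      using comm1[OF that] subgroup.one_closed[OF K0(1)] by simp
    show "\<exists>n>0. g [^] (n::nat) \<in> K0" if g: "g \<in> carrier G" for g
    proof (cases "g = \<one>")
      case True
      then show ?thesis using subgroup.one_closed[OF K0(1)] by (intro exI[of _ 1]) simp
    next
      case False
      then show ?thesis using commensurable[OF a(1) a1 g] by (simp add: K0_def)
    qed
  qed
  define \<F> where "\<F> = {cyclic_closure y | y. y \<in> carrier G \<and> y \<noteq> \<one> \<and> K0 \<subseteq> cyclic_closure y}"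
  \<comment> \<open>Each member is a union of cosets of \<open>K0\<close>, and there are finitely
    many cosets.\<close>
  have "\<F> \<subseteq> Union ` Pow (carrier (G Mod K0))"
  proof
    fix S assume "S \<in> \<F>"
    then obtain y where y: "y \<in> carrier G" "S = cyclic_closure y" "K0 \<subseteq> S" by (auto simp: \<F>_def)
    then have S: "subgroup S G" using cyclic_closure by simp
    have "S = \<Union>((\<lambda>s. K0 #> s) ` S)"
    proof
      show "S \<subseteq> \<Union>((\<lambda>s. K0 #> s) ` S)"
        using rcos_self[OF subgroup.mem_carrier[OF S] K0(1)] by blast
      show "\<Union>((\<lambda>s. K0 #> s) ` S) \<subseteq> S" using y(3) subgroup.m_closed[OF S] by (auto simp: r_coset_def)
    qed
    moreover have "(\<lambda>s. K0 #> s) ` S \<subseteq> carrier (G Mod K0)"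
      using subgroup.subset[OF S] by (auto simp: carrier_FactGroup)
    ultimately show "S \<in> Union ` Pow (carrier (G Mod K0))" by blast
  qed
  then have "finite \<F>" by (rule finite_subset) (use fin in simp)
  moreover have "K0 \<in> \<F>" using a(1) a1 by (auto simp: \<F>_def K0_def)
  ultimately obtain M where M: "M \<in> \<F>" "\<And>S. S \<in> \<F> \<Longrightarrow> M \<subseteq> S \<Longrightarrow> M = S"
    using finite_has_maximal[of \<F>] by blast
  then obtain x where x: "x \<in> carrier G" "x \<noteq> \<one>" "K0 \<subseteq> M" "M = cyclic_closure x" by (auto simp: \<F>_def)
  interpret K: monothetic "G\<lparr>carrier := M\<rparr>" "subtopology \<tau> M" x unfolding x(4) by (rule mono[OF x(1,2)])
  note pK = nat_pow_consistent[of _ _ M, symmetric]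
  have Ms: "subgroup M G" "closedin \<tau> M" using cyclic_closure[OF x(1)] x(4) by auto
  have "M = carrier G"
  proof (rule ccontr)
    assume "M \<noteq> carrier G"
    then obtain g where g: "g \<in> carrier G" "g \<notin> M" using subgroup.subset[OF Ms(1)] by blast
    then have "g \<noteq> \<one>" using subgroup.one_closed[OF Ms(1)] by blast
    then have ex: "\<exists>n::nat. n > 0 \<and> g [^] n \<in> M" using commensurable[OF x(1,2) g(1)] x(4) by blast
    define n where "n = (LEAST n::nat. n > 0 \<and> g [^] n \<in> M)"
    have n: "n > 0" "g [^] n \<in> M" using LeastI_ex[OF ex] by (auto simp: n_def)
    have nl: "\<not> (m > 0 \<and> g [^] m \<in> M)" if "m < n" for m :: nat using not_less_Least that unfolding n_def by blast
    have "n \<noteq> 1" using n g by auto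
    then obtain q where q: "prime q" "q dvd n" using prime_factor_nat by blast
    then obtain m where m: "n = m * q" by (metis dvd_def mult.commute)
    then have m0: "m > 0" "m < n" using n(1) prime_gt_1_nat[OF q(1)] by auto
    define y where "y = g [^] m"
    have yG: "y \<in> carrier G" using g by (simp add: y_def)
    have yM: "y \<notin> M" using nl[OF m0(2)] m0(1) by (simp add: y_def)
    have yqM: "y [^] q \<in> M" using n m g by (simp add: y_def nat_pow_pow)
    have y1: "y \<noteq> \<one>" using yM subgroup.one_closed[OF Ms(1)] by blast
    \<comment> \<open>By torsion-freeness a \<open>q\<close>-th root of \<open>y [^] q\<close> in
      \<open>M\<close> would be \<open>y\<close> itself.\<close>
    have ynp: "y [^] q \<notin> K.pow_image q"
    proof
      assume "y [^] q \<in> K.pow_image q"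
      then obtain z where z: "z \<in> M" "y [^] q = z [^] q" by (auto simp: pK)
      then have zG: "z \<in> carrier G" using subgroup.mem_carrier[OF Ms(1)] by blast
      have "(y \<otimes> inv z) [^] q = \<one>" using z(2) yG zG by (simp add: nat_pow_distrib nat_pow_inv)
      then have "y \<otimes> inv z = \<one>" using tf[of "y \<otimes> inv z" q] yG zG prime_gt_0_nat[OF q(1)] by simp
      then show False using yM z(1) yG zG by (simp add: mult_inv_eq_one_iff)
    qed
    define N where "N = cyclic_closure y \<inter> M"
    have N: "subgroup N G" "closedin \<tau> N" "N \<subseteq> M"
      unfolding N_def using cyclic_closure[OF yG] Ms by (auto intro: subgroups_Inter_pair)
    have "y [^] q \<in> cyclic_closure y"
      using subgroup_int_pow_closed[OF cyclic_closure(1,3)[OF yG], of "int q"] yG cyclic_closure(3) by (simp add: int_pow_int)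
    then have "y [^] q \<in> N" using yqM by (simp add: N_def)
    moreover have "subgroup N (G\<lparr>carrier := M\<rparr>)" "closedin (subtopology \<tau> M) N"
      using subcl[OF x(1) N(1,2)] N(3) x(4) by simp_all
    ultimately have "N = carrier (G\<lparr>carrier := M\<rparr>)"
      using ynp by (intro K.closed_subgroup_not_pow[OF q(1)])
    then have "M \<subseteq> cyclic_closure y" by (auto simp: N_def)
    then have "cyclic_closure y \<in> \<F>" using x(3) yG y1 by (auto simp: \<F>_def)
    then have "M = cyclic_closure y" using M(2) \<open>M \<subseteq> cyclic_closure y\<close> by blast
    then show False using yM cyclic_closure(3)[OF yG] by simp
  qed
  then have "G\<lparr>carrier := M\<rparr> = G" "subtopology \<tau> M = \<tau>" using subtopology_topspace[of \<tau>] by simp_all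
  then show ?thesis using K.monothetic_axioms by auto
qed

end

subsection \<open>Normal subgroups isomorphic to the \<open>p\<close>-adic integers\<close>

lemma (in monothetic) infinite_carrier: "infinite (carrier G)"
proof
  assume "finite (carrier G)"
  then show False using inf_order[of "ord x"] ord_ge_1 gen by (simp add: Suc_le_eq)
qed

text \<open>The generator \<open>y\<close> and the coordinate \<open>f\<close> accompany
  \<open>Z\<close>: with \<open>f y\<close> normalized to 1, the action of \<open>G\<close> on
  \<open>Z\<close> can be read off from the conjugates of one element.\<close>

locale padic_normal = topgroup G \<tau> for G (structure) and \<tau> +
  fixes Z y p f
  assumes Zn: "Z \<lhd> G" and Zc: "closedin \<tau> Z"
    and mono: "monothetic (G\<lparr>carrier := Z\<rparr>) (subtopology \<tau> Z) y"
    and iso: "padic_isomorphism p (G\<lparr>carrier := Z\<rparr>) (subtopology \<tau> Z) f"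
    and f_gen: "f y = \<one>\<^bsub>padic_int p\<^esub>"
begin

lemma p: "prime p" using iso by (simp add: padic_isomorphism_def)

lemma p_pos: "p > 0" by (rule prime_gt_0_nat[OF p])

lemma Zs: "subgroup Z G" by (rule normal_imp_subgroup[OF Zn])

lemma Z_carrier: "z \<in> Z \<Longrightarrow> z \<in> carrier G" by (rule subgroup.mem_carrier[OF Zs])

lemma conj_Z: "g \<in> carrier G \<Longrightarrow> z \<in> Z \<Longrightarrow> g \<otimes> z \<otimes> inv g \<in> Z"
  by (rule normal.inv_op_closed2[OF Zn])

lemma y_in_Z: "y \<in> Z" using monothetic.gen[OF mono] by simp

lemma f_bij: "bij_betw f Z (carrier (padic_int p))"
  using iso by (simp add: padic_isomorphism_def iso_def)

lemma f_closed: "z \<in> Z \<Longrightarrow> f z \<in> carrier (padic_int p)"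
  using f_bij by (auto simp: bij_betw_def)

lemma f_inj: "z \<in> Z \<Longrightarrow> w \<in> Z \<Longrightarrow> f z = f w \<Longrightarrow> z = w"
  using f_bij by (auto simp: bij_betw_def inj_on_def)

lemma f_mult: "z \<in> Z \<Longrightarrow> w \<in> Z \<Longrightarrow> f (z \<otimes> w) = f z \<oplus>\<^bsub>padic_int p\<^esub> f w"
  using iso by (simp add: padic_isomorphism_def iso_def hom_def)

lemma f_mult_nth: "z \<in> Z \<Longrightarrow> w \<in> Z \<Longrightarrow> f (z \<otimes> w) n = (f z n + f w n) mod int p ^ n"
  by (simp add: f_mult padic_int_def)

lemma f_nth_mod: "z \<in> Z \<Longrightarrow> f z n mod int p ^ n = f z n"
  by (rule padic_mod[OF f_closed])

lemma f_one: "f \<one> = \<zero>\<^bsub>padic_int p\<^esub>"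
proof
  fix n
  have 1: "\<one> \<in> Z" by (rule subgroup.one_closed[OF Zs])
  have "f \<one> n = (f \<one> n + f \<one> n) mod int p ^ n" using f_mult_nth[OF 1 1] by simp
  then have "(f \<one> n + f \<one> n) mod int p ^ n = f \<one> n mod int p ^ n" using f_nth_mod[OF 1] by simp
  then have "int p ^ n dvd f \<one> n" by (simp add: mod_eq_dvd_iff)
  then show "f \<one> n = \<zero>\<^bsub>padic_int p\<^esub> n" using f_nth_mod[OF 1, of n] by (simp add: padic_int_def)
qed

lemma pow_in_Z: "z \<in> Z \<Longrightarrow> z [^] (k::nat) \<in> Z"
  using subgroup_int_pow_closed[OF Zs, of z "int k"] by (simp add: int_pow_int)

lemma f_pow_nth: "z \<in> Z \<Longrightarrow> f (z [^] (k::nat)) n = (int k * f z n) mod int p ^ n"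
proof (induction k)
  case 0
  then show ?case by (simp add: f_one padic_int_def)
next
  case (Suc k)
  then have "f (z [^] Suc k) n = (int k * f z n mod int p ^ n + f z n) mod int p ^ n"
    using f_mult_nth[OF pow_in_Z] by simp
  then show ?case by (simp add: mod_simps algebra_simps)
qed

lemma f_inv_nth: "z \<in> Z \<Longrightarrow> f (inv z) n = (- f z n) mod int p ^ n"
proof -
  assume z: "z \<in> Z"
  then have iz: "inv z \<in> Z" using Zs by (simp add: subgroup.m_inv_closed)
  have "(f (inv z) n + f z n) mod int p ^ n = 0"
    using f_mult_nth[OF iz z, of n] z f_one Z_carrier by (simp add: padic_int_def)
  then have "int p ^ n dvd f (inv z) n - (- f z n)" by (simp add: dvd_eq_mod_eq_0)
  then have "f (inv z) n mod int p ^ n = (- f z n) mod int p ^ n" by (simp add: mod_eq_dvd_iff)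
  then show ?thesis using f_nth_mod[OF iz] by simp
qed

text \<open>A continuous automorphism of Z_p is multiplication by the image of 1, and
  \<open>y\<close> has coordinate 1; so \<open>u g\<close> is the unit by which conjugation with
  \<open>g\<close> acts on \<open>Z\<close>.\<close>

definition u where "u g = f (g \<otimes> y \<otimes> inv g)"

lemma u_closed: "g \<in> carrier G \<Longrightarrow> u g \<in> carrier (padic_int p)"
  unfolding u_def by (rule f_closed[OF conj_Z[OF _ y_in_Z]])

lemma conj_pow:
  fixes k :: nat
  assumes "g \<in> carrier G" "z \<in> carrier G"
  shows "g \<otimes> z [^] k \<otimes> inv g = (g \<otimes> z \<otimes> inv g) [^] k"
proof (induction k)
  case (Suc k)
  have "g \<otimes> z [^] Suc k \<otimes> inv g = (g \<otimes> z [^] k \<otimes> inv g) \<otimes> (g \<otimes> z \<otimes> inv g)"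
    using assms by (simp add: group_normalize)
  then show ?case using Suc by simp
qed (use assms in simp)

text \<open>Modulo \<open>p ^ n\<close> every \<open>z\<close> is a power of \<open>y\<close>: it is
  \<open>y [^] i\<close> times a \<open>p ^ n\<close>-th power, and the conjugate of the latter is
  again a \<open>p ^ n\<close>-th power, with residue 0.\<close>

lemma f_conj:
  assumes g: "g \<in> carrier G" and z: "z \<in> Z"
  shows "f (g \<otimes> z \<otimes> inv g) = u g \<otimes>\<^bsub>padic_int p\<^esub> f z"
proof
  fix n
  interpret Z: monothetic "G\<lparr>carrier := Z\<rparr>" "subtopology \<tau> Z" y by (rule mono)
  note pZ = nat_pow_consistent[of _ _ Z, symmetric]
  obtain i where i: "inv (y [^] (i::nat)) \<otimes> z \<in> Z.pow_image (p ^ n)"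
    using Z.coset_representative[of "p ^ n" z] p_pos z y_in_Z Zs by (auto simp: pZ pow_in_Z)
  then obtain k where k: "k \<in> Z" "inv (y [^] i) \<otimes> z = k [^] (p ^ n)" by (auto simp: pZ)
  have G: "y \<in> carrier G" "z \<in> carrier G" "k \<in> carrier G" using y_in_Z z k Z_carrier by auto
  have zk: "z = y [^] i \<otimes> k [^] (p ^ n)" using k(2) G by (metis mult_inv_cancel_left(1) nat_pow_closed)
  have fz: "f z n = int i mod int p ^ n"
  proof -
    have "f z n = (f (y [^] i) n + f (k [^] (p ^ n)) n) mod int p ^ n"
      unfolding zk by (rule f_mult_nth[OF pow_in_Z[OF y_in_Z] pow_in_Z[OF k(1)]])
    also have "\<dots> = int i mod int p ^ n"
      by (simp add: f_pow_nth y_in_Z k(1) f_gen padic_int_def mod_simps)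
    finally show ?thesis .
  qed
  have "g \<otimes> z \<otimes> inv g = (g \<otimes> y [^] i \<otimes> inv g) \<otimes> (g \<otimes> k [^] (p ^ n) \<otimes> inv g)"
    unfolding zk using G g by (simp add: group_normalize)
  also have "\<dots> = (g \<otimes> y \<otimes> inv g) [^] i \<otimes> (g \<otimes> k \<otimes> inv g) [^] (p ^ n)"
    using conj_pow[OF g] G by simp
  finally have "f (g \<otimes> z \<otimes> inv g) n = (f ((g \<otimes> y \<otimes> inv g) [^] i) n + f ((g \<otimes> k \<otimes> inv g) [^] (p ^ n)) n) mod int p ^ n"
    using f_mult_nth[OF pow_in_Z[OF conj_Z[OF g y_in_Z]] pow_in_Z[OF conj_Z[OF g k(1)]]] by simp
  also have "\<dots> = (int i * u g n) mod int p ^ n"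
    using conj_Z[OF g] y_in_Z k(1) by (simp add: f_pow_nth u_def mod_simps)
  finally show "f (g \<otimes> z \<otimes> inv g) n = (u g \<otimes>\<^bsub>padic_int p\<^esub> f z) n"
    by (simp add: fz padic_int_def mod_simps mult.commute)
qed

lemma u_mult:
  assumes "g \<in> carrier G" "h \<in> carrier G"
  shows "u (g \<otimes> h) = u g \<otimes>\<^bsub>padic_int p\<^esub> u h"
proof -
  have yG: "y \<in> carrier G" using y_in_Z Z_carrier by blast
  have "g \<otimes> h \<otimes> y \<otimes> inv (g \<otimes> h) = g \<otimes> (h \<otimes> y \<otimes> inv h) \<otimes> inv g"
    using assms yG by (simp add: group_normalize)
  then show ?thesis using f_conj[OF assms(1) conj_Z[OF assms(2) y_in_Z]] by (simp add: u_def)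
qed

lemma u_one: "u \<one> = \<one>\<^bsub>padic_int p\<^esub>"
  using y_in_Z Z_carrier by (simp add: u_def f_gen)

text \<open>The kernel of \<open>u\<close> is the centralizer of \<open>Z\<close>. So
  \<open>G Mod Z\<close> embeds into the units of Z_p, and in particular it is abelian.\<close>

lemma u_eq_iff:
  assumes g: "g \<in> carrier G" "h \<in> carrier G" and cZ: "centralizer G Z = Z"
  shows "u g = u h \<longleftrightarrow> g \<otimes> inv h \<in> Z"
proof -
  interpret R: cring "padic_int p" by (rule padic_cring[OF p_pos])
  have key: "u k = \<one>\<^bsub>padic_int p\<^esub> \<longleftrightarrow> k \<in> Z" if k: "k \<in> carrier G" for k
  proof
    assume u1: "u k = \<one>\<^bsub>padic_int p\<^esub>"
    have "k \<otimes> z = z \<otimes> k" if z: "z \<in> Z" for z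
    proof -
      have "f (k \<otimes> z \<otimes> inv k) = f z" using f_conj[OF k z] f_closed[OF z] u1 by simp
      then have "k \<otimes> z \<otimes> inv k = z" using f_inj conj_Z[OF k z] z by blast
      then have "k \<otimes> z \<otimes> inv k \<otimes> k = z \<otimes> k" by simp
      then show ?thesis using k z Z_carrier by (simp add: m_assoc)
    qed
    then have "k \<in> centralizer G Z" using k by (simp add: centralizer_def)
    then show "k \<in> Z" using cZ by simp
  next
    assume kZ: "k \<in> Z"
    then have "k \<in> centralizer G Z" using cZ by simp
    then have "k \<otimes> y = y \<otimes> k" using y_in_Z by (simp add: centralizer_def)
    then have "k \<otimes> y \<otimes> inv k = y" using k y_in_Z Z_carrier by (simp add: m_assoc)
    then show "u k = \<one>\<^bsub>padic_int p\<^esub>" by (simp add: u_def f_gen)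
  qed
  have uh: "u (inv h) \<otimes>\<^bsub>padic_int p\<^esub> u h = \<one>\<^bsub>padic_int p\<^esub>" using u_mult[of "inv h" h] g u_one by simp
  have uG: "u g \<in> carrier (padic_int p)" "u h \<in> carrier (padic_int p)" "u (inv h) \<in> carrier (padic_int p)"
    using u_closed g by auto
  show ?thesis
  proof
    assume "u g = u h"
    then have "u (g \<otimes> inv h) = \<one>\<^bsub>padic_int p\<^esub>" using u_mult[of g "inv h"] g uh uG R.m_comm by simp
    then show "g \<otimes> inv h \<in> Z" using key g by simp
  next
    assume "g \<otimes> inv h \<in> Z"
    then have "u (g \<otimes> inv h) = \<one>\<^bsub>padic_int p\<^esub>" using key g by simp
    then have "u ((g \<otimes> inv h) \<otimes> h) = u h" using u_mult[of "g \<otimes> inv h" h] g uG by simp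
    then show "u g = u h" using g by (simp add: m_assoc)
  qed
qed

lemma commutator_in_Z:
  assumes "g \<in> carrier G" "h \<in> carrier G" and cZ: "centralizer G Z = Z"
  shows "g \<otimes> h \<otimes> inv (h \<otimes> g) \<in> Z"
proof -
  interpret R: cring "padic_int p" by (rule padic_cring[OF p_pos])
  have "u (g \<otimes> h) = u (h \<otimes> g)" using u_mult assms u_closed R.m_comm by simp
  then show ?thesis using u_eq_iff[of "g \<otimes> h" "h \<otimes> g"] assms by simp
qed

lemma u_pow_nth: "g \<in> carrier G \<Longrightarrow> u (g [^] (k::nat)) n = (u g n) ^ k mod int p ^ n"
proof (induction k)
  case 0
  then show ?case by (simp add: u_one padic_int_def)
next
  case (Suc k)
  then have "u (g [^] Suc k) n = ((u g n) ^ k mod int p ^ n * u g n) mod int p ^ n"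
    by (simp add: u_mult padic_int_def)
  then show ?case by (simp add: mod_simps mult.commute)
qed

lemma u_unit_nth_1:
  assumes g: "g \<in> carrier G"
  shows "\<not> int p dvd u g 1"
proof
  assume "int p dvd u g 1"
  moreover have "u (g \<otimes> inv g) 1 = (u g 1 * u (inv g) 1) mod int p"
    using u_mult[of g "inv g"] g by (simp add: padic_int_def)
  then have "(u g 1 * u (inv g) 1) mod int p = 1 mod int p" using g u_one by (simp add: padic_int_def)
  ultimately have "1 mod int p = 0" by (metis dvd_mult2 dvd_imp_mod_0)
  then show False using prime_gt_1_nat[OF p] by simp
qed

text \<open>It remains to see that the abelian quotient is torsion. If no positive power of
  \<open>g\<close> is in \<open>Z\<close>, then \<open>h = g [^] (p - 1)\<close> acts trivially
  modulo \<open>p\<close>, by Fermat. Modulo the subgroup \<open>N\<close> of \<open>Z\<close> that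
  corresponds to the multiples of \<open>p\<close>, the element \<open>h\<close> has infinite order
  and commutes with the image of \<open>y\<close>, which has order \<open>p\<close>.\<close>

lemma finite_index:
  assumes htm: "hereditarily_totally_minimal G \<tau>" and lc: "locally_compact_space \<tau>"
    and cZ: "centralizer G Z = Z"
  shows "finite (carrier (G Mod Z))"
proof (rule torsion_quotient_finite[OF htm lc Zn Zc commutator_in_Z[OF _ _ cZ]])
  fix g assume g: "g \<in> carrier G"
  show "\<exists>n>0. g [^] (n::nat) \<in> Z"
  proof (rule ccontr)
    assume no: "\<not> (\<exists>n>0. g [^] (n::nat) \<in> Z)"
    define N where "N = {z \<in> Z. f z 1 = 0}"
    have N: "subgroup N G"
    proof (rule subgroupI)
      show "N \<subseteq> carrier G" using Z_carrier by (auto simp: N_def)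
      have "\<one> \<in> N" using f_one subgroup.one_closed[OF Zs] by (simp add: N_def padic_int_def)
      then show "N \<noteq> {}" by blast
      show "inv a \<in> N" if "a \<in> N" for a
        using that f_inv_nth[of a 1] Zs by (simp add: N_def subgroup.m_inv_closed)
      show "a \<otimes> b \<in> N" if "a \<in> N" "b \<in> N" for a b
        using that f_mult_nth[of a b 1] Zs by (simp add: N_def subgroup.m_closed)
    qed
    have Nn: "N \<lhd> G"
      unfolding normal_inv_iff
      using N conj_Z f_conj by (auto simp: N_def padic_int_def)
    have "closedin (padic_topology p) {x \<in> carrier (padic_int p). x 1 = 0}"
      using openin_padic_topology[OF p_pos, of "{x \<in> carrier (padic_int p). x 1 \<noteq> 0}"]
      by (auto simp: closedin_def topspace_padic_topology[OF p_pos] Collect_neg_eq set_diff_eq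
          intro!: exI[of _ 1] elim!: back_subst[of "openin _"])
    moreover have cf: "continuous_map (subtopology \<tau> Z) (padic_topology p) f"
      using iso homeomorphic_imp_continuous_map by (auto simp: padic_isomorphism_def)
    ultimately have "closedin (subtopology \<tau> Z) {z \<in> topspace (subtopology \<tau> Z). f z \<in> {x \<in> carrier (padic_int p). x 1 = 0}}"
      by (rule closedin_continuous_map_preimage[rotated])
    moreover have "{z \<in> topspace (subtopology \<tau> Z). f z \<in> {x \<in> carrier (padic_int p). x 1 = 0}} = N"
      using f_closed Z_carrier by (auto simp: N_def)
    ultimately have Nc: "closedin \<tau> N" using Zc closedin_trans_full by metis
    let ?Q = "G Mod N" and ?\<sigma> = "quotient_group_topology G \<tau> N"
    have hmQ: "hereditarily_minimal ?Q ?\<sigma>" by (rule hereditarily_minimal_quotient[OF htm Nn Nc])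
    interpret Q: topgroup ?Q ?\<sigma> using hmQ by unfold_locales (simp add: hereditarily_minimal_def)
    have qN: "N #> g = N \<longleftrightarrow> g \<in> N" if "g \<in> carrier G" for g
      using rcoset_eq_iff[OF Nn that one_closed] that by (simp add: coset_mult_one subgroup.subset[OF N])
    have pow: "(N #> g) [^]\<^bsub>?Q\<^esub> (n::nat) = N #> (g [^] n)" if "g \<in> carrier G" for g n
      using normal.FactGroup_pow[OF Nn that] .
    define h where "h = g [^] (p - 1)"
    have hG: "h \<in> carrier G" using g by (simp add: h_def)
    have yG: "y \<in> carrier G" using y_in_Z Z_carrier by blast
    have uh: "u h 1 = 1"
    proof -
      define a where "a = nat (u g 1)"
      have "0 \<le> u g 1" using u_closed[OF g] by (simp add: padic_int_def)
      then have a: "u g 1 = int a" by (simp add: a_def)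
      then have "\<not> p dvd a" using u_unit_nth_1[OF g] by simp
      then have "[a ^ (p - 1) = 1] (mod p)" by (rule fermat_theorem[OF p])
      then have "int (a ^ (p - 1)) mod int p = int 1 mod int p" by (metis cong_def zmod_int)
      then show ?thesis using u_pow_nth[OF g, of "p - 1" 1] prime_gt_1_nat[OF p] a by (simp add: h_def)
    qed
    have "N #> y = \<one>\<^bsub>?Q\<^esub>"
    proof (rule Q.torsion_commuting_trivial[OF locally_compact_quotient[OF Nn lc] hmQ, of "N #> h" _ p])
      show "N #> h \<in> carrier ?Q" "N #> y \<in> carrier ?Q" using hG yG by (auto simp: carrier_FactGroup)
      show "(N #> h) [^]\<^bsub>?Q\<^esub> n \<noteq> \<one>\<^bsub>?Q\<^esub>" if n: "n > 0" for n :: nat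
      proof -
        have "(p - 1) * n > 0" using prime_gt_1_nat[OF p] n by simp
        then have "g [^] ((p - 1) * n) \<notin> Z" using no by blast
        then have "h [^] n \<notin> N" using g by (simp add: h_def nat_pow_pow N_def)
        then show ?thesis using qN hG by (simp add: pow)
      qed
      show "p > 0" by (rule p_pos)
      have "y [^] p \<in> N" using pow_in_Z[OF y_in_Z] f_pow_nth[OF y_in_Z, of p 1] by (simp add: N_def)
      then show "(N #> y) [^]\<^bsub>?Q\<^esub> p = \<one>\<^bsub>?Q\<^esub>" using qN yG by (simp add: pow)
      have hy: "h \<otimes> y \<otimes> inv (y \<otimes> h) = (h \<otimes> y \<otimes> inv h) \<otimes> inv y" using hG yG by (simp add: group_normalize)
      have iy: "inv y \<in> Z" using y_in_Z Zs by (simp add: subgroup.m_inv_closed)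
      have "f ((h \<otimes> y \<otimes> inv h) \<otimes> inv y) 1 = 0"
        using f_mult_nth[OF conj_Z[OF hG y_in_Z] iy, of 1] uh
        by (simp add: f_inv_nth[OF y_in_Z] f_gen padic_int_def mod_simps flip: u_def)
      then have "h \<otimes> y \<otimes> inv (y \<otimes> h) \<in> N"
        unfolding hy N_def using subgroup.m_closed[OF Zs conj_Z[OF hG y_in_Z] iy] by simp
      then have "N #> (h \<otimes> y) = N #> (y \<otimes> h)" using rcoset_eq_iff[OF Nn, of "h \<otimes> y" "y \<otimes> h"] hG yG by simp
      then show "(N #> h) \<otimes>\<^bsub>?Q\<^esub> (N #> y) = (N #> y) \<otimes>\<^bsub>?Q\<^esub> (N #> h)"
        using hG yG normal.rcos_sum[OF Nn] by simp
    qed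
    then have "f y 1 = 0" using qN[OF yG] by (simp add: N_def)
    then show False using prime_gt_1_nat[OF p] by (simp add: f_gen padic_int_def)
  qed
qed

end

text \<open>The elements of \<open>Z\<close> commuting with \<open>c\<close> form a nontrivial
  closed subgroup, which contains all \<open>m\<close>-th powers for some \<open>m > 0\<close>.
  Roots in \<open>Z\<close> are unique, so \<open>c\<close> commutes with the roots too.\<close>

lemma (in topgroup) monothetic_eq_conj:
  assumes Z: "subgroup Z G" "monothetic (G\<lparr>carrier := Z\<rparr>) (subtopology \<tau> Z) y"
    and c: "c \<in> carrier G" "\<And>z. z \<in> Z \<Longrightarrow> c \<otimes> z \<otimes> inv c \<in> Z"
    and w: "w \<in> Z" "w \<noteq> \<one>" "c \<otimes> w = w \<otimes> c" and z: "z \<in> Z"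
  shows "c \<otimes> z = z \<otimes> c"
proof -
  interpret Z: monothetic "G\<lparr>carrier := Z\<rparr>" "subtopology \<tau> Z" y by (rule Z(2))
  note pZ = nat_pow_consistent[of _ _ Z, symmetric]
  have ZG: "Z \<subseteq> carrier G" using Z(1) by (rule subgroup.subset)
  define N where "N = Z \<inter> centralizer G {c}"
  have "subgroup N G" unfolding N_def by (rule subgroups_Inter_pair[OF Z(1) subgroup_centralizer]) (use c in simp)
  then have "subgroup N (G\<lparr>carrier := Z\<rparr>)" by (rule subgroup_incl[OF _ Z(1)]) (simp add: N_def)
  moreover have "closedin (subtopology \<tau> Z) N"
    using closedin_centralizer[of "{c}"] c(1) by (auto simp: N_def closedin_subtopology)
  moreover have "w \<in> N" using w ZG by (auto simp: N_def centralizer_def)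
  then have "N \<noteq> {\<one>\<^bsub>G\<lparr>carrier := Z\<rparr>\<^esub>}" using w(2) by auto
  ultimately obtain m where m: "m > 0" "Z.pow_image m \<subseteq> N" using Z.closed_subgroup_pow by blast
  have zG: "z \<in> carrier G" using z ZG by blast
  have "z [^] m \<in> N" using m(2) z by (auto simp: pZ)
  then have cm: "c \<otimes> z [^] m = z [^] m \<otimes> c" by (simp add: N_def centralizer_def)
  have conj_pow: "c \<otimes> z [^] k \<otimes> inv c = (c \<otimes> z \<otimes> inv c) [^] k" for k :: nat
  proof (induction k)
    case (Suc k)
    have "c \<otimes> z [^] Suc k \<otimes> inv c = (c \<otimes> z [^] k \<otimes> inv c) \<otimes> (c \<otimes> z \<otimes> inv c)"
      using c(1) zG by (simp add: group_normalize)
    then show ?case using Suc by simp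
  qed (use c(1) in simp)
  have "(c \<otimes> z \<otimes> inv c) [^] m = z [^] m" using conj_pow[of m] cm c(1) zG by (simp add: m_assoc)
  then have "c \<otimes> z \<otimes> inv c = z"
    using Z.pow_cancel[of "c \<otimes> z \<otimes> inv c" z m] c(2)[OF z] z m(1) by (simp add: pZ)
  then have "c \<otimes> z \<otimes> inv c \<otimes> c = z \<otimes> c" by simp
  then show ?thesis using c(1) zG by (simp add: m_assoc)
qed

section \<open>Closed derived subgroups, centralizers and the inductive step\<close>

context topgroup
begin

text \<open>Commutators are continuous in each variable, so closures are taken one variable at a
  time. This keeps the derived length under control when subgroups are replaced by their
  closures.\<close>

lemma derived_closure:
  assumes H: "subgroup H G"
  shows "derived G (\<tau> closure_of H) \<subseteq> \<tau> closure_of (derived G H)"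
proof -
  let ?D = "\<tau> closure_of (derived G H)"
  have HG: "H \<subseteq> carrier G" using H by (rule subgroup.subset)
  have D: "subgroup ?D G" by (rule subgroup_closure[OF derived_is_subgroup[OF HG]])
  have DG: "derived G H \<subseteq> carrier G" by (rule subgroup.subset[OF derived_is_subgroup[OF HG]])
  have c0: "g \<otimes> h \<otimes> inv g \<otimes> inv h \<in> ?D" if "g \<in> H" "h \<in> H" for g h
  proof -
    have "g \<otimes> h \<otimes> inv g \<otimes> inv h \<in> derived G H"
      unfolding derived_def by (rule generate.incl) (use that in blast)
    then show ?thesis using closure_of_subset[of "derived G H" \<tau>] DG by auto
  qed
  have c1: "g \<otimes> h \<otimes> inv g \<otimes> inv h \<in> ?D" if g: "g \<in> \<tau> closure_of H" and h: "h \<in> H" for g h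
  proof -
    have hG: "h \<in> carrier G" using h HG by blast
    have "closedin \<tau> {g \<in> carrier G. g \<otimes> h \<otimes> inv g \<otimes> inv h \<in> ?D}"
      by (rule closedin_preimage) (intro continuous_map_mult continuous_map_inv, use hG in auto)
    moreover have "H \<subseteq> {g \<in> carrier G. g \<otimes> h \<otimes> inv g \<otimes> inv h \<in> ?D}" using c0 h HG by blast
    ultimately show ?thesis using closure_of_minimal g by blast
  qed
  have c2: "g \<otimes> h \<otimes> inv g \<otimes> inv h \<in> ?D" if g: "g \<in> \<tau> closure_of H" and h: "h \<in> \<tau> closure_of H" for g h
  proof -
    have gG: "g \<in> carrier G" using g closure_subset by blast
    have "closedin \<tau> {h \<in> carrier G. g \<otimes> h \<otimes> inv g \<otimes> inv h \<in> ?D}"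
      by (rule closedin_preimage) (intro continuous_map_mult continuous_map_inv, use gG in auto)
    moreover have "H \<subseteq> {h \<in> carrier G. g \<otimes> h \<otimes> inv g \<otimes> inv h \<in> ?D}" using c1[OF g] HG by blast
    ultimately show ?thesis using closure_of_minimal h by blast
  qed
  show ?thesis
    unfolding derived_def[of G "\<tau> closure_of H"]
    by (rule generate_subgroup_incl[OF _ D]) (use c2 in blast)
qed

lemma derived_funpow_closure:
  assumes "subgroup H G"
  shows "(derived G ^^ n) (\<tau> closure_of H) \<subseteq> \<tau> closure_of ((derived G ^^ n) H)"
proof (induction n)
  case (Suc n)
  have "derived G ((derived G ^^ n) (\<tau> closure_of H)) \<subseteq> derived G (\<tau> closure_of ((derived G ^^ n) H))"
    by (rule mono_derived[OF Suc.IH])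
  also have "\<dots> \<subseteq> \<tau> closure_of (derived G ((derived G ^^ n) H))"
    by (rule derived_closure[OF exp_of_derived_is_subgroup[OF assms]])
  finally show ?case by simp
qed simp

text \<open>The closure of the subgroup generated by \<open>Z\<close> and \<open>c\<close> is
  abelian and infinite, hence again monothetic, and there the nontrivial closed subgroup
  \<open>Z\<close> contains all \<open>m\<close>-th powers for some \<open>m > 0\<close>.\<close>

lemma torsion_mod_subgroup:
  assumes htm: "hereditarily_totally_minimal G \<tau>" and lc: "locally_compact_space \<tau>"
    and Z: "subgroup Z G" "closedin \<tau> Z" "monothetic (G\<lparr>carrier := Z\<rparr>) (subtopology \<tau> Z) y"
    and c: "c \<in> centralizer G Z"
  shows "\<exists>n>0. c [^] (n::nat) \<in> Z"
proof -
  interpret Z: monothetic "G\<lparr>carrier := Z\<rparr>" "subtopology \<tau> Z" y by (rule Z(3))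
  have cG: "c \<in> carrier G" and cz: "\<And>z. z \<in> Z \<Longrightarrow> c \<otimes> z = z \<otimes> c" using c by (auto simp: centralizer_def)
  have ZG: "Z \<subseteq> carrier G" using Z(1) by (rule subgroup.subset)
  have zw: "z \<otimes> w = w \<otimes> z" if "z \<in> Z" "w \<in> Z" for z w using Z.m_comm that by simp
  have ci: "c [^] (i::int) \<otimes> z = z \<otimes> c [^] i" if "z \<in> Z" for z i
    using int_pow_commute[OF cz[OF that] cG, of i 1] that ZG by auto
  define H where "H = {z \<otimes> c [^] (i::int) | z i. z \<in> Z}"
  have mult: "(z \<otimes> c [^] i) \<otimes> (w \<otimes> c [^] j) = (z \<otimes> w) \<otimes> c [^] (i + j)"
    if "z \<in> Z" "w \<in> Z" for z w and i j :: int
  proof -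
    have G: "z \<in> carrier G" "w \<in> carrier G" using that ZG by auto
    have "(z \<otimes> c [^] i) \<otimes> (w \<otimes> c [^] j) = z \<otimes> (c [^] i \<otimes> w) \<otimes> c [^] j" using G cG by (simp add: m_assoc)
    then show ?thesis using ci[OF that(2)] G cG by (simp add: m_assoc int_pow_mult)
  qed
  have H: "subgroup H G"
  proof (rule subgroupI)
    show "H \<subseteq> carrier G" using ZG cG by (auto simp: H_def)
    have "\<one> \<otimes> c [^] (0::int) \<in> H" unfolding H_def using subgroup.one_closed[OF Z(1)] by blast
    then show "H \<noteq> {}" by blast
    fix a b assume "a \<in> H" "b \<in> H"
    then obtain z i w j where *: "z \<in> Z" "a = z \<otimes> c [^] (i::int)" "w \<in> Z" "b = w \<otimes> c [^] (j::int)" unfolding H_def by blast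
    then show "a \<otimes> b \<in> H" unfolding H_def using mult subgroup.m_closed[OF Z(1)] by blast
    have iz: "inv z \<in> Z" using * Z(1) by (simp add: subgroup.m_inv_closed)
    have "inv a = c [^] (- i) \<otimes> inv z" using * ZG cG by (auto simp: inv_mult_group int_pow_neg)
    also have "\<dots> = inv z \<otimes> c [^] (- i)" by (rule ci[OF iz])
    finally show "inv a \<in> H" unfolding H_def using iz by blast
  qed
  have Hc: "a \<otimes> b = b \<otimes> a" if "a \<in> H" "b \<in> H" for a b
  proof -
    obtain z i w j where *: "z \<in> Z" "a = z \<otimes> c [^] (i::int)" "w \<in> Z" "b = w \<otimes> c [^] (j::int)"
      using \<open>a \<in> H\<close> \<open>b \<in> H\<close> unfolding H_def by blast
    then show ?thesis using mult zw by (simp add: add.commute)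
  qed
  define L where "L = \<tau> closure_of H"
  have L: "subgroup L G" unfolding L_def by (rule subgroup_closure[OF H])
  have HL: "H \<subseteq> L" unfolding L_def using closure_of_subset[of H \<tau>] subgroup.subset[OF H] by simp
  have "z \<in> H" if "z \<in> Z" for z
  proof -
    have "z \<otimes> c [^] (0::int) \<in> H" unfolding H_def using that by blast
    then show ?thesis using that ZG by auto
  qed
  then have ZL: "Z \<subseteq> L" using HL by blast
  have "\<one> \<otimes> c [^] (1::int) \<in> H" unfolding H_def using subgroup.one_closed[OF Z(1)] by blast
  then have cL: "c \<in> L" using HL cG by auto
  interpret L: topgroup "G\<lparr>carrier := L\<rparr>" "subtopology \<tau> L" by (rule topological_subgroup[OF L])
  have "infinite Z" using Z.infinite_carrier by simp
  then have "infinite (carrier (G\<lparr>carrier := L\<rparr>))" using ZL finite_subset by auto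
  moreover have "locally_compact_space (subtopology \<tau> L)"
    by (rule locally_compact_space_closed_subset[OF lc]) (simp add: L_def)
  moreover have "comm_group (G\<lparr>carrier := L\<rparr>)" unfolding L_def by (rule comm_group_closure[OF H Hc])
  ultimately obtain x where x: "monothetic (G\<lparr>carrier := L\<rparr>) (subtopology \<tau> L) x"
    using L.abelian_monothetic[OF _ hereditarily_totally_minimal_subgroup[OF htm L]] by blast
  interpret X: monothetic "G\<lparr>carrier := L\<rparr>" "subtopology \<tau> L" x by (rule x)
  have "subgroup Z (G\<lparr>carrier := L\<rparr>)" by (rule subgroup_incl[OF Z(1) L ZL])
  moreover have "closedin (subtopology \<tau> L) Z" using Z(2) ZL by (simp add: closedin_subset_topspace)
  moreover have "Z \<noteq> {\<one>\<^bsub>G\<lparr>carrier := L\<rparr>\<^esub>}" using \<open>infinite Z\<close> by auto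
  ultimately obtain m where "m > 0" "X.pow_image m \<subseteq> Z" using X.closed_subgroup_pow by blast
  then show ?thesis using cL by (intro exI[of _ m]) (auto simp flip: nat_pow_consistent)
qed

end

text \<open>Conjugation by powers of \<open>x\<close> moves an element \<open>a\<close> of
  \<open>A\<close> within a finite set, so some positive power of \<open>x\<close> commutes with
  \<open>a\<close>. That power has infinite order, and \<open>a\<close> is torsion.\<close>

lemma (in topgroup) finite_normal_trivial:
  assumes hm: "hereditarily_minimal G \<tau>" and lc: "locally_compact_space \<tau>"
    and A: "A \<lhd> G" "finite A"
    and x: "x \<in> carrier G" "\<And>n. n > 0 \<Longrightarrow> x [^] (n::nat) \<noteq> \<one>"
  shows "A = {\<one>}"
proof -
  interpret A: normal A G by (rule A(1))
  have "a = \<one>" if a: "a \<in> A" for a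
  proof -
    have aG: "a \<in> carrier G" using a by simp
    let ?g = "\<lambda>i::nat. x [^] i \<otimes> a \<otimes> inv (x [^] i)"
    have "range ?g \<subseteq> A" using A.inv_op_closed2 a x(1) by auto
    then have "finite (range ?g)" using A(2) finite_subset by blast
    then have "\<not> inj ?g" using finite_imageD infinite_UNIV_nat by blast
    then obtain i j where "i \<noteq> j" "?g i = ?g j" by (auto simp: inj_def)
    then obtain i j where ij: "i < j" "?g i = ?g j" by (metis linorder_neqE_nat)
    define k where "k = j - i"
    have k: "k > 0" "x [^] j = x [^] i \<otimes> x [^] k" using ij x(1) by (auto simp: k_def nat_pow_mult)
    have "x [^] i \<otimes> a \<otimes> inv (x [^] i) = x [^] i \<otimes> (x [^] k \<otimes> a \<otimes> inv (x [^] k)) \<otimes> inv (x [^] i)"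
      using ij(2) k(2) x(1) aG by (simp add: group_normalize)
    then have "a = x [^] k \<otimes> a \<otimes> inv (x [^] k)" using x(1) aG by simp
    then have "a \<otimes> x [^] k = x [^] k \<otimes> a \<otimes> inv (x [^] k) \<otimes> x [^] k" by simp
    then have comm: "x [^] k \<otimes> a = a \<otimes> x [^] k" using x(1) aG by (simp add: m_assoc)
    have "finite (carrier (G\<lparr>carrier := A\<rparr>))" using A(2) by simp
    then have "group.ord (G\<lparr>carrier := A\<rparr>) a > 0"
      using group.ord_ge_1[OF subgroup_imp_group[OF A.is_subgroup], of a] a by simp
    moreover have "a [^] group.ord (G\<lparr>carrier := A\<rparr>) a = \<one>"
      using group.pow_ord_eq_1[OF subgroup_imp_group[OF A.is_subgroup], of a] a by (simp flip: nat_pow_consistent)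
    moreover have "(x [^] k) [^] n \<noteq> \<one>" if "n > 0" for n :: nat
      using x(2)[of "k * n"] x(1) k(1) that by (simp add: nat_pow_pow)
    ultimately show "a = \<one>"
      using torsion_commuting_trivial[OF lc hm, of "x [^] k" a] x(1) aG comm by blast
  qed
  then show ?thesis using A.one_closed by blast
qed

lemma (in topgroup) finite_if_finite_quotient:
  assumes A: "A \<lhd> G" "finite A" "finite (carrier (G Mod A))"
  shows "finite (carrier G)"
proof -
  interpret A: normal A G by (rule A(1))
  have "carrier G \<subseteq> \<Union>(carrier (G Mod A))"
    using rcos_self[OF _ A.is_subgroup] by (auto simp: carrier_FactGroup)
  moreover have "finite X" if "X \<in> carrier (G Mod A)" for X
    using that A(2) by (auto simp: carrier_FactGroup r_coset_def)
  ultimately show ?thesis using A(3) finite_subset by blast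
qed

text \<open>The inductive hypothesis gives a subgroup \<open>Z\<close> that is self-centralizing
  only inside the closed commutator subgroup \<open>A\<close>. It is replaced by its centralizer
  \<open>C\<close> in all of \<open>G\<close>; the work is to show that \<open>Z\<close> is normal
  in \<open>G\<close> and that \<open>C\<close> is abelian, after which \<open>C\<close> is its own
  centralizer.\<close>

lemma (in topgroup) padic_normal_step:
  assumes htm: "hereditarily_totally_minimal G \<tau>" and lc: "locally_compact_space \<tau>"
    and inf: "infinite (carrier G)"
    and IH: "infinite (\<tau> closure_of derived G (carrier G)) \<Longrightarrow>
      \<exists>Z y p f. padic_normal (G\<lparr>carrier := \<tau> closure_of derived G (carrier G)\<rparr>)
          (subtopology \<tau> (\<tau> closure_of derived G (carrier G))) Z y p f \<and>
        centralizer (G\<lparr>carrier := \<tau> closure_of derived G (carrier G)\<rparr>) Z = Z \<and>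
        finite (carrier (G\<lparr>carrier := \<tau> closure_of derived G (carrier G)\<rparr> Mod Z))"
  shows "\<exists>Z y p f. padic_normal G \<tau> Z y p f \<and> centralizer G Z = Z \<and> finite (carrier (G Mod Z))"
proof -
  have hm: "hereditarily_minimal G \<tau>" by (rule hereditarily_minimal_if_totally[OF htm])
  define D where "D = derived G (carrier G)"
  define A where "A = \<tau> closure_of D"
  have D: "subgroup D G" unfolding D_def by (rule derived_is_subgroup) simp
  have DG: "D \<subseteq> carrier G" using D by (rule subgroup.subset)
  have A: "subgroup A G" unfolding A_def by (rule subgroup_closure[OF D])
  have AG: "A \<subseteq> carrier G" using A by (rule subgroup.subset)
  have DA: "D \<subseteq> A" unfolding A_def using DG by (simp add: closure_of_subset)
  have Ac: "closedin \<tau> A" by (simp add: A_def)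
  have An: "A \<lhd> G"
    unfolding normal_inv_iff
  proof (intro conjI ballI A)
    fix g a assume ga: "g \<in> carrier G" "a \<in> A"
    have "D \<lhd> G" unfolding D_def by (rule derived_self_is_normal)
    then have "g \<otimes> d \<otimes> inv g \<in> D" if "d \<in> D" for d using ga(1) that by (rule normal.inv_op_closed2)
    then show "g \<otimes> a \<otimes> inv g \<in> A" unfolding A_def by (rule closure_conj[OF ga(1) DG _ ga(2)[unfolded A_def]])
  qed
  have comm: "g \<otimes> h \<otimes> inv (h \<otimes> g) \<in> D" if "g \<in> carrier G" "h \<in> carrier G" for g h
  proof -
    have "g \<otimes> h \<otimes> inv g \<otimes> inv h \<in> D"
      unfolding D_def derived_def by (rule generate.incl) (use that in blast)
    then show ?thesis using that by (simp add: group_normalize)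
  qed
  interpret A: topgroup "G\<lparr>carrier := A\<rparr>" "subtopology \<tau> A" by (rule topological_subgroup[OF A])
  \<comment> \<open>It suffices to find an infinite closed normal abelian subgroup that is its own
    centralizer: the abelian theorem supplies its coordinate, and the finite index follows.\<close>
  have comm_case: ?thesis if Z: "comm_group (G\<lparr>carrier := Z\<rparr>)" "Z \<lhd> G" "closedin \<tau> Z" "infinite Z"
    and cZ: "centralizer G Z = Z" for Z
  proof -
    have Zs: "subgroup Z G" by (rule normal_imp_subgroup[OF Z(2)])
    interpret Z: topgroup "G\<lparr>carrier := Z\<rparr>" "subtopology \<tau> Z" by (rule topological_subgroup[OF Zs])
    obtain y where y: "monothetic (G\<lparr>carrier := Z\<rparr>) (subtopology \<tau> Z) y"
      using Z.abelian_monothetic[OF Z(1) hereditarily_totally_minimal_subgroup[OF htm Zs]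
          locally_compact_space_closed_subset[OF lc Z(3)]] Z(4) by auto
    obtain p f where pf: "padic_isomorphism p (G\<lparr>carrier := Z\<rparr>) (subtopology \<tau> Z) f" "f y = \<one>\<^bsub>padic_int p\<^esub>"
      using monothetic.proper_prime_pow_image[OF y] monothetic.padic_coordinates[OF y] by blast
    have "padic_normal G \<tau> Z y p f"
      by (rule padic_normal.intro[OF topgroup_axioms padic_normal_axioms.intro[OF Z(2,3) y pf]])
    then show ?thesis using padic_normal.finite_index[OF _ htm lc cZ] cZ by blast
  qed
  show ?thesis
  proof (cases "finite A")
    case True
    \<comment> \<open>If all elements were torsion, the quotient by the finite subgroup
      \<open>A\<close> would be finite and so would \<open>G\<close>. An element of infinite order
      in turn forces \<open>A\<close> to be trivial, which makes \<open>G\<close> abelian.\<close>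
    have "\<not> (\<forall>g\<in>carrier G. \<exists>n>0. g [^] (n::nat) = \<one>)"
    proof
      assume tor: "\<forall>g\<in>carrier G. \<exists>n>0. g [^] (n::nat) = \<one>"
      have "finite (carrier (G Mod A))"
        by (rule torsion_quotient_finite[OF htm lc An Ac])
           (use comm DA tor subgroup.one_closed[OF A] in \<open>fastforce+\<close>)
      then show False using finite_if_finite_quotient[OF An True] inf by blast
    qed
    then obtain x where "x \<in> carrier G" "\<And>n. n > 0 \<Longrightarrow> x [^] (n::nat) \<noteq> \<one>" by blast
    then have "A = {\<one>}" by (rule finite_normal_trivial[OF hm lc An True])
    then have gh: "g \<otimes> h = h \<otimes> g" if "g \<in> carrier G" "h \<in> carrier G" for g h
      using comm[OF that] DA that by (auto simp: mult_inv_eq_one_iff)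
    show ?thesis
    proof (rule comm_case)
      show "comm_group (G\<lparr>carrier := carrier G\<rparr>)" by (rule comm_group_subgroup[OF subgroup_self gh])
      show "carrier G \<lhd> G" using subgroup_self by (simp add: normal_inv_iff)
      show "closedin \<tau> (carrier G)" using closedin_topspace[of \<tau>] by simp
      show "centralizer G (carrier G) = carrier G" using gh by (auto simp: centralizer_def)
    qed (rule inf)
  next
    case False
    then obtain Z y p f where pn: "padic_normal (G\<lparr>carrier := A\<rparr>) (subtopology \<tau> A) Z y p f"
      and cZ: "centralizer (G\<lparr>carrier := A\<rparr>) Z = Z" and fZ: "finite (carrier (G\<lparr>carrier := A\<rparr> Mod Z))"
      using IH unfolding A_def D_def by blast
    interpret Z: padic_normal "G\<lparr>carrier := A\<rparr>" "subtopology \<tau> A" Z y p f by (rule pn)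
    have ZA: "Z \<subseteq> A" using subgroup.subset[OF Z.Zs] by simp
    have Zs: "subgroup Z G" by (rule subgroup_subgroup(1)[OF A Z.Zs])
    have ZG: "Z \<subseteq> carrier G" using Zs by (rule subgroup.subset)
    have Zc: "closedin \<tau> Z" by (rule closedin_trans_full[OF Z.Zc Ac])
    have st: "subtopology (subtopology \<tau> A) Z = subtopology \<tau> Z" using ZA by (simp add: subtopology_subtopology inf.absorb2)
    have mZ: "monothetic (G\<lparr>carrier := Z\<rparr>) (subtopology \<tau> Z) y" using Z.mono st by simp
    interpret M: monothetic "G\<lparr>carrier := Z\<rparr>" "subtopology \<tau> Z" y by (rule mZ)
    note pZ = nat_pow_consistent[of _ _ Z, symmetric]
    have Zcomm: "z \<otimes> w = w \<otimes> z" if "z \<in> Z" "w \<in> Z" for z w using M.m_comm that by simp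
    have cZA: "c \<in> Z" if "c \<in> A" "\<And>z. z \<in> Z \<Longrightarrow> c \<otimes> z = z \<otimes> c" for c
      using cZ that by (auto simp: centralizer_def)
    \<comment> \<open>Since \<open>Z\<close> has finite index in \<open>A\<close>, some power
      \<open>w\<close> of the conjugated generator falls back into \<open>Z\<close>. The conjugate
      of \<open>z\<close> commutes with \<open>w\<close>, hence with all of \<open>Z\<close>, and
      \<open>Z\<close> is its own centralizer in \<open>A\<close>.\<close>
    have Zconj: "g \<otimes> z \<otimes> inv g \<in> Z" if g: "g \<in> carrier G" and z: "z \<in> Z" for g z
    proof -
      define t where "t = y"
      have t: "t \<in> Z" "t \<noteq> \<one>" using M.gen M.inf_order[of 1] ZG by (auto simp: t_def)
      have tG: "t \<in> carrier G" using t ZG by blast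
      have conjA: "g \<otimes> a \<otimes> inv g \<in> A" if "a \<in> A" for a using normal.inv_op_closed2[OF An g that] .
      define s where "s = g \<otimes> t \<otimes> inv g"
      have sA: "s \<in> A" using conjA t ZA by (auto simp: s_def)
      have sG: "s \<in> carrier G" using sA AG by blast
      define Q where "Q = G\<lparr>carrier := A\<rparr> Mod Z"
      have "group Q" unfolding Q_def by (rule normal.factorgroup_is_group[OF Z.Zn])
      moreover have fin: "finite (carrier Q)" using fZ by (simp add: Q_def)
      moreover have sQ: "r_coset (G\<lparr>carrier := A\<rparr>) Z s \<in> carrier Q" using sA by (auto simp: Q_def carrier_FactGroup)
      ultimately obtain k where k: "k > 0" "r_coset (G\<lparr>carrier := A\<rparr>) Z s [^]\<^bsub>Q\<^esub> (k::nat) = \<one>\<^bsub>Q\<^esub>"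
        using group.ord_ge_1[of Q] group.pow_ord_eq_1[of Q] by (metis less_le_trans less_one)
      then have "r_coset (G\<lparr>carrier := A\<rparr>) Z (s [^] k) = Z"
        using normal.FactGroup_pow[OF Z.Zn, of s k] sA by (simp add: Q_def flip: nat_pow_consistent)
      moreover have sk: "s [^] k \<in> A" using subgroup_int_pow_closed[OF A sA, of "int k"] by (simp add: int_pow_int)
      ultimately have skZ: "s [^] k \<in> Z"
        using A.rcos_self[OF _ Z.Zs, of "s [^] k"] by simp
      have conj_pow: "g \<otimes> t [^] i \<otimes> inv g = s [^] i" for i :: nat
      proof (induction i)
        case (Suc i)
        have "g \<otimes> t [^] Suc i \<otimes> inv g = (g \<otimes> t [^] i \<otimes> inv g) \<otimes> s"
          using g tG by (simp add: group_normalize s_def)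
        then show ?case using Suc by simp
      qed (use g in simp)
      define w where "w = s [^] k"
      have w: "w = g \<otimes> t [^] k \<otimes> inv g" using conj_pow by (simp add: w_def)
      have tk: "t [^] k \<noteq> \<one>" using M.torsion_free[of t k] t k(1) by (auto simp: pZ)
      have w1: "w \<noteq> \<one>"
      proof
        assume "w = \<one>"
        then have "inv g \<otimes> w \<otimes> g = \<one>" using g by simp
        then show False using tk g tG by (simp add: w group_normalize)
      qed
      define c where "c = g \<otimes> z \<otimes> inv g"
      have zG: "z \<in> carrier G" using z ZG by blast
      have cA: "c \<in> A" using conjA z ZA by (auto simp: c_def)
      have "z \<otimes> t [^] k = t [^] k \<otimes> z"
        using Zcomm[OF z, of "t [^] k"] subgroup_int_pow_closed[OF Zs t(1), of "int k"] by (simp add: int_pow_int)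
      then have "g \<otimes> (z \<otimes> t [^] k) \<otimes> inv g = g \<otimes> (t [^] k \<otimes> z) \<otimes> inv g" by simp
      then have cw: "c \<otimes> w = w \<otimes> c" using g zG tG by (simp add: c_def w group_normalize)
      have "c \<otimes> v = v \<otimes> c" if v: "v \<in> Z" for v
      proof (rule monothetic_eq_conj[OF Zs mZ _ _ _ w1 cw v])
        show "c \<in> carrier G" using cA AG by blast
        show "w \<in> Z" using skZ by (simp add: w_def)
        show "c \<otimes> v \<otimes> inv c \<in> Z" if "v \<in> Z" for v using Z.conj_Z[of c v] cA that A by simp
      qed
      then show ?thesis using cZA[OF cA] by (simp add: c_def)
    qed
    have Zn: "Z \<lhd> G" using Zs Zconj by (simp add: normal_inv_iff)
    define C where "C = centralizer G Z"
    have C: "subgroup C G" unfolding C_def by (rule subgroup_centralizer[OF ZG])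
    have CG: "C \<subseteq> carrier G" using C by (rule subgroup.subset)
    have ZC: "Z \<subseteq> C" using ZG Zcomm by (auto simp: C_def centralizer_def)
    have Cn: "C \<lhd> G"
      unfolding normal_inv_iff
    proof (intro conjI ballI C)
      fix g c assume g: "g \<in> carrier G" and c: "c \<in> C"
      have cG: "c \<in> carrier G" using c CG by blast
      have "(g \<otimes> c \<otimes> inv g) \<otimes> z = z \<otimes> (g \<otimes> c \<otimes> inv g)" if z: "z \<in> Z" for z
      proof -
        have zG: "z \<in> carrier G" using z ZG by blast
        have "inv g \<otimes> z \<otimes> inv (inv g) \<in> Z" using Zconj[of "inv g" z] g z by simp
        then have "c \<otimes> (inv g \<otimes> z \<otimes> g) = (inv g \<otimes> z \<otimes> g) \<otimes> c" using c g by (simp add: C_def centralizer_def)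
        then have "g \<otimes> (c \<otimes> (inv g \<otimes> z \<otimes> g)) \<otimes> inv g = g \<otimes> ((inv g \<otimes> z \<otimes> g) \<otimes> c) \<otimes> inv g" by simp
        then show ?thesis using g cG zG by (simp add: group_normalize)
      qed
      then show "g \<otimes> c \<otimes> inv g \<in> C" using g cG by (simp add: C_def centralizer_def)
    qed
    \<comment> \<open>The commutator \<open>e\<close> of \<open>c\<close> and \<open>d\<close> lies
      in \<open>A\<close> and centralizes \<open>Z\<close>, so it is in \<open>Z\<close> and
      commutes with \<open>c\<close> and \<open>d\<close>. Therefore \<open>c [^] m\<close> and
      \<open>d\<close> have commutator \<open>e [^] m\<close>; for some \<open>m > 0\<close> the
      element \<open>c [^] m\<close> is in \<open>Z\<close>, which \<open>d\<close> centralizes, and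
      torsion-freeness of \<open>Z\<close> gives \<open>e = \<one>\<close>.\<close>
    have Ccomm: "c \<otimes> d = d \<otimes> c" if c: "c \<in> C" and d: "d \<in> C" for c d
    proof -
      have G: "c \<in> carrier G" "d \<in> carrier G" using c d CG by auto
      define e where "e = c \<otimes> d \<otimes> inv (d \<otimes> c)"
      have "e \<in> A" using comm[OF G] DA by (auto simp: e_def)
      moreover have "e \<in> C" unfolding e_def
        by (rule subgroup_div_closed[OF C]) (use c d C in \<open>simp_all add: subgroup.m_closed\<close>)
      ultimately have eZ: "e \<in> Z" using cZA by (simp add: C_def centralizer_def)
      have eG: "e \<in> carrier G" using eZ ZG by blast
      have cde: "c \<otimes> d = e \<otimes> (d \<otimes> c)" using G by (simp add: e_def group_normalize)
      have ec: "c \<otimes> e = e \<otimes> c" "d \<otimes> e = e \<otimes> d" using c d eZ by (auto simp: C_def centralizer_def)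
      have pw: "c [^] i \<otimes> d = e [^] i \<otimes> (d \<otimes> c [^] i)" for i :: nat
      proof (induction i)
        case (Suc i)
        have ei: "c \<otimes> e [^] i = e [^] i \<otimes> c" using group_commutes_pow[of e c i] ec eG G by simp
        have "c [^] Suc i \<otimes> d = c \<otimes> (c [^] i \<otimes> d)"
          unfolding nat_pow_Suc2[OF G(1)] using G by (simp add: m_assoc)
        also have "\<dots> = (c \<otimes> e [^] i) \<otimes> (d \<otimes> c [^] i)" using Suc G eG by (simp add: m_assoc)
        also have "\<dots> = e [^] i \<otimes> ((c \<otimes> d) \<otimes> c [^] i)" using G eG by (simp add: ei m_assoc)
        also have "\<dots> = (e [^] i \<otimes> e) \<otimes> (d \<otimes> (c \<otimes> c [^] i))" using G eG by (simp add: cde m_assoc)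
        also have "c \<otimes> c [^] i = c [^] Suc i" by (rule nat_pow_Suc2[OF G(1), symmetric])
        finally show ?case by simp
      qed (use G in simp)
      obtain m where m: "m > 0" "c [^] (m::nat) \<in> Z"
        using torsion_mod_subgroup[OF htm lc Zs Zc mZ] c by (auto simp: C_def)
      have "d \<otimes> c [^] m = c [^] m \<otimes> d" using d m(2) by (simp add: C_def centralizer_def)
      then have "d \<otimes> c [^] m = e [^] m \<otimes> (d \<otimes> c [^] m)" using pw[of m] by simp
      then have "e [^] m = \<one>" using G eG by (metis l_cancel_one m_closed nat_pow_closed r_cancel_one')
      then have "e = \<one>" using M.torsion_free[of e m] eZ m(1) by (simp add: pZ)
      then show ?thesis using cde G by simp
    qed
    show ?thesis
    proof (rule comm_case[OF comm_group_subgroup[OF C Ccomm] Cn])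
      show "closedin \<tau> C" unfolding C_def by (rule closedin_centralizer[OF ZG])
      have "infinite Z" using M.infinite_carrier by simp
      then show "infinite C" using ZC finite_subset by blast
      show "centralizer G C = C"
      proof
        show "centralizer G C \<subseteq> C" using ZC by (auto simp: C_def centralizer_def)
        show "C \<subseteq> centralizer G C" using Ccomm CG by (auto simp: centralizer_def)
      qed
    qed
  qed
qed

text \<open>The normal copy of the \<open>p\<close>-adic integers is found by induction on the derived length.\<close>

theorem padic_normal_of_solvable:
  assumes "topological_group G \<tau>" "hereditarily_totally_minimal G \<tau>" "locally_compact_space \<tau>"
    "(derived G ^^ n) (carrier G) = {\<one>\<^bsub>G\<^esub>}" "infinite (carrier G)"
  shows "\<exists>Z y p f. padic_normal G \<tau> Z y p f \<and> centralizer G Z = Z \<and> finite (carrier (G Mod Z))"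
  using assms
proof (induction n arbitrary: G \<tau>)
  case 0
  then show ?case by simp
next
  case (Suc n)
  interpret topgroup G \<tau> by unfold_locales (rule Suc.prems(1))
  define D where "D = derived G (carrier G)"
  define A where "A = \<tau> closure_of D"
  have D: "subgroup D G" unfolding D_def by (rule derived_is_subgroup) simp
  have A: "subgroup A G" unfolding A_def by (rule subgroup_closure[OF D])
  interpret A: topgroup "G\<lparr>carrier := A\<rparr>" "subtopology \<tau> A" by (rule topological_subgroup[OF A])
  have sub: "(derived G ^^ m) A \<subseteq> A" for m
    by (induction m) (use derived_incl[OF _ A] in auto)
  \<comment> \<open>The derived series of \<open>A\<close> may be computed inside \<open>G\<close>,
    where the closure lemma bounds its \<open>n\<close>-th term by the closure of the trivial
    group.\<close>
  have "(derived (G\<lparr>carrier := A\<rparr>) ^^ m) A = (derived G ^^ m) A" for m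
    by (induction m) (use derived_consistent[OF sub A] in auto)
  moreover have "(derived G ^^ n) A = {\<one>\<^bsub>G\<^esub>}"
  proof
    have "(derived G ^^ n) D = {\<one>\<^bsub>G\<^esub>}" using Suc.prems(4) by (simp add: D_def funpow_swap1)
    then have "(derived G ^^ n) A \<subseteq> \<tau> closure_of {\<one>\<^bsub>G\<^esub>}"
      using derived_funpow_closure[OF D, of n] by (simp add: A_def)
    also have "\<tau> closure_of {\<one>\<^bsub>G\<^esub>} = {\<one>\<^bsub>G\<^esub>}" using closedin_finite[of "{\<one>\<^bsub>G\<^esub>}"] by (simp add: closure_of_closedin)
    finally show "(derived G ^^ n) A \<subseteq> {\<one>\<^bsub>G\<^esub>}" .
    show "{\<one>\<^bsub>G\<^esub>} \<subseteq> (derived G ^^ n) A" using subgroup.one_closed[OF exp_of_derived_is_subgroup[OF A]] by simp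
  qed
  ultimately have der: "(derived (G\<lparr>carrier := A\<rparr>) ^^ n) (carrier (G\<lparr>carrier := A\<rparr>)) = {\<one>\<^bsub>G\<lparr>carrier := A\<rparr>\<^esub>}" by simp
  have lcA: "locally_compact_space (subtopology \<tau> A)"
    by (rule locally_compact_space_closed_subset[OF Suc.prems(3)]) (simp add: A_def)
  show ?case
  proof (rule padic_normal_step[OF Suc.prems(2,3,5)])
    assume "infinite (\<tau> closure_of derived G (carrier G))"
    then have "infinite (carrier (G\<lparr>carrier := A\<rparr>))" by (simp add: A_def D_def)
    from Suc.IH[OF A.top_group hereditarily_totally_minimal_subgroup[OF Suc.prems(2) A] lcA der this]
    show "\<exists>Z y p f. padic_normal (G\<lparr>carrier := \<tau> closure_of derived G (carrier G)\<rparr>)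
          (subtopology \<tau> (\<tau> closure_of derived G (carrier G))) Z y p f \<and>
        centralizer (G\<lparr>carrier := \<tau> closure_of derived G (carrier G)\<rparr>) Z = Z \<and>
        finite (carrier (G\<lparr>carrier := \<tau> closure_of derived G (carrier G)\<rparr> Mod Z))"
      unfolding A_def D_def .
  qed
qed

subsection \<open>Torsion units of the \<open>p\<close>-adic integers\<close>

lemma sum_powers_cong:
  fixes b p :: int
  assumes "[b = 1] (mod p)"
  shows "[(\<Sum>i<m. b ^ i) = int m] (mod p)"
proof -
  have "[b ^ i = 1] (mod p)" for i using cong_pow[OF assms, of i] by simp
  then have "[(\<Sum>i<m. b ^ i) = (\<Sum>i<m. 1)] (mod p)" by (intro cong_sum) auto
  then show ?thesis by simp
qed

text \<open>A form of lifting the exponent: \<open>v (a ^ m - 1) \<le> v m + v (a - 1)\<close>.\<close>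

lemma prime_power_dvd_pow_minus_one:
  fixes a :: int
  assumes p: "prime p" and a: "[a = 1] (mod int p)" "p = 2 \<Longrightarrow> [a = 1] (mod 4)"
    and m: "m > 0" and dvd: "int p ^ N dvd a ^ m - 1"
  shows "int p ^ N dvd int m * (a - 1)"
  using m dvd
proof (induction m arbitrary: N rule: less_induct)
  case (less m)
  have pi: "prime (int p)" using p by simp
  have geo: "b ^ k - 1 = (b - 1) * (\<Sum>i<k. b ^ i)" for b :: int and k by (rule power_diff_1_eq)
  show ?case
  proof (cases "p dvd m")
    case False
    \<comment> \<open>Because \<open>a\<close> is 1 modulo \<open>p\<close>, this cofactor of
      \<open>a - 1\<close> in \<open>a ^ m - 1\<close> is congruent to \<open>m\<close>.\<close>
    have "\<not> int p dvd (\<Sum>i<m. a ^ i)"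
      using sum_powers_cong[OF a(1), of m] False by (metis cong_dvd_iff int_dvd_int_iff)
    then have "coprime (int p ^ N) (\<Sum>i<m. a ^ i)" using pi by (metis coprime_power_left_iff prime_imp_coprime)
    then have "int p ^ N dvd a - 1" using less.prems(2) unfolding geo by (simp add: coprime_dvd_mult_left_iff)
    then show ?thesis by simp
  next
    case True
    then obtain k where k: "m = p * k" by blast
    then have k0: "k > 0" "k < m" using less.prems(1) prime_gt_1_nat[OF p] by auto
    define b where "b = a ^ k"
    have b1: "[b = 1] (mod int p)" using cong_pow[OF a(1), of k] by (simp add: b_def)
    have b4: "[b = 1] (mod 4)" if "p = 2" using cong_pow[OF a(2)[OF that], of k] by (simp add: b_def)
    define T where "T = (\<Sum>i<p. b ^ i)"
    \<comment> \<open>This says that the cofactor \<open>T\<close> of \<open>b - 1\<close> in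
      \<open>b ^ p - 1\<close> contains the prime \<open>p\<close> exactly once. For odd
      \<open>p\<close> the difference is \<open>b - 1\<close> times a sum congruent to
      \<open>0 + 1 + ... + (p - 1)\<close>, a multiple of \<open>p\<close>; for \<open>p = 2\<close>
      it is \<open>b - 1\<close> itself, which is where the congruence modulo 4 enters.\<close>
    have "int p ^ 2 dvd T - int p"
    proof (cases "p = 2")
      case True
      then have "T - int p = b - 1" by (simp add: T_def numeral_2_eq_2)
      then show ?thesis using b4[OF True] True by (simp add: cong_iff_dvd_diff)
    next
      case False
      have "T - int p = (\<Sum>i<p. b ^ i - 1)" by (simp add: T_def sum_subtractf)
      also have "\<dots> = (b - 1) * (\<Sum>i<p. \<Sum>j<i. b ^ j)" by (simp add: geo sum_distrib_left)
      finally have T: "T - int p = (b - 1) * (\<Sum>i<p. \<Sum>j<i. b ^ j)" .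
      have "[(\<Sum>i<p. \<Sum>j<i. b ^ j) = (\<Sum>i<p. int i)] (mod int p)"
        by (intro cong_sum sum_powers_cong[OF b1])
      moreover have "int p dvd (\<Sum>i<p. int i)"
      proof -
        have "2 * (\<Sum>i<n. int i) = int n * (int n - 1)" for n :: nat
          by (induction n) (simp_all add: algebra_simps)
        then have "int p dvd 2 * (\<Sum>i<p. int i)" by simp
        moreover have "\<not> int p dvd 2" using False p
          by (metis int_dvd_int_iff of_nat_numeral primes_dvd_imp_eq two_is_prime_nat)
        ultimately show ?thesis using pi prime_dvd_mult_iff by blast
      qed
      ultimately have "int p dvd (\<Sum>i<p. \<Sum>j<i. b ^ j)" by (simp add: cong_dvd_iff)
      moreover have "int p dvd b - 1" using b1 by (simp add: cong_iff_dvd_diff)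
      ultimately show ?thesis unfolding T power2_eq_square by (rule mult_dvd_mono[rotated])
    qed
    then obtain r where "T - int p = int p ^ 2 * r" by blast
    then have T: "T = int p * (1 + int p * r)" by (simp add: power2_eq_square algebra_simps)
    have "\<not> int p dvd 1 + int p * r" using pi by (metis dvd_add_left_iff dvd_triv_left not_prime_unit)
    then have cop: "coprime (int p ^ N) (1 + int p * r)" using pi by (metis coprime_power_left_iff prime_imp_coprime)
    have "a ^ m - 1 = (int p * (b - 1)) * (1 + int p * r)"
    proof -
      have "a ^ m = b ^ p" by (simp add: k b_def power_mult[symmetric] mult.commute)
      then show ?thesis using geo[of b p] T by (simp add: T_def[symmetric] mult_ac)
    qed
    then have pN: "int p ^ N dvd int p * (b - 1)" using less.prems(2) cop by (simp add: coprime_dvd_mult_left_iff)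
    show ?thesis
    proof (cases N)
      case (Suc n)
      then have "int p ^ n dvd a ^ k - 1" using pN p by (simp add: b_def prime_gt_0_nat)
      then have "int p ^ n dvd int k * (a - 1)" by (rule less.IH[OF k0(2,1)])
      then show ?thesis using Suc k by (simp add: mult.assoc)
    qed simp
  qed
qed

text \<open>The divisibility is read at level \<open>n + m\<close>. A power \<open>p ^ i\<close>
  dividing \<open>m\<close> has \<open>i < p ^ i \<le> m\<close>, so more than \<open>n\<close> of
  the factors \<open>p\<close> are left to divide \<open>x (n + m) - c\<close>.\<close>

lemma padic_int_torsion_free:
  assumes p: "prime p" and x: "x \<in> carrier (padic_int p)"
    and m: "m > 0" "\<And>n. int p ^ n dvd int m * (x n - c)"
  shows "x n = c mod int p ^ n"
proof -
  have pi: "prime (int p)" using p by simp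
  obtain i j where ij: "i + j = n + m" "int p ^ i dvd int m" "int p ^ j dvd x (n + m) - c"
    using prime_elem_power_dvd_prod[OF m(2)[of "n + m"]] pi by auto
  have "p ^ i dvd m" using ij(2) by (metis int_dvd_int_iff of_nat_power)
  then have "p ^ i \<le> m" using m(1) by (simp add: dvd_imp_le)
  moreover have "i < p ^ i" using prime_gt_1_nat[OF p] by (simp add: power_gt_expt)
  ultimately have "n \<le> j" using ij(1) by linarith
  then have "int p ^ n dvd x (n + m) - c" using ij(3) by (meson le_imp_power_dvd dvd_trans)
  then have "x (n + m) mod int p ^ n = c mod int p ^ n" by (simp add: mod_eq_dvd_iff)
  then show ?thesis using padic_compat[OF x, of n "n + m"] by simp
qed

text \<open>By the exponent estimate \<open>m * (x n - 1)\<close> is divisible by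
  \<open>p ^ n\<close> for every \<open>n\<close>, and Z_p is torsion-free. The condition modulo 4
  excludes the torsion unit -1 of the 2-adic integers.\<close>

lemma padic_torsion_unit_trivial:
  assumes p: "prime p" and x: "x \<in> carrier (padic_int p)"
    and m: "m > 0" "\<And>n. x n ^ m mod int p ^ n = 1 mod int p ^ n"
    and one: "[x 1 = 1] (mod int p)" "p = 2 \<Longrightarrow> [x 2 = 1] (mod 4)"
  shows "x = \<one>\<^bsub>padic_int p\<^esub>"
proof
  fix n
  have "int p ^ n dvd int m * (x n - 1)" for n
  proof -
    \<comment> \<open>Level \<open>n + 2\<close> is high enough for the residues modulo
      \<open>p\<close> and modulo 4 to be visible, even for \<open>n = 0\<close>.\<close>
    have c1: "[x (n + 2) = 1] (mod int p)"
      using padic_compat[OF x, of 1 "n + 2"] padic_mod[OF x, of 1] one(1) by (simp add: cong_def)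
    have c4: "[x (n + 2) = 1] (mod 4)" if "p = 2"
      using padic_compat[OF x, of 2 "n + 2"] padic_mod[OF x, of 2] one(2)[OF that] that by (simp add: cong_def)
    have "int p ^ (n + 2) dvd x (n + 2) ^ m - 1" using m(2)[of "n + 2"] by (simp add: mod_eq_dvd_iff)
    then have "int p ^ (n + 2) dvd int m * (x (n + 2) - 1)"
      using prime_power_dvd_pow_minus_one[of p "x (n + 2)" m "n + 2"] p c1 c4 m(1) by blast
    then have "int p ^ n dvd int m * (x (n + 2) - 1)" by (meson le_imp_power_dvd dvd_trans le_add1)
    moreover have "int p ^ n dvd x (n + 2) - x n"
      using padic_compat[OF x, of n "n + 2"] padic_mod[OF x, of n] by (metis le_add1 mod_eq_dvd_iff)
    ultimately have "int p ^ n dvd int m * (x (n + 2) - 1) - int m * (x (n + 2) - x n)" by (intro dvd_diff) auto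
    then show ?thesis by (simp add: algebra_simps)
  qed
  then have "x n = 1 mod int p ^ n" by (rule padic_int_torsion_free[OF p x m(1)])
  then show "x n = \<one>\<^bsub>padic_int p\<^esub> n" by (simp add: padic_int_def)
qed

text \<open>The congruence is solved at each level separately. As \<open>w n\<close> is coprime to
  \<open>p ^ n\<close>, solutions are unique modulo \<open>p ^ n\<close> and therefore
  compatible.\<close>

lemma padic_unit_divides:
  assumes p: "prime p" and w: "w \<in> carrier (padic_int p)" "\<not> int p dvd w 1" and v: "v \<in> carrier (padic_int p)"
  shows "\<exists>x\<in>carrier (padic_int p). w \<otimes>\<^bsub>padic_int p\<^esub> x = v"
proof -
  have p0: "p > 0" using prime_gt_0_nat[OF p] .
  have cop: "coprime (w n) (int p ^ n)" for n
  proof (cases n)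
    case (Suc k)
    then have "[w n = w 1] (mod int p)" using padic_compat[OF w(1), of 1 n] padic_mod[OF w(1), of 1] by (simp add: cong_def)
    then have "\<not> int p dvd w n" using w(2) by (simp add: cong_dvd_iff)
    then have "coprime (int p) (w n)" using p by (simp add: prime_imp_coprime)
    then show ?thesis by (simp add: coprime_commute)
  qed simp
  have "\<exists>x. [w n * x = v n] (mod int p ^ n)" for n
  proof -
    obtain r where "[w n * r = 1] (mod int p ^ n)" using cong_solve_coprime_int[OF cop] by blast
    then have "[w n * r * v n = 1 * v n] (mod int p ^ n)" by (rule cong_mult[OF _ cong_refl])
    then show ?thesis by (auto simp: mult.assoc)
  qed
  then obtain x where x: "\<And>n. [w n * x n = v n] (mod int p ^ n)" by metis
  have "x (Suc n) mod int p ^ n = x n mod int p ^ n" for n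
  proof -
    have "[w (Suc n) * x (Suc n) = v (Suc n)] (mod int p ^ n)"
      using x[of "Suc n"] by (rule cong_dvd_modulus) simp
    moreover have "[w (Suc n) = w n] (mod int p ^ n)" "[v (Suc n) = v n] (mod int p ^ n)"
      using padic_suc_mod[OF w(1)] padic_suc_mod[OF v] by (simp_all add: cong_def)
    ultimately have "[w n * x (Suc n) = v n] (mod int p ^ n)"
      by (meson cong_mult cong_refl cong_sym cong_trans)
    then have "[w n * x (Suc n) = w n * x n] (mod int p ^ n)" using x[of n] cong_sym cong_trans by blast
    then show ?thesis using cong_mult_lcancel[OF cop] by (simp add: cong_def)
  qed
  then have "(\<lambda>n. x n mod int p ^ n) \<in> carrier (padic_int p)" by (rule padic_carrierI[OF p0])
  moreover have "w \<otimes>\<^bsub>padic_int p\<^esub> (\<lambda>n. x n mod int p ^ n) = v"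
    using x padic_mod[OF v] by (auto simp: padic_int_def mod_simps cong_def)
  ultimately show ?thesis by blast
qed

subsection \<open>Splitting\<close>

lemma padic_units_carrier:
  assumes "p > 0" "x \<in> carrier (padic_int p)" "\<not> int p dvd x 1"
  shows "x \<in> carrier (padic_units p)"
proof -
  have "x \<notin> PIdl\<^bsub>padic_int p\<^esub> padic_of_int p (int p)"
  proof
    assume "x \<in> PIdl\<^bsub>padic_int p\<^esub> padic_of_int p (int p)"
    then obtain r where "x = r \<otimes>\<^bsub>padic_int p\<^esub> padic_of_int p (int p)" by (auto simp: cgenideal_def)
    then have "x 1 = 0" by (simp add: padic_int_def padic_of_int_def)
    then show False using assms(3) by simp
  qed
  then show ?thesis using assms(2) by (simp add: padic_units_def)
qed

lemma padic_units_simps [simp]: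
  "x \<otimes>\<^bsub>padic_units p\<^esub> y = x \<otimes>\<^bsub>padic_int p\<^esub> y" "\<one>\<^bsub>padic_units p\<^esub> = \<one>\<^bsub>padic_int p\<^esub>"
  by (simp_all add: padic_units_def)

lemma padic_units_pow: "x [^]\<^bsub>padic_units p\<^esub> (k::nat) = x [^]\<^bsub>padic_int p\<^esub> k"
  by (induction k) simp_all

lemma padic_pow_nth: "(x [^]\<^bsub>padic_int p\<^esub> (k::nat)) n = x n ^ k mod int p ^ n"
proof (induction k)
  case (Suc k)
  have "(x [^]\<^bsub>padic_int p\<^esub> Suc k) n = ((x [^]\<^bsub>padic_int p\<^esub> k) n * x n) mod int p ^ n"
    by (simp add: padic_int_def)
  then show ?case using Suc by (simp add: mod_simps mult.commute)
qed (simp add: padic_int_def)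

context padic_normal
begin

lemma pow_in_Z_of_finite_index:
  assumes fin: "finite (carrier (G Mod Z))" and g: "g \<in> carrier G"
  shows "\<exists>k>0. g [^] (k::nat) \<in> Z"
proof -
  interpret Q: group "G Mod Z" by (rule normal.factorgroup_is_group[OF Zn])
  have q: "Z #> g \<in> carrier (G Mod Z)" using g by (auto simp: carrier_FactGroup)
  have "(Z #> g) [^]\<^bsub>G Mod Z\<^esub> Q.ord (Z #> g) = Z" using Q.pow_ord_eq_1[OF q] by simp
  then have "Z #> g [^] Q.ord (Z #> g) = Z" using normal.FactGroup_pow[OF Zn g] by simp
  then have "g [^] Q.ord (Z #> g) \<in> Z" using rcos_self[OF _ Zs] g by (metis nat_pow_closed)
  then show ?thesis using Q.ord_ge_1[OF fin q] by (metis less_le_trans less_one)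
qed

lemma u_pow:
  assumes "g \<in> carrier G"
  shows "u (g [^] (k::nat)) = u g [^]\<^bsub>padic_int p\<^esub> k"
  by (induction k) (simp_all add: u_one u_mult assms)

lemma u_image_units:
  assumes cZ: "centralizer G Z = Z" and fin: "finite (carrier (G Mod Z))"
  shows "subgroup (u ` carrier G) (padic_units p)" "u ` carrier G \<subseteq> padic_torsion_units p"
proof -
  interpret R: cring "padic_int p" by (rule padic_cring[OF p_pos])
  have unit: "u g \<in> carrier (padic_units p)" if "g \<in> carrier G" for g
    by (rule padic_units_carrier[OF p_pos u_closed[OF that] u_unit_nth_1[OF that]])
  show "subgroup (u ` carrier G) (padic_units p)"
  proof
    show "u ` carrier G \<subseteq> carrier (padic_units p)" using unit by blast
    show "\<one>\<^bsub>padic_units p\<^esub> \<in> u ` carrier G" using u_one by (metis imageI one_closed padic_units_simps(2))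
    fix a assume "a \<in> u ` carrier G"
    then obtain g where g: "g \<in> carrier G" "a = u g" by blast
    have inv: "u g \<otimes>\<^bsub>padic_int p\<^esub> u (inv g) = \<one>\<^bsub>padic_int p\<^esub>" using u_mult[of g "inv g"] g(1) u_one by simp
    \<comment> \<open>The inverse is unfolded to its definite description, and uniqueness of
      inverses in the ring evaluates it.\<close>
    have "inv\<^bsub>padic_units p\<^esub> a = u (inv g)"
      unfolding m_inv_def[of "padic_units p"]
    proof (rule the_equality)
      show "u (inv g) \<in> carrier (padic_units p) \<and> a \<otimes>\<^bsub>padic_units p\<^esub> u (inv g) = \<one>\<^bsub>padic_units p\<^esub> \<and>
          u (inv g) \<otimes>\<^bsub>padic_units p\<^esub> a = \<one>\<^bsub>padic_units p\<^esub>"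
        using unit[of "inv g"] inv g R.m_comm[OF u_closed u_closed, of g "inv g"] by simp
      fix b assume b: "b \<in> carrier (padic_units p) \<and> a \<otimes>\<^bsub>padic_units p\<^esub> b = \<one>\<^bsub>padic_units p\<^esub> \<and>
          b \<otimes>\<^bsub>padic_units p\<^esub> a = \<one>\<^bsub>padic_units p\<^esub>"
      then have "b \<in> carrier (padic_int p)" by (simp add: padic_units_def)
      moreover have "b \<otimes>\<^bsub>padic_int p\<^esub> u g = \<one>\<^bsub>padic_int p\<^esub>" using b g by simp
      ultimately show "b = u (inv g)"
        using inv g u_closed[of g] u_closed[of "inv g"] by (metis R.inv_unique inv_closed)
    qed
    then show "inv\<^bsub>padic_units p\<^esub> a \<in> u ` carrier G" using g by simp
    fix b assume "b \<in> u ` carrier G"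
    then obtain h where "h \<in> carrier G" "b = u h" by blast
    then show "a \<otimes>\<^bsub>padic_units p\<^esub> b \<in> u ` carrier G" using g by (auto simp flip: u_mult)
  qed
  show "u ` carrier G \<subseteq> padic_torsion_units p"
  proof
    fix a assume "a \<in> u ` carrier G"
    then obtain g where g: "g \<in> carrier G" "a = u g" by blast
    obtain k :: nat where k: "k > 0" "g [^] k \<in> Z" using pow_in_Z_of_finite_index[OF fin g(1)] by blast
    have "u (g [^] k) = u \<one>" using u_eq_iff[of "g [^] k" \<one>] g(1) k(2) cZ by simp
    then have "u g [^]\<^bsub>padic_int p\<^esub> k = \<one>\<^bsub>padic_int p\<^esub>" using u_pow[OF g(1)] u_one by simp
    then show "a \<in> padic_torsion_units p"
      using unit[OF g(1)] g(2) k(1) by (auto simp: padic_torsion_units_def padic_units_pow)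
  qed
qed

text \<open>Finite index makes \<open>u g\<close> a torsion unit, and a torsion unit with these
  residues is 1.\<close>

lemma u_trivial:
  assumes cZ: "centralizer G Z = Z" and fin: "finite (carrier (G Mod Z))" and g: "g \<in> carrier G"
    and one: "[u g 1 = 1] (mod int p)" "p = 2 \<Longrightarrow> [u g 2 = 1] (mod 4)"
  shows "g \<in> Z"
proof -
  obtain k :: nat where k: "k > 0" "g [^] k \<in> Z" using pow_in_Z_of_finite_index[OF fin g] by blast
  have "u (g [^] k) = u \<one>" using u_eq_iff[of "g [^] k" \<one>] g k(2) cZ by simp
  then have "u g n ^ k mod int p ^ n = 1 mod int p ^ n" for n
    using u_pow_nth[OF g, of k n] u_one by (simp add: padic_int_def)
  then have "u g = \<one>\<^bsub>padic_int p\<^esub>"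
    using padic_torsion_unit_trivial[of p "u g" k] p u_closed[OF g] k(1) one by blast
  then show ?thesis using u_eq_iff[of g \<one>] g cZ u_one by simp
qed

text \<open>A fixed point other than \<open>\<one>\<close> would make \<open>g\<close> centralize
  \<open>Z\<close>. So elements outside \<open>Z\<close> act on it without nontrivial fixed points,
  and this is what makes a complement meet \<open>Z\<close> trivially.\<close>

lemma commuting_in_Z_trivial:
  assumes cZ: "centralizer G Z = Z" and g: "g \<in> carrier G" "g \<notin> Z" and z: "z \<in> Z" "g \<otimes> z = z \<otimes> g"
  shows "z = \<one>"
proof (rule ccontr)
  assume "z \<noteq> \<one>"
  then have "g \<otimes> w = w \<otimes> g" if "w \<in> Z" for w
    using monothetic_eq_conj[OF Zs mono g(1) conj_Z[OF g(1)] z(1) _ z(2) that] by blast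
  then have "g \<in> centralizer G Z" using g(1) by (simp add: centralizer_def)
  then show False using cZ g(2) by simp
qed

lemma complement_exists:
  assumes cZ: "centralizer G Z = Z" and fin: "finite (carrier (G Mod Z))"
  shows "\<exists>S. subgroup S G \<and> S \<inter> Z = {\<one>} \<and> (\<forall>g\<in>carrier G. \<exists>z\<in>Z. z \<otimes> g \<in> S)"
proof -
  have one_Z: "\<one> \<in> Z" by (rule subgroup.one_closed[OF Zs])
  show ?thesis
  proof (cases "carrier G = Z")
    case True
    then have "\<forall>g\<in>carrier G. \<exists>z\<in>Z. z \<otimes> g \<in> {\<one>}" by (metis inv_closed l_inv singletonI)
    then show ?thesis using triv_subgroup one_Z by (intro exI[of _ "{\<one>}"]) auto
  next
    case False
    then obtain g1 where g1: "g1 \<in> carrier G" "g1 \<notin> Z" using Z_carrier by blast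
    show ?thesis
    proof (cases "p = 2")
      case True
      have odd: "u g 2 mod 4 = 1 \<or> u g 2 mod 4 = 3" if g: "g \<in> carrier G" for g
      proof -
        have "u g 2 mod 2 = u g 1" using padic_compat[OF u_closed[OF g], of 1 2] True by simp
        then have "odd (u g 2)" using u_unit_nth_1[OF g] True by (metis dvd_mod_iff dvd_refl int_ops(3) of_nat_numeral)
        then show ?thesis by presburger
      qed
      have Z4: "g \<in> Z" if g: "g \<in> carrier G" and 1: "u g 2 mod 4 = 1" for g
      proof (rule u_trivial[OF cZ fin g])
        show "[u g 2 = 1] (mod 4)" using 1 by (simp add: cong_def)
        have "u g 2 mod 2 = (u g 2 mod 4) mod 2" by (simp add: mod_mod_cancel)
        then have "u g 2 mod 2 = 1" using 1 by simp
        then show "[u g 1 = 1] (mod int p)" using padic_compat[OF u_closed[OF g], of 1 2] True by (simp add: cong_def)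
      qed
      \<comment> \<open>Outside \<open>Z\<close> the unit is 3 modulo 4, and \<open>3 * 3\<close> is
        1 modulo 4; so \<open>Z\<close> has index two.\<close>
      have prod_Z: "g \<otimes> h \<in> Z" if "g \<in> carrier G" "h \<in> carrier G" "g \<notin> Z" "h \<notin> Z" for g h
      proof (rule Z4)
        have "u g 2 mod 4 = 3" "u h 2 mod 4 = 3" using odd Z4 that by blast+
        then have "(u g 2 * u h 2) mod 4 = (3 * 3) mod 4" by (metis mod_mult_eq)
        then show "u (g \<otimes> h) 2 mod 4 = 1" using u_mult[OF that(1,2)] True by (simp add: padic_int_def)
      qed (use that in simp)
      \<comment> \<open>The square lies in \<open>Z\<close> and commutes with
        \<open>g1\<close>.\<close>
      have sq: "g1 \<otimes> g1 = \<one>"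
        by (rule commuting_in_Z_trivial[OF cZ g1 prod_Z[OF g1(1,1) g1(2,2)]]) (use g1 in \<open>simp add: m_assoc\<close>)
      then have inv1: "inv g1 = g1" using g1(1) inv_equality by blast
      have "subgroup {\<one>, g1} G"
        by (rule subgroupI) (use g1(1) sq inv1 in auto)
      moreover have "{\<one>, g1} \<inter> Z = {\<one>}" using g1(2) one_Z by auto
      moreover have "\<exists>z\<in>Z. z \<otimes> g \<in> {\<one>, g1}" if g: "g \<in> carrier G" for g
      proof (cases "g \<in> Z")
        case True
        then show ?thesis using g subgroup.m_inv_closed[OF Zs True] by (intro bexI[of _ "inv g"]) auto
      next
        case False
        have "g1 \<otimes> inv g \<in> Z"
          using prod_Z[OF g1(1) inv_closed[OF g] g1(2)] False subgroup.m_inv_closed[OF Zs, of "inv g"] g by auto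
        moreover have "(g1 \<otimes> inv g) \<otimes> g = g1" using g g1(1) by (simp add: m_assoc)
        ultimately show ?thesis by (metis insertCI)
      qed
      ultimately show ?thesis by blast
    next
      case odd: False
      \<comment> \<open>Hence \<open>u g1 - 1\<close> is a unit, and multiplication by it, which
        describes commutators of \<open>g1\<close> with elements of \<open>Z\<close>, is
        invertible.\<close>
      have "\<not> [u g1 1 = 1] (mod int p)" using u_trivial[OF cZ fin g1(1)] g1(2) odd by blast
      then have unit: "\<not> int p dvd u g1 1 - 1" by (simp add: cong_iff_dvd_diff)
      define S where "S = centralizer G {g1}"
      have S: "subgroup S G" unfolding S_def by (rule subgroup_centralizer) (use g1 in simp)
      have "z = \<one>" if "z \<in> S" "z \<in> Z" for z
        using commuting_in_Z_trivial[OF cZ g1 that(2)] that(1) by (simp add: S_def centralizer_def)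
      then have "S \<inter> Z = {\<one>}" using subgroup.one_closed[OF S] one_Z by blast
      moreover have "\<exists>z\<in>Z. z \<otimes> g \<in> S" if g: "g \<in> carrier G" for g
      proof -
        interpret R: cring "padic_int p" by (rule padic_cring[OF p_pos])
        \<comment> \<open>For \<open>z \<otimes> g\<close> to commute with \<open>g1\<close> one
          needs \<open>z \<otimes> e = g1 \<otimes> z \<otimes> inv g1\<close>, which in coordinates
          reads \<open>(u g1 - 1) * f z = f e\<close>.\<close>
        define e where "e = g \<otimes> g1 \<otimes> inv (g1 \<otimes> g)"
        have e: "e \<in> Z" unfolding e_def by (rule commutator_in_Z[OF g g1(1) cZ])
        define w where "w = (\<lambda>n. (u g1 n - 1) mod int p ^ n)"
        have wR: "w \<in> carrier (padic_int p)"
          unfolding w_def by (rule padic_carrierI[OF p_pos], rule mod_diff_cong[OF padic_suc_mod[OF u_closed[OF g1(1)]] refl])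
        have "\<not> int p dvd w 1" using unit by (simp add: w_def dvd_mod_iff)
        from padic_unit_divides[OF p wR this f_closed[OF e]]
        obtain x where x: "x \<in> carrier (padic_int p)" "w \<otimes>\<^bsub>padic_int p\<^esub> x = f e" by blast
        obtain z where z: "z \<in> Z" "f z = x" by (rule imageE[of x f Z]) (simp_all add: bij_betw_imp_surj_on[OF f_bij] x(1))
        have zG: "z \<in> carrier G" "e \<in> carrier G" using z(1) e Z_carrier by auto
        have "f (z \<otimes> e) = f (g1 \<otimes> z \<otimes> inv g1)"
        proof
          fix n
          have "(w n * x n) mod int p ^ n = f e n" using fun_cong[OF x(2), of n] by (simp add: padic_int_def)
          then have "((u g1 n - 1) * x n) mod int p ^ n = f e n" by (simp add: w_def mod_simps)
          then have "(x n + f e n) mod int p ^ n = (x n + (u g1 n - 1) * x n) mod int p ^ n" by (metis mod_add_right_eq)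
          then show "f (z \<otimes> e) n = f (g1 \<otimes> z \<otimes> inv g1) n"
            using f_mult_nth[OF z(1) e, of n] f_conj[OF g1(1) z(1)] z(2) by (simp add: padic_int_def algebra_simps)
        qed
        then have ze: "z \<otimes> e = g1 \<otimes> z \<otimes> inv g1"
          using f_inj[OF subgroup.m_closed[OF Zs z(1) e] conj_Z[OF g1(1) z(1)]] by blast
        have "z \<otimes> g \<otimes> g1 = z \<otimes> e \<otimes> (g1 \<otimes> g)"
          using zG g g1(1) by (simp add: e_def group_normalize)
        also have "\<dots> = g1 \<otimes> (z \<otimes> g)" unfolding ze using zG g g1(1) by (simp add: group_normalize)
        finally have "z \<otimes> g \<in> S" using zG g by (simp add: S_def centralizer_def)
        then show ?thesis using z(1) by blast
      qed
      ultimately show ?thesis using S by blast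
    qed
  qed
qed

text \<open>Writing \<open>g = z \<otimes> s\<close> with \<open>z\<close> in \<open>Z\<close> and
  \<open>s\<close> in the complement, the isomorphism takes \<open>g\<close> to
  \<open>(f z, u g)\<close>. Since \<open>Z\<close> is open, compact and of finite index, continuity
  is checked on its cosets and \<open>G\<close> is compact; a continuous bijection onto a Hausdorff
  space is then a homeomorphism.\<close>

theorem isomorphic_semidirect:
  assumes cZ: "centralizer G Z = Z" and fin: "finite (carrier (G Mod Z))"
  shows "topologically_isomorphic G \<tau> (padic_semidirect p (u ` carrier G)) (padic_semidirect_topology p (u ` carrier G))"
proof -
  obtain S where S: "subgroup S G" "S \<inter> Z = {\<one>}" "\<forall>g\<in>carrier G. \<exists>z\<in>Z. z \<otimes> g \<in> S"
    using complement_exists[OF cZ fin] by blast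
  have SG: "s \<in> carrier G" if "s \<in> S" for s using that S(1) by (simp add: subgroup.mem_carrier)
  have S_unique: "s = t" if s: "s \<in> S" and t: "t \<in> S" and Z: "s \<otimes> inv t \<in> Z" for s t
  proof -
    have "s \<otimes> inv t \<in> S" by (rule subgroup_div_closed[OF S(1) s t])
    then have "s \<otimes> inv t = \<one>" using Z S(2) by blast
    then show ?thesis using s t SG by (simp add: mult_inv_eq_one_iff)
  qed
  \<comment> \<open>The projection to the complement; the factor in \<open>Z\<close> is
    \<open>g \<otimes> inv (\<sigma> g)\<close>.\<close>
  define \<sigma> where "\<sigma> g = (SOME s. s \<in> S \<and> g \<otimes> inv s \<in> Z)" for g
  have \<sigma>: "\<sigma> g \<in> S" "g \<otimes> inv (\<sigma> g) \<in> Z" if g: "g \<in> carrier G" for g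
  proof -
    obtain z where z: "z \<in> Z" "z \<otimes> g \<in> S" using S(3) g by blast
    have "g \<otimes> inv (z \<otimes> g) = inv z" using z Z_carrier g by (simp add: group_normalize)
    then have "z \<otimes> g \<in> S \<and> g \<otimes> inv (z \<otimes> g) \<in> Z" using z subgroup.m_inv_closed[OF Zs] by simp
    then have "\<sigma> g \<in> S \<and> g \<otimes> inv (\<sigma> g) \<in> Z" unfolding \<sigma>_def by (rule someI)
    then show "\<sigma> g \<in> S" "g \<otimes> inv (\<sigma> g) \<in> Z" by auto
  qed
  have \<sigma>_eq: "\<sigma> (z \<otimes> s) = s" if z: "z \<in> Z" and s: "s \<in> S" for z s
  proof -
    have G: "z \<in> carrier G" "s \<in> carrier G" using z s Z_carrier SG by auto
    have g: "z \<otimes> s \<in> carrier G" using G by simp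
    have \<sigma>G: "\<sigma> (z \<otimes> s) \<in> carrier G" using \<sigma>(1)[OF g] SG by blast
    have "inv z \<otimes> ((z \<otimes> s) \<otimes> inv (\<sigma> (z \<otimes> s))) \<in> Z"
      by (rule subgroup.m_closed[OF Zs subgroup.m_inv_closed[OF Zs z] \<sigma>(2)[OF g]])
    then have "s \<otimes> inv (\<sigma> (z \<otimes> s)) \<in> Z" using G \<sigma>G by (simp add: m_assoc mult_inv_cancel_left)
    then show ?thesis using S_unique[OF s \<sigma>(1)[OF g]] by simp
  qed
  have decomp: "\<exists>z\<in>Z. \<exists>s\<in>S. g = z \<otimes> s" if g: "g \<in> carrier G" for g
    using \<sigma>[OF g] g SG by (intro bexI[of _ "g \<otimes> inv (\<sigma> g)"] bexI[of _ "\<sigma> g"]) (auto simp: m_assoc)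
  define h where "h g = (f (g \<otimes> inv (\<sigma> g)), u g)" for g
  have u_Z: "u z = \<one>\<^bsub>padic_int p\<^esub>" if "z \<in> Z" for z
    using u_eq_iff[of z \<one>] that Z_carrier cZ u_one by simp
  interpret R: cring "padic_int p" by (rule padic_cring[OF p_pos])
  have u_zs: "u (z \<otimes> s) = u s" if "z \<in> Z" "s \<in> S" for z s
    using u_mult[of z s] u_Z that Z_carrier SG u_closed by simp
  have h_zs: "h (z \<otimes> s) = (f z, u s)" if "z \<in> Z" "s \<in> S" for z s
    using \<sigma>_eq[OF that] u_zs[OF that] that Z_carrier SG by (simp add: h_def m_assoc)
  let ?F = "u ` carrier G"
  have h_closed: "h g \<in> carrier (padic_semidirect p ?F)" if "g \<in> carrier G" for g
    using \<sigma>(2)[OF that] f_closed that by (auto simp: h_def padic_semidirect_def)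
  have "h (a \<otimes> b) = h a \<otimes>\<^bsub>padic_semidirect p ?F\<^esub> h b" if ab: "a \<in> carrier G" "b \<in> carrier G" for a b
  proof -
    obtain z s w t where *: "z \<in> Z" "s \<in> S" "a = z \<otimes> s" "w \<in> Z" "t \<in> S" "b = w \<otimes> t"
      using decomp[OF ab(1)] decomp[OF ab(2)] by blast
    have G: "z \<in> carrier G" "s \<in> carrier G" "w \<in> carrier G" "t \<in> carrier G" using * Z_carrier SG by auto
    have st: "s \<otimes> t \<in> S" using * S(1) by (simp add: subgroup.m_closed)
    have sw: "s \<otimes> w \<otimes> inv s \<in> Z" by (rule conj_Z[OF G(2) *(4)])
    have "a \<otimes> b = (z \<otimes> (s \<otimes> w \<otimes> inv s)) \<otimes> (s \<otimes> t)" using G by (simp add: * group_normalize)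
    moreover have "z \<otimes> (s \<otimes> w \<otimes> inv s) \<in> Z" by (rule subgroup.m_closed[OF Zs *(1) sw])
    ultimately have "h (a \<otimes> b) = (f (z \<otimes> (s \<otimes> w \<otimes> inv s)), u (s \<otimes> t))" using h_zs st by simp
    also have "\<dots> = (f z \<oplus>\<^bsub>padic_int p\<^esub> (u s \<otimes>\<^bsub>padic_int p\<^esub> f w), u s \<otimes>\<^bsub>padic_int p\<^esub> u t)"
      using f_mult[OF *(1) sw] f_conj[OF G(2) *(4)] u_mult[OF G(2,4)] by simp
    also have "\<dots> = h a \<otimes>\<^bsub>padic_semidirect p ?F\<^esub> h b"
      using h_zs *(1-6) by (simp add: padic_semidirect_def)
    finally show ?thesis .
  qed
  moreover have bij: "bij_betw h (carrier G) (carrier (padic_semidirect p ?F))"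
    unfolding bij_betw_def
  proof (intro conjI equalityI subsetI inj_onI)
    fix a b assume ab: "a \<in> carrier G" "b \<in> carrier G" "h a = h b"
    obtain z s w t where *: "z \<in> Z" "s \<in> S" "a = z \<otimes> s" "w \<in> Z" "t \<in> S" "b = w \<otimes> t"
      using decomp[OF ab(1)] decomp[OF ab(2)] by blast
    have "f z = f w" "u s = u t" using ab(3) h_zs * by auto
    then have "z = w" "s \<otimes> inv t \<in> Z" using f_inj * u_eq_iff[of s t] SG cZ by auto
    then show "a = b" using S_unique * by metis
  next
    fix q assume "q \<in> h ` carrier G"
    then show "q \<in> carrier (padic_semidirect p ?F)" using h_closed by blast
  next
    fix q assume "q \<in> carrier (padic_semidirect p ?F)"
    then obtain x g where q: "q = (x, u g)" "x \<in> carrier (padic_int p)" "g \<in> carrier G" by (auto simp: padic_semidirect_def)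
    obtain z where z: "z \<in> Z" "f z = x" by (rule imageE[of x f Z]) (simp_all add: bij_betw_imp_surj_on[OF f_bij] q(2))
    obtain w s where ws: "w \<in> Z" "s \<in> S" "g = w \<otimes> s" using decomp[OF q(3)] by blast
    have "h (z \<otimes> s) = q" using h_zs[OF z(1) ws(2)] u_zs[OF ws(1,2)] ws(3) z(2) q(1) by simp
    moreover have "z \<otimes> s \<in> carrier G" using z ws Z_carrier SG by simp
    ultimately show "q \<in> h ` carrier G" by blast
  qed
  ultimately have iso_h: "h \<in> iso G (padic_semidirect p ?F)" using h_closed by (auto simp: iso_def hom_def)
  have Z_coset: "openin \<tau> {x \<in> carrier G. x \<otimes> inv s \<in> V}"
    if V: "openin \<tau> V" and s: "s \<in> carrier G" for V s
    by (rule openin_preimage[OF continuous_map_rmult V]) (use s in simp)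
  have S_fin: "finite S"
  proof (rule inj_on_finite[OF _ _ fin])
    show "(\<lambda>s. Z #> s) ` S \<subseteq> carrier (G Mod Z)" using SG by (auto simp: carrier_FactGroup)
    show "inj_on (\<lambda>s. Z #> s) S"
    proof (rule inj_onI)
      fix s t assume st: "s \<in> S" "t \<in> S" "Z #> s = Z #> t"
      then have "s \<otimes> inv t \<in> Z" using rcoset_eq_iff[OF Zn SG SG] by blast
      then show "s = t" by (rule S_unique[OF st(1,2)])
    qed
  qed
  have Z_open: "openin \<tau> Z"
  proof -
    \<comment> \<open>The cosets of \<open>Z\<close> other than \<open>Z\<close> itself are closed
      and finite in number.\<close>
    have *: "closedin \<tau> (\<Union>s\<in>S - {\<one>}. {x \<in> carrier G. x \<otimes> inv s \<in> Z})"
      using S_fin SG by (intro closedin_Union) (auto intro!: closedin_preimage[OF continuous_map_rmult Zc])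
    have eq: "Z = carrier G - (\<Union>s\<in>S - {\<one>}. {x \<in> carrier G. x \<otimes> inv s \<in> Z})"
    proof (intro equalityI subsetI)
      fix z assume z: "z \<in> Z"
      have "s = \<one>" if s: "s \<in> S" "z \<otimes> inv s \<in> Z" for s
      proof -
        have "z \<in> carrier G" "s \<in> carrier G" using z s Z_carrier SG by auto
        moreover have "inv z \<otimes> (z \<otimes> inv s) \<in> Z" by (rule subgroup.m_closed[OF Zs subgroup.m_inv_closed[OF Zs z] s(2)])
        ultimately have "inv s \<in> Z" by (simp add: mult_inv_cancel_left)
        then have "\<one> \<otimes> inv s \<in> Z" using \<open>s \<in> carrier G\<close> by simp
        then show ?thesis using S_unique[OF subgroup.one_closed[OF S(1)] s(1)] by simp
      qed
      then show "z \<in> carrier G - (\<Union>s\<in>S - {\<one>}. {x \<in> carrier G. x \<otimes> inv s \<in> Z})" using z Z_carrier by blast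
    next
      fix x assume x: "x \<in> carrier G - (\<Union>s\<in>S - {\<one>}. {x \<in> carrier G. x \<otimes> inv s \<in> Z})"
      then have xG: "x \<in> carrier G" by blast
      then have "\<sigma> x = \<one>" using \<sigma>[OF xG] x by blast
      then show "x \<in> Z" using \<sigma>(2)[OF xG] xG by simp
    qed
    show ?thesis by (subst eq) (rule openin_diff[OF openin_topspace *, unfolded topspace_eq])
  qed
  \<comment> \<open>Openness is tested on cosets: around each of its points the set must contain the
    translate by \<open>\<sigma> g\<close> of an open subset of \<open>Z\<close>. This serves both
    coordinates of \<open>h\<close>, because \<open>\<sigma>\<close> is constant on each
    coset.\<close>
  have pre: "openin \<tau> {g \<in> carrier G. P g}"
    if P: "\<And>g. g \<in> carrier G \<Longrightarrow> P g \<Longrightarrow> \<exists>V. openin \<tau> V \<and> V \<subseteq> Z \<and> g \<otimes> inv (\<sigma> g) \<in> V \<and>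
        (\<forall>z\<in>V. P (z \<otimes> \<sigma> g))" for P
  proof (subst openin_subopen, intro ballI)
    fix g assume "g \<in> {g \<in> carrier G. P g}"
    then have g: "g \<in> carrier G" "P g" by auto
    then obtain V where V: "openin \<tau> V" "V \<subseteq> Z" "g \<otimes> inv (\<sigma> g) \<in> V" "\<forall>z\<in>V. P (z \<otimes> \<sigma> g)" using P by blast
    have sG: "\<sigma> g \<in> carrier G" using \<sigma>(1)[OF g(1)] SG by blast
    have "{x \<in> carrier G. x \<otimes> inv (\<sigma> g) \<in> V} \<subseteq> {g \<in> carrier G. P g}"
    proof
      fix x assume "x \<in> {x \<in> carrier G. x \<otimes> inv (\<sigma> g) \<in> V}"
      then have x: "x \<in> carrier G" "P ((x \<otimes> inv (\<sigma> g)) \<otimes> \<sigma> g)" using V(4) by auto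
      then show "x \<in> {g \<in> carrier G. P g}" using sG by (simp add: m_assoc)
    qed
    moreover have "g \<in> {x \<in> carrier G. x \<otimes> inv (\<sigma> g) \<in> V}" using g V(3) by simp
    ultimately show "\<exists>T. openin \<tau> T \<and> g \<in> T \<and> T \<subseteq> {g \<in> carrier G. P g}" using Z_coset[OF V(1) sG] by blast
  qed
  have cf: "continuous_map (subtopology \<tau> Z) (padic_topology p) f"
    using iso homeomorphic_imp_continuous_map by (auto simp: padic_isomorphism_def)
  have c1: "continuous_map \<tau> (padic_topology p) (fst \<circ> h)"
    unfolding continuous_map_def
  proof (intro conjI allI impI)
    show "fst \<circ> h \<in> topspace \<tau> \<rightarrow> topspace (padic_topology p)"
      using \<sigma>(2) f_closed by (auto simp: h_def topspace_padic_topology[OF p_pos])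
    fix W assume W: "openin (padic_topology p) W"
    define V where "V = {z \<in> Z. f z \<in> W}"
    have "topspace (subtopology \<tau> Z) = Z" using Z_carrier by auto
    then have "openin (subtopology \<tau> Z) V"
      using openin_continuous_map_preimage[OF cf W] by (simp add: V_def)
    then have V: "openin \<tau> V" using Z_open openin_trans_full by blast
    have "openin \<tau> {g \<in> carrier G. f (g \<otimes> inv (\<sigma> g)) \<in> W}"
    proof (rule pre)
      fix g assume g: "g \<in> carrier G" "f (g \<otimes> inv (\<sigma> g)) \<in> W"
      have "f ((z \<otimes> \<sigma> g) \<otimes> inv (\<sigma> (z \<otimes> \<sigma> g))) \<in> W" if "z \<in> V" for z
        using that \<sigma>_eq[OF _ \<sigma>(1)[OF g(1)], of z] \<sigma>(1)[OF g(1)] SG Z_carrier by (simp add: V_def m_assoc)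
      then show "\<exists>V. openin \<tau> V \<and> V \<subseteq> Z \<and> g \<otimes> inv (\<sigma> g) \<in> V \<and>
          (\<forall>z\<in>V. f ((z \<otimes> \<sigma> g) \<otimes> inv (\<sigma> (z \<otimes> \<sigma> g))) \<in> W)"
        using V g \<sigma>(2)[OF g(1)] by (intro exI[of _ V]) (auto simp: V_def)
    qed
    then show "openin \<tau> {g \<in> topspace \<tau>. (fst \<circ> h) g \<in> W}" by (simp add: h_def)
  qed
  have top_F: "topspace (subtopology (padic_topology p) ?F) = ?F"
    using u_closed by (auto simp: topspace_padic_topology[OF p_pos])
  have c2: "continuous_map \<tau> (subtopology (padic_topology p) ?F) (snd \<circ> h)"
    unfolding continuous_map_def top_F
  proof (intro conjI allI impI)
    show "snd \<circ> h \<in> topspace \<tau> \<rightarrow> ?F" by (auto simp: h_def)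
    fix W assume "openin (subtopology (padic_topology p) ?F) W"
    have "openin \<tau> {g \<in> carrier G. u g \<in> W}"
    proof (rule pre)
      fix g assume g: "g \<in> carrier G" "u g \<in> W"
      have "u (z \<otimes> \<sigma> g) = u g" if "z \<in> Z" for z
      proof -
        have "u ((g \<otimes> inv (\<sigma> g)) \<otimes> \<sigma> g) = u (\<sigma> g)" by (rule u_zs[OF \<sigma>(2,1)[OF g(1)]])
        then have "u g = u (\<sigma> g)" using g(1) \<sigma>(1)[OF g(1)] SG by (simp add: m_assoc)
        then show ?thesis using u_zs[OF that \<sigma>(1)[OF g(1)]] by simp
      qed
      then show "\<exists>V. openin \<tau> V \<and> V \<subseteq> Z \<and> g \<otimes> inv (\<sigma> g) \<in> V \<and> (\<forall>z\<in>V. u (z \<otimes> \<sigma> g) \<in> W)"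
        using Z_open \<sigma>(2)[OF g(1)] g(2) by (intro exI[of _ Z]) auto
    qed
    then show "openin \<tau> {g \<in> topspace \<tau>. (snd \<circ> h) g \<in> W}" by (simp add: h_def)
  qed
  have cont: "continuous_map \<tau> (padic_semidirect_topology p ?F) h"
    unfolding padic_semidirect_topology_def continuous_map_pairwise using c1 c2 by blast
  have comp: "compact_space \<tau>"
  proof -
    have "compact_space (subtopology \<tau> Z)" using monothetic.compact[OF mono] .
    then have "compactin \<tau> Z" using Z_carrier by (auto simp: compactin_subspace)
    then have "compactin \<tau> (\<Union>s\<in>S. (\<lambda>z. z \<otimes> s) ` Z)"
      using S_fin SG by (intro compactin_Union) (auto intro!: image_compactin continuous_map_rmult)
    moreover have "(\<Union>s\<in>S. (\<lambda>z. z \<otimes> s) ` Z) = carrier G" using decomp Z_carrier SG by blast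
    ultimately show ?thesis by (simp add: compact_space_def)
  qed
  have "Hausdorff_space (padic_semidirect_topology p ?F)"
    unfolding padic_semidirect_topology_def
    by (simp add: Hausdorff_space_prod_topology Hausdorff_space_subtopology Hausdorff_padic_topology p_pos)
  moreover have "topspace (padic_semidirect_topology p ?F) = carrier (padic_semidirect p ?F)"
    unfolding padic_semidirect_topology_def topspace_prod_topology top_F
    by (simp add: padic_semidirect_def topspace_padic_topology[OF p_pos])
  ultimately have "homeomorphic_map \<tau> (padic_semidirect_topology p ?F) h"
    by (intro continuous_imp_homeomorphic_map[OF cont comp]) (use bij in \<open>auto simp: bij_betw_def\<close>)
  then show ?thesis using iso_h unfolding topologically_isomorphic_def by blast
qed

end

subsection \<open>Total minimality of the semidirect product\<close>

lemma (in topgroup) finite_imp_discrete: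
  assumes "finite (carrier G)"
  shows "\<tau> = discrete_topology (carrier G)"
proof -
  have "openin \<tau> {x}" if "x \<in> carrier G" for x
  proof -
    have "openin \<tau> (carrier G - (carrier G - {x}))"
      using closedin_finite[of "carrier G - {x}"] assms by (simp add: closedin_def)
    moreover have "carrier G - (carrier G - {x}) = {x}" using that by blast
    ultimately show ?thesis by simp
  qed
  then have "discrete_topology (carrier G) = \<tau>" by (simp add: discrete_topology_unique)
  then show ?thesis by simp
qed

lemma finite_discrete_minimal_group:
  assumes "group G" "finite (carrier G)"
  shows "minimal_group G (discrete_topology (carrier G))"
proof -
  interpret group G by fact
  have "topological_group G (discrete_topology (carrier G))"
    unfolding topological_group_def
    by (auto simp: is_group prod_topology_discrete_topology[symmetric])
  moreover have "\<sigma> = discrete_topology (carrier G)" if "topological_group G \<sigma>" for \<sigma>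
  proof -
    interpret S: topgroup G \<sigma> using that by unfold_locales
    show ?thesis by (rule S.finite_imp_discrete[OF assms(2)])
  qed
  ultimately show ?thesis unfolding minimal_group_def by blast
qed

text \<open>A closed normal subgroup of finite index is open, and the discrete topology is the only
  Hausdorff group topology of a finite group.\<close>

lemma (in topgroup) minimal_group_finite_quotient:
  assumes N: "N \<lhd> G" "closedin \<tau> N" and fin: "finite (carrier (G Mod N))"
  shows "minimal_group (G Mod N) (quotient_group_topology G \<tau> N)"
proof -
  have closed: "closedin \<tau> {x \<in> carrier G. N #> x \<in> W}" if "W \<subseteq> carrier (G Mod N)" for W
  proof -
    have "closedin \<tau> {x \<in> carrier G. N #> x = C}" if C: "C \<in> W" for C
    proof -
      obtain g where g: "g \<in> carrier G" "C = N #> g" using C \<open>W \<subseteq> carrier (G Mod N)\<close> by (auto simp: carrier_FactGroup)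
      have "{x \<in> carrier G. N #> x = C} = {x \<in> carrier G. x \<otimes> inv g \<in> N}" using g rcoset_eq_iff[OF N(1)] by auto
      moreover have "closedin \<tau> {x \<in> carrier G. x \<otimes> inv g \<in> N}"
        by (rule closedin_preimage[OF continuous_map_rmult N(2)]) (use g in simp)
      ultimately show ?thesis by simp
    qed
    then have "closedin \<tau> (\<Union>C\<in>W. {x \<in> carrier G. N #> x = C})"
      using finite_subset[OF that fin] by (intro closedin_Union) auto
    moreover have "(\<Union>C\<in>W. {x \<in> carrier G. N #> x = C}) = {x \<in> carrier G. N #> x \<in> W}" by blast
    ultimately show ?thesis by simp
  qed
  have "openin (quotient_group_topology G \<tau> N) {C}" if C: "C \<in> carrier (G Mod N)" for C
  proof -
    have "closedin \<tau> {x \<in> carrier G. N #> x \<in> carrier (G Mod N) - {C}}" by (rule closed) blast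
    then have "openin \<tau> (carrier G - {x \<in> carrier G. N #> x \<in> carrier (G Mod N) - {C}})" by (simp add: closedin_def)
    moreover have "carrier G - {x \<in> carrier G. N #> x \<in> carrier (G Mod N) - {C}} = {x \<in> carrier G. N #> x \<in> {C}}"
      by (auto simp: carrier_FactGroup)
    ultimately show ?thesis using C by (simp add: openin_quotient_group_topology)
  qed
  then have "discrete_topology (carrier (G Mod N)) = quotient_group_topology G \<tau> N"
    by (simp add: discrete_topology_unique topspace_quotient)
  then show ?thesis
    using finite_discrete_minimal_group[OF normal.factorgroup_is_group[OF N(1)] fin] by simp
qed

text \<open>
  The properties of the subgroups \<open>p ^ n Z\<^sub>p\<close> of \<open>K\<close> that are inherited by the traces
  on arbitrary subgroups. The map \<open>c n\<close> separates cosets of \<open>A n\<close> and has finite range.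
\<close>

locale padic_filtration = topgroup +
  fixes A :: "nat \<Rightarrow> 'a set" and c :: "nat \<Rightarrow> 'a \<Rightarrow> 'c"
  assumes A_subgroup: "subgroup (A n) G"
    and A_decreasing: "A (Suc n) \<subseteq> A n"
    and A_base: "openin \<tau> U \<Longrightarrow> \<one> \<in> U \<Longrightarrow> \<exists>n. A n \<subseteq> U"
    and A_open: "openin \<tau> (A n)"
    and c_finite: "finite (c n ` carrier G)"
    and c_coset: "g \<in> carrier G \<Longrightarrow> h \<in> carrier G \<Longrightarrow> c n g = c n h \<Longrightarrow> g \<otimes> inv h \<in> A n"
    and A_conj: "a \<in> A 0 \<Longrightarrow> g \<in> carrier G \<Longrightarrow> g \<otimes> a \<otimes> inv g \<in> A 0"
    and A_commute: "a \<in> A 0 \<Longrightarrow> b \<in> A 0 \<Longrightarrow> a \<otimes> b = b \<otimes> a"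
    and A_centralizer: "a \<in> A 0 \<Longrightarrow> a \<noteq> \<one> \<Longrightarrow> g \<in> carrier G \<Longrightarrow> g \<otimes> a = a \<otimes> g \<Longrightarrow> g \<in> A 0"
    and A_power: "a \<in> A 0 \<Longrightarrow> a \<noteq> \<one> \<Longrightarrow> \<exists>j::nat. a [^] j \<in> A n \<and> a [^] j \<noteq> \<one>"
    and A_approx: "a \<in> A 0 \<Longrightarrow> a \<notin> A (Suc k) \<Longrightarrow> h \<in> A k \<Longrightarrow> \<exists>j::int. h \<otimes> inv (a [^] j) \<in> A n"
begin

lemma A_antimono: "m \<le> n \<Longrightarrow> A n \<subseteq> A m"
  by (induction n rule: dec_induct) (use A_decreasing in blast)+

lemma A_carrier: "a \<in> A n \<Longrightarrow> a \<in> carrier G"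
  using A_subgroup by (meson subgroup.mem_carrier)

lemma finite_carrier:
  assumes "A 0 = {\<one>}"
  shows "finite (carrier G)"
proof (rule finite_imageD[OF c_finite[of 0]], rule inj_onI)
  fix g h assume *: "g \<in> carrier G" "h \<in> carrier G" "c 0 g = c 0 h"
  then have "g \<otimes> inv h = \<one>" using c_coset[OF *] assms by blast
  then show "g = h" using * by (simp add: mult_inv_eq_one_iff)
qed

text \<open>Here \<open>m\<close> is the valuation of \<open>x\<close>; it is finite because the
  sets \<open>A n\<close> are arbitrarily small and the topology is Hausdorff.\<close>

lemma last_index:
  assumes x: "x \<in> A k" "x \<noteq> \<one>"
  obtains m where "k \<le> m" "x \<in> A m" "x \<notin> A (Suc m)"
proof -
  have xG: "x \<in> carrier G" using A_carrier x(1) by blast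
  obtain V where V: "openin \<tau> V" "\<one> \<in> V" "\<forall>v\<in>V. \<forall>w\<in>V. v \<otimes> w \<noteq> x" using nbhd_exclude[OF xG x(2)] by blast
  obtain n where n: "A n \<subseteq> V" using A_base[OF V(1,2)] by blast
  have "x \<notin> A n"
  proof
    assume "x \<in> A n"
    then have "x \<otimes> \<one> \<noteq> x" using V(2,3) n by blast
    then show False using xG by simp
  qed
  then have P: "x \<notin> A (LEAST n. x \<notin> A n)" by (rule LeastI)
  define m where "m = (LEAST n. x \<notin> A n)"
  have "k < m"
  proof (rule ccontr)
    assume "\<not> k < m"
    then show False using A_antimono[of m k] x(1) P by (auto simp: m_def)
  qed
  then obtain l where l: "m = Suc l" by (cases m) auto
  have "x \<in> A l" using not_less_Least[of l "\<lambda>n. x \<notin> A n"] l by (simp add: m_def)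
  then show ?thesis using that[of l] \<open>k < m\<close> l P by (simp add: m_def)
qed

text \<open>\<open>B\<close> is the \<sigma>-closure of some \<open>A n\<close> so small that the
  closure misses a chosen nontrivial \<open>x\<close> in \<open>A k\<close>. Commuting with
  \<open>x\<close> survives the closure, so \<open>B\<close> lies in \<open>A 0\<close>. An element
  of \<open>B\<close> with valuation at most that of \<open>x\<close> would have powers
  approximating \<open>x\<close> up to elements of \<open>A n\<close>, and \<open>x\<close> would be
  in \<open>B\<close>. Hence \<open>B\<close> is contained in \<open>A k\<close>; being closed of
  finite index, it is open.\<close>

lemma coarser_nbhd:
  assumes \<sigma>: "topological_group G \<sigma>" "\<And>U. openin \<sigma> U \<Longrightarrow> openin \<tau> U" and x0: "x0 \<in> A 0" "x0 \<noteq> \<one>"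
  shows "\<exists>B. openin \<sigma> B \<and> \<one> \<in> B \<and> B \<subseteq> A k"
proof -
  interpret S: topgroup G \<sigma> using \<sigma>(1) by unfold_locales
  obtain j :: nat where "x0 [^] j \<in> A k" "x0 [^] j \<noteq> \<one>" using A_power[OF x0] by blast
  then obtain x where x: "x \<in> A k" "x \<noteq> \<one>" by blast
  obtain m where m: "k \<le> m" "x \<in> A m" "x \<notin> A (Suc m)" by (rule last_index[OF x])
  have x_0: "x \<in> A 0" using A_antimono[of 0 m] m(2) by auto
  have xG: "x \<in> carrier G" using A_carrier x_0 by blast
  obtain V where V: "openin \<sigma> V" "\<one> \<in> V" "\<forall>v\<in>V. inv v \<in> V" "\<forall>v\<in>V. \<forall>w\<in>V. v \<otimes> w \<noteq> x"
    using S.nbhd_exclude[OF xG x(2)] by blast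
  obtain n where n: "A n \<subseteq> V" using A_base[OF \<sigma>(2)[OF V(1)] V(2)] by blast
  define B where "B = \<sigma> closure_of (A n)"
  have AG: "A n \<subseteq> carrier G" using A_carrier by blast
  have Bs: "subgroup B G" unfolding B_def by (rule S.subgroup_closure[OF A_subgroup])
  have AB: "A n \<subseteq> B" unfolding B_def using AG by (simp add: closure_of_subset)
  have Bc: "closedin \<sigma> B" by (simp add: B_def)
  have xB: "x \<notin> B"
  proof
    assume "x \<in> B"
    then obtain s where s: "s \<in> A n" "inv x \<otimes> s \<in> V" using S.in_closure_iff[OF xG AG] V(1,2) unfolding B_def by blast
    have sG: "s \<in> carrier G" using s(1) AG by blast
    have "s \<otimes> inv (inv x \<otimes> s) = x" using sG xG by (simp add: group_normalize)
    moreover have "s \<otimes> inv (inv x \<otimes> s) \<noteq> x" using V(3,4) s n by blast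
    ultimately show False by simp
  qed
  have "A n \<subseteq> centralizer G {x}"
    using A_antimono[of 0 n] A_commute[OF _ x_0] AG by (auto simp: centralizer_def)
  then have "B \<subseteq> centralizer G {x}"
    unfolding B_def by (rule closure_of_minimal) (use S.closedin_centralizer xG in simp)
  then have B0: "B \<subseteq> A 0" using A_centralizer[OF x_0 x(2)] by (auto simp: centralizer_def)
  have "B \<subseteq> A (Suc m)"
  proof (rule ccontr)
    assume "\<not> B \<subseteq> A (Suc m)"
    then obtain b where b: "b \<in> B" "b \<notin> A (Suc m)" by blast
    obtain j :: int where j: "x \<otimes> inv (b [^] j) \<in> A n" using A_approx[of b m x n] b B0 m(2) by blast
    have bj: "b [^] j \<in> B" using subgroup_int_pow_closed[OF Bs b(1)] .
    have bG: "b [^] j \<in> carrier G" using bj Bs by (simp add: subgroup.mem_carrier)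
    have "x \<otimes> inv (b [^] j) \<otimes> b [^] j \<in> B" using subgroup.m_closed[OF Bs _ bj] j AB by blast
    then show False using xB xG bG by (simp add: m_assoc)
  qed
  then have "B \<subseteq> A k" using A_antimono[of k "Suc m"] m(1) by auto
  moreover have "openin \<sigma> B"
  proof -
    \<comment> \<open>Finitely many elements that realize all values of \<open>c n\<close>; they
      represent all cosets of \<open>A n\<close> and therefore all cosets of
      \<open>B\<close>.\<close>
    obtain T where T: "T \<subseteq> carrier G" "finite T" "c n ` carrier G = c n ` T"
      using finite_subset_image[OF c_finite[of n], of "c n" "carrier G"] by blast
    have *: "closedin \<sigma> (\<Union>t\<in>T - B. {g \<in> carrier G. g \<otimes> inv t \<in> B})"
      using T(1,2) by (intro closedin_Union) (auto intro!: S.closedin_preimage[OF S.continuous_map_rmult Bc])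
    have eq: "B = carrier G - (\<Union>t\<in>T - B. {g \<in> carrier G. g \<otimes> inv t \<in> B})"
    proof (intro equalityI subsetI)
      fix b assume b: "b \<in> B"
      have bG: "b \<in> carrier G" using b Bs by (simp add: subgroup.mem_carrier)
      have "t \<in> B" if t: "t \<in> T" "b \<otimes> inv t \<in> B" for t
      proof -
        have "inv (b \<otimes> inv t) \<otimes> b \<in> B" by (intro subgroup.m_closed[OF Bs] subgroup.m_inv_closed[OF Bs] t(2) b)
        then show ?thesis using t(1) T(1) bG by (auto simp: group_normalize subset_iff)
      qed
      then show "b \<in> carrier G - (\<Union>t\<in>T - B. {g \<in> carrier G. g \<otimes> inv t \<in> B})" using bG by blast
    next
      fix g assume g: "g \<in> carrier G - (\<Union>t\<in>T - B. {g \<in> carrier G. g \<otimes> inv t \<in> B})"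
      then have gG: "g \<in> carrier G" by blast
      obtain t where t: "t \<in> T" "c n g = c n t" using T(3) gG by blast
      have tG: "t \<in> carrier G" using t(1) T(1) by blast
      have gt: "g \<otimes> inv t \<in> B" using c_coset[OF gG tG t(2)] AB by blast
      then have "t \<in> B" using g t(1) gG by blast
      then have "g \<otimes> inv t \<otimes> t \<in> B" by (rule subgroup.m_closed[OF Bs gt])
      then show "g \<in> B" using gG tG by (simp add: m_assoc)
    qed
    show ?thesis by (subst eq) (rule openin_diff[OF openin_topspace *, unfolded S.topspace_eq])
  qed
  ultimately show ?thesis using subgroup.one_closed[OF Bs] by blast
qed

lemma minimal: "minimal_group G \<tau>"
proof (cases "A 0 = {\<one>}")
  case True
  then show ?thesis
    using finite_discrete_minimal_group[OF is_group] finite_imp_discrete finite_carrier by metis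
next
  case False
  then obtain x0 where x0: "x0 \<in> A 0" "x0 \<noteq> \<one>" using subgroup.one_closed[OF A_subgroup[of 0]] by blast
  have "\<sigma> = \<tau>" if \<sigma>: "topological_group G \<sigma>" "\<And>U. openin \<sigma> U \<Longrightarrow> openin \<tau> U" for \<sigma>
  proof -
    interpret S: topgroup G \<sigma> using \<sigma>(1) by unfold_locales
    have "openin \<sigma> U" if U: "openin \<tau> U" for U
    proof (subst openin_subopen, intro ballI)
      fix u assume u: "u \<in> U"
      have uG: "u \<in> carrier G" using openin_carrier[OF U] u by blast
      have "openin \<tau> {y \<in> carrier G. y \<otimes> u \<in> U}" by (rule openin_preimage[OF continuous_map_rmult[OF uG] U])
      moreover have "\<one> \<in> {y \<in> carrier G. y \<otimes> u \<in> U}" using uG u by simp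
      ultimately obtain k where k: "A k \<subseteq> {y \<in> carrier G. y \<otimes> u \<in> U}" using A_base by blast
      obtain B where B: "openin \<sigma> B" "\<one> \<in> B" "B \<subseteq> A k" using coarser_nbhd[OF \<sigma> x0, of k] by blast
      have "openin \<sigma> {g \<in> carrier G. g \<otimes> inv u \<in> B}"
        by (rule S.openin_preimage[OF S.continuous_map_rmult B(1)]) (use uG in simp)
      moreover have "u \<in> {g \<in> carrier G. g \<otimes> inv u \<in> B}" using uG B(2) by simp
      moreover have "{g \<in> carrier G. g \<otimes> inv u \<in> B} \<subseteq> U"
      proof
        fix g assume "g \<in> {g \<in> carrier G. g \<otimes> inv u \<in> B}"
        then have "g \<in> carrier G" "g \<otimes> inv u \<otimes> u \<in> U" using B(3) k by auto
        then show "g \<in> U" using uG by (simp add: m_assoc)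
      qed
      ultimately show "\<exists>T. openin \<sigma> T \<and> u \<in> T \<and> T \<subseteq> U" by blast
    qed
    then show ?thesis using \<sigma>(2) by (auto simp: topology_eq)
  qed
  then show ?thesis unfolding minimal_group_def using top_group by blast
qed

lemma finite_quotient:
  assumes N: "N \<lhd> G" and k: "A k \<subseteq> N"
  shows "finite (carrier (G Mod N))"
proof -
  obtain T where T: "T \<subseteq> carrier G" "finite T" "c k ` carrier G = c k ` T"
    using finite_subset_image[OF c_finite[of k], of "c k" "carrier G"] by blast
  have "carrier (G Mod N) \<subseteq> (\<lambda>t. N #> t) ` T"
  proof
    fix C assume "C \<in> carrier (G Mod N)"
    then obtain g where g: "g \<in> carrier G" "C = N #> g" by (auto simp: carrier_FactGroup)
    obtain t where t: "t \<in> T" "c k g = c k t" using T(3) g(1) by blast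
    have tG: "t \<in> carrier G" using t(1) T(1) by blast
    have "g \<otimes> inv t \<in> N" using c_coset[OF g(1) tG t(2)] k by blast
    then have "C = N #> t" using rcoset_eq_iff[OF N g(1) tG] g(2) by simp
    then show "C \<in> (\<lambda>t. N #> t) ` T" using t(1) by blast
  qed
  then show ?thesis using T(2) finite_surj by blast
qed

text \<open>A nontrivial closed normal \<open>N\<close> turns out to have finite index. If it shares
  some \<open>x \<noteq> \<one>\<close> with \<open>A 0\<close>, powers of \<open>x\<close>
  approximate all elements of some \<open>A k\<close>, which is then inside the closed set
  \<open>N\<close>. If it does not, commutators of \<open>N\<close> with \<open>A 0\<close> are
  trivial; a nontrivial element of \<open>A 0\<close> would then put \<open>N\<close> into
  \<open>A 0\<close>, so \<open>A 0\<close> is trivial and the group is finite.\<close>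

lemma total_minimal: "totally_minimal G \<tau>"
  unfolding totally_minimal_def
proof (intro conjI allI impI top_group)
  fix N assume "N \<lhd> G \<and> closedin \<tau> N"
  then have N: "N \<lhd> G" "closedin \<tau> N" by auto
  have Ns: "subgroup N G" using N(1) by (simp add: normal_def)
  consider "N = {\<one>}" | x where "x \<in> N" "x \<in> A 0" "x \<noteq> \<one>" | "N \<inter> A 0 \<subseteq> {\<one>}" "N \<noteq> {\<one>}" by blast
  then show "minimal_group (G Mod N) (quotient_group_topology G \<tau> N)"
  proof cases
    case 1
    then show ?thesis using minimal minimal_group_quotient_trivial_iff by simp
  next
    case 2
    have xG: "x \<in> carrier G" using A_carrier 2(2) by blast
    obtain k where k: "x \<in> A k" "x \<notin> A (Suc k)" by (rule last_index[OF 2(2,3)])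
    have "A k \<subseteq> N"
    proof (rule subsetI, rule ccontr)
      fix h assume h: "h \<in> A k" "h \<notin> N"
      have hG: "h \<in> carrier G" using A_carrier h(1) by blast
      have "openin \<tau> {y \<in> carrier G. y \<otimes> h \<in> carrier G - N}"
        by (rule openin_preimage[OF continuous_map_rmult[OF hG]]) (use N(2) in \<open>simp add: closedin_def\<close>)
      moreover have "\<one> \<in> {y \<in> carrier G. y \<otimes> h \<in> carrier G - N}" using h(2) hG by simp
      ultimately obtain n where n: "A n \<subseteq> {y \<in> carrier G. y \<otimes> h \<in> carrier G - N}" using A_base by blast
      obtain j :: int where j: "h \<otimes> inv (x [^] j) \<in> A n" using A_approx[OF 2(2) k(2) h(1)] by blast
      have "inv (h \<otimes> inv (x [^] j)) \<in> A n" by (rule subgroup.m_inv_closed[OF A_subgroup j])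
      then have "inv (h \<otimes> inv (x [^] j)) \<otimes> h \<notin> N" using n by blast
      moreover have "inv (h \<otimes> inv (x [^] j)) \<otimes> h = x [^] j" using hG xG by (simp add: inv_mult_group m_assoc)
      ultimately show False using subgroup_int_pow_closed[OF Ns 2(1)] by simp
    qed
    then show ?thesis by (rule minimal_group_finite_quotient[OF N finite_quotient[OF N(1)]])
  next
    case 3
    then obtain y where y: "y \<in> N" "y \<noteq> \<one>" using subgroup.one_closed[OF Ns] by blast
    have yG: "y \<in> carrier G" using y(1) Ns by (simp add: subgroup.mem_carrier)
    have "a = \<one>" if a: "a \<in> A 0" for a
    proof (rule ccontr)
      assume a1: "a \<noteq> \<one>"
      have aG: "a \<in> carrier G" using A_carrier a by blast
      have "(y \<otimes> a \<otimes> inv y) \<otimes> inv a \<in> A 0"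
        by (intro subgroup.m_closed[OF A_subgroup] A_conj a yG subgroup.m_inv_closed[OF A_subgroup])
      moreover have "y \<otimes> (a \<otimes> inv y \<otimes> inv a) \<in> N"
        by (intro subgroup.m_closed[OF Ns] y(1) normal.inv_op_closed2[OF N(1) aG] subgroup.m_inv_closed[OF Ns])
      ultimately have "(y \<otimes> a) \<otimes> inv (a \<otimes> y) = \<one>" using 3(1) aG yG by (auto simp: group_normalize)
      then have "y \<otimes> a = a \<otimes> y" using aG yG by (simp add: mult_inv_eq_one_iff)
      then have "y \<in> A 0" by (rule A_centralizer[OF a a1 yG])
      then show False using 3(1) y by blast
    qed
    then have "A 0 \<subseteq> N" using subgroup.one_closed[OF Ns] by auto
    then show ?thesis by (rule minimal_group_finite_quotient[OF N finite_quotient[OF N(1)]])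
  qed
qed

text \<open>The existential axioms of the locale ask for powers of given elements, and these stay in
  \<open>H\<close>. This is the reason for stating approximation through integer exponents and not
  through scalars in Z_p.\<close>

lemma filtration_subgroup:
  assumes H: "subgroup H G"
  shows "padic_filtration (G\<lparr>carrier := H\<rparr>) (subtopology \<tau> H) (\<lambda>n. A n \<inter> H) c"
proof -
  interpret H: topgroup "G\<lparr>carrier := H\<rparr>" "subtopology \<tau> H" by (rule topological_subgroup[OF H])
  have HG: "H \<subseteq> carrier G" using H by (rule subgroup.subset)
  have inv: "inv\<^bsub>G\<lparr>carrier := H\<rparr>\<^esub> x = inv x" if "x \<in> H" for x using m_inv_consistent[OF H that] .
  have pow: "x [^]\<^bsub>G\<lparr>carrier := H\<rparr>\<^esub> (j::nat) = x [^] j" for x j by (simp add: nat_pow_consistent[symmetric])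
  have ipow: "x [^]\<^bsub>G\<lparr>carrier := H\<rparr>\<^esub> (j::int) = x [^] j" if "x \<in> H" for x j
    using int_pow_consistent[OF H that] by simp
  show ?thesis
  proof (intro padic_filtration.intro padic_filtration_axioms.intro H.topgroup_axioms)
    fix n
    show "subgroup (A n \<inter> H) (G\<lparr>carrier := H\<rparr>)"
      using subgroup_incl[OF subgroups_Inter_pair[OF A_subgroup H] H] by blast
    show "A (Suc n) \<inter> H \<subseteq> A n \<inter> H" using A_decreasing by blast
    show "openin (subtopology \<tau> H) (A n \<inter> H)" using A_open by (auto simp: openin_subtopology)
    show "finite (c n ` carrier (G\<lparr>carrier := H\<rparr>))" using finite_subset[OF image_mono[OF HG] c_finite] by simp
  next
    fix U assume "openin (subtopology \<tau> H) U" "\<one>\<^bsub>G\<lparr>carrier := H\<rparr>\<^esub> \<in> U"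
    then obtain T where T: "openin \<tau> T" "U = T \<inter> H" "\<one> \<in> T" by (auto simp: openin_subtopology)
    then show "\<exists>n. A n \<inter> H \<subseteq> U" using A_base[OF T(1,3)] by blast
  next
    fix g h n assume *: "g \<in> carrier (G\<lparr>carrier := H\<rparr>)" "h \<in> carrier (G\<lparr>carrier := H\<rparr>)" "c n g = c n h"
    then show "g \<otimes>\<^bsub>G\<lparr>carrier := H\<rparr>\<^esub> inv\<^bsub>G\<lparr>carrier := H\<rparr>\<^esub> h \<in> A n \<inter> H"
      using c_coset[of g h n] HG inv subgroup.m_closed[OF H _ subgroup.m_inv_closed[OF H]] by auto
  next
    fix a g assume *: "a \<in> A 0 \<inter> H" "g \<in> carrier (G\<lparr>carrier := H\<rparr>)"
    then show "g \<otimes>\<^bsub>G\<lparr>carrier := H\<rparr>\<^esub> a \<otimes>\<^bsub>G\<lparr>carrier := H\<rparr>\<^esub> inv\<^bsub>G\<lparr>carrier := H\<rparr>\<^esub> g \<in> A 0 \<inter> H"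
      using A_conj[of a g] HG inv subgroup.m_closed[OF H] subgroup.m_inv_closed[OF H] by auto
  next
    fix a b assume "a \<in> A 0 \<inter> H" "b \<in> A 0 \<inter> H"
    then show "a \<otimes>\<^bsub>G\<lparr>carrier := H\<rparr>\<^esub> b = b \<otimes>\<^bsub>G\<lparr>carrier := H\<rparr>\<^esub> a" using A_commute[of a b] by simp
  next
    fix a g assume "a \<in> A 0 \<inter> H" "a \<noteq> \<one>\<^bsub>G\<lparr>carrier := H\<rparr>\<^esub>" "g \<in> carrier (G\<lparr>carrier := H\<rparr>)"
      "g \<otimes>\<^bsub>G\<lparr>carrier := H\<rparr>\<^esub> a = a \<otimes>\<^bsub>G\<lparr>carrier := H\<rparr>\<^esub> g"
    then show "g \<in> A 0 \<inter> H" using A_centralizer[of a g] HG by auto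
  next
    fix a n assume "a \<in> A 0 \<inter> H" "a \<noteq> \<one>\<^bsub>G\<lparr>carrier := H\<rparr>\<^esub>"
    then have a: "a \<in> A 0" "a \<in> H" "a \<noteq> \<one>" by auto
    obtain j :: nat where j: "a [^] j \<in> A n" "a [^] j \<noteq> \<one>" using A_power[OF a(1,3)] by blast
    moreover have "a [^] j \<in> H" using H.nat_pow_closed[of a j] a(2) pow by simp
    ultimately show "\<exists>j::nat. a [^]\<^bsub>G\<lparr>carrier := H\<rparr>\<^esub> j \<in> A n \<inter> H \<and> a [^]\<^bsub>G\<lparr>carrier := H\<rparr>\<^esub> j \<noteq> \<one>\<^bsub>G\<lparr>carrier := H\<rparr>\<^esub>"
      by (intro exI[of _ j]) (simp add: pow)
  next
    fix a k h n assume "a \<in> A 0 \<inter> H" "a \<notin> A (Suc k) \<inter> H" "h \<in> A k \<inter> H"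
    then have a: "a \<in> A 0" "a \<in> H" "a \<notin> A (Suc k)" "h \<in> A k" "h \<in> H" by auto
    obtain j :: int where j: "h \<otimes> inv (a [^] j) \<in> A n" using A_approx[OF a(1,3,4)] by blast
    moreover have aj: "a [^] j \<in> H" using subgroup_int_pow_closed[OF H a(2)] .
    moreover have "h \<otimes> inv (a [^] j) \<in> H" by (intro subgroup.m_closed[OF H] a(5) subgroup.m_inv_closed[OF H] aj)
    ultimately show "\<exists>j::int. h \<otimes>\<^bsub>G\<lparr>carrier := H\<rparr>\<^esub> inv\<^bsub>G\<lparr>carrier := H\<rparr>\<^esub> (a [^]\<^bsub>G\<lparr>carrier := H\<rparr>\<^esub> j) \<in> A n \<inter> H"
      by (intro exI[of _ j]) (simp add: ipow[OF a(2)] inv[OF aj])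
  qed
qed

theorem hereditarily_totally_minimal: "hereditarily_totally_minimal G \<tau>"
  unfolding hereditarily_totally_minimal_def
  using top_group padic_filtration.total_minimal[OF filtration_subgroup] by blast

end

text \<open>The computations take place in \<open>G\<close>, through the two coordinates of
  \<open>f\<close>: the group laws come from \<open>G\<close>, and the semidirect product
  contributes its multiplication formula and its topology.\<close>

locale padic_semidirect_iso = topgroup +
  fixes p :: nat and F :: "(nat \<Rightarrow> int) set" and f :: "'a \<Rightarrow> (nat \<Rightarrow> int) \<times> (nat \<Rightarrow> int)"
  assumes p: "prime p" and F_subgroup: "subgroup F (padic_units p)" and F_torsion: "F \<subseteq> padic_torsion_units p"
    and f_iso: "f \<in> iso G (padic_semidirect p F)"
    and f_homeo: "homeomorphic_map \<tau> (padic_semidirect_topology p F) f"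
begin

definition a :: "'a \<Rightarrow> nat \<Rightarrow> int" where "a g = fst (f g)"
definition v :: "'a \<Rightarrow> nat \<Rightarrow> int" where "v g = snd (f g)"

lemma p_pos: "p > 0"
  using p by (rule prime_gt_0_nat)

lemma F_carrier: "x \<in> F \<Longrightarrow> x \<in> carrier (padic_int p)"
  using subgroup.mem_carrier[OF F_subgroup] by (simp add: padic_units_def)

lemma f_bij: "bij_betw f (carrier G) (carrier (padic_int p) \<times> F)"
  using f_iso by (simp add: iso_def padic_semidirect_def)

lemma a_closed [simp]: "g \<in> carrier G \<Longrightarrow> a g \<in> carrier (padic_int p)"
  and v_closed: "g \<in> carrier G \<Longrightarrow> v g \<in> F"
  using bij_betwE[OF f_bij] by (auto simp: a_def v_def mem_Times_iff)

lemma v_carrier [simp]: "g \<in> carrier G \<Longrightarrow> v g \<in> carrier (padic_int p)"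
  using v_closed F_carrier by blast

lemma f_inj: "g \<in> carrier G \<Longrightarrow> h \<in> carrier G \<Longrightarrow> a g = a h \<Longrightarrow> v g = v h \<Longrightarrow> g = h"
  using bij_betw_imp_inj_on[OF f_bij] by (auto simp: a_def v_def inj_on_def prod_eq_iff)

lemma f_mult:
  assumes "g \<in> carrier G" "h \<in> carrier G"
  shows "f (g \<otimes> h) = (a g \<oplus>\<^bsub>padic_int p\<^esub> (v g \<otimes>\<^bsub>padic_int p\<^esub> a h), v g \<otimes>\<^bsub>padic_int p\<^esub> v h)"
proof -
  have "f (g \<otimes> h) = f g \<otimes>\<^bsub>padic_semidirect p F\<^esub> f h" using f_iso assms by (simp add: iso_def hom_def)
  then show ?thesis by (simp add: padic_semidirect_def a_def v_def case_prod_unfold)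
qed

lemma a_mult_nth: "g \<in> carrier G \<Longrightarrow> h \<in> carrier G \<Longrightarrow> a (g \<otimes> h) n = (a g n + v g n * a h n) mod int p ^ n"
  by (simp add: a_def[of "g \<otimes> h"] f_mult padic_int_def mod_simps)

lemma v_mult: "g \<in> carrier G \<Longrightarrow> h \<in> carrier G \<Longrightarrow> v (g \<otimes> h) = v g \<otimes>\<^bsub>padic_int p\<^esub> v h"
  by (simp add: v_def[of "g \<otimes> h"] f_mult)

lemma v_mult_nth: "g \<in> carrier G \<Longrightarrow> h \<in> carrier G \<Longrightarrow> v (g \<otimes> h) n = (v g n * v h n) mod int p ^ n"
  by (simp add: v_mult padic_int_def)

text \<open>Comparing \<open>f g\<close> with \<open>f (\<one> \<otimes> g)\<close> for a preimage
  \<open>g\<close> of the neutral pair identifies the value at \<open>\<one>\<close> with that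
  pair.\<close>

lemma f_one: "f \<one> = (\<lambda>n. 0, \<one>\<^bsub>padic_int p\<^esub>)"
proof -
  interpret R: cring "padic_int p" by (rule padic_cring[OF p_pos])
  have "\<one>\<^bsub>padic_int p\<^esub> \<in> F" using subgroup.one_closed[OF F_subgroup] by simp
  then have "(\<zero>\<^bsub>padic_int p\<^esub>, \<one>\<^bsub>padic_int p\<^esub>) \<in> f ` carrier G"
    using bij_betw_imp_surj_on[OF f_bij] by simp
  then obtain g where g: "g \<in> carrier G" "f g = (\<zero>\<^bsub>padic_int p\<^esub>, \<one>\<^bsub>padic_int p\<^esub>)" by auto
  have "f g = f (\<one> \<otimes> g)" using g(1) by simp
  also have "\<dots> = (a \<one>, v \<one>)" using f_mult[OF one_closed g(1)] g(2) by (simp add: a_def[of g] v_def[of g])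
  also have "\<dots> = f \<one>" by (simp add: a_def v_def)
  finally show ?thesis using g(2) by (simp add: padic_int_def)
qed

lemma a_one: "a \<one> = (\<lambda>n. 0)" and v_one [simp]: "v \<one> = \<one>\<^bsub>padic_int p\<^esub>"
  by (simp_all add: a_def v_def f_one)

lemma one_nth: "\<one>\<^bsub>padic_int p\<^esub> n = 1 mod int p ^ n"
  by (simp add: padic_int_def)

text \<open>A residue modulo \<open>p ^ 2\<close> determines the residue modulo \<open>p\<close>
  and, for \<open>p = 2\<close>, the one modulo 4; so level 2 detects triviality of a torsion unit
  for all primes alike.\<close>

lemma v_trivial:
  assumes g: "g \<in> carrier G" "v g 2 = 1 mod int p ^ 2"
  shows "v g = \<one>\<^bsub>padic_int p\<^esub>"
proof -
  obtain m :: nat where m: "m > 0" "v g [^]\<^bsub>padic_units p\<^esub> m = \<one>\<^bsub>padic_units p\<^esub>"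
    using v_closed[OF g(1)] F_torsion by (auto simp: padic_torsion_units_def)
  then have pow: "v g n ^ m mod int p ^ n = 1 mod int p ^ n" for n
    using padic_pow_nth[of p "v g" m n] by (simp add: padic_units_pow one_nth)
  have "v g 1 = v g 2 mod int p ^ 1" using padic_compat[OF v_carrier[OF g(1)], of 1 2] by simp
  also have "\<dots> = 1 mod int p" using g(2) by (simp add: mod_mod_cancel)
  finally have 1: "[v g 1 = 1] (mod int p)" by (simp add: cong_def)
  show ?thesis
    by (rule padic_torsion_unit_trivial[OF p v_carrier[OF g(1)] m(1) pow 1]) (use g(2) in \<open>simp add: cong_def\<close>)
qed

text \<open>The preimage of the subgroup \<open>p ^ n Z_p\<close> of the first factor.\<close>

definition A :: "nat \<Rightarrow> 'a set" where
  "A n = {g \<in> carrier G. a g n = 0 \<and> v g = \<one>\<^bsub>padic_int p\<^esub>}"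

lemma a_zero: "g \<in> carrier G \<Longrightarrow> a g 0 = 0"
  using padic_mod[OF a_closed, of g 0] by simp

lemma A_zero: "g \<in> A 0 \<longleftrightarrow> g \<in> carrier G \<and> v g = \<one>\<^bsub>padic_int p\<^esub>"
  by (auto simp: A_def a_zero)

lemma a_mod: "g \<in> carrier G \<Longrightarrow> a g n mod int p ^ n = a g n"
  by (rule padic_mod) simp

lemma a_mult_A:
  assumes g: "g \<in> A 0" and h: "h \<in> carrier G"
  shows "a (g \<otimes> h) n = (a g n + a h n) mod int p ^ n" "v (g \<otimes> h) = v h"
proof -
  have *: "g \<in> carrier G" "v g = \<one>\<^bsub>padic_int p\<^esub>" using g by (auto simp: A_zero)
  show "a (g \<otimes> h) n = (a g n + a h n) mod int p ^ n"
    using a_mult_nth[OF *(1) h, of n] *(2) mod_add_cong[OF refl mod_mult_left_eq[of 1 "int p ^ n" "a h n"], of "a g n"]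
    by (simp add: one_nth)
  interpret R: cring "padic_int p" by (rule padic_cring[OF p_pos])
  show "v (g \<otimes> h) = v h" using v_mult[OF *(1) h] *(2) h by simp
qed

lemma A_subset_0: "g \<in> A n \<Longrightarrow> g \<in> A 0"
  by (auto simp: A_def a_zero)

lemma v_conj:
  assumes "h \<in> A 0" "g \<in> carrier G"
  shows "g \<otimes> h \<otimes> inv g \<in> A 0"
proof -
  interpret R: cring "padic_int p" by (rule padic_cring[OF p_pos])
  have h: "h \<in> carrier G" "v h = \<one>\<^bsub>padic_int p\<^esub>" using assms by (auto simp: A_zero)
  have "v (g \<otimes> h \<otimes> inv g) = v g \<otimes>\<^bsub>padic_int p\<^esub> v (inv g)" using assms(2) h by (simp add: v_mult)
  also have "\<dots> = v (g \<otimes> inv g)" using assms(2) by (simp only: v_mult inv_closed)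
  also have "\<dots> = \<one>\<^bsub>padic_int p\<^esub>" using assms(2) by simp
  finally show ?thesis using assms(2) h by (simp add: A_zero)
qed

lemma inv_A:
  assumes g: "g \<in> A 0"
  shows "inv g \<in> A 0" "a (inv g) n = (- a g n) mod int p ^ n"
proof -
  have gG: "g \<in> carrier G" using g by (simp add: A_zero)
  show "inv g \<in> A 0" using a_mult_A(2)[OF g, of "inv g"] gG by (simp add: A_zero)
  have "(a g n + a (inv g) n) mod int p ^ n = 0"
    using a_mult_A(1)[OF g, of "inv g" n] gG a_one by simp
  then have "int p ^ n dvd a (inv g) n - (- a g n)" by (simp add: mod_eq_0_iff_dvd add.commute)
  then show "a (inv g) n = (- a g n) mod int p ^ n" using a_mod[OF inv_closed[OF gG], of n] by (metis mod_eq_dvd_iff)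
qed

lemma subgroup_A: "subgroup (A n) G"
proof (rule subgroupI)
  show "A n \<subseteq> carrier G" by (auto simp: A_def)
  show "A n \<noteq> {}" using a_one by (auto simp: A_def intro!: exI[of _ \<one>])
next
  fix g assume "g \<in> A n"
  then show "inv g \<in> A n" using inv_A(1)[OF A_subset_0, of g n] inv_A(2)[OF A_subset_0, of g n n] by (simp add: A_def A_zero)
next
  fix g h assume g: "g \<in> A n" and h: "h \<in> A n"
  then show "g \<otimes> h \<in> A n" using a_mult_A[OF A_subset_0[OF g], of h] by (simp add: A_def)
qed

lemma pow_A:
  assumes g: "g \<in> A 0"
  shows "g [^] (j::int) \<in> A 0" "a (g [^] (j::int)) n = (j * a g n) mod int p ^ n"
proof -
  have gG: "g \<in> carrier G" using g by (simp add: A_zero)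
  have nat: "g [^] (k::nat) \<in> A 0 \<and> a (g [^] k) n = (int k * a g n) mod int p ^ n" for k
  proof (induction k)
    case 0
    then show ?case using a_one subgroup.one_closed[OF subgroup_A] by simp
  next
    case (Suc k)
    then have "a (g [^] k \<otimes> g) n = (int k * a g n + a g n) mod int p ^ n"
      using a_mult_A(1)[of "g [^] k" g n] gG by (simp add: mod_simps)
    then show ?case using Suc subgroup.m_closed[OF subgroup_A, of "g [^] k" 0 g] g by (simp add: algebra_simps)
  qed
  show "g [^] j \<in> A 0" using subgroup_int_pow_closed[OF subgroup_A g] .
  show "a (g [^] j) n = (j * a g n) mod int p ^ n"
  proof (cases j rule: int_cases2)
    case (nonneg k)
    then show ?thesis using nat[of k] by (simp add: int_pow_int)
  next
    case (nonpos k)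
    then have "g [^] j = inv (g [^] k)" using int_pow_neg_int[OF gG, of k] by simp
    then show ?thesis using inv_A(2)[of "g [^] k" n] nat[of k] nonpos by (simp add: mod_simps)
  qed
qed

lemma A_eq_one:
  assumes "g \<in> A 0" "\<And>n. a g n = 0"
  shows "g = \<one>"
  by (rule f_inj) (use assms a_one in \<open>auto simp: A_zero\<close>)

lemma A_commute:
  assumes "g \<in> A 0" "h \<in> A 0"
  shows "g \<otimes> h = h \<otimes> g"
proof (rule f_inj)
  show "a (g \<otimes> h) = a (h \<otimes> g)"
    using assms by (intro ext) (simp add: a_mult_A A_zero add.commute)
qed (use assms a_mult_A(2) in \<open>auto simp: A_zero\<close>)

text \<open>Commuting means \<open>(v g - 1) * a h = 0\<close>, with \<open>a h\<close> nonzero, and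
  Z_p has no zero divisors. In terms of residues: if \<open>p ^ k\<close> does not divide
  \<open>a h\<close>, then at level \<open>k + m\<close> more than \<open>m\<close> of the factors
  \<open>p\<close> fall to \<open>v g - 1\<close>.\<close>

lemma A_centralizer:
  assumes h: "h \<in> A 0" "h \<noteq> \<one>" and g: "g \<in> carrier G" and comm: "g \<otimes> h = h \<otimes> g"
  shows "g \<in> A 0"
proof -
  have hG: "h \<in> carrier G" using h by (simp add: A_zero)
  obtain k where k: "a h k \<noteq> 0" using A_eq_one[OF h(1)] h(2) by blast
  have "v g m = 1 mod int p ^ m" for m
  proof -
    let ?n = "k + m"
    have "(a g ?n + v g ?n * a h ?n) mod int p ^ ?n = (a h ?n + a g ?n) mod int p ^ ?n"
      using a_mult_nth[OF g hG, of ?n] a_mult_A(1)[OF h(1) g, of ?n] comm by simp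
    then have "int p ^ ?n dvd (a g ?n + v g ?n * a h ?n) - (a h ?n + a g ?n)" by (simp only: mod_eq_dvd_iff)
    then have "int p ^ ?n dvd (v g ?n - 1) * a h ?n" by (simp add: algebra_simps)
    from prime_elem_power_dvd_prod[OF this] p
    obtain i j where ij: "i + j = ?n" "int p ^ i dvd v g ?n - 1" "int p ^ j dvd a h ?n"
      by (auto simp: prime_imp_prime_elem)
    have "j < k"
    proof (rule ccontr)
      assume "\<not> j < k"
      then have "int p ^ k dvd a h ?n" using dvd_trans[OF le_imp_power_dvd ij(3), of k] by simp
      then show False using k padic_compat[OF a_closed[OF hG], of k ?n] by simp
    qed
    then have "int p ^ m dvd v g ?n - 1" using dvd_trans[OF le_imp_power_dvd ij(2), of m] ij(1) by simp
    then have "v g ?n mod int p ^ m = 1 mod int p ^ m" by (simp add: mod_eq_dvd_iff)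
    then show ?thesis using padic_compat[OF v_carrier[OF g], of m ?n] by simp
  qed
  then have "v g = \<one>\<^bsub>padic_int p\<^esub>" by (intro ext) (simp add: one_nth)
  then show ?thesis using g by (simp add: A_zero)
qed

text \<open>The exponent is \<open>p ^ n\<close>; multiplication by it maps Z_p injectively into
  \<open>p ^ n Z_p\<close>.\<close>

lemma A_power:
  assumes h: "h \<in> A 0" "h \<noteq> \<one>"
  shows "\<exists>j::nat. h [^] j \<in> A n \<and> h [^] j \<noteq> \<one>"
proof (intro exI conjI)
  have hG: "h \<in> carrier G" using h by (simp add: A_zero)
  have *: "h [^] (p ^ n) \<in> A 0" "a (h [^] (p ^ n)) i = (int (p ^ n) * a h i) mod int p ^ i" for i
    by (rule pow_A[OF h(1), of "int (p ^ n)", unfolded int_pow_int])+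
  show "h [^] (p ^ n) \<in> A n" using * by (simp add: A_def)
  show "h [^] (p ^ n) \<noteq> \<one>"
  proof
    assume eq: "h [^] (p ^ n) = \<one>"
    have "a h m = 0" for m
    proof -
      have "(int p ^ n * a h (n + m)) mod int p ^ (n + m) = 0" using *(2)[of "n + m"] eq a_one by simp
      then have "int p ^ n * int p ^ m dvd int p ^ n * a h (n + m)" by (simp add: mod_eq_0_iff_dvd power_add)
      then have "int p ^ m dvd a h (n + m)" using p_pos by simp
      then show ?thesis using padic_compat[OF a_closed[OF hG], of m "n + m"] by simp
    qed
    then show False using A_eq_one[OF h(1)] h(2) by blast
  qed
qed

text \<open>The exponent \<open>j\<close> solves \<open>j * a g = a h\<close> modulo
  \<open>p ^ n\<close>. A solution exists because the valuation of \<open>a g\<close> is at most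
  \<open>k\<close>, as \<open>g\<close> is outside \<open>A (Suc k)\<close>, while that of
  \<open>a h\<close> is at least \<open>k\<close>.\<close>

lemma A_approx:
  assumes g: "g \<in> A 0" "g \<notin> A (Suc k)" and h: "h \<in> A k"
  shows "\<exists>j::int. h \<otimes> inv (g [^] j) \<in> A n"
proof -
  have h0: "h \<in> A 0" by (rule A_subset_0[OF h])
  have G: "g \<in> carrier G" "h \<in> carrier G" using g(1) h0 by (auto simp: A_zero)
  have "gcd (a g n) (int p ^ n) dvd a h n"
  proof -
    obtain e where e: "e \<le> n" "normalize (gcd (a g n) (int p ^ n)) = int p ^ e"
      using divides_primepow[of "int p" "gcd (a g n) (int p ^ n)" n] p by auto
    then have e': "gcd (a g n) (int p ^ n) = int p ^ e" by simp
    have "e \<le> k"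
    proof (rule ccontr)
      assume "\<not> e \<le> k"
      then have k: "Suc k \<le> e" by simp
      then have "Suc k \<le> n" using e(1) by simp
      have "int p ^ e dvd a g n" unfolding e'[symmetric] by (rule gcd_dvd1)
      then have "int p ^ Suc k dvd a g n" by (rule dvd_trans[OF le_imp_power_dvd[OF k]])
      then have "a g (Suc k) = 0" using padic_compat[OF a_closed[OF G(1)] \<open>Suc k \<le> n\<close>] by (simp add: mod_eq_0_iff_dvd)
      then show False using g by (simp add: A_def)
    qed
    have "int p ^ e dvd a h n"
    proof (cases "k \<le> n")
      case True
      then have "a h n mod int p ^ k = 0" using padic_compat[OF a_closed[OF G(2)] True] h by (simp add: A_def)
      then have "int p ^ k dvd a h n" by (simp add: mod_eq_0_iff_dvd)
      then show ?thesis by (rule dvd_trans[OF le_imp_power_dvd[OF \<open>e \<le> k\<close>]])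
    next
      case False
      then have "a h n = 0" using padic_compat[OF a_closed[OF G(2)], of n k] h by (simp add: A_def)
      then show ?thesis by simp
    qed
    then show ?thesis using e' by simp
  qed
  then obtain d where d: "a h n = gcd (a g n) (int p ^ n) * d" by (rule dvdE)
  obtain x where "[a g n * x = gcd (a g n) (int p ^ n)] (mod int p ^ n)" using cong_solve_int by blast
  then have "[a g n * x * d = a h n] (mod int p ^ n)" unfolding d by (rule cong_scalar_right)
  then have "int p ^ n dvd a g n * x * d - a h n" by (simp add: cong_iff_dvd_diff)
  then have x: "int p ^ n dvd a h n - x * d * a g n" by (subst dvd_diff_commute) (simp add: ac_simps)
  let ?q = "g [^] (x * d)"
  have q: "?q \<in> A 0" "a ?q n = (x * d * a g n) mod int p ^ n" by (rule pow_A[OF g(1)])+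
  have "h \<otimes> inv ?q \<in> A 0" by (rule subgroup.m_closed[OF subgroup_A h0 inv_A(1)[OF q(1)]])
  moreover have "a (h \<otimes> inv ?q) n = 0"
    using a_mult_A(1)[OF h0, of "inv ?q" n] inv_A(1)[OF q(1)] inv_A(2)[OF q(1), of n] q(2) x
    by (simp add: A_zero mod_simps mod_eq_0_iff_dvd)
  ultimately have "h \<otimes> inv ?q \<in> A n" by (simp add: A_def A_zero)
  then show ?thesis ..
qed

lemma v_diff:
  assumes g: "g \<in> carrier G" "h \<in> carrier G" and eq: "a g n = a h n" "v g 2 = v h 2"
  shows "g \<otimes> inv h \<in> A n"
proof -
  let ?q = "g \<otimes> inv h"
  have qG: "?q \<in> carrier G" using g by simp
  have "v ?q 2 = v (h \<otimes> inv h) 2"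
    unfolding v_mult_nth[OF g(1) inv_closed[OF g(2)]] v_mult_nth[OF g(2) inv_closed[OF g(2)]] eq(2) ..
  then have "v ?q = \<one>\<^bsub>padic_int p\<^esub>" using v_trivial[OF qG] g by (simp add: one_nth)
  then have q: "?q \<in> A 0" using qG by (simp add: A_zero)
  have "?q \<otimes> h = g" using g by (simp add: m_assoc)
  then have "a g n = (a ?q n + a h n) mod int p ^ n" using a_mult_A(1)[OF q g(2), of n] by simp
  then have "(a ?q n + a h n) mod int p ^ n = a h n mod int p ^ n" using eq(1) a_mod[OF g(2), of n] by simp
  then have "int p ^ n dvd a ?q n" by (simp add: mod_eq_dvd_iff)
  then have "a ?q n = 0" using a_mod[OF qG, of n] by simp
  then show ?thesis using q by (simp add: A_def A_zero)
qed

lemma continuous_f: "continuous_map \<tau> (prod_topology (padic_topology p) (subtopology (padic_topology p) F)) f"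
  using homeomorphic_imp_continuous_map[OF f_homeo] by (simp add: padic_semidirect_topology_def)

text \<open>Triviality of \<open>v g\<close> is an open condition since it is decided by the residue
  at level 2.\<close>

lemma openin_A: "openin \<tau> (A n)"
proof -
  let ?P = "{y \<in> carrier (padic_int p). y n = 0}" and ?Q = "F \<inter> {y \<in> carrier (padic_int p). y 2 = 1 mod int p ^ 2}"
  have "openin (prod_topology (padic_topology p) (subtopology (padic_topology p) F)) (?P \<times> ?Q)"
    by (intro openin_prod_Times_iff[THEN iffD2] disjI2 conjI openin_padic_ball[OF p_pos] openin_subtopology_Int2)
  then have "openin \<tau> {g \<in> carrier G. f g \<in> ?P \<times> ?Q}"
    using openin_continuous_map_preimage[OF continuous_f] by fastforce
  moreover have "{g \<in> carrier G. f g \<in> ?P \<times> ?Q} = A n"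
  proof -
    have "f g \<in> ?P \<times> ?Q \<longleftrightarrow> a g n = 0 \<and> v g = \<one>\<^bsub>padic_int p\<^esub>" if "g \<in> carrier G" for g
    proof -
      have fg: "f g = (a g, v g)" by (simp add: a_def v_def)
      have "v g 2 = 1 mod int p ^ 2 \<longleftrightarrow> v g = \<one>\<^bsub>padic_int p\<^esub>"
      proof
        show "v g 2 = 1 mod int p ^ 2" if "v g = \<one>\<^bsub>padic_int p\<^esub>" using that one_nth[of 2] by simp
      qed (rule v_trivial[OF that])
      moreover have "a g \<in> carrier (padic_int p)" "v g \<in> carrier (padic_int p)" "v g \<in> F"
        using that by (simp_all add: v_closed)
      ultimately show ?thesis unfolding fg by (simp only: mem_Times_iff fst_conv snd_conv Int_iff mem_Collect_eq simp_thms)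
    qed
    then show ?thesis unfolding A_def by (intro Collect_cong conj_cong refl)
  qed
  ultimately show ?thesis by (simp only:)
qed

lemma A_base:
  assumes U: "openin \<tau> U" "\<one> \<in> U"
  shows "\<exists>n. A n \<subseteq> U"
proof -
  have UG: "U \<subseteq> carrier G" by (rule openin_carrier[OF U(1)])
  have op: "openin (prod_topology (padic_topology p) (subtopology (padic_topology p) F)) (f ` U)"
    using homeomorphic_imp_open_map[OF f_homeo] U(1) by (simp add: open_map_def padic_semidirect_topology_def)
  have "(\<lambda>n. 0, \<one>\<^bsub>padic_int p\<^esub>) \<in> f ` U" using imageI[OF U(2), of f] by (simp only: f_one)
  from op[unfolded openin_prod_topology_alt, rule_format, OF this]
  obtain P Q where PQ: "openin (padic_topology p) P" "(\<lambda>n. 0) \<in> P" "\<one>\<^bsub>padic_int p\<^esub> \<in> Q" "P \<times> Q \<subseteq> f ` U"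
    by (elim exE conjE)
  have "\<forall>x\<in>P. \<exists>n. \<forall>y\<in>carrier (padic_int p). y n = x n \<longrightarrow> y \<in> P"
    using PQ(1) by (simp add: openin_padic_topology[OF p_pos])
  from bspec[OF this PQ(2)] obtain n where n: "\<forall>y\<in>carrier (padic_int p). y n = 0 \<longrightarrow> y \<in> P" ..
  have "A n \<subseteq> U"
  proof
    fix g assume g: "g \<in> A n"
    then have gG: "g \<in> carrier G" "a g n = 0" "v g = \<one>\<^bsub>padic_int p\<^esub>" by (auto simp: A_def)
    have "f g \<in> P \<times> Q" using n gG a_closed[OF gG(1)] PQ(3) by (simp add: mem_Times_iff a_def v_def)
    then have "f g \<in> f ` U" by (rule subsetD[OF PQ(4)])
    then obtain w where w: "f g = f w" "w \<in> U" by (rule imageE)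
    have "g = w" by (rule f_inj[OF gG(1) subsetD[OF UG w(2)]]) (simp_all add: a_def v_def w(1))
    then show "g \<in> U" using w(2) by simp
  qed
  then show ?thesis ..
qed

lemma padic_filtration: "padic_filtration G \<tau> A (\<lambda>n g. (a g n, v g 2))"
proof (intro padic_filtration.intro padic_filtration_axioms.intro topgroup_axioms)
  fix n
  show "subgroup (A n) G" by (rule subgroup_A)
  show "A (Suc n) \<subseteq> A n"
  proof
    fix g assume "g \<in> A (Suc n)"
    then show "g \<in> A n" using padic_compat[OF a_closed, of g n "Suc n"] by (simp add: A_def)
  qed
  have "(\<lambda>g. (a g n, v g 2)) ` carrier G \<subseteq> {0..<int p ^ n} \<times> {0..<int p ^ 2}"
    using a_closed v_carrier by (auto simp: padic_int_def)
  then show "finite ((\<lambda>g. (a g n, v g 2)) ` carrier G)" by (rule finite_subset) simp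
next
  fix U assume "openin \<tau> U" "\<one> \<in> U"
  then show "\<exists>n. A n \<subseteq> U" by (rule A_base)
next
  fix g h n assume "g \<in> carrier G" "h \<in> carrier G" "(a g n, v g 2) = (a h n, v h 2)"
  then show "g \<otimes> inv h \<in> A n" by (intro v_diff) simp_all
qed (fact openin_A v_conj A_commute A_centralizer A_power A_approx)+

end

theorem theorem6p21:
  fixes G :: "('a, 'b) monoid_scheme" and \<tau> :: "'a topology"
  assumes "topological_group G \<tau>"
    and "infinite (carrier G)"
    and "locally_compact_space \<tau>"
    and "solvable G"
  shows "hereditarily_totally_minimal G \<tau> \<longleftrightarrow>
    (\<exists>p F. prime p \<and> subgroup F (padic_units p) \<and> F \<subseteq> padic_torsion_units p \<and>
       topologically_isomorphic G \<tau> (padic_semidirect p F) (padic_semidirect_topology p F))"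
proof
  assume htm: "hereditarily_totally_minimal G \<tau>"
  have "group G" using assms(1) by (simp add: topological_group_def)
  then obtain n where n: "(derived G ^^ n) (carrier G) = {\<one>\<^bsub>G\<^esub>}"
    using group.solvable_iff_trivial_derived_seq assms(4) by blast
  obtain Z y p f where *: "padic_normal G \<tau> Z y p f" "centralizer G Z = Z" "finite (carrier (G Mod Z))"
    using padic_normal_of_solvable[OF assms(1) htm assms(3) n assms(2)] by blast
  show "\<exists>p F. prime p \<and> subgroup F (padic_units p) \<and> F \<subseteq> padic_torsion_units p \<and>
       topologically_isomorphic G \<tau> (padic_semidirect p F) (padic_semidirect_topology p F)"
    using padic_normal.p[OF *(1)] padic_normal.u_image_units[OF *] padic_normal.isomorphic_semidirect[OF *] by blast
next
  assume "\<exists>p F. prime p \<and> subgroup F (padic_units p) \<and> F \<subseteq> padic_torsion_units p \<and>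
       topologically_isomorphic G \<tau> (padic_semidirect p F) (padic_semidirect_topology p F)"
  then obtain p F f where *: "prime p" "subgroup F (padic_units p)" "F \<subseteq> padic_torsion_units p"
    "f \<in> iso G (padic_semidirect p F)" "homeomorphic_map \<tau> (padic_semidirect_topology p F) f"
    unfolding topologically_isomorphic_def by blast
  have "padic_semidirect_iso G \<tau> p F f"
    by (intro padic_semidirect_iso.intro padic_semidirect_iso_axioms.intro topgroup.intro assms(1) *)
  then show "hereditarily_totally_minimal G \<tau>"
    using padic_filtration.hereditarily_totally_minimal[OF padic_semidirect_iso.padic_filtration] by blast
qed

end
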